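(* Let the setting and notation of the context hold. Assume (A), (B) and (C), that $f=\iota_p^*f_0$ in $L^{p'}(I;V^* )$ for some $f_0\in L^{p'}(Q;\mathbb{R}^\ell)$, and that there exists $u^\sharp\in\operatorname{dom}(I_G\circ\nabla)\cap\operatorname{dom}(I_F)$ such that $I_G\circ\nabla$ or $I_F$ is continuous at $u^\sharp$ (as functionals on $L^p(I;V)$). Then, for every $(y,\lambda)\in\operatorname{dom}(-\mathcal{D})$ with $\operatorname{div}y,\partial_t\lambda\in L^{p'}(Q;\mathbb{R}^\ell)$, $$\begin{aligned}\eta_{-\mathcal{D}}^2(y,\lambda)=&\int_Q\bigl(\phi^*(\cdot,\cdot,y)-y:\nabla\lambda+\phi(\cdot,\cdot,\nabla\lambda)\bigr)\,dt\,dx\\&+\int_Q\bigl(\psi^*(\cdot,\cdot,\operatorname{div}y+f_0-\partial_t\lambda)-(\operatorname{div}y+f_0-\partial_t\lambda)\cdot\lambda+\psi(\cdot,\cdot,\lambda)\bigr)\,dt\,dx+\tfrac12\|\lambda(0)-u_0\|_H^2 .\end{aligned}$$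
   Context: Spaces. $\Omega\subseteq\mathbb{R}^d$ is a bounded Lipschitz domain whose boundary is split into disjoint relatively open sets $\Gamma_D\neq\emptyset$, $\Gamma_N$ with $\overline\Gamma_D\cup\overline\Gamma_N=\partial\Omega$; $\ell\in\mathbb{N}$; $p\in(1,\infty)$ with $p\ge\frac{2d}{d+2}$, $\frac1p+\frac1{p'}=1$; $I=(0,T)$, $0<T<\infty$; $Q=I\times\Omega$. $V=W^{1,p}_D(\Omega;\mathbb{R}^\ell)$ (zero trace on $\Gamma_D$), $H=L^2(\Omega;\mathbb{R}^\ell)$, $Y=L^p(\Omega;\mathbb{R}^{\ell\times d})$, $Y^*=L^{p'}(\Omega;\mathbb{R}^{\ell\times d})$. $V\hookrightarrow H\cong H^*\hookrightarrow V^*$ is the usual evolution triple, $\mathcal{W}(I)=\{v\in L^p(I;V)\mid\partial_tv\in L^{p'}(I;V^* )\}\hookrightarrow C^0(\overline I;H)$. $L=\nabla\colon V\to Y$ with adjoint $L^*\colon Y^*\to V^*$ (pointwise in time). $\operatorname{div}$ is the row-wise (spatial) distributional divergence. $\iota_p\colon V\to L^p(\Omega;\mathbb{R}^\ell)$ is the inclusion, $\iota_p^*\colon L^{p'}(\Omega;\mathbb{R}^\ell)\to V^*$ its adjoint (pointwise in time); "$\partial_t\lambda\in L^{p'}(Q;\mathbb{R}^\ell)$" means $\partial_t\lambda=\iota_p^*w$ for some $w\in L^{p'}(Q;\mathbb{R}^\ell)$, denoted again $\partial_t\lambda$. Integral functionals. A convex normal integrand $g$ on $Q\times\mathbb{R}^m$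 is a (Lebesgue $\otimes$ Borel)-measurable function into $\mathbb{R}\cup\{+\infty\}$ such that $g(t,x,\cdot)$ is proper, convex and lower semicontinuous for a.e. $(t,x)$. For an integrand $g$, $I_g(x)=\int g(s,x(s))\,ds$ if the positive part of the integrand is integrable, $I_g(x)=+\infty$ otherwise. $I_g^\Omega(t,v)=\int_\Omega g(t,x,v(x))\,dx$ with the same convention. A superscript $*$ on an integrand or a time-dependent functional denotes the Fenchel conjugate in the last argument for fixed other arguments. $\operatorname{dom}(g)=\{g<+\infty\}$. Assumption (A). $\phi\colon Q\times\mathbb{R}^{\ell\times d}\to\mathbb{R}\cup\{+\infty\}$ and $\psi\colon Q\times\mathbb{R}^\ell\to\mathbb{R}\cup\{+\infty\}$ are convex normal integrands, and there exist $u^\star\in L^p(I;V)$, $z^\star\in L^{p'}(I;Y^* )$, $w^\star\in L^{p'}(Q;\mathbb{R}^\ell)$ such that the positive parts of $I_\phi^\Omega(\cdot,\nabla u^\star)$, $I_\psi^\Omega(\cdot,u^\star)$, $I_{\phi^*}^\Omega(\cdot,z^\star)$, $I_{\psi^*}^\Omega(\cdot,w^\star)$ are in $L^1(I)$. Data: $f\in L^{p'}(I;V^* )$, $u_0\in H$. For a.e. $t\in I$: $G(t,y)=I_\phi^\Omega(t,y)$ for $y\in Y$, $F(t,v)=I_\psi^\Omega(t,v)-\langle f(t),v\rangle_V$ and $E(t,v)=G(t,\nabla v)+F(t,v)$ for $v\in V$. $I_G,I_F,I_E,I_{G^*},I_{F^*}$ are the associated time-integral functionals on $L^p(I;Y)$,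 $L^p(I;V)$, $L^p(I;V)$, $L^{p'}(I;Y^* )$, $L^{p'}(I;V^* )$. Assumption (B). $I_F\colon L^p(I;V)\to\mathbb{R}$ is finite-valued, continuous, and maps bounded sets to bounded sets. Assumption (C). For a.e. $t\in I$ and every $v^*\in V^*$: $F^*(t,v^* )=I_{\psi^*}^\Omega(t,w^* )$ if $\iota_p^*w^*=v^*+f(t)$ in $V^*$ for some $w^*\in L^{p'}(\Omega;\mathbb{R}^\ell)$, and $F^*(t,v^* )=+\infty$ otherwise. Dual functional on $L^{p'}(I;Y^* )\times\mathcal{W}(I)$: $\mathcal{D}(y,\lambda)=-I_{G^*}(y)-I_{F^*}(-L^*y-\partial_t\lambda)-I_E(\lambda)-\frac12\|\lambda(T)\|_H^2+(\lambda(0),u_0)_H$, $\operatorname{dom}(-\mathcal{D})=\{\mathcal{D}>-\infty\}$. Dual gap estimator: $\eta_{-\mathcal{D}}^2(y,\lambda)=-\mathcal{D}(y,\lambda)+\frac12\|u_0\|_H^2$. *)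

theory Defs
  imports "HOL-Analysis.Analysis"
begin

text \<open>
  Elements of Lebesgue, Sobolev and Bochner spaces are represented by functions; two functions
  represent the same element iff they agree almost everywhere.  All spaces below are therefore
  seminormed spaces of representatives, and all functionals on them depend only on the class.
  The matrices of size \<open>\<ell> \<times> d\<close> are the type \<^typ>\<open>real^'d^'l\<close>, whose norm and inner product are
  the Frobenius ones.
\<close>

type_synonym ('d, 'l) vfield = "real^'d \<Rightarrow> real^'l"
type_synonym ('d, 'l) tfield = "real^'d \<Rightarrow> real^'d^'l"
type_synonym ('d, 'l) vdual = "('d, 'l) vfield \<Rightarrow> real"

definition Lp_space :: "'a measure \<Rightarrow> real \<Rightarrow> ('a \<Rightarrow> 'b::euclidean_space) set" where
  "Lp_space M p = {u \<in> borel_measurable M. integrable M (\<lambda>x. norm (u x) powr p)}"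

definition Lp_norm :: "'a measure \<Rightarrow> real \<Rightarrow> ('a \<Rightarrow> 'b::euclidean_space) \<Rightarrow> real" where
  "Lp_norm M p u = (LINT x|M. norm (u x) powr p) powr (1 / p)"

definition int_pair ::
    "'a::euclidean_space set \<Rightarrow> ('a \<Rightarrow> 'b::euclidean_space) \<Rightarrow> ('a \<Rightarrow> 'b) \<Rightarrow> real" where
  "int_pair \<Omega> u v = (LINT x|lebesgue_on \<Omega>. u x \<bullet> v x)"

primrec k_smooth :: "nat \<Rightarrow> ('a::euclidean_space \<Rightarrow> 'b::real_normed_vector) \<Rightarrow> bool" where
  "k_smooth 0 f \<longleftrightarrow> continuous_on UNIV f"
| "k_smooth (Suc k) f \<longleftrightarrow> (\<forall>x. f differentiable (at x)) \<and>
     (\<forall>b\<in>Basis. k_smooth k (\<lambda>x. frechet_derivative f (at x) b))"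

definition smooth :: "('a::euclidean_space \<Rightarrow> 'b::real_normed_vector) \<Rightarrow> bool" where
  "smooth f \<longleftrightarrow> (\<forall>k. k_smooth k f)"

definition test_functions :: "'a::euclidean_space set \<Rightarrow> ('a \<Rightarrow> real) set" where
  "test_functions S = {\<theta>. smooth \<theta> \<and> compact (closure {x. \<theta> x \<noteq> 0}) \<and> closure {x. \<theta> x \<noteq> 0} \<subseteq> S}"

abbreviation partial_deriv :: "'d \<Rightarrow> (real^'d \<Rightarrow> real) \<Rightarrow> real^'d \<Rightarrow> real" where
  "partial_deriv j \<theta> x \<equiv> frechet_derivative \<theta> (at x) (axis j 1)"

definition locally_integrable ::
    "'a::euclidean_space set \<Rightarrow> ('a \<Rightarrow> 'b::euclidean_space) \<Rightarrow> bool" where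
  "locally_integrable \<Omega> u \<longleftrightarrow> (\<forall>K. compact K \<and> K \<subseteq> \<Omega> \<longrightarrow> u absolutely_integrable_on K)"

definition has_weak_grad ::
    "(real^'d) set \<Rightarrow> ('d::finite, 'l::finite) vfield \<Rightarrow> ('d, 'l) tfield \<Rightarrow> bool" where
  "has_weak_grad \<Omega> u g \<longleftrightarrow> locally_integrable \<Omega> u \<and> locally_integrable \<Omega> g \<and>
     (\<forall>\<theta>\<in>test_functions \<Omega>. \<forall>i j.
        (LINT x|lebesgue_on \<Omega>. u x $ i * partial_deriv j \<theta> x)
        = - (LINT x|lebesgue_on \<Omega>. g x $ i $ j * \<theta> x))"

definition grad :: "(real^'d) set \<Rightarrow> ('d::finite, 'l::finite) vfield \<Rightarrow> ('d, 'l) tfield" where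
  "grad \<Omega> u = (SOME g. has_weak_grad \<Omega> u g)"

definition has_weak_div ::
    "(real^'d) set \<Rightarrow> ('d::finite, 'l::finite) tfield \<Rightarrow> ('d, 'l) vfield \<Rightarrow> bool" where
  "has_weak_div \<Omega> y r \<longleftrightarrow> locally_integrable \<Omega> y \<and> locally_integrable \<Omega> r \<and>
     (\<forall>\<theta>\<in>test_functions \<Omega>. \<forall>i.
        (LINT x|lebesgue_on \<Omega>. (\<Sum>j\<in>UNIV. y x $ i $ j * partial_deriv j \<theta> x))
        = - (LINT x|lebesgue_on \<Omega>. r x $ i * \<theta> x))"

definition W1p :: "(real^'d) set \<Rightarrow> real \<Rightarrow> ('d::finite, 'l::finite) vfield set" where
  "W1p \<Omega> p = {u \<in> Lp_space (lebesgue_on \<Omega>) p.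
     \<exists>g \<in> Lp_space (lebesgue_on \<Omega>) p. has_weak_grad \<Omega> u g}"

definition W1p_norm :: "(real^'d) set \<Rightarrow> real \<Rightarrow> ('d::finite, 'l::finite) vfield \<Rightarrow> real" where
  "W1p_norm \<Omega> p u = (Lp_norm (lebesgue_on \<Omega>) p u powr p
     + Lp_norm (lebesgue_on \<Omega>) p (grad \<Omega> u) powr p) powr (1 / p)"

text \<open>
  Near each boundary point \<open>x\<close> the domain is, in a cylinder with axis \<open>n\<close>, the strict epigraph
  of a Lipschitz function of the coordinates orthogonal to \<open>n\<close>.
\<close>

definition lipschitz_domain :: "(real^'d::finite) set \<Rightarrow> bool" where
  "lipschitz_domain \<Omega> \<longleftrightarrow> open \<Omega> \<and> connected \<Omega> \<and> \<Omega> \<noteq> {} \<and>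
     (\<forall>x\<in>frontier \<Omega>. \<exists>n r h C \<gamma>.
        norm n = 1 \<and> r > 0 \<and> h > 0 \<and> C-lipschitz_on {z. z \<bullet> n = 0} \<gamma> \<and>
        (\<forall>a s. a \<bullet> n = 0 \<and> norm a < r \<and> \<bar>s\<bar> < h \<longrightarrow>
           (x + a + s *\<^sub>R n \<in> \<Omega> \<longleftrightarrow> \<gamma> a < (s::real))))"

definition boundary_partition ::
    "(real^'d::finite) set \<Rightarrow> (real^'d) set \<Rightarrow> (real^'d) set \<Rightarrow> bool" where
  "boundary_partition \<Omega> \<Gamma>D \<Gamma>N \<longleftrightarrow>
     openin (top_of_set (frontier \<Omega>)) \<Gamma>D \<and> openin (top_of_set (frontier \<Omega>)) \<Gamma>N \<and>
     \<Gamma>D \<inter> \<Gamma>N = {} \<and> \<Gamma>D \<noteq> {} \<and> closure \<Gamma>D \<union> closure \<Gamma>N = frontier \<Omega>"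

text \<open>
  The \<open>n\<close>-dimensional Hausdorff measure.  Empty covering sets are treated separately because
  \<open>0 ^ 0 = 1\<close>; for \<open>n = 0\<close> this is the counting measure.
\<close>

definition hausdorff_outer :: "nat \<Rightarrow> 'a::metric_space set \<Rightarrow> ennreal" where
  "hausdorff_outer n A =
     (SUP \<delta>\<in>{0<..}. INF C\<in>{C :: nat \<Rightarrow> 'a set. A \<subseteq> (\<Union>i. C i) \<and>
                                  (\<forall>i. bounded (C i) \<and> diameter (C i) \<le> \<delta>)}.
        (\<Sum>i. if C i = {} then 0
              else ennreal (unit_ball_vol (real n) * (diameter (C i) / 2) ^ n)))"

definition hausdorff_measure :: "nat \<Rightarrow> 'a::metric_space measure" where
  "hausdorff_measure n = measure_of UNIV (sets borel) (hausdorff_outer n)"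

abbreviation surface_measure :: "(real^'d::finite) measure" where
  "surface_measure \<equiv> hausdorff_measure (CARD('d) - 1)"

text \<open>
  The trace operator is the continuous extension of the restriction to the boundary from
  functions that are smooth up to the boundary.
\<close>

definition has_trace ::
    "(real^'d) set \<Rightarrow> real \<Rightarrow> ('d::finite, 'l::finite) vfield \<Rightarrow> ('d, 'l) vfield \<Rightarrow> bool" where
  "has_trace \<Omega> p u g \<longleftrightarrow> g \<in> borel_measurable borel \<and>
     (\<exists>un. (\<forall>n. smooth (un n)) \<and>
        (\<lambda>n. W1p_norm \<Omega> p (\<lambda>x. un n x - u x)) \<longlonglongrightarrow> 0 \<and>
        (\<lambda>n. \<integral>\<^sup>+x\<in>frontier \<Omega>. ennreal (norm (un n x - g x) powr p) \<partial>surface_measure) \<longlonglongrightarrow> 0)"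

definition V_space ::
    "(real^'d) set \<Rightarrow> (real^'d) set \<Rightarrow> real \<Rightarrow> ('d::finite, 'l::finite) vfield set" where
  "V_space \<Omega> \<Gamma>D p =
     {u \<in> W1p \<Omega> p. \<exists>g. has_trace \<Omega> p u g \<and> (AE x in surface_measure. x \<in> \<Gamma>D \<longrightarrow> g x = 0)}"

text \<open>
  Functionals on a space \<open>X\<close> matter only on \<open>X\<close>: equality in the dual space is equality on \<open>X\<close>.
\<close>

definition dual_space ::
    "('a \<Rightarrow> 'b::real_vector) set \<Rightarrow> (('a \<Rightarrow> 'b) \<Rightarrow> real) \<Rightarrow> (('a \<Rightarrow> 'b) \<Rightarrow> real) set" where
  "dual_space X N = {\<xi>.
     (\<forall>u\<in>X. \<forall>v\<in>X. \<xi> (\<lambda>x. u x + v x) = \<xi> u + \<xi> v) \<and>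
     (\<forall>c. \<forall>u\<in>X. \<xi> (\<lambda>x. c *\<^sub>R u x) = c * \<xi> u) \<and>
     (\<exists>C. \<forall>u\<in>X. \<bar>\<xi> u\<bar> \<le> C * N u)}"

definition dual_norm ::
    "('a \<Rightarrow> 'b::real_vector) set \<Rightarrow> (('a \<Rightarrow> 'b) \<Rightarrow> real) \<Rightarrow> (('a \<Rightarrow> 'b) \<Rightarrow> real) \<Rightarrow> real" where
  "dual_norm X N \<xi> = (SUP u\<in>{u \<in> X. N u \<le> 1}. \<bar>\<xi> u\<bar>)"

definition simple_fun ::
    "real \<Rightarrow> ('a \<Rightarrow> 'b) set \<Rightarrow> (real \<Rightarrow> 'a \<Rightarrow> 'b) \<Rightarrow> bool" where
  "simple_fun T X s \<longleftrightarrow> finite (s ` {0<..<T}) \<and> s ` {0<..<T} \<subseteq> X \<and>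
     (\<forall>c. {t \<in> {0<..<T}. s t = c} \<in> sets lebesgue)"

definition strongly_measurable ::
    "real \<Rightarrow> ('a \<Rightarrow> 'b::real_vector) set \<Rightarrow> (('a \<Rightarrow> 'b) \<Rightarrow> real) \<Rightarrow> (real \<Rightarrow> 'a \<Rightarrow> 'b) \<Rightarrow> bool" where
  "strongly_measurable T X N u \<longleftrightarrow>
     (\<exists>s. (\<forall>n. simple_fun T X (s n)) \<and>
        (AE t in lebesgue_on {0<..<T}. (\<lambda>n::nat. N (\<lambda>x. u t x - s n t x)) \<longlonglongrightarrow> 0))"

definition Bochner_Lp ::
    "real \<Rightarrow> ('a \<Rightarrow> 'b::real_vector) set \<Rightarrow> (('a \<Rightarrow> 'b) \<Rightarrow> real) \<Rightarrow> real \<Rightarrow> (real \<Rightarrow> 'a \<Rightarrow> 'b) set" where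
  "Bochner_Lp T X N p = {u. (AE t in lebesgue_on {0<..<T}. u t \<in> X) \<and>
     strongly_measurable T X N u \<and> integrable (lebesgue_on {0<..<T}) (\<lambda>t. N (u t) powr p)}"

definition Bochner_norm ::
    "real \<Rightarrow> (('a \<Rightarrow> 'b) \<Rightarrow> real) \<Rightarrow> real \<Rightarrow> (real \<Rightarrow> 'a \<Rightarrow> 'b) \<Rightarrow> real" where
  "Bochner_norm T N p u = (LINT t|lebesgue_on {0<..<T}. N (u t) powr p) powr (1 / p)"

abbreviation Qcyl :: "real \<Rightarrow> 'a set \<Rightarrow> (real \<times> 'a) set" where
  "Qcyl T \<Omega> \<equiv> {0<..<T} \<times> \<Omega>"

definition Lp_Q ::
    "real \<Rightarrow> (real^'d::finite) set \<Rightarrow> real \<Rightarrow> (real \<Rightarrow> real^'d \<Rightarrow> 'b::euclidean_space) set" where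
  "Lp_Q T \<Omega> p = {u. case_prod u \<in> Lp_space (lebesgue_on (Qcyl T \<Omega>)) p}"

text \<open>
  Classes in a Bochner space of functions on \<open>\<Omega>\<close> are represented by functions that are also
  jointly measurable on the space-time cylinder.  Every class has such a representative, and only
  for these does an integral over the cylinder make sense.
\<close>

definition jointly_measurable ::
    "real \<Rightarrow> (real^'d::finite) set \<Rightarrow> (real \<Rightarrow> real^'d \<Rightarrow> 'b::euclidean_space) set" where
  "jointly_measurable T \<Omega> = {u. case_prod u \<in> borel_measurable (lebesgue_on (Qcyl T \<Omega>))}"

definition LpV ::
    "real \<Rightarrow> (real^'d) set \<Rightarrow> (real^'d) set \<Rightarrow> real \<Rightarrow> (real \<Rightarrow> ('d::finite, 'l::finite) vfield) set"
  where
  "LpV T \<Omega> \<Gamma>D p =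
     Bochner_Lp T (V_space \<Omega> \<Gamma>D p) (W1p_norm \<Omega> p) p \<inter> jointly_measurable T \<Omega>"

abbreviation LpV_norm ::
    "real \<Rightarrow> (real^'d) set \<Rightarrow> real \<Rightarrow> (real \<Rightarrow> ('d::finite, 'l::finite) vfield) \<Rightarrow> real" where
  "LpV_norm T \<Omega> p \<equiv> Bochner_norm T (W1p_norm \<Omega> p) p"

text \<open>
  \<open>LpY T \<Omega> r\<close> is \<open>L\<^sup>r(I; L\<^sup>r(\<Omega>; \<real>\<^bsup>\<ell>\<times>d\<^esup>))\<close>; it serves both for \<open>Y\<close> (\<open>r = p\<close>) and for \<open>Y\<^sup>*\<close>
  (\<open>r = p'\<close>), elements of \<open>Y\<^sup>*\<close> acting on \<open>Y\<close> through \<^const>\<open>int_pair\<close>.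
\<close>

definition LpY ::
    "real \<Rightarrow> (real^'d) set \<Rightarrow> real \<Rightarrow> (real \<Rightarrow> ('d::finite, 'l::finite) tfield) set" where
  "LpY T \<Omega> r =
     Bochner_Lp T (Lp_space (lebesgue_on \<Omega>) r) (Lp_norm (lebesgue_on \<Omega>) r) r
     \<inter> jointly_measurable T \<Omega>"

abbreviation V_dual ::
    "(real^'d) set \<Rightarrow> (real^'d) set \<Rightarrow> real \<Rightarrow> ('d::finite, 'l::finite) vdual set" where
  "V_dual \<Omega> \<Gamma>D p \<equiv> dual_space (V_space \<Omega> \<Gamma>D p) (W1p_norm \<Omega> p)"

definition LpVdual ::
    "real \<Rightarrow> (real^'d) set \<Rightarrow> (real^'d) set \<Rightarrow> real \<Rightarrow> real \<Rightarrow>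
     (real \<Rightarrow> ('d::finite, 'l::finite) vdual) set" where
  "LpVdual T \<Omega> \<Gamma>D p p' =
     Bochner_Lp T (V_dual \<Omega> \<Gamma>D p) (dual_norm (V_space \<Omega> \<Gamma>D p) (W1p_norm \<Omega> p)) p'"

abbreviation H_space :: "(real^'d) set \<Rightarrow> ('d::finite, 'l::finite) vfield set" where
  "H_space \<Omega> \<equiv> Lp_space (lebesgue_on \<Omega>) 2"

abbreviation H_norm :: "(real^'d) set \<Rightarrow> ('d::finite, 'l::finite) vfield \<Rightarrow> real" where
  "H_norm \<Omega> \<equiv> Lp_norm (lebesgue_on \<Omega>) 2"

text \<open>
  Adjoint of the inclusion of \<open>V\<close> into \<open>L\<^sup>p(\<Omega>)\<close>, and adjoint of the gradient.
\<close>

definition iota_star :: "(real^'d) set \<Rightarrow> ('d::finite, 'l::finite) vfield \<Rightarrow> ('d, 'l) vdual" where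
  "iota_star \<Omega> w = (\<lambda>v. int_pair \<Omega> w v)"

definition grad_star :: "(real^'d) set \<Rightarrow> ('d::finite, 'l::finite) tfield \<Rightarrow> ('d, 'l) vdual" where
  "grad_star \<Omega> y = (\<lambda>v. int_pair \<Omega> y (grad \<Omega> v))"

text \<open>
  Weak time derivative with respect to the evolution triple: \<open>v \<in> V\<close> is regarded as an element of
  \<open>V\<^sup>*\<close> through the inner product of \<open>H\<close>, and the identity in \<open>V\<^sup>*\<close> is written out on elements
  of \<open>V\<close>.
\<close>

definition has_time_deriv ::
    "real \<Rightarrow> (real^'d) set \<Rightarrow> (real^'d) set \<Rightarrow> real \<Rightarrow>
     (real \<Rightarrow> ('d::finite, 'l::finite) vfield) \<Rightarrow> (real \<Rightarrow> ('d, 'l) vdual) \<Rightarrow> bool" where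
  "has_time_deriv T \<Omega> \<Gamma>D p lam \<xi> \<longleftrightarrow>
     (\<forall>\<theta>\<in>test_functions {0<..<T}. \<forall>v\<in>V_space \<Omega> \<Gamma>D p.
        (LINT t|lebesgue_on {0<..<T}. int_pair \<Omega> (lam t) v * deriv \<theta> t)
        = - (LINT t|lebesgue_on {0<..<T}. \<xi> t v * \<theta> t))"

definition time_deriv ::
    "real \<Rightarrow> (real^'d) set \<Rightarrow> (real^'d) set \<Rightarrow> real \<Rightarrow> real \<Rightarrow>
     (real \<Rightarrow> ('d::finite, 'l::finite) vfield) \<Rightarrow> (real \<Rightarrow> ('d, 'l) vdual)" where
  "time_deriv T \<Omega> \<Gamma>D p p' lam =
     (SOME \<xi>. \<xi> \<in> LpVdual T \<Omega> \<Gamma>D p p' \<and> has_time_deriv T \<Omega> \<Gamma>D p lam \<xi>)"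

text \<open>
  Because of the embedding of \<open>\<W>(I)\<close> into the continuous \<open>H\<close>-valued functions on the closed
  interval, elements of \<open>\<W>(I)\<close> are represented by their \<open>H\<close>-continuous representative, so that
  \<open>lam 0\<close> and \<open>lam T\<close> are the values at the end points.
\<close>

definition W_space ::
    "real \<Rightarrow> (real^'d) set \<Rightarrow> (real^'d) set \<Rightarrow> real \<Rightarrow> real \<Rightarrow>
     (real \<Rightarrow> ('d::finite, 'l::finite) vfield) set" where
  "W_space T \<Omega> \<Gamma>D p p' = {lam \<in> LpV T \<Omega> \<Gamma>D p.
     (\<exists>\<xi> \<in> LpVdual T \<Omega> \<Gamma>D p p'. has_time_deriv T \<Omega> \<Gamma>D p lam \<xi>) \<and>
     (\<forall>t\<in>{0..T}. lam t \<in> H_space \<Omega> \<and>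
        ((\<lambda>s. H_norm \<Omega> (\<lambda>x. lam s x - lam t x)) \<longlongrightarrow> 0) (at t within {0..T}))}"

text \<open>
  The integral if the positive part is integrable (possibly \<open>-\<infinity>\<close>), and \<open>+\<infinity>\<close> otherwise.
  Note that \<^const>\<open>e2ennreal\<close> maps negative values to \<open>0\<close>.
\<close>

definition ext_integral :: "'a measure \<Rightarrow> ('a \<Rightarrow> ereal) \<Rightarrow> ereal" where
  "ext_integral M h =
     (if h \<in> borel_measurable M \<and> (\<integral>\<^sup>+x. e2ennreal (h x) \<partial>M) < \<infinity>
      then enn2ereal (\<integral>\<^sup>+x. e2ennreal (h x) \<partial>M) - enn2ereal (\<integral>\<^sup>+x. e2ennreal (- h x) \<partial>M)
      else \<infinity>)"

definition fenchel_conj ::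
    "'a set \<Rightarrow> ('b \<Rightarrow> 'a \<Rightarrow> real) \<Rightarrow> ('a \<Rightarrow> ereal) \<Rightarrow> 'b \<Rightarrow> ereal" where
  "fenchel_conj X pair g s = (SUP r\<in>X. ereal (pair s r) - g r)"

definition integrand_conj ::
    "(real \<Rightarrow> 'a \<Rightarrow> 'm::euclidean_space \<Rightarrow> ereal) \<Rightarrow> (real \<Rightarrow> 'a \<Rightarrow> 'm \<Rightarrow> ereal)" where
  "integrand_conj g t x = fenchel_conj UNIV (\<bullet>) (g t x)"

definition proper_convex_lsc :: "('m::euclidean_space \<Rightarrow> ereal) \<Rightarrow> bool" where
  "proper_convex_lsc g \<longleftrightarrow>
     (\<forall>r. g r \<noteq> -\<infinity>) \<and> (\<exists>r. g r < \<infinity>) \<and>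
     (\<forall>r s a. 0 < a \<and> a < 1 \<longrightarrow>
        g (a *\<^sub>R r + (1 - a) *\<^sub>R s) \<le> ereal a * g r + ereal (1 - a) * g s) \<and>
     (\<forall>r. g r \<le> Liminf (at r) g)"

definition convex_normal_integrand ::
    "real \<Rightarrow> (real^'d::finite) set \<Rightarrow> (real \<Rightarrow> real^'d \<Rightarrow> 'm::euclidean_space \<Rightarrow> ereal) \<Rightarrow> bool" where
  "convex_normal_integrand T \<Omega> g \<longleftrightarrow>
     (\<lambda>((t, x), r). g t x r) \<in> borel_measurable (lebesgue_on (Qcyl T \<Omega>) \<Otimes>\<^sub>M borel) \<and>
     (\<forall>t\<in>{0<..<T}. \<forall>x\<in>\<Omega>. \<forall>r. g t x r \<noteq> -\<infinity>) \<and>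
     (AE (t, x) in lebesgue_on (Qcyl T \<Omega>). proper_convex_lsc (g t x))"

definition I_space ::
    "(real^'d::finite) set \<Rightarrow> (real \<Rightarrow> real^'d \<Rightarrow> 'm::euclidean_space \<Rightarrow> ereal) \<Rightarrow>
     real \<Rightarrow> (real^'d \<Rightarrow> 'm) \<Rightarrow> ereal" where
  "I_space \<Omega> g t v = ext_integral (lebesgue_on \<Omega>) (\<lambda>x. g t x (v x))"

definition I_time :: "real \<Rightarrow> (real \<Rightarrow> 'a \<Rightarrow> ereal) \<Rightarrow> (real \<Rightarrow> 'a) \<Rightarrow> ereal" where
  "I_time T J u = ext_integral (lebesgue_on {0<..<T}) (\<lambda>t. J t (u t))"

definition pos_part_L1 :: "real \<Rightarrow> (real \<Rightarrow> ereal) \<Rightarrow> bool" where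
  "pos_part_L1 T h \<longleftrightarrow>
     (\<lambda>t. e2ennreal (h t)) \<in> borel_measurable (lebesgue_on {0<..<T}) \<and>
     (\<integral>\<^sup>+t. e2ennreal (h t) \<partial>lebesgue_on {0<..<T}) < \<infinity>"

definition continuous_at_in ::
    "(real \<Rightarrow> 'a \<Rightarrow> 'b::real_vector) set \<Rightarrow> ((real \<Rightarrow> 'a \<Rightarrow> 'b) \<Rightarrow> real) \<Rightarrow>
     ((real \<Rightarrow> 'a \<Rightarrow> 'b) \<Rightarrow> ereal) \<Rightarrow> (real \<Rightarrow> 'a \<Rightarrow> 'b) \<Rightarrow> bool" where
  "continuous_at_in X N J u \<longleftrightarrow>
     (\<forall>U. open U \<and> J u \<in> U \<longrightarrow>
        (\<exists>\<delta>>0. \<forall>v\<in>X. N (\<lambda>t x. v t x - u t x) < \<delta> \<longrightarrow> J v \<in> U))"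

definition G_fun ::
    "(real^'d) set \<Rightarrow> (real \<Rightarrow> real^'d \<Rightarrow> real^'d^'l \<Rightarrow> ereal) \<Rightarrow>
     real \<Rightarrow> ('d::finite, 'l::finite) tfield \<Rightarrow> ereal" where
  "G_fun \<Omega> \<phi> t y = I_space \<Omega> \<phi> t y"

definition F_fun ::
    "(real^'d) set \<Rightarrow> (real \<Rightarrow> real^'d \<Rightarrow> real^'l \<Rightarrow> ereal) \<Rightarrow> (real \<Rightarrow> ('d, 'l) vdual) \<Rightarrow>
     real \<Rightarrow> ('d::finite, 'l::finite) vfield \<Rightarrow> ereal" where
  "F_fun \<Omega> \<psi> f t v = I_space \<Omega> \<psi> t v - ereal (f t v)"

definition E_fun ::
    "(real^'d) set \<Rightarrow> (real \<Rightarrow> real^'d \<Rightarrow> real^'d^'l \<Rightarrow> ereal) \<Rightarrow>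
     (real \<Rightarrow> real^'d \<Rightarrow> real^'l \<Rightarrow> ereal) \<Rightarrow> (real \<Rightarrow> ('d, 'l) vdual) \<Rightarrow>
     real \<Rightarrow> ('d::finite, 'l::finite) vfield \<Rightarrow> ereal" where
  "E_fun \<Omega> \<phi> \<psi> f t v = G_fun \<Omega> \<phi> t (grad \<Omega> v) + F_fun \<Omega> \<psi> f t v"

definition G_conj ::
    "(real^'d) set \<Rightarrow> real \<Rightarrow> (real \<Rightarrow> real^'d \<Rightarrow> real^'d^'l \<Rightarrow> ereal) \<Rightarrow>
     real \<Rightarrow> ('d::finite, 'l::finite) tfield \<Rightarrow> ereal" where
  "G_conj \<Omega> p \<phi> t = fenchel_conj (Lp_space (lebesgue_on \<Omega>) p) (int_pair \<Omega>) (G_fun \<Omega> \<phi> t)"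

definition F_conj ::
    "(real^'d) set \<Rightarrow> (real^'d) set \<Rightarrow> real \<Rightarrow> (real \<Rightarrow> real^'d \<Rightarrow> real^'l \<Rightarrow> ereal) \<Rightarrow>
     (real \<Rightarrow> ('d, 'l) vdual) \<Rightarrow> real \<Rightarrow> ('d::finite, 'l::finite) vdual \<Rightarrow> ereal" where
  "F_conj \<Omega> \<Gamma>D p \<psi> f t = fenchel_conj (V_space \<Omega> \<Gamma>D p) (\<lambda>\<xi> v. \<xi> v) (F_fun \<Omega> \<psi> f t)"

definition assumption_A ::
    "real \<Rightarrow> (real^'d) set \<Rightarrow> (real^'d) set \<Rightarrow> real \<Rightarrow> real \<Rightarrow>
     (real \<Rightarrow> real^'d \<Rightarrow> real^'d^'l \<Rightarrow> ereal) \<Rightarrow>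
     (real \<Rightarrow> real^'d::finite \<Rightarrow> real^'l::finite \<Rightarrow> ereal) \<Rightarrow> bool" where
  "assumption_A T \<Omega> \<Gamma>D p p' \<phi> \<psi> \<longleftrightarrow>
     convex_normal_integrand T \<Omega> \<phi> \<and> convex_normal_integrand T \<Omega> \<psi> \<and>
     (\<exists>u \<in> LpV T \<Omega> \<Gamma>D p. \<exists>z \<in> LpY T \<Omega> p'. \<exists>w \<in> Lp_Q T \<Omega> p'.
        pos_part_L1 T (\<lambda>t. I_space \<Omega> \<phi> t (grad \<Omega> (u t))) \<and>
        pos_part_L1 T (\<lambda>t. I_space \<Omega> \<psi> t (u t)) \<and>
        pos_part_L1 T (\<lambda>t. I_space \<Omega> (integrand_conj \<phi>) t (z t)) \<and>
        pos_part_L1 T (\<lambda>t. I_space \<Omega> (integrand_conj \<psi>) t (w t)))"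

definition assumption_B ::
    "real \<Rightarrow> (real^'d) set \<Rightarrow> (real^'d) set \<Rightarrow> real \<Rightarrow>
     (real \<Rightarrow> real^'d::finite \<Rightarrow> real^'l::finite \<Rightarrow> ereal) \<Rightarrow> (real \<Rightarrow> ('d, 'l) vdual) \<Rightarrow> bool" where
  "assumption_B T \<Omega> \<Gamma>D p \<psi> f \<longleftrightarrow>
     (\<forall>u \<in> LpV T \<Omega> \<Gamma>D p. \<bar>I_time T (F_fun \<Omega> \<psi> f) u\<bar> \<noteq> \<infinity>) \<and>
     (\<forall>u \<in> LpV T \<Omega> \<Gamma>D p.
        continuous_at_in (LpV T \<Omega> \<Gamma>D p) (LpV_norm T \<Omega> p) (I_time T (F_fun \<Omega> \<psi> f)) u) \<and>
     (\<forall>R. \<exists>C. \<forall>u \<in> LpV T \<Omega> \<Gamma>D p. LpV_norm T \<Omega> p u \<le> R \<longrightarrow>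
        \<bar>I_time T (F_fun \<Omega> \<psi> f) u\<bar> \<le> ereal C)"

definition assumption_C ::
    "real \<Rightarrow> (real^'d) set \<Rightarrow> (real^'d) set \<Rightarrow> real \<Rightarrow> real \<Rightarrow>
     (real \<Rightarrow> real^'d::finite \<Rightarrow> real^'l::finite \<Rightarrow> ereal) \<Rightarrow> (real \<Rightarrow> ('d, 'l) vdual) \<Rightarrow> bool" where
  "assumption_C T \<Omega> \<Gamma>D p p' \<psi> f \<longleftrightarrow>
     (AE t in lebesgue_on {0<..<T}. \<forall>\<xi> \<in> V_dual \<Omega> \<Gamma>D p.
        (\<forall>w \<in> Lp_space (lebesgue_on \<Omega>) p'.
           (\<forall>v \<in> V_space \<Omega> \<Gamma>D p. iota_star \<Omega> w v = \<xi> v + f t v) \<longrightarrow>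
           F_conj \<Omega> \<Gamma>D p \<psi> f t \<xi> = I_space \<Omega> (integrand_conj \<psi>) t w) \<and>
        ((\<nexists>w. w \<in> Lp_space (lebesgue_on \<Omega>) p' \<and>
              (\<forall>v \<in> V_space \<Omega> \<Gamma>D p. iota_star \<Omega> w v = \<xi> v + f t v)) \<longrightarrow>
           F_conj \<Omega> \<Gamma>D p \<psi> f t \<xi> = \<infinity>))"

definition dual_functional ::
    "real \<Rightarrow> (real^'d) set \<Rightarrow> (real^'d) set \<Rightarrow> real \<Rightarrow> real \<Rightarrow>
     (real \<Rightarrow> real^'d \<Rightarrow> real^'d^'l \<Rightarrow> ereal) \<Rightarrow> (real \<Rightarrow> real^'d \<Rightarrow> real^'l \<Rightarrow> ereal) \<Rightarrow>
     (real \<Rightarrow> ('d, 'l) vdual) \<Rightarrow> ('d, 'l) vfield \<Rightarrow>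
     (real \<Rightarrow> ('d::finite, 'l::finite) tfield) \<Rightarrow> (real \<Rightarrow> ('d, 'l) vfield) \<Rightarrow> ereal" where
  "dual_functional T \<Omega> \<Gamma>D p p' \<phi> \<psi> f u0 y lam =
     - I_time T (G_conj \<Omega> p \<phi>) y
     - I_time T (F_conj \<Omega> \<Gamma>D p \<psi> f)
         (\<lambda>t v. - grad_star \<Omega> (y t) v - time_deriv T \<Omega> \<Gamma>D p p' lam t v)
     - I_time T (E_fun \<Omega> \<phi> \<psi> f) lam
     - ereal ((H_norm \<Omega> (lam T))\<^sup>2 / 2)
     + ereal (int_pair \<Omega> (lam 0) u0)"

definition dom_neg_D ::
    "real \<Rightarrow> (real^'d) set \<Rightarrow> (real^'d) set \<Rightarrow> real \<Rightarrow> real \<Rightarrow>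
     (real \<Rightarrow> real^'d \<Rightarrow> real^'d^'l \<Rightarrow> ereal) \<Rightarrow> (real \<Rightarrow> real^'d \<Rightarrow> real^'l \<Rightarrow> ereal) \<Rightarrow>
     (real \<Rightarrow> ('d, 'l) vdual) \<Rightarrow> ('d, 'l) vfield \<Rightarrow>
     ((real \<Rightarrow> ('d::finite, 'l::finite) tfield) \<times> (real \<Rightarrow> ('d, 'l) vfield)) set" where
  "dom_neg_D T \<Omega> \<Gamma>D p p' \<phi> \<psi> f u0 =
     {(y, lam) \<in> LpY T \<Omega> p' \<times> W_space T \<Omega> \<Gamma>D p p'.
        dual_functional T \<Omega> \<Gamma>D p p' \<phi> \<psi> f u0 y lam > -\<infinity>}"

definition eta_sq ::
    "real \<Rightarrow> (real^'d) set \<Rightarrow> (real^'d) set \<Rightarrow> real \<Rightarrow> real \<Rightarrow>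
     (real \<Rightarrow> real^'d \<Rightarrow> real^'d^'l \<Rightarrow> ereal) \<Rightarrow> (real \<Rightarrow> real^'d \<Rightarrow> real^'l \<Rightarrow> ereal) \<Rightarrow>
     (real \<Rightarrow> ('d, 'l) vdual) \<Rightarrow> ('d, 'l) vfield \<Rightarrow>
     (real \<Rightarrow> ('d::finite, 'l::finite) tfield) \<Rightarrow> (real \<Rightarrow> ('d, 'l) vfield) \<Rightarrow> ereal" where
  "eta_sq T \<Omega> \<Gamma>D p p' \<phi> \<psi> f u0 y lam =
     - dual_functional T \<Omega> \<Gamma>D p p' \<phi> \<psi> f u0 y lam + ereal ((H_norm \<Omega> u0)\<^sup>2 / 2)"

end

theory Submission
  imports Defs
begin

text \<open>
  Write \<open>w = div y + f\<^sub>0 - \<partial>\<^sub>t \<lambda>\<close>.  Both integrands on the right are Fenchel gaps, hence nonnegative, so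
  Tonelli reduces the identity to almost every fixed time and no splitting over the cylinder (whose
  single terms need not be integrable there) occurs.  At a fixed time the conjugate of \<open>I\<^sub>\<phi>\<close> is
  \<open>I\<^bsub>\<phi>*\<^esub>\<close>, by truncating a measurable selection of near maximisers; the selection is the point of least
  norm of a closed convex sublevel set and is measurable by the projection theorem.  For \<open>\<psi>\<close>,
  finiteness of \<open>F*\<close> and (C) give a representative of \<open>- \<nabla>\<^sup>* y - \<partial>\<^sub>t \<lambda> + f\<close> in \<open>L\<^bsup>p'\<^esup>\<close>, which test
  functions identify with \<open>w\<close>.  Summing up, all pairings cancel except \<open>\<integral> \<langle>\<partial>\<^sub>t \<lambda>, \<lambda>\<rangle>\<close>, which is the
  difference of the squared \<open>H\<close>-norms at the end points.
\<close>

section \<open>Measurable projection\<close>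

text \<open>Normality of an integrand means joint measurability over Lebesgue sets of the cylinder
  and Borel sets of the fibre, with no selection built in. Both the conjugate integrand, a supremum
  over an uncountable fibre, and the choice of near maximisers therefore lead to projections of
  product sets, which are measurable because Lebesgue measure is complete. Selections are made once
  on the cylinder, so that almost every time slice inherits a whole countable family of them. The
  second obstacle is infinity. A finite \<open>dual_functional\<close> says little about its terms
  until each is bounded below by a competitor: the gradient of the element of \<open>V\<close> from
  (A) for the conjugate of \<open>G\<close>, \<open>\<lambda>\<close> itself with its finite
  \<open>F\<close>-energy from (B) for the conjugate of \<open>F\<close>, and the dual element from
  (A) for \<open>E\<close>. Finiteness of the \<open>F\<close>-energy then also separates the two
  parts of \<open>E\<close>. The third is representatives: gradients and time derivatives are
  choices up to null sets, and Lebesgue measure on the cylinder is the completion of a product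
  measure, so every passage to time slices goes through Borel versions.\<close>

definition suslin_scheme :: "'s set set \<Rightarrow> (nat \<Rightarrow> (nat \<Rightarrow> nat) \<Rightarrow> 's set) \<Rightarrow> bool" where
  "suslin_scheme \<P> P \<longleftrightarrow> range (case_prod P) \<subseteq> \<P> \<and>
     (\<forall>n \<sigma> \<tau>. (\<forall>i\<le>n. \<sigma> i = \<tau> i) \<longrightarrow> P n \<sigma> = P n \<tau>)"

text \<open>This is the Suslin operation A. Finite index sequences are encoded by infinite ones of
  which level \<open>n\<close> sees only the entries up to \<open>n\<close>, so that following a
  branch needs no list surgery.\<close>

definition suslin_op :: "(nat \<Rightarrow> (nat \<Rightarrow> nat) \<Rightarrow> 's set) \<Rightarrow> 's set" where
  "suslin_op P = (\<Union>\<sigma>. \<Inter>n. P n \<sigma>)"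

definition suslin_sets :: "'s set set \<Rightarrow> 's set set" where
  "suslin_sets \<P> = {suslin_op P | P. suslin_scheme \<P> P}"

lemma suslin_scheme_cong:
  "suslin_scheme \<P> P \<Longrightarrow> (\<And>i. i \<le> n \<Longrightarrow> \<sigma> i = \<tau> i) \<Longrightarrow> P n \<sigma> = P n \<tau>"
  unfolding suslin_scheme_def by blast

lemma suslin_scheme_mem: "suslin_scheme \<P> P \<Longrightarrow> P n \<sigma> \<in> \<P>"
  unfolding suslin_scheme_def by auto

lemma suslin_sets_basic: "A \<in> \<P> \<Longrightarrow> A \<in> suslin_sets \<P>"
  unfolding suslin_sets_def suslin_scheme_def suslin_op_def
  by (auto intro!: exI[of _ "\<lambda>_ _. A"])

text \<open>The entry \<open>\<sigma> 0\<close> carries two numbers: the index of the set and the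
  first entry of a branch of its scheme. Level 0 thus already knows which scheme to follow, and
  dependence on initial segments survives.\<close>

lemma suslin_sets_UN:
  fixes A :: "nat \<Rightarrow> 's set"
  assumes "\<And>k. A k \<in> suslin_sets \<P>"
  shows "(\<Union>k. A k) \<in> suslin_sets \<P>"
proof -
  have "\<forall>k. \<exists>P. suslin_scheme \<P> P \<and> A k = suslin_op P"
    using assms unfolding suslin_sets_def by auto
  then obtain P where P: "\<And>k. suslin_scheme \<P> (P k)" "\<And>k. A k = suslin_op (P k)"
    by metis
  define R where "R n \<sigma> = P (fst (prod_decode (\<sigma> 0))) n (\<sigma>(0 := snd (prod_decode (\<sigma> 0))))"
    for n :: nat and \<sigma> :: "nat \<Rightarrow> nat"
  have "suslin_scheme \<P> R"
    unfolding suslin_scheme_def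
  proof (intro conjI allI impI)
    show "range (case_prod R) \<subseteq> \<P>"
      using suslin_scheme_mem[OF P(1)] by (auto simp: R_def)
    fix n and \<sigma> \<tau> :: "nat \<Rightarrow> nat" assume "\<forall>i\<le>n. \<sigma> i = \<tau> i"
    then show "R n \<sigma> = R n \<tau>"
      unfolding R_def by (auto intro!: suslin_scheme_cong[OF P(1)])
  qed
  moreover have "(\<Union>k. A k) = suslin_op R"
  proof (intro set_eqI iffI)
    fix x assume "x \<in> (\<Union>k. A k)"
    then obtain k \<sigma> where *: "\<And>n. x \<in> P k n \<sigma>"
      by (auto simp: P(2) suslin_op_def)
    have "x \<in> R n (\<sigma>(0 := prod_encode (k, \<sigma> 0)))" for n
      using * by (simp add: R_def)
    then show "x \<in> suslin_op R"
      unfolding suslin_op_def by blast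
  next
    fix x assume "x \<in> suslin_op R"
    then show "x \<in> (\<Union>k. A k)"
      unfolding suslin_op_def R_def P(2) by blast
  qed
  ultimately show ?thesis
    unfolding suslin_sets_def by blast
qed

text \<open>A point needs one branch for each \<open>k\<close>, so a single \<open>\<sigma>\<close>
  stores countably many branches, entry \<open>j\<close> of the \<open>k\<close>-th one at position
  \<open>prod_encode (k, j)\<close>. Level \<open>m = prod_encode (k, i)\<close> tests level
  \<open>i\<close> of scheme \<open>k\<close>; running through all \<open>m\<close> tests every
  level of every scheme.\<close>

lemma suslin_sets_INT:
  fixes A :: "nat \<Rightarrow> 's set"
  assumes "\<And>k. A k \<in> suslin_sets \<P>"
  shows "(\<Inter>k. A k) \<in> suslin_sets \<P>"
proof -
  have "\<forall>k. \<exists>P. suslin_scheme \<P> P \<and> A k = suslin_op P"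
    using assms unfolding suslin_sets_def by auto
  then obtain P where P: "\<And>k. suslin_scheme \<P> (P k)" "\<And>k. A k = suslin_op (P k)"
    by metis
  define R where "R m \<sigma> = P (fst (prod_decode m)) (snd (prod_decode m))
      (\<lambda>j. \<sigma> (prod_encode (fst (prod_decode m), j)))"
    for m :: nat and \<sigma> :: "nat \<Rightarrow> nat"
  have "suslin_scheme \<P> R"
    unfolding suslin_scheme_def
  proof (intro conjI allI impI)
    show "range (case_prod R) \<subseteq> \<P>"
      using suslin_scheme_mem[OF P(1)] by (auto simp: R_def)
    fix m and \<sigma> \<tau> :: "nat \<Rightarrow> nat" assume eq: "\<forall>i\<le>m. \<sigma> i = \<tau> i"
    obtain k i where m: "m = prod_encode (k, i)"
      by (metis prod_decode_inverse surj_pair)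
    \<comment> \<open>The pairing is monotone in its second argument, so all entries that level
      \<open>i\<close> of scheme \<open>k\<close> reads are stored at positions up to
      \<open>m\<close>.\<close>
    have "prod_encode (k, j) \<le> m" if "j \<le> i" for j
    proof -
      have "triangle a \<le> triangle b" if "a \<le> b" for a b
        using that unfolding triangle_def by (intro div_le_mono mult_le_mono) auto
      from this[of "k + j" "k + i"] show ?thesis
        using that unfolding m prod_encode_def by simp
    qed
    then show "R m \<sigma> = R m \<tau>"
      unfolding R_def using eq by (auto intro!: suslin_scheme_cong[OF P(1)] simp: m)
  qed
  moreover have "(\<Inter>k. A k) = suslin_op R"
  proof (intro set_eqI iffI)
    fix x assume "x \<in> (\<Inter>k. A k)"
    then have "\<forall>k. \<exists>\<sigma>. \<forall>n. x \<in> P k n \<sigma>"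
      by (auto simp: P(2) suslin_op_def)
    then obtain \<sigma> where *: "\<And>k n. x \<in> P k n (\<sigma> k)"
      by metis
    have "x \<in> R m (\<lambda>j. \<sigma> (fst (prod_decode j)) (snd (prod_decode j)))" for m
      using * by (simp add: R_def)
    then show "x \<in> suslin_op R"
      unfolding suslin_op_def by blast
  next
    fix x assume "x \<in> suslin_op R"
    then obtain \<sigma> where *: "\<And>m. x \<in> R m \<sigma>"
      unfolding suslin_op_def by blast
    have "x \<in> P k n (\<lambda>j. \<sigma> (prod_encode (k, j)))" for k n
      using *[of "prod_encode (k, n)"] by (simp add: R_def)
    then show "x \<in> (\<Inter>k. A k)"
      unfolding suslin_op_def P(2) by blast
  qed
  ultimately show ?thesis
    unfolding suslin_sets_def by blast
qed

lemma suslin_sets_Un: "A \<in> suslin_sets \<P> \<Longrightarrow> B \<in> suslin_sets \<P> \<Longrightarrow> A \<union> B \<in> suslin_sets \<P>"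
proof -
  assume "A \<in> suslin_sets \<P>" "B \<in> suslin_sets \<P>"
  then have "(\<Union>k::nat. if k = 0 then A else B) \<in> suslin_sets \<P>"
    by (intro suslin_sets_UN) auto
  also have "(\<Union>k::nat. if k = 0 then A else B) = A \<union> B"
    by (auto split: if_splits)
  finally show ?thesis .
qed

section \<open>Measurability of Suslin sets in finite complete measure spaces\<close>

text \<open>Koenig's lemma for the finitely branching tree of sequences bounded by \<open>h\<close>.\<close>

lemma bounded_branch:
  fixes h :: "nat \<Rightarrow> nat"
  assumes dep: "\<And>n \<sigma> \<tau>. (\<And>i. i \<le> n \<Longrightarrow> \<sigma> i = \<tau> i) \<Longrightarrow> R n \<sigma> = R n \<tau>"
    and ex: "\<And>n. \<exists>\<sigma>. (\<forall>i. \<sigma> i \<le> h i) \<and> (\<forall>i\<le>n. R i \<sigma>)"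
  shows "\<exists>\<sigma>. \<forall>n. R n \<sigma>"
proof -
  \<comment> \<open>A prefix is good if arbitrarily deep finite paths begin with it. Asking for a
    depth beyond every \<open>m\<close> is the form of the condition that survives a choice among
    finitely many successors.\<close>
  define good where "good k \<tau> \<longleftrightarrow>
    (\<forall>m. \<exists>n\<ge>m. \<exists>\<sigma>. (\<forall>i. \<sigma> i \<le> h i) \<and> (\<forall>i\<le>n. R i \<sigma>) \<and> (\<forall>i<k. \<sigma> i = \<tau> i))"
    for k and \<tau> :: "nat \<Rightarrow> nat"
  have step: "\<exists>j. good (Suc k) (\<tau>(k := j))" if "good k \<tau>" for k \<tau>
  proof (rule ccontr)
    assume "\<nexists>j. good (Suc k) (\<tau>(k := j))"
    then have "\<forall>j. \<exists>m. \<not> (\<exists>n\<ge>m. \<exists>\<sigma>. (\<forall>i. \<sigma> i \<le> h i) \<and> (\<forall>i\<le>n. R i \<sigma>) \<and>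
        (\<forall>i<Suc k. \<sigma> i = (\<tau>(k := j)) i))"
      unfolding good_def not_ex[symmetric] not_all by simp
    then obtain m where m: "\<forall>j. \<not> (\<exists>n\<ge>m j. \<exists>\<sigma>. (\<forall>i. \<sigma> i \<le> h i) \<and> (\<forall>i\<le>n. R i \<sigma>) \<and>
        (\<forall>i<Suc k. \<sigma> i = (\<tau>(k := j)) i))"
      by (rule choice[THEN exE])
    \<comment> \<open>If every continuation \<open>j\<close> failed beyond depth \<open>m j\<close>,
      a path through the good prefix deeper than the maximum over the finitely many
      \<open>j \<le> h k\<close> would contradict the failure of its own entry at
      \<open>k\<close>.\<close>
    define M where "M = Max (m ` {..h k})"
    obtain n \<sigma> where n: "M \<le> n" "\<forall>i. \<sigma> i \<le> h i" "\<forall>i\<le>n. R i \<sigma>" "\<forall>i<k. \<sigma> i = \<tau> i"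
      using spec[OF \<open>good k \<tau>\<close>[unfolded good_def], of M] by blast
    have "m (\<sigma> k) \<le> M"
      unfolding M_def using n(2) by (intro Max_ge) auto
    with n(1) have "m (\<sigma> k) \<le> n" by simp
    moreover have "\<forall>i<Suc k. \<sigma> i = (\<tau>(k := \<sigma> k)) i"
      using n(4) by (simp add: less_Suc_eq)
    ultimately show False
      using m[rule_format, of "\<sigma> k"] n(2,3) by blast
  qed
  define f where "f = rec_nat (\<lambda>_. 0) (\<lambda>k \<tau>. \<tau>(k := SOME j. good (Suc k) (\<tau>(k := j))))"
  have f_Suc: "f (Suc k) = (f k)(k := SOME j. good (Suc k) ((f k)(k := j)))" for k
    by (simp add: f_def)
  have good: "good k (f k)" for k
  proof (induction k)
    case 0
    show ?case
      using ex unfolding good_def by auto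
  next
    case (Suc k)
    show ?case
      unfolding f_Suc by (rule someI_ex[OF step[OF Suc]])
  qed
  have stable: "f (i + Suc j) j = f (Suc j) j" for i j
    by (induction i) (auto simp: f_Suc)
  define \<sigma> where "\<sigma> j = f (Suc j) j" for j
  have \<sigma>: "\<sigma> j = f (Suc n) j" if "j \<le> n" for j n
    using stable[of "n - j" j] that by (simp add: \<sigma>_def)
  have "R n \<sigma>" for n
  proof -
    obtain N \<tau> where "n \<le> N" "\<forall>i\<le>N. R i \<tau>" "\<forall>i<Suc n. \<tau> i = f (Suc n) i"
      using spec[OF good[of "Suc n", unfolded good_def], of n] by blast
    then have "R n \<tau>" "\<And>i. i \<le> n \<Longrightarrow> \<tau> i = \<sigma> i"
      using \<sigma> by auto
    then show ?thesis
      using dep[of n \<tau> \<sigma>] by auto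
  qed
  then show ?thesis
    by blast
qed

text \<open>Outer measure is continuous along increasing unions of arbitrary sets. Hence the entries
  of the branches can be bounded one after another, by \<open>h 0\<close>, \<open>h 1\<close> and so
  on, while the outer measure of what remains stays above \<open>a\<close>. Under these bounds each
  level is a finite union of measurable sets, and the intersection of the levels lies in the Suslin
  set by \<open>bounded_branch\<close>.\<close>

lemma suslin_inner_approx:
  assumes P: "suslin_scheme (sets M) P" and fin: "finite_measure M"
    and a: "a < outer_measure_of M (suslin_op P)"
  shows "\<exists>L\<in>sets M. L \<subseteq> suslin_op P \<and> a \<le> emeasure M L"
proof -
  interpret finite_measure M by fact
  have sub: "P n \<sigma> \<subseteq> space M" for n \<sigma>
    using suslin_scheme_mem[OF P] sets.sets_into_space by blast
  define D where "D k h = {s. \<exists>\<sigma>. (\<forall>i<k. \<sigma> i \<le> h i) \<and> (\<forall>n. s \<in> P n \<sigma>)}"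
    for k :: nat and h :: "nat \<Rightarrow> nat"
  have D_sub: "D k h \<subseteq> space M" for k h
    using sub unfolding D_def by blast
  have step: "\<exists>j. a < outer_measure_of M (D (Suc k) (h(k := j)))"
    if "a < outer_measure_of M (D k h)" for k h
  proof -
    have "(\<Union>j. D (Suc k) (h(k := j))) = D k h"
    proof (intro set_eqI iffI)
      fix s assume "s \<in> D k h"
      then obtain \<sigma> where "\<forall>i<k. \<sigma> i \<le> h i" "\<forall>n. s \<in> P n \<sigma>"
        by (auto simp: D_def)
      then have "s \<in> D (Suc k) (h(k := \<sigma> k))"
        unfolding D_def by (auto simp: less_Suc_eq intro!: exI[of _ \<sigma>])
      then show "s \<in> (\<Union>j. D (Suc k) (h(k := j)))" by blast
    next
      fix s assume "s \<in> (\<Union>j. D (Suc k) (h(k := j)))"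
      then obtain j \<sigma> where \<sigma>: "\<forall>i<Suc k. \<sigma> i \<le> (h(k := j)) i" "\<forall>n. s \<in> P n \<sigma>"
        by (auto simp: D_def)
      from \<sigma>(1) have "\<forall>i<k. \<sigma> i \<le> h i"
        by (metis fun_upd_other less_SucI less_irrefl)
      with \<sigma>(2) show "s \<in> D k h" by (auto simp: D_def)
    qed
    moreover have "incseq (\<lambda>j. D (Suc k) (h(k := j)))"
    proof (rule incseq_SucI, rule subsetI)
      fix j s assume "s \<in> D (Suc k) (h(k := j))"
      then obtain \<sigma> where \<sigma>: "\<forall>i<Suc k. \<sigma> i \<le> (h(k := j)) i" "\<forall>n. s \<in> P n \<sigma>"
        by (auto simp: D_def)
      have "\<forall>i<Suc k. \<sigma> i \<le> (h(k := Suc j)) i"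
      proof (intro allI impI)
        fix i assume "i < Suc k"
        with \<sigma>(1) have "\<sigma> i \<le> (h(k := j)) i" by blast
        then show "\<sigma> i \<le> (h(k := Suc j)) i" by (cases "i = k") auto
      qed
      with \<sigma>(2) show "s \<in> D (Suc k) (h(k := Suc j))" unfolding D_def by blast
    qed
    ultimately have "(SUP j. outer_measure_of M (D (Suc k) (h(k := j)))) = outer_measure_of M (D k h)"
      using SUP_outer_measure_of_incseq[of "\<lambda>j. D (Suc k) (h(k := j))" M] D_sub by simp
    then show ?thesis
      using that by (metis less_SUP_iff UNIV_I)
  qed
  define H where "H = rec_nat (\<lambda>_. 0)
    (\<lambda>k h. h(k := SOME j. a < outer_measure_of M (D (Suc k) (h(k := j)))))"
  have H_Suc: "H (Suc k) = (H k)(k := SOME j. a < outer_measure_of M (D (Suc k) ((H k)(k := j))))" for k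
    by (simp add: H_def)
  have H: "a < outer_measure_of M (D k (H k))" for k
  proof (induction k)
    case 0
    have "D 0 (H 0) = suslin_op P"
      by (auto simp: D_def suslin_op_def)
    with a show ?case by simp
  next
    case (Suc k)
    show ?case unfolding H_Suc by (rule someI_ex[OF step[OF Suc]])
  qed
  have stable: "H (i + Suc j) j = H (Suc j) j" for i j
    by (induction i) (auto simp: H_Suc)
  define h where "h j = H (Suc j) j" for j
  have h: "h j = H k j" if "j < k" for j k
    using stable[of "k - Suc j" j] that by (simp add: h_def)
  \<comment> \<open>Levels up to \<open>n\<close> cannot see entries beyond \<open>n\<close>, so
    these are set to 0; finitely many sequences below \<open>h\<close> remain, which makes
    \<open>B n\<close> measurable.\<close>
  define S where "S n = (\<lambda>f i. if i \<le> n then f i else 0) ` (\<Pi>\<^sub>E i\<in>{..n}. {..h i})" for n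
  have finS: "finite (S n)" for n
    unfolding S_def by (intro finite_imageI finite_PiE) auto
  define B where "B n = (\<Union>\<sigma>\<in>S n. \<Inter>i\<in>{..n}. P i \<sigma>)" for n
  have Bsets: "B n \<in> sets M" for n
    unfolding B_def using suslin_scheme_mem[OF P]
    by (intro sets.finite_UN finS sets.finite_INT) auto
  have memB: "s \<in> B n" if "\<forall>i\<le>n. \<sigma> i \<le> h i" "\<forall>i\<le>n. s \<in> P i \<sigma>" for s n \<sigma>
  proof -
    define \<tau> where "\<tau> = (\<lambda>i. if i \<le> n then \<sigma> i else 0)"
    have "\<tau> \<in> S n"
      unfolding S_def \<tau>_def using that(1)
      by (intro image_eqI[of _ _ "restrict \<sigma> {..n}"]) (auto simp: fun_eq_iff PiE_iff)
    moreover have "P i \<sigma> = P i \<tau>" if "i \<le> n" for i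
      using that by (intro suslin_scheme_cong[OF P]) (auto simp: \<tau>_def)
    ultimately show ?thesis
      unfolding B_def using that(2) by auto
  qed
  have Bmem: "\<exists>\<sigma>. (\<forall>i. \<sigma> i \<le> h i) \<and> (\<forall>i\<le>n. s \<in> P i \<sigma>)" if "s \<in> B n" for s n
  proof -
    from that obtain \<sigma> where "\<sigma> \<in> S n" "\<forall>i\<le>n. s \<in> P i \<sigma>"
      unfolding B_def by auto
    moreover have "\<sigma> i \<le> h i" for i
      using \<open>\<sigma> \<in> S n\<close> unfolding S_def by (auto simp: PiE_iff)
    ultimately show ?thesis by blast
  qed
  have big: "a \<le> emeasure M (B n)" for n
  proof -
    have "D (Suc n) (H (Suc n)) \<subseteq> B n"
    proof
      fix s assume "s \<in> D (Suc n) (H (Suc n))"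
      then obtain \<sigma> where "\<forall>i<Suc n. \<sigma> i \<le> H (Suc n) i" "\<forall>n. s \<in> P n \<sigma>"
        by (auto simp: D_def)
      then show "s \<in> B n"
        by (intro memB[of n \<sigma>]) (auto simp: h[of _ "Suc n"])
    qed
    then have "outer_measure_of M (D (Suc n) (H (Suc n))) \<le> outer_measure_of M (B n)"
      by (rule outer_measure_of_mono)
    with H[of "Suc n"] Bsets show ?thesis
      by (auto intro: less_imp_le order.strict_trans2)
  qed
  have dec: "decseq B"
  proof (rule decseq_SucI, rule subsetI)
    fix n s assume "s \<in> B (Suc n)"
    then obtain \<sigma> where "\<forall>i. \<sigma> i \<le> h i" "\<forall>i\<le>Suc n. s \<in> P i \<sigma>"
      using Bmem by blast
    then show "s \<in> B n" by (intro memB[of n \<sigma>]) auto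
  qed
  define L where "L = (\<Inter>n. B n)"
  have "L \<in> sets M"
    unfolding L_def using Bsets by blast
  moreover have "L \<subseteq> suslin_op P"
  proof
    fix s assume "s \<in> L"
    then have ex: "\<And>n. \<exists>\<sigma>. (\<forall>i. \<sigma> i \<le> h i) \<and> (\<forall>i\<le>n. s \<in> P i \<sigma>)"
      using Bmem by (auto simp: L_def)
    have "\<exists>\<sigma>. \<forall>n. s \<in> P n \<sigma>"
    proof (rule bounded_branch[where h=h and R="\<lambda>n \<sigma>. s \<in> P n \<sigma>"])
      fix n and \<sigma> \<tau> :: "nat \<Rightarrow> nat" assume "\<And>i. i \<le> n \<Longrightarrow> \<sigma> i = \<tau> i"
      then show "(s \<in> P n \<sigma>) = (s \<in> P n \<tau>)"
        using suslin_scheme_cong[OF P, of n \<sigma> \<tau>] by simp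
    qed (rule ex)
    then show "s \<in> suslin_op P" by (auto simp: suslin_op_def)
  qed
  moreover have "a \<le> emeasure M L"
  proof -
    have "(INF n. emeasure M (B n)) = emeasure M L"
      unfolding L_def using dec Bsets by (intro INF_emeasure_decseq) auto
    moreover have "a \<le> (INF n. emeasure M (B n))"
      using big by (intro INF_greatest)
    ultimately show ?thesis by simp
  qed
  ultimately show ?thesis by blast
qed

text \<open>A measurable hull from outside and a union of inner approximations have the same finite
  measure. The Suslin set exceeds the inner one by a subset of a null set, which completeness makes
  measurable.\<close>

lemma suslin_op_measurable:
  assumes P: "suslin_scheme (sets M) P" and fin: "finite_measure M" and cM: "complete_measure M"
  shows "suslin_op P \<in> sets M"
proof -
  interpret finite_measure M by fact
  interpret complete_measure M by fact
  let ?A = "suslin_op P"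
  have sub: "?A \<subseteq> space M"
    using suslin_scheme_mem[OF P] sets.sets_into_space unfolding suslin_op_def by blast
  obtain E where E: "E \<in> sets M" "?A \<subseteq> E" "outer_measure_of M ?A = emeasure M E"
    using outer_measure_of_attain[OF sub] by blast
  obtain L where L: "L \<in> sets M" "L \<subseteq> ?A" "emeasure M E \<le> emeasure M L"
  proof (cases "emeasure M E = 0")
    case True
    then show ?thesis by (intro that[of "{}"]) auto
  next
    case False
    then obtain a :: "nat \<Rightarrow> ennreal" where a: "\<And>n. a n < emeasure M E" "a \<longlonglongrightarrow> emeasure M E"
      using approx_from_below_dense_linorder[of 0 "emeasure M E"] by (auto simp: zero_less_iff_neq_zero)
    have "\<forall>n. \<exists>L\<in>sets M. L \<subseteq> ?A \<and> a n \<le> emeasure M L"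
      using suslin_inner_approx[OF P fin] a(1) E(3) by simp
    then obtain L where L: "\<And>n. L n \<in> sets M" "\<And>n. L n \<subseteq> ?A" "\<And>n. a n \<le> emeasure M (L n)"
      by metis
    have "a n \<le> emeasure M (\<Union>n. L n)" for n
      using L(1) by (intro order.trans[OF L(3)] emeasure_mono) auto
    then have "emeasure M E \<le> emeasure M (\<Union>n. L n)"
      using a(2) by (intro LIMSEQ_le_const2) auto
    then show ?thesis
      using L by (intro that[of "\<Union>n. L n"]) auto
  qed
  have "emeasure M (E - L) = emeasure M E - emeasure M L"
    using L E by (intro emeasure_Diff) auto
  also have "\<dots> = 0"
    using L(3) by (simp add: diff_eq_0_iff_ennreal less_top[symmetric])
  finally have "E - L \<in> null_sets M"
    using E(1) L(1) by auto
  then have "?A - L \<in> sets M"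
    using E(2) by (intro complete[of _ "E - L"]) auto
  then have "L \<union> (?A - L) \<in> sets M"
    using L(1) by blast
  with L(2) show ?thesis
    by (simp add: Un_absorb1)
qed

section \<open>Product-measurable sets as Suslin sets over rectangles with compact second
  factor\<close>

definition compact_rectangles :: "'s measure \<Rightarrow> ('s \<times> 'b::euclidean_space) set set" where
  "compact_rectangles M = {E \<times> K | E K. E \<in> sets M \<and> compact K}"

lemma suslin_rectangle_closed:
  assumes "E \<in> sets M" "closed F"
  shows "E \<times> F \<in> suslin_sets (compact_rectangles M)"
proof -
  have "E \<times> (F \<inter> cball 0 (real n)) \<in> compact_rectangles M" for n
    using assms(1) closed_Int_compact[OF assms(2) compact_cball] unfolding compact_rectangles_def by blast
  then have "(\<Union>n. E \<times> (F \<inter> cball 0 (real n))) \<in> suslin_sets (compact_rectangles M)"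
    by (intro suslin_sets_UN suslin_sets_basic)
  also have "(\<Union>n. E \<times> (F \<inter> cball 0 (real n))) = E \<times> (\<Union>n. F \<inter> cball 0 (real n))"
    by blast
  also have "(\<Union>n. F \<inter> cball 0 (real n)) = F"
    using real_arch_simple by (auto simp: mem_cball_0)
  finally show ?thesis .
qed

lemma suslin_rectangle_open:
  assumes "E \<in> sets M" "open U"
  shows "E \<times> U \<in> suslin_sets (compact_rectangles M)"
proof -
  obtain \<D> where D: "countable \<D>" "\<And>X. X \<in> \<D> \<Longrightarrow> \<exists>a b. X = cbox a b" "\<Union>\<D> = U"
    using open_countable_Union_open_cbox[OF assms(2)] by metis
  define F where "F = from_nat_into (insert {} \<D>)"
  have F: "closed (F n)" for n
    using from_nat_into[of "insert {} \<D>" n] D(2) unfolding F_def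
    by (metis closed_cbox closed_empty insertE insert_not_empty)
  have FU: "(\<Union>n. F n) = U"
    using range_from_nat_into[of "insert {} \<D>"] D(1,3) by (simp add: F_def)
  have "(\<Union>n. E \<times> F n) \<in> suslin_sets (compact_rectangles M)"
    using assms F by (intro suslin_sets_UN suslin_rectangle_closed) auto
  also have "(\<Union>n. E \<times> F n) = E \<times> U"
    using FU by auto
  finally show ?thesis .
qed

text \<open>Suslin sets are closed under countable unions and intersections but in general not under
  complements. The induction over the sigma-algebra therefore carries a set and its complement
  together, and the complement step merely swaps the two.\<close>

lemma suslin_rectangle_borel:
  assumes "E \<in> sets M" "B \<in> sets borel"
  shows "E \<times> B \<in> suslin_sets (compact_rectangles M) \<and> E \<times> (- B) \<in> suslin_sets (compact_rectangles M)"
proof -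
  from assms(2) have "B \<in> sigma_sets UNIV {S. open S}"
    by (simp add: borel_def)
  then show ?thesis
  proof induction
    case (Basic a)
    then have "open a" by simp
    then show ?case
      using suslin_rectangle_open[OF assms(1), of a] suslin_rectangle_closed[OF assms(1), of "- a"]
      by (simp add: closed_Compl)
  next
    case Empty
    then show ?case
      using suslin_rectangle_open[OF assms(1), of "{}"] suslin_rectangle_open[OF assms(1), of UNIV] by simp
  next
    case (Compl a)
    then show ?case by (simp add: Compl_eq_Diff_UNIV[symmetric])
  next
    case (Union a)
    have "(\<Union>i. E \<times> a i) \<in> suslin_sets (compact_rectangles M)"
      using Union by (intro suslin_sets_UN) auto
    moreover have "(\<Inter>i. E \<times> (- a i)) \<in> suslin_sets (compact_rectangles M)"
      using Union by (intro suslin_sets_INT) auto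
    moreover have "(\<Inter>i. E \<times> (- a i)) = E \<times> (- (\<Union>i. a i))" "(\<Union>i. E \<times> a i) = E \<times> (\<Union>i. a i)"
      by auto
    ultimately show ?case by simp
  qed
qed

text \<open>The same device as for Borel sets, now relative to the product space; the base case
  works because the complement of a rectangle is a union of two rectangles.\<close>

lemma suslin_product_sets:
  assumes "A \<in> sets (M \<Otimes>\<^sub>M (borel :: 'b::euclidean_space measure))"
  shows "A \<in> suslin_sets (compact_rectangles M)"
proof -
  let ?S = "suslin_sets (compact_rectangles M)"
  let ?X = "space M \<times> (UNIV :: 'b set)"
  from assms have "A \<in> sigma_sets ?X {a \<times> b | a b. a \<in> sets M \<and> b \<in> sets (borel :: 'b measure)}"
    by (simp add: sets_pair_measure)
  then have "A \<in> ?S \<and> ?X - A \<in> ?S"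
  proof induction
    case (Basic A)
    then obtain E B where A: "A = E \<times> B" "E \<in> sets M" "B \<in> sets borel"
      by auto
    have "?X - A = (space M - E) \<times> UNIV \<union> E \<times> (- B)"
      using A sets.sets_into_space[OF A(2)] by auto
    then show ?case
      using A suslin_rectangle_borel[of E M B] suslin_rectangle_open[of "space M - E" M UNIV]
      by (auto intro!: suslin_sets_Un)
  next
    case Empty
    then show ?case
      using suslin_rectangle_open[of "space M" M "{}"] suslin_rectangle_open[of "space M" M UNIV] by simp
  next
    case (Compl a)
    have "a \<subseteq> ?X"
      using sigma_sets_into_sp[OF _ Compl.hyps] pair_measure_closed[of M borel] by auto
    then show ?case
      using Compl.IH by (simp add: double_diff)
  next
    case (Union a)
    have "?X - (\<Union>i. a i) = (\<Inter>i. ?X - a i)" by auto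
    then show ?case
      using Union suslin_sets_UN[of a] suslin_sets_INT[of "\<lambda>i. ?X - a i"] by auto
  qed
  then show ?thesis ..
qed

text \<open>
  The rectangles of a scheme may be taken decreasing along each branch; the projection of a branch
  is then governed by the nonemptiness of nested compact sets alone.
\<close>

theorem measurable_projection:
  assumes "A \<in> sets (M \<Otimes>\<^sub>M (borel :: 'b::euclidean_space measure))"
    and "finite_measure M" and "complete_measure M"
  shows "fst ` A \<in> sets M"
proof -
  obtain P where P: "suslin_scheme (compact_rectangles M) P" and A: "A = suslin_op P"
    using suslin_product_sets[OF assms(1)] unfolding suslin_sets_def by blast
  have "\<forall>n \<sigma>. \<exists>E K. P n \<sigma> = E \<times> K \<and> E \<in> sets M \<and> compact (K :: 'b set)"
    using suslin_scheme_mem[OF P] unfolding compact_rectangles_def by blast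
  then obtain E0 K0 where 0: "\<And>n \<sigma>. P n \<sigma> = E0 n \<sigma> \<times> K0 n \<sigma>" "\<And>n \<sigma>. E0 n \<sigma> \<in> sets M"
      "\<And>n \<sigma>. compact (K0 n \<sigma> :: 'b set)"
    by metis
  \<comment> \<open>\<open>E0\<close> and \<open>K0\<close> were chosen for each \<open>n\<close>
    and \<open>\<sigma>\<close> separately and may depend on all of \<open>\<sigma>\<close>. The
    projections of \<open>P n \<sigma>\<close> depend on \<open>\<sigma>\<close> only as much as
    \<open>P n \<sigma>\<close> itself does.\<close>
  define E where "E n \<sigma> = fst ` P n \<sigma>" for n \<sigma>
  define K where "K n \<sigma> = snd ` P n \<sigma>" for n \<sigma>
  have EK: "P n \<sigma> = E n \<sigma> \<times> K n \<sigma>" "E n \<sigma> \<in> sets M" "compact (K n \<sigma>)" for n \<sigma>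
    using 0[of n \<sigma>] unfolding E_def K_def by (auto simp: fst_image_times snd_image_times)
  have dep: "E n \<sigma> = E n \<tau>" "K n \<sigma> = K n \<tau>" if "\<And>i. i \<le> n \<Longrightarrow> \<sigma> i = \<tau> i" for n \<sigma> \<tau>
    unfolding E_def K_def by (simp_all add: suslin_scheme_cong[OF P that])
  \<comment> \<open>On the first factor a branch imposes all the conditions
    \<open>E n \<sigma>\<close>; the second factor contributes only whether the compact sets met so
    far still have a common point.\<close>
  define R where "R n \<sigma> = (if (\<Inter>i\<le>n. K i \<sigma>) = {} then {} else E n \<sigma>)" for n \<sigma>
  have "suslin_scheme (sets M) R"
    unfolding suslin_scheme_def
  proof (intro conjI allI impI)
    show "range (case_prod R) \<subseteq> sets M"
      using EK(2) by (auto simp: R_def)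
    fix n and \<sigma> \<tau> :: "nat \<Rightarrow> nat" assume *: "\<forall>i\<le>n. \<sigma> i = \<tau> i"
    have "K i \<sigma> = K i \<tau>" if "i \<le> n" for i
      using * that by (intro dep(2)) simp
    then have "(\<Inter>i\<le>n. K i \<sigma>) = (\<Inter>i\<le>n. K i \<tau>)"
      by simp
    moreover have "E n \<sigma> = E n \<tau>"
      using * by (intro dep(1)) simp
    ultimately show "R n \<sigma> = R n \<tau>"
      unfolding R_def by simp
  qed
  then have "suslin_op R \<in> sets M"
    using assms by (intro suslin_op_measurable)
  also have "suslin_op R = fst ` A"
  proof (intro set_eqI iffI)
    fix s assume "s \<in> suslin_op R"
    then obtain \<sigma> where \<sigma>: "\<And>n. s \<in> R n \<sigma>"
      by (auto simp: suslin_op_def)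
    have ne: "(\<Inter>i\<le>n. K i \<sigma>) \<noteq> {}" and s: "s \<in> E n \<sigma>" for n
      using \<sigma>[of n] by (auto simp: R_def split: if_splits)
    have "(\<Inter>n. (\<Inter>i\<le>n. K i \<sigma>)) \<noteq> {}"
      using EK(3) ne by (intro compact_nest compact_Inter) (auto intro: INF_superset_mono)
    then obtain x where "\<And>i. x \<in> K i \<sigma>"
      by blast
    with s have "(s, x) \<in> A"
      unfolding A suslin_op_def by (auto simp: EK(1))
    then show "s \<in> fst ` A" by force
  next
    fix s assume "s \<in> fst ` A"
    then obtain x where "(s, x) \<in> suslin_op P"
      unfolding A by auto
    then obtain \<sigma> where "\<And>n. (s, x) \<in> P n \<sigma>"
      unfolding suslin_op_def by blast
    then have "s \<in> R n \<sigma>" for n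
      unfolding R_def by (auto simp: EK(1))
    then show "s \<in> suslin_op R"
      by (auto simp: suslin_op_def)
  qed
  finally show ?thesis .
qed

section \<open>Smooth cutoffs and the fundamental lemma of the calculus of variations\<close>

lemma k_smooth_SucI:
  assumes "\<And>x. (f has_derivative D x) (at x)" "\<And>b. b \<in> Basis \<Longrightarrow> k_smooth k (\<lambda>x. D x b)"
  shows "k_smooth (Suc k) f"
proof -
  have "frechet_derivative f (at x) = D x" for x
    using frechet_derivative_at[OF assms(1)] by simp
  with assms show ?thesis
    by (auto simp: differentiable_def)
qed

lemma k_smooth_mono_Suc: "k_smooth (Suc k) f \<Longrightarrow> k_smooth k f"
proof (induction k arbitrary: f)
  case 0
  then show ?case
    by (auto intro!: differentiable_imp_continuous_on simp: differentiable_on_def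
        intro: differentiable_at_withinI)
next
  case (Suc k)
  then show ?case by (metis k_smooth.simps(2))
qed

lemma k_smooth_const: "k_smooth k (\<lambda>x. c)"
proof (induction k arbitrary: c)
  case (Suc k)
  have "((\<lambda>x. c) has_derivative (\<lambda>_. 0)) (at x)" for x :: 'a
    by simp
  then show ?case
    using Suc[of 0] by (rule k_smooth_SucI)
qed simp

lemma k_smooth_linear: "bounded_linear f \<Longrightarrow> k_smooth k f"
proof (cases k)
  case 0
  then show "bounded_linear f \<Longrightarrow> k_smooth k f"
    by (simp add: linear_continuous_on)
next
  case (Suc j)
  show "bounded_linear f \<Longrightarrow> k_smooth k f"
    unfolding Suc by (rule k_smooth_SucI[OF bounded_linear_imp_has_derivative]) (auto simp: k_smooth_const)
qed

lemma k_smooth_derivative: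
  assumes "k_smooth (Suc k) f"
  shows "(f has_derivative frechet_derivative f (at x)) (at x)"
  using assms frechet_derivative_works by auto

lemma k_smooth_add: "k_smooth k f \<Longrightarrow> k_smooth k g \<Longrightarrow> k_smooth k (\<lambda>x. f x + g x)"
proof (induction k arbitrary: f g)
  case 0
  then show ?case by (auto intro: continuous_intros)
next
  case (Suc k)
  show ?case
    by (rule k_smooth_SucI[OF has_derivative_add[OF k_smooth_derivative[OF Suc.prems(1)]
            k_smooth_derivative[OF Suc.prems(2)]]])
      (use Suc in auto)
qed

lemma k_smooth_mult:
  fixes f g :: "'a::euclidean_space \<Rightarrow> real"
  shows "k_smooth k f \<Longrightarrow> k_smooth k g \<Longrightarrow> k_smooth k (\<lambda>x. f x * g x)"
proof (induction k arbitrary: f g)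
  case 0
  then show ?case by (auto intro: continuous_intros)
next
  case (Suc k)
  show ?case
    by (rule k_smooth_SucI[OF has_derivative_mult[OF k_smooth_derivative[OF Suc.prems(1)]
            k_smooth_derivative[OF Suc.prems(2)]]])
      (intro k_smooth_add Suc.IH, use Suc.prems k_smooth_mono_Suc in auto)
qed

lemma k_smooth_compose:
  fixes f :: "'a::euclidean_space \<Rightarrow> real" and g :: "real \<Rightarrow> real"
  shows "k_smooth k g \<Longrightarrow> k_smooth k f \<Longrightarrow> k_smooth k (\<lambda>x. g (f x))"
proof (induction k arbitrary: f g)
  case 0
  then show ?case
    by (auto intro: continuous_on_compose2)
next
  case (Suc k)
  have lin: "frechet_derivative g (at y) c = c * frechet_derivative g (at y) 1" for y c
    using linear_cmul[OF has_derivative_linear[OF k_smooth_derivative[OF Suc.prems(1)]], of y c 1] by simp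
  have g': "k_smooth k (\<lambda>y. frechet_derivative g (at y) 1)"
    using Suc.prems(1) by simp
  have f': "k_smooth k (\<lambda>x. frechet_derivative f (at x) b)" if "b \<in> Basis" for b
    using Suc.prems(2) that by simp
  show ?case
  proof (rule k_smooth_SucI)
    show "((\<lambda>x. g (f x)) has_derivative
        (\<lambda>h. frechet_derivative f (at x) h * frechet_derivative g (at (f x)) 1)) (at x)" for x
      using has_derivative_compose[OF k_smooth_derivative[OF Suc.prems(2)]
          k_smooth_derivative[OF Suc.prems(1)], of x]
      by (subst (asm) lin)
    show "k_smooth k (\<lambda>x. frechet_derivative f (at x) b * frechet_derivative g (at (f x)) 1)"
      if "b \<in> Basis" for b
      using Suc.IH[OF g' k_smooth_mono_Suc[OF Suc.prems(2)]] f'[OF that] by (rule k_smooth_mult[rotated])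
  qed
qed

lemma k_smooth_prod:
  fixes f :: "'i \<Rightarrow> 'a::euclidean_space \<Rightarrow> real"
  assumes "\<And>i. i \<in> I \<Longrightarrow> k_smooth k (f i)"
  shows "k_smooth k (\<lambda>x. \<Prod>i\<in>I. f i x)"
  using assms
  by (induction I rule: infinite_finite_induct) (auto intro: k_smooth_const k_smooth_mult)

lemma k_smooth_scaleR:
  fixes f :: "'a::euclidean_space \<Rightarrow> real"
  shows "k_smooth k f \<Longrightarrow> k_smooth k (\<lambda>x. f x *\<^sub>R v)"
proof (induction k arbitrary: f)
  case 0
  then show ?case by (auto intro: continuous_intros)
next
  case (Suc k)
  show ?case
    by (rule k_smooth_SucI[OF has_derivative_scaleR_left[OF k_smooth_derivative[OF Suc.prems(1)]]])
      (use Suc in auto)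
qed

section \<open>Smooth functions that approximate indicators of boxes\<close>

lemma k_smooth_exp: "k_smooth k (exp :: real \<Rightarrow> real)"
proof (induction k)
  case (Suc k)
  have "(exp has_derivative (\<lambda>h. exp x * h)) (at x)" for x :: real
    using DERIV_exp[of x] by (simp add: has_field_derivative_def)
  then show ?case
    by (rule k_smooth_SucI) (use Suc in simp)
qed (auto intro: continuous_intros)

text \<open>For \<open>m = 0\<close> this is the classical smooth function that is flat at 0. The
  powers of \<open>t\<close> in the denominator make the family closed under differentiation up to
  linear combinations, so that one induction on \<open>k\<close>, general in \<open>m\<close>,
  proves smoothness.\<close>

definition flat :: "nat \<Rightarrow> real \<Rightarrow> real" where
  "flat m t = (if t > 0 then exp (- (1 / t)) / t ^ m else 0)"

lemma flat_nonneg [simp]: "flat m t \<ge> 0"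
  by (simp add: flat_def)

lemma flat_eq_0_iff [simp]: "flat m t = 0 \<longleftrightarrow> t \<le> 0"
  by (simp add: flat_def)

lemma flat_tendsto_0: "(flat m \<longlongrightarrow> 0) (at 0)"
proof (rule filterlim_split_at)
  have "\<forall>\<^sub>F t in at_left 0. flat m t = 0"
    by (auto simp: eventually_at_filter)
  then show "(flat m \<longlongrightarrow> 0) (at_left 0)"
    by (rule tendsto_eventually)
next
  have "((\<lambda>t::real. inverse t ^ m / exp (inverse t)) \<longlongrightarrow> 0) (at_right 0)"
    by (rule filterlim_compose[OF tendsto_power_div_exp_0 filterlim_inverse_at_top_right])
  moreover have "\<forall>\<^sub>F t in at_right 0. inverse t ^ m / exp (inverse t) = flat m t"
    by (auto simp: eventually_at_filter flat_def exp_minus field_simps)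
  ultimately show "(flat m \<longlongrightarrow> 0) (at_right 0)"
    by (rule Lim_transform_eventually)
qed

lemma flat_DERIV: "(flat m has_real_derivative flat (m + 2) t - real m * flat (m + 1) t) (at t)"
proof -
  consider "t < 0" | "t = 0" | "t > 0" by linarith
  then show ?thesis
  proof cases
    case 1
    have "((\<lambda>_. 0) has_real_derivative flat (m + 2) t - real m * flat (m + 1) t) (at t)"
      using 1 by (simp add: flat_def)
    then show ?thesis
      by (rule has_field_derivative_transform_within_open[of _ _ _ "{..<0}"]) (use 1 in \<open>auto simp: flat_def\<close>)
  next
    case 3
    have "((\<lambda>t. exp (- (1 / t)) / t ^ m) has_real_derivative flat (m + 2) t - real m * flat (m + 1) t) (at t)"
      using 3
      apply (auto intro!: derivative_eq_intros simp: flat_def)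
      apply (cases m)
       apply (auto simp: field_simps power2_eq_square)
      done
    then show ?thesis
      by (rule has_field_derivative_transform_within_open[of _ _ _ "{0<..}"]) (use 3 in \<open>auto simp: flat_def\<close>)
  next
    case 2
    \<comment> \<open>At 0 the difference quotient of \<open>flat m\<close> is
      \<open>flat (m + 1)\<close> itself, which tends to 0.\<close>
    have "\<forall>\<^sub>F h in at 0. flat (m + 1) h = (flat m (0 + h) - flat m 0) / h"
      by (auto simp: eventually_at_filter flat_def)
    from Lim_transform_eventually[OF flat_tendsto_0 this] show ?thesis
      unfolding 2 DERIV_def by (simp add: flat_def)
  qed
qed

lemma k_smooth_flat: "k_smooth k (flat m)"
proof (induction k arbitrary: m)
  case 0
  show ?case
    by (auto intro!: DERIV_continuous_on[OF DERIV_subset[OF flat_DERIV]])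
next
  case (Suc k)
  have "(flat m has_derivative (\<lambda>h. (flat (m + 2) t + (- real m) * flat (m + 1) t) * h)) (at t)" for t
    using flat_DERIV[of m t] by (simp add: has_field_derivative_def)
  then show ?case
  proof (rule k_smooth_SucI)
    show "k_smooth k (\<lambda>t. (flat (m + 2) t + (- real m) * flat (m + 1) t) * b)" for b
      by (intro k_smooth_add k_smooth_mult k_smooth_const Suc)
  qed
qed

definition box_weight :: "'a::euclidean_space \<Rightarrow> 'a \<Rightarrow> 'a \<Rightarrow> real" where
  "box_weight a b x = (\<Prod>i\<in>Basis. flat 0 ((x - a) \<bullet> i) * flat 0 ((b - x) \<bullet> i))"

text \<open>\<open>box_weight\<close> is positive exactly in the open box. For \<open>n > 0\<close>
  the cutoff therefore vanishes outside the box, stays between 0 and 1, and tends to 1 inside as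
  \<open>n\<close> grows, which gives smooth approximations of the indicator without
  convolution.\<close>

definition box_cutoff :: "'a::euclidean_space \<Rightarrow> 'a \<Rightarrow> real \<Rightarrow> 'a \<Rightarrow> real" where
  "box_cutoff a b n x = 1 - exp (- n * box_weight a b x)"

lemma box_weight_nonneg [simp]: "box_weight a b x \<ge> 0"
  by (simp add: box_weight_def prod_nonneg)

lemma box_weight_eq_0_iff: "box_weight a b x = 0 \<longleftrightarrow> x \<notin> box a b"
  by (auto simp: box_weight_def box_def inner_diff_left not_less)

lemma smooth_box_cutoff: "smooth (box_cutoff a b n)"
  unfolding smooth_def
proof
  fix k
  have aff: "k_smooth k (\<lambda>x. (x - a) \<bullet> i)" "k_smooth k (\<lambda>x. (b - x) \<bullet> i)" for i
  proof -
    have "k_smooth k (\<lambda>x. x \<bullet> i + - (a \<bullet> i))" "k_smooth k (\<lambda>x. b \<bullet> i + - (x \<bullet> i))"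
      by (intro k_smooth_add k_smooth_const k_smooth_linear
          bounded_linear_inner_left bounded_linear_minus[OF bounded_linear_inner_left])+
    then show "k_smooth k (\<lambda>x. (x - a) \<bullet> i)" "k_smooth k (\<lambda>x. (b - x) \<bullet> i)"
      by (simp_all add: inner_diff_left)
  qed
  have "k_smooth k (box_weight a b)"
    unfolding box_weight_def[abs_def]
    by (intro k_smooth_prod k_smooth_mult k_smooth_compose[OF k_smooth_flat] aff)
  then have "k_smooth k (\<lambda>x. 1 + (- 1) * exp ((- n) * box_weight a b x))"
    by (intro k_smooth_add k_smooth_mult k_smooth_const k_smooth_compose[OF k_smooth_exp])
  then show "k_smooth k (box_cutoff a b n)"
    by (simp add: box_cutoff_def[abs_def])
qed

lemma box_cutoff_test_function:
  assumes "cbox a b \<subseteq> S" "n > 0"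
  shows "box_cutoff a b n \<in> test_functions S"
proof -
  have "{x. box_cutoff a b n x \<noteq> 0} \<subseteq> cbox a b"
    using assms(2) box_subset_cbox[of a b] by (auto simp: box_cutoff_def box_weight_eq_0_iff)
  then have "closure {x. box_cutoff a b n x \<noteq> 0} \<subseteq> cbox a b"
    by (rule closure_minimal) (rule closed_cbox)
  then show ?thesis
    using assms smooth_box_cutoff unfolding test_functions_def
    by (auto intro: compact_closure[THEN iffD2] bounded_subset[OF bounded_cbox]
        dest: order.trans[OF closure_subset])
qed

lemma box_cutoff_bounds: "n \<ge> 0 \<Longrightarrow> 0 \<le> box_cutoff a b n x" "box_cutoff a b n x \<le> 1"
  by (simp_all add: box_cutoff_def)

lemma box_cutoff_tendsto: "(\<lambda>n. box_cutoff a b (real (Suc n)) x) \<longlonglongrightarrow> indicator (box a b) x"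
proof (cases "x \<in> box a b")
  case True
  then have pos: "box_weight a b x > 0"
    using box_weight_eq_0_iff[of a b x] box_weight_nonneg[of a b x] by linarith
  then have "(\<lambda>n. exp (- box_weight a b x) ^ Suc n) \<longlonglongrightarrow> 0"
    by (intro LIMSEQ_Suc LIMSEQ_power_zero) simp
  then have "(\<lambda>n. exp (- real (Suc n) * box_weight a b x)) \<longlonglongrightarrow> 0"
    by (simp only: exp_of_nat_mult[symmetric] mult_minus_left mult_minus_right)
  from tendsto_diff[OF tendsto_const[of 1] this] True show ?thesis
    by (simp add: box_cutoff_def)
next
  case False
  then show ?thesis
    by (simp add: box_cutoff_def box_weight_eq_0_iff[THEN iffD2])
qed


section \<open>Functions determined by their integrals over boxes and against test functions\<close>

lemma indicator_box_measurable [measurable]: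
  "(indicator (box a b) :: _ \<Rightarrow> real) \<in> borel_measurable lebesgue"
  by (intro borel_measurable_indicator sets_completionI_sets) simp

text \<open>Boxes are stable under intersection and generate the Borel sets, so a Dynkin argument
  carries the vanishing from boxes to all Borel sets. It is run on a Borel version \<open>g\<close>
  of \<open>f\<close> under \<open>lborel\<close>.\<close>

lemma AE_zero_if_box_integrals_zero:
  fixes f :: "'a::euclidean_space \<Rightarrow> real"
  assumes f: "integrable lebesgue f"
    and 0: "\<And>a b. (LINT x|lebesgue. indicator (box a b) x * f x) = 0"
  shows "AE x in lebesgue. f x = 0"
proof -
  obtain g where g: "g \<in> borel_measurable lborel" "AE x in lborel. f x = g x"
    using completion_ex_borel_measurable_real[OF borel_measurable_integrable[OF f]] by blast
  have fg: "AE x in lebesgue. f x = g x"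
    using g(2) by (rule AE_completion)
  have gi: "integrable lborel g"
  proof -
    have "integrable lebesgue g"
      using integrable_cong_AE_imp[OF f _ fg] g(1) by (simp add: measurable_completion)
    then show ?thesis using g(1) by (simp add: integrable_completion)
  qed
  have box: "(LINT x:box a b|lborel. g x) = 0" for a b
  proof -
    have "(LINT x:box a b|lborel. g x) = (LINT x|lebesgue. indicator (box a b) x * g x)"
      using g(1) unfolding set_lebesgue_integral_def by (subst integral_completion) auto
    also have "\<dots> = (LINT x|lebesgue. indicator (box a b) x * f x)"
    proof (rule integral_cong_AE)
      have "g \<in> borel_measurable lebesgue" using g(1) by (rule measurable_completion)
      then show "(\<lambda>x. indicator (box a b) x * g x) \<in> borel_measurable lebesgue"
        by (intro borel_measurable_times indicator_box_measurable)
      show "(\<lambda>x. indicator (box a b) x * f x) \<in> borel_measurable lebesgue"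
        using borel_measurable_integrable[OF f] by (intro borel_measurable_times indicator_box_measurable)
      show "AE x in lebesgue. indicat_real (box a b) x * g x = indicat_real (box a b) x * f x"
        using fg by eventually_elim simp
    qed
    finally show ?thesis using 0 by simp
  qed
  have int: "set_integrable lborel A g" if "A \<in> sets borel" for A
    using gi that unfolding set_integrable_def by (intro integrable_mult_indicator) auto
  \<comment> \<open>Complements are handled by subtraction from the whole space, so the total
    integral has to vanish too; the space is exhausted by growing boxes.\<close>
  have UNIV: "(LINT x:UNIV|lborel. g x) = 0"
  proof -
    define B where "B n = box (- real n *\<^sub>R One) (real n *\<^sub>R One :: 'a)" for n
    have "(\<lambda>n. LINT x:B n|lborel. g x) \<longlonglongrightarrow> (LINT x:UNIV|lborel. g x)"
      unfolding set_lebesgue_integral_def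
    proof (rule integral_dominated_convergence)
      show "integrable lborel (\<lambda>x. \<bar>g x\<bar>)" using gi by simp
      show "AE x in lborel. (\<lambda>n. indicat_real (B n) x *\<^sub>R g x) \<longlonglongrightarrow> indicat_real UNIV x *\<^sub>R g x"
      proof (rule AE_I2)
        fix x :: 'a
        obtain N where N: "norm x < real N" using reals_Archimedean2 by blast
        have "x \<in> B n" if "n \<ge> N" for n
        proof -
          have "\<bar>x \<bullet> i\<bar> < real n" if "i \<in> Basis" for i
            using Basis_le_norm[OF that, of x] N \<open>n \<ge> N\<close> by linarith
          then show ?thesis unfolding B_def by (auto simp: box_def abs_less_iff minus_less_iff)
        qed
        then have "\<forall>\<^sub>F n in sequentially. indicat_real (B n) x *\<^sub>R g x = indicat_real UNIV x *\<^sub>R g x"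
          by (auto simp: eventually_sequentially intro!: exI[of _ N])
        then show "(\<lambda>n. indicat_real (B n) x *\<^sub>R g x) \<longlonglongrightarrow> indicat_real UNIV x *\<^sub>R g x"
          by (rule tendsto_eventually)
      qed
      show "AE x in lborel. norm (indicat_real (B n) x *\<^sub>R g x) \<le> \<bar>g x\<bar>" for n
        by (auto simp: indicator_def)
    qed (use g(1) in \<open>auto simp: B_def\<close>)
    then show ?thesis
      unfolding B_def using box by (simp add: LIMSEQ_const_iff)
  qed
  have "(LINT x:A|lborel. g x) = 0" if "A \<in> sets borel" for A
  proof -
    have "Int_stable (range (\<lambda>(a, b). box a b :: 'a set))"
      by (auto simp: Int_stable_def box_Int_box)
    moreover have "range (\<lambda>(a, b). box a b :: 'a set) \<subseteq> Pow UNIV"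
      by simp
    moreover have "A \<in> sigma_sets UNIV (range (\<lambda>(a, b). box a b))"
      using that by (simp add: borel_eq_box)
    ultimately show ?thesis
    proof (induction rule: sigma_sets_induct_disjoint[consumes 3])
      case (basic A)
      then show ?case using box by auto
    next
      case empty
      show ?case by (simp add: set_lebesgue_integral_def)
    next
      case (compl A)
      then have "A \<in> sets borel" by (simp add: borel_eq_box)
      then have "(LINT x:A \<union> (UNIV - A)|lborel. g x) = (LINT x:A|lborel. g x) + (LINT x:UNIV - A|lborel. g x)"
        by (intro set_integral_Un int) auto
      with compl UNIV show ?case by simp
    next
      case (union A)
      then have A: "range A \<subseteq> sets borel" by (auto simp: borel_eq_box)
      have "(LINT x:(\<Union>i. A i)|lborel. g x) = (\<Sum>i. LINT x:A i|lborel. g x)"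
        using A union(1) by (intro lebesgue_integral_countable_add int) (auto simp: disjoint_family_on_def)
      with union show ?case by simp
    qed
  qed
  then have "AE x in lborel. g x = 0"
    using gi by (intro density_unique_real) (auto simp: set_lebesgue_integral_def)
  with g(2) have "AE x in lborel. f x = 0" by eventually_elim simp
  then show ?thesis by (rule AE_completion)
qed

text \<open>Dominated convergence along \<open>box_cutoff\<close> gives zero integrals over all
  boxes whose closed box lies in \<open>\<Omega>\<close>. For such a box the localised function has
  zero integral over every box of the space, since boxes intersect in boxes. Countably many closed
  boxes fill \<open>\<Omega>\<close>.\<close>

lemma fundamental_lemma:
  fixes h :: "'a::euclidean_space \<Rightarrow> real"
  assumes "open \<Omega>" and loc: "locally_integrable \<Omega> h"
    and 0: "\<And>\<theta>. \<theta> \<in> test_functions \<Omega> \<Longrightarrow> (LINT x|lebesgue_on \<Omega>. h x * \<theta> x) = 0"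
  shows "AE x in lebesgue_on \<Omega>. h x = 0"
proof -
  have \<Omega>: "\<Omega> \<in> sets lebesgue" using \<open>open \<Omega>\<close> by auto
  have box: "(LINT x|lebesgue. indicator (box a b) x * h x) = 0" if ab: "cbox a b \<subseteq> \<Omega>" for a b
  proof -
    have hi: "integrable lebesgue (\<lambda>x. indicator (cbox a b) x * h x)"
      using loc ab compact_cbox unfolding locally_integrable_def set_integrable_def by auto
    define F where "F n x = box_cutoff a b (real (Suc n)) x * (indicator (cbox a b) x * h x)" for n x
    have cut_meas: "box_cutoff a b n \<in> borel_measurable lebesgue" for n
    proof -
      have "continuous_on UNIV (box_cutoff a b n)"
        using smooth_box_cutoff[of a b n, unfolded smooth_def, rule_format, of 0] by simp
      then show ?thesis
        by (intro measurable_completion) (simp add: borel_measurable_continuous_onI)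
    qed
    have F0: "(LINT x|lebesgue. F n x) = 0" for n
    proof -
      have "(LINT x|lebesgue. F n x) = (LINT x|lebesgue. indicator \<Omega> x *\<^sub>R (h x * box_cutoff a b (real (Suc n)) x))"
      proof (rule Bochner_Integration.integral_cong)
        fix x
        have "box_cutoff a b (real (Suc n)) x = 0" if "x \<notin> cbox a b"
        proof -
          have "box_weight a b x = 0"
            using that box_subset_cbox[of a b] by (subst box_weight_eq_0_iff) blast
          then show ?thesis by (simp add: box_cutoff_def)
        qed
        then show "F n x = indicator \<Omega> x *\<^sub>R (h x * box_cutoff a b (real (Suc n)) x)"
          using ab by (auto simp: F_def indicator_def)
      qed simp
      also have "\<dots> = (LINT x|lebesgue_on \<Omega>. h x * box_cutoff a b (real (Suc n)) x)"
        using \<Omega> by (subst integral_restrict_space) auto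
      also have "\<dots> = 0"
        by (intro 0 box_cutoff_test_function ab) simp
      finally show ?thesis .
    qed
    have "(\<lambda>n. LINT x|lebesgue. F n x) \<longlonglongrightarrow> (LINT x|lebesgue. indicator (box a b) x * h x)"
    proof (rule integral_dominated_convergence)
      show "integrable lebesgue (\<lambda>x. \<bar>indicator (cbox a b) x * h x\<bar>)"
        using hi by (rule integrable_abs)
      show "F n \<in> borel_measurable lebesgue" for n
        unfolding F_def by (intro borel_measurable_times[OF cut_meas borel_measurable_integrable[OF hi]])
      show "AE x in lebesgue. (\<lambda>n. F n x) \<longlonglongrightarrow> indicator (box a b) x * h x"
      proof (rule AE_I2)
        fix x
        have "(\<lambda>n. F n x) \<longlonglongrightarrow> indicator (box a b) x * (indicator (cbox a b) x * h x)"
          unfolding F_def by (intro tendsto_mult box_cutoff_tendsto tendsto_const)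
        also have "indicator (box a b) x * (indicator (cbox a b) x * h x) = indicator (box a b) x * h x"
          using box_subset_cbox[of a b] by (auto simp: indicator_def)
        finally show "(\<lambda>n. F n x) \<longlonglongrightarrow> indicator (box a b) x * h x" .
      qed
      show "AE x in lebesgue. norm (F n x) \<le> \<bar>indicator (cbox a b) x * h x\<bar>" for n
        by (intro AE_I2) (simp add: F_def abs_mult box_cutoff_bounds mult_left_le_one_le)
      have "(\<lambda>x. indicator (box a b) x * (indicator (cbox a b) x * h x)) \<in> borel_measurable lebesgue"
        by (intro borel_measurable_times[OF indicator_box_measurable borel_measurable_integrable[OF hi]])
      also have "(\<lambda>x. indicator (box a b) x * (indicator (cbox a b) x * h x)) = (\<lambda>x. indicator (box a b) x * h x)"
        using box_subset_cbox[of a b] by (auto simp: indicator_def fun_eq_iff)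
      finally show "(\<lambda>x. indicator (box a b) x * h x) \<in> borel_measurable lebesgue" .
    qed
    then show ?thesis by (simp add: F0 LIMSEQ_const_iff)
  qed
  have AE_box: "AE x in lebesgue. x \<in> cbox c d \<longrightarrow> h x = 0" if cd: "cbox c d \<subseteq> \<Omega>" for c d
  proof -
    have hi: "integrable lebesgue (\<lambda>x. indicator (box c d) x * (indicator (cbox c d) x * h x))"
    proof -
      have "integrable lebesgue (\<lambda>x. indicator (cbox c d) x * h x)"
        using loc cd compact_cbox unfolding locally_integrable_def set_integrable_def by auto
      from integrable_mult_indicator[OF _ this, of "box c d"] show ?thesis by simp
    qed
    also have "(\<lambda>x. indicator (box c d) x * (indicator (cbox c d) x * h x)) = (\<lambda>x. indicator (box c d) x * h x)"
      using box_subset_cbox[of c d] by (auto simp: indicator_def fun_eq_iff)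
    finally have hi: "integrable lebesgue (\<lambda>x. indicator (box c d) x * h x)" .
    have "AE x in lebesgue. indicator (box c d) x * h x = 0"
    proof (rule AE_zero_if_box_integrals_zero[OF hi])
      fix a b :: 'a
      obtain a' b' where ab': "box a b \<inter> box c d = box a' b'"
        by (rule that[OF box_Int_box])
      show "(LINT x|lebesgue. indicator (box a b) x * (indicator (box c d) x * h x)) = 0"
      proof (cases "box a' b' = {}")
        case True
        then have "indicator (box a b) x * (indicator (box c d) x * h x) = 0" for x
          using ab' by (auto simp: indicator_def)
        then show ?thesis by (simp only: Bochner_Integration.integral_zero)
      next
        case False
        have "cbox a' b' \<subseteq> cbox c d"
        proof -
          have "box a' b' \<subseteq> cbox c d" using ab' box_subset_cbox[of c d] by blast
          from closure_minimal[OF this closed_cbox] False show ?thesis by (simp add: closure_box)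
        qed
        moreover have "indicator (box a b) x * (indicator (box c d) x * h x) = indicator (box a' b') x * h x" for x
          unfolding ab'[symmetric] by (auto simp: indicator_def)
        ultimately show ?thesis using box[OF order.trans[OF _ cd], of a' b'] by (simp only:)
      qed
    qed
    \<comment> \<open>The localisation is to the open box; the faces of the closed box form a null
      set.\<close>
    moreover have "AE x in lebesgue. x \<notin> cbox c d - box c d"
      by (rule AE_not_in[OF negligible_frontier_interval[of c d, unfolded negligible_iff_null_sets]])
    ultimately show ?thesis
      by eventually_elim (auto simp: indicator_def)
  qed
  obtain \<D> where D: "countable \<D>" "\<D> \<subseteq> Pow \<Omega>" "\<And>X. X \<in> \<D> \<Longrightarrow> \<exists>a b. X = cbox a b" "\<Union>\<D> = \<Omega>"
    using open_countable_Union_open_cbox[OF \<open>open \<Omega>\<close>] by metis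
  have "AE x in lebesgue. \<forall>X\<in>\<D>. x \<in> X \<longrightarrow> h x = 0"
    using D(1)
  proof (rule AE_ball_countable'[rotated])
    show "AE x in lebesgue. x \<in> X \<longrightarrow> h x = 0" if "X \<in> \<D>" for X
      using D(2,3) that AE_box by blast
  qed
  then have "AE x in lebesgue. x \<in> \<Omega> \<longrightarrow> h x = 0"
    by eventually_elim (use D(4) in blast)
  then show ?thesis
    using \<Omega> by (simp add: AE_restrict_space_iff)
qed

section \<open>Local integrability, test functions and uniqueness of weak gradients\<close>

lemma locally_integrable_measurable:
  fixes f :: "'a::euclidean_space \<Rightarrow> 'b::euclidean_space"
  assumes "open \<Omega>" "locally_integrable \<Omega> f"
  shows "f \<in> borel_measurable (lebesgue_on \<Omega>)"
proof -
  obtain \<D> where D: "countable \<D>" "\<D> \<subseteq> Pow \<Omega>" "\<And>X. X \<in> \<D> \<Longrightarrow> \<exists>a b. X = cbox a b" "\<Union>\<D> = \<Omega>"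
    using open_countable_Union_open_cbox[OF \<open>open \<Omega>\<close>] by metis
  have meas: "f \<in> borel_measurable (restrict_space (lebesgue_on \<Omega>) X)" if XD: "X \<in> \<D>" for X
  proof -
    obtain a b where X: "X = cbox a b" using D(3)[OF XD] by blast
    then have "f absolutely_integrable_on X"
      using assms(2) D(2) XD unfolding locally_integrable_def by (auto simp: compact_cbox)
    then have "f \<in> borel_measurable (lebesgue_on X)"
      using absolutely_integrable_measurable X lmeasurable_cbox fmeasurableD by blast
    moreover have "restrict_space (lebesgue_on \<Omega>) X = lebesgue_on X"
      using D(2) XD \<open>open \<Omega>\<close> X by (subst restrict_restrict_space) (auto simp: Int_absorb1)
    ultimately show ?thesis by simp
  qed
  show ?thesis
  proof (rule measurable_piecewise_restrict[OF D(1)])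
    show "\<And>X. X \<in> \<D> \<Longrightarrow> X \<inter> space (lebesgue_on \<Omega>) \<in> sets (lebesgue_on \<Omega>)"
      using D(2,3) \<open>open \<Omega>\<close> by (fastforce simp: sets_restrict_space_iff Int_absorb2)
  qed (use D meas in auto)
qed

lemma locally_integrable_component:
  fixes f :: "'a::euclidean_space \<Rightarrow> 'b::euclidean_space"
  assumes "locally_integrable \<Omega> f"
  shows "locally_integrable \<Omega> (\<lambda>x. f x \<bullet> c)"
  using assms unfolding locally_integrable_def
  by (auto intro: absolutely_integrable_linear[OF _ bounded_linear_inner_left, unfolded o_def])

lemma locally_integrable_diff:
  assumes "locally_integrable \<Omega> f" "locally_integrable \<Omega> g"
  shows "locally_integrable \<Omega> (\<lambda>x. f x - g x)"
  using assms unfolding locally_integrable_def by (auto intro: set_integral_diff)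

lemma test_function_continuous: "\<theta> \<in> test_functions S \<Longrightarrow> continuous_on A \<theta>"
proof -
  assume "\<theta> \<in> test_functions S"
  then have "k_smooth 0 \<theta>" unfolding test_functions_def smooth_def by blast
  then show ?thesis by (auto intro: continuous_on_subset)
qed

lemma test_function_partial_continuous:
  "\<theta> \<in> test_functions S \<Longrightarrow> b \<in> Basis \<Longrightarrow> continuous_on A (\<lambda>x. frechet_derivative \<theta> (at x) b)"
proof -
  assume "\<theta> \<in> test_functions S" "b \<in> Basis"
  then have "k_smooth (Suc 0) \<theta>" unfolding test_functions_def smooth_def by blast
  with \<open>b \<in> Basis\<close> show ?thesis by (auto intro: continuous_on_subset)
qed

lemma test_function_has_derivative:
  "\<theta> \<in> test_functions S \<Longrightarrow> (\<theta> has_derivative frechet_derivative \<theta> (at x)) (at x)"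
  unfolding test_functions_def smooth_def using k_smooth_derivative[of 0 \<theta>] by blast

lemma test_function_support:
  assumes "\<theta> \<in> test_functions S"
  obtains K where "compact K" "K \<subseteq> S" "\<And>x. x \<notin> K \<Longrightarrow> \<theta> x = 0"
    "\<And>x b. x \<notin> K \<Longrightarrow> frechet_derivative \<theta> (at x) b = 0"
proof -
  define K where "K = closure {x. \<theta> x \<noteq> 0}"
  have K: "compact K" "K \<subseteq> S" "\<And>x. x \<notin> K \<Longrightarrow> \<theta> x = 0"
    using assms closure_subset[of "{x. \<theta> x \<noteq> 0}"] unfolding test_functions_def K_def by auto
  have "frechet_derivative \<theta> (at x) b = 0" if "x \<notin> K" for x b
  proof -
    have "((\<lambda>_. 0) has_derivative (\<lambda>_. 0)) (at x)" by simp
    then have "(\<theta> has_derivative (\<lambda>_. 0)) (at x)"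
      by (rule has_derivative_transform_within_open[of _ _ _ _ "- K"]) (use that K compact_imp_closed in auto)
    from frechet_derivative_at[OF this] show ?thesis by metis
  qed
  with K show thesis by (intro that[of K])
qed

lemma test_function_bounded:
  assumes "\<theta> \<in> test_functions S"
  obtains C where "\<And>x. \<bar>\<theta> x\<bar> \<le> C"
proof -
  obtain K where K: "compact K" "\<And>x. x \<notin> K \<Longrightarrow> \<theta> x = 0"
    using test_function_support[OF assms] by metis
  have "bounded (\<theta> ` K)"
    using K(1) test_function_continuous[OF assms] by (intro compact_imp_bounded compact_continuous_image)
  then obtain C where C: "\<And>x. x \<in> K \<Longrightarrow> \<bar>\<theta> x\<bar> \<le> C"
    unfolding bounded_iff by auto
  have "\<bar>\<theta> x\<bar> \<le> max C 0" for x
    using C[of x] K(2)[of x] by (cases "x \<in> K") auto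
  then show thesis by (rule that)
qed

lemma test_function_partial_bounded:
  assumes "\<theta> \<in> test_functions S" "b \<in> Basis"
  obtains C where "\<And>x. \<bar>frechet_derivative \<theta> (at x) b\<bar> \<le> C"
proof -
  obtain K where K: "compact K" "\<And>x. x \<notin> K \<Longrightarrow> frechet_derivative \<theta> (at x) b = 0"
    using test_function_support[OF assms(1)] by metis
  have "bounded ((\<lambda>x. frechet_derivative \<theta> (at x) b) ` K)"
    using K(1) test_function_partial_continuous[OF assms]
    by (intro compact_imp_bounded compact_continuous_image)
  then obtain C where C: "\<And>x. x \<in> K \<Longrightarrow> \<bar>frechet_derivative \<theta> (at x) b\<bar> \<le> C"
    unfolding bounded_iff by auto
  have "\<bar>frechet_derivative \<theta> (at x) b\<bar> \<le> max C 0" for x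
    using C[of x] K(2)[of x] by (cases "x \<in> K") auto
  then show thesis by (rule that)
qed

lemma integrable_locally_times_test:
  fixes h :: "'a::euclidean_space \<Rightarrow> real"
  assumes "open \<Omega>" "locally_integrable \<Omega> h" "\<theta> \<in> test_functions \<Omega>"
  shows "integrable (lebesgue_on \<Omega>) (\<lambda>x. h x * \<theta> x)"
proof -
  have \<Omega>: "\<Omega> \<in> sets lebesgue" using \<open>open \<Omega>\<close> by auto
  obtain K where K: "compact K" "K \<subseteq> \<Omega>" "\<And>x. x \<notin> K \<Longrightarrow> \<theta> x = 0"
    using test_function_support[OF assms(3)] by metis
  obtain C where C: "\<And>x. \<bar>\<theta> x\<bar> \<le> C" using test_function_bounded[OF assms(3)] by metis
  have "integrable lebesgue (\<lambda>x. indicator K x *\<^sub>R h x)"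
    using assms(2) K unfolding locally_integrable_def set_integrable_def by auto
  also have "(\<lambda>x. indicator K x *\<^sub>R h x) = (\<lambda>x. indicator \<Omega> x *\<^sub>R (indicator K x *\<^sub>R h x))"
    using K(2) by (auto simp: indicator_def fun_eq_iff)
  finally have "integrable (lebesgue_on \<Omega>) (\<lambda>x. indicator K x *\<^sub>R h x)"
    using \<Omega> by (subst integrable_restrict_space) auto
  then have "integrable (lebesgue_on \<Omega>) (\<lambda>x. C * \<bar>indicator K x *\<^sub>R h x\<bar>)"
    by (intro integrable_mult_right integrable_abs)
  then show ?thesis
  proof (rule Bochner_Integration.integrable_bound)
    show "(\<lambda>x. h x * \<theta> x) \<in> borel_measurable (lebesgue_on \<Omega>)"
      using locally_integrable_measurable[OF assms(1,2)] test_function_continuous[OF assms(3), of \<Omega>] \<Omega>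
      by (intro borel_measurable_times) (auto intro: continuous_imp_measurable_on_sets_lebesgue)
    show "AE x in lebesgue_on \<Omega>. norm (h x * \<theta> x) \<le> norm (C * \<bar>indicat_real K x *\<^sub>R h x\<bar>)"
    proof (rule AE_I2)
      fix x show "norm (h x * \<theta> x) \<le> norm (C * \<bar>indicat_real K x *\<^sub>R h x\<bar>)"
        using K(3)[of x] C[of x] by (cases "x \<in> K") (auto simp: abs_mult mult.commute intro: mult_right_mono)
    qed
  qed
qed

text \<open>\<open>grad\<close> is an arbitrary choice among weak gradients. Uniqueness up to null
  sets lets a concrete weak gradient replace it under integrals.\<close>

lemma has_weak_grad_unique:
  assumes "open \<Omega>" "has_weak_grad \<Omega> u g" "has_weak_grad \<Omega> u g'"
  shows "AE x in lebesgue_on \<Omega>. g x = (g' x :: real^'d::finite^'l::finite)"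
proof -
  have "AE x in lebesgue_on \<Omega>. g x $ i $ j - g' x $ i $ j = 0" for i j
  proof (rule fundamental_lemma[OF \<open>open \<Omega>\<close>])
    have comp: "locally_integrable \<Omega> (\<lambda>x. h x $ i $ j)" if "locally_integrable \<Omega> h"
      for h :: "real^'d \<Rightarrow> real^'d^'l"
      using locally_integrable_component[OF that, of "axis i (axis j 1)"] by (simp add: inner_axis)
    have li: "locally_integrable \<Omega> (\<lambda>x. g x $ i $ j)" "locally_integrable \<Omega> (\<lambda>x. g' x $ i $ j)"
      using assms(2,3) comp unfolding has_weak_grad_def by auto
    show "locally_integrable \<Omega> (\<lambda>x. g x $ i $ j - g' x $ i $ j)"
      using li by (rule locally_integrable_diff)
    fix \<theta> assume \<theta>: "\<theta> \<in> test_functions \<Omega>"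
    have eq: "(LINT x|lebesgue_on \<Omega>. u x $ i * partial_deriv j \<theta> x) = - (LINT x|lebesgue_on \<Omega>. h x $ i $ j * \<theta> x)"
      if "has_weak_grad \<Omega> u h" for h
      using that \<theta> unfolding has_weak_grad_def by blast
    have "(LINT x|lebesgue_on \<Omega>. g x $ i $ j * \<theta> x) = (LINT x|lebesgue_on \<Omega>. g' x $ i $ j * \<theta> x)"
      using eq[OF assms(2)] eq[OF assms(3)] by simp
    then show "(LINT x|lebesgue_on \<Omega>. (g x $ i $ j - g' x $ i $ j) * \<theta> x) = 0"
      using integrable_locally_times_test[OF \<open>open \<Omega>\<close> li(1) \<theta>] integrable_locally_times_test[OF \<open>open \<Omega>\<close> li(2) \<theta>]
      by (simp add: left_diff_distrib)
  qed
  then have "AE x in lebesgue_on \<Omega>. \<forall>i j. g x $ i $ j - g' x $ i $ j = 0"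
    by (simp add: AE_all_countable)
  then show ?thesis
    by eventually_elim (simp add: vec_eq_iff)
qed

lemma has_weak_grad_grad:
  "has_weak_grad \<Omega> u g \<Longrightarrow> has_weak_grad \<Omega> u (grad \<Omega> u)"
  unfolding grad_def by (rule someI[of "has_weak_grad \<Omega> u"])

text \<open>Translations preserve the integral of \<open>h\<close>, so every difference quotient in
  direction \<open>b\<close> integrates to zero. The quotients converge to the derivative and are
  dominated by a constant on a fixed ball.\<close>

lemma integral_partial_zero:
  fixes h :: "'a::euclidean_space \<Rightarrow> real"
  assumes h: "h \<in> test_functions S" and b: "b \<in> Basis"
  shows "(LINT x|lebesgue. frechet_derivative h (at x) b) = 0"
proof -
  obtain K where K: "compact K" "\<And>x. x \<notin> K \<Longrightarrow> h x = 0"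
      "\<And>x b. x \<notin> K \<Longrightarrow> frechet_derivative h (at x) b = 0"
    using test_function_support[OF h] by metis
  obtain C where C: "\<And>x. \<bar>frechet_derivative h (at x) b\<bar> \<le> C"
    using test_function_partial_bounded[OF h b] by metis
  obtain C0 where C0: "\<And>x. \<bar>h x\<bar> \<le> C0" using test_function_bounded[OF h] by metis
  obtain R where "\<And>x. x \<in> K \<Longrightarrow> norm x \<le> R"
    using compact_imp_bounded[OF K(1)] unfolding bounded_iff by blast
  then have R: "K \<subseteq> cball 0 R" by auto
  have cont: "h \<in> borel_measurable borel" "(\<lambda>x. frechet_derivative h (at x) b) \<in> borel_measurable borel"
    using test_function_continuous[OF h] test_function_partial_continuous[OF h b]
    by (auto intro: borel_measurable_continuous_onI)
  have bi: "integrable lborel (\<lambda>x. c * indicator (cball (0 :: 'a) r) x)" for c r :: real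
    by (intro integrable_mult_right integrable_real_indicator)
      (use emeasure_bounded_finite[OF bounded_cball, of "0 :: 'a" r] in auto)
  have cb: "integrable lborel g"
    if g: "g \<in> borel_measurable borel" "\<And>x. \<bar>g x\<bar> \<le> c" "\<And>x. x \<notin> K \<Longrightarrow> g x = 0" for g :: "'a \<Rightarrow> real" and c
  proof (rule Bochner_Integration.integrable_bound[OF bi[of c R]])
    show "AE x in lborel. norm (g x) \<le> norm (c * indicat_real (cball 0 R) x)"
    proof (rule AE_I2)
      fix x show "norm (g x) \<le> norm (c * indicat_real (cball 0 R) x)"
      proof (cases "x \<in> cball 0 R")
        case True
        then show ?thesis using g(2)[of x] by simp
      next
        case False
        then have "g x = 0" using R g(3) by blast
        then show ?thesis by simp
      qed
    qed
  qed (use g(1) in simp)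
  have hi: "integrable lborel h"
    by (rule cb[OF cont(1) C0 K(2)])
  define q where "q n x = (h (x + (1 / real (Suc n)) *\<^sub>R b) - h x) / (1 / real (Suc n))" for n x
  have transl: "integrable lborel (\<lambda>x. h (x + s))" "(LINT x|lborel. h (x + s)) = (LINT x|lborel. h x)" for s
  proof -
    have "distr lborel borel ((+) s) = (lborel :: 'a measure)" by (rule lborel_distr_plus)
    then show "integrable lborel (\<lambda>x. h (x + s))" "(LINT x|lborel. h (x + s)) = (LINT x|lborel. h x)"
      using hi integrable_distr_eq[of "(+) s" lborel borel h] integral_distr[of "(+) s" lborel borel h] cont
      by (simp_all add: add.commute)
  qed
  have q0: "(LINT x|lborel. q n x) = 0" for n
    unfolding q_def using transl hi by simp
  have "(\<lambda>n. LINT x|lborel. q n x) \<longlonglongrightarrow> (LINT x|lborel. frechet_derivative h (at x) b)"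
  proof (rule integral_dominated_convergence[OF _ _ bi[of C "R + 1"]])
    show "q n \<in> borel_measurable lborel" for n
      unfolding q_def using borel_measurable_integrable[OF transl(1)] cont by auto
    show "AE x in lborel. (\<lambda>n. q n x) \<longlonglongrightarrow> frechet_derivative h (at x) b"
    proof (rule AE_I2)
      fix x
      have "((\<lambda>t. h (x + t *\<^sub>R b)) has_derivative (\<lambda>t. frechet_derivative h (at x) (t *\<^sub>R b))) (at 0)"
      proof -
        have "((\<lambda>t. x + t *\<^sub>R b) has_derivative (\<lambda>t. t *\<^sub>R b)) (at 0)"
          by (auto intro!: derivative_eq_intros)
        moreover have "(h has_derivative frechet_derivative h (at x)) (at (x + 0 *\<^sub>R b))"
          using test_function_has_derivative[OF h] by simp
        ultimately show ?thesis by (rule has_derivative_compose)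
      qed
      moreover have "frechet_derivative h (at x) (t *\<^sub>R b) = frechet_derivative h (at x) b * t" for t
        using linear_cmul[OF has_derivative_linear[OF test_function_has_derivative[OF h]]] by simp
      ultimately have "((\<lambda>t. h (x + t *\<^sub>R b)) has_field_derivative frechet_derivative h (at x) b) (at 0)"
        by (simp add: has_field_derivative_def)
      then have "((\<lambda>s. (h (x + s *\<^sub>R b) - h x) / s) \<longlongrightarrow> frechet_derivative h (at x) b) (at 0)"
        by (simp add: DERIV_def)
      moreover have "filterlim (\<lambda>n. 1 / real (Suc n)) (at 0) sequentially"
        using LIMSEQ_inverse_real_of_nat by (auto simp: filterlim_at inverse_eq_divide)
      ultimately show "(\<lambda>n. q n x) \<longlonglongrightarrow> frechet_derivative h (at x) b"
        unfolding q_def by (rule filterlim_compose)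
    qed
    \<comment> \<open>The increments have length at most 1, so the quotients vanish outside the ball
      of radius \<open>R + 1\<close>; inside, the mean value theorem bounds them by
      \<open>C\<close>.\<close>
    show "AE x in lborel. norm (q n x) \<le> C * indicator (cball 0 (R + 1)) x" for n
    proof (rule AE_I2)
      fix x
      let ?s = "1 / real (Suc n)"
      have s: "0 < ?s" "?s \<le> 1" by auto
      show "norm (q n x) \<le> C * indicator (cball 0 (R + 1)) x"
      proof (cases "x \<in> cball 0 (R + 1)")
        case True
        have "norm (h (x + ?s *\<^sub>R b) - h x) \<le> C * norm ((x + ?s *\<^sub>R b) - x)"
        proof -
          have "((\<lambda>t. h (x + t *\<^sub>R b)) has_real_derivative frechet_derivative h (at (x + t *\<^sub>R b)) b) (at t)" for t
          proof -
            have "((\<lambda>t. x + t *\<^sub>R b) has_derivative (\<lambda>t. t *\<^sub>R b)) (at t)"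
              by (auto intro!: derivative_eq_intros)
            from has_derivative_compose[OF this test_function_has_derivative[OF h]]
            have "((\<lambda>t. h (x + t *\<^sub>R b)) has_derivative (\<lambda>s. s * frechet_derivative h (at (x + t *\<^sub>R b)) b)) (at t)"
              using linear_cmul[OF has_derivative_linear[OF test_function_has_derivative[OF h]]] by simp
            moreover have "(\<lambda>s. s * frechet_derivative h (at (x + t *\<^sub>R b)) b) = (*) (frechet_derivative h (at (x + t *\<^sub>R b)) b)"
              by (simp add: fun_eq_iff)
            ultimately show ?thesis
              unfolding has_field_derivative_def by simp
          qed
          from MVT2[OF s(1) this]
          obtain z where "h (x + ?s *\<^sub>R b) - h (x + 0 *\<^sub>R b) = (?s - 0) * frechet_derivative h (at (x + z *\<^sub>R b)) b"
            by blast
          then show ?thesis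
            using C[of "x + z *\<^sub>R b"] b s by (simp add: abs_mult divide_right_mono)
        qed
        then have "\<bar>h (x + ?s *\<^sub>R b) - h x\<bar> \<le> C * ?s"
          using b s(1) by simp
        then have "\<bar>h (x + ?s *\<^sub>R b) - h x\<bar> / ?s \<le> C"
          using s(1) by (subst pos_divide_le_eq)
        moreover have "norm (q n x) = \<bar>h (x + ?s *\<^sub>R b) - h x\<bar> / ?s"
          unfolding q_def real_norm_def abs_divide by simp
        ultimately show ?thesis
          using True by (simp only: indicator_simps mult_1_right)
      next
        case False
        then have "norm x > R + 1" by simp
        moreover have "norm (x + ?s *\<^sub>R b) \<ge> norm x - 1"
        proof -
          have "norm (?s *\<^sub>R b) = ?s" using b s(1) by simp
          with norm_diff_ineq[of x "?s *\<^sub>R b"] s(2) show ?thesis by linarith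
        qed
        ultimately have "x \<notin> K" "x + ?s *\<^sub>R b \<notin> K" using R by auto
        moreover have "0 \<le> C" using C[of x] by linarith
        ultimately show ?thesis by (simp add: q_def K(2))
      qed
    qed
  qed (use cont in auto)
  then have "(LINT x|lborel. frechet_derivative h (at x) b) = 0"
    by (simp add: q0 LIMSEQ_const_iff)
  then show "(LINT x|lebesgue. frechet_derivative h (at x) b) = 0"
    using cont(2) by (subst integral_completion) auto
qed

section \<open>Lebesgue and Sobolev pairings\<close>

lemma Young_conjugate:
  assumes "1 < p" "1 / p + 1 / p' = (1::real)"
  shows "1 < p'" "0 \<le> a \<Longrightarrow> 0 \<le> b \<Longrightarrow> a * b \<le> a powr p' + b powr (p::real)"
proof -
  have "1 / p < 1" using assms(1) by simp
  with assms(2) have "1 / p' > 0" by linarith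
  then have "p' > 0" by simp
  have "1 / p > 0" using assms(1) by simp
  with assms(2) have "1 / p' < 1" by linarith
  with \<open>p' > 0\<close> show p': "1 < p'" by (simp add: field_simps)
  assume ab: "0 \<le> a" "0 \<le> b"
  have "a * b \<le> a powr p' / p' + b powr p / p"
    using Youngs_inequality[of p' p a b] p' assms ab by simp
  also have "\<dots> \<le> a powr p' + b powr p"
    using p' assms(1) by (intro add_mono) (auto simp: divide_le_eq mult_le_cancel_left1)
  finally show "a * b \<le> a powr p' + b powr p" .
qed

lemma Lp_space_measurable: "u \<in> Lp_space M p \<Longrightarrow> u \<in> borel_measurable M"
  and Lp_space_integrable: "u \<in> Lp_space M p \<Longrightarrow> integrable M (\<lambda>x. norm (u x) powr p)"
  by (auto simp: Lp_space_def)

lemma Lp_norm_powr: "p \<noteq> 0 \<Longrightarrow> Lp_norm M p u powr p = (LINT x|M. norm (u x) powr p)"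
  by (simp add: Lp_norm_def powr_powr Bochner_Integration.integral_nonneg)

lemma Lp_norm_nonneg [simp]: "Lp_norm M p u \<ge> 0"
  by (simp add: Lp_norm_def)

lemma Lp_norm_cong_AE:
  assumes "u \<in> borel_measurable M" "v \<in> borel_measurable M" "AE x in M. u x = v x"
  shows "Lp_norm M p u = Lp_norm M p v"
proof -
  have "(LINT x|M. norm (u x) powr p) = (LINT x|M. norm (v x) powr p)"
    using assms by (intro integral_cong_AE) auto
  then show ?thesis by (simp add: Lp_norm_def)
qed

lemma Lp_space_cong_AE:
  assumes "u \<in> Lp_space M p" "v \<in> borel_measurable M" "AE x in M. u x = v x"
  shows "v \<in> Lp_space M p"
proof -
  have "integrable M (\<lambda>x. norm (v x) powr p)"
    by (rule integrable_cong_AE_imp[OF Lp_space_integrable[OF assms(1)]])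
      (use assms in \<open>auto elim!: eventually_mono\<close>)
  with assms(2) show ?thesis by (simp add: Lp_space_def)
qed

lemma powr_add_le: "0 \<le> a \<Longrightarrow> 0 \<le> b \<Longrightarrow> 0 < p \<Longrightarrow> (a + b) powr p \<le> 2 powr p * (a powr p + b powr (p::real))"
proof -
  assume "0 \<le> a" "0 \<le> b" "0 < p"
  then have "(a + b) powr p \<le> (2 * max a b) powr p"
    by (intro powr_mono2) auto
  also have "\<dots> = 2 powr p * (max a b) powr p"
    using \<open>0 \<le> a\<close> \<open>0 \<le> b\<close> by (intro powr_mult)
  also have "(max a b) powr p \<le> a powr p + b powr p"
    by (auto simp: max_def)
  finally show ?thesis by simp
qed

lemma Lp_space_add:
  assumes "u \<in> Lp_space M p" "v \<in> Lp_space M p" "p > 0"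
  shows "(\<lambda>x. u x + v x) \<in> Lp_space M p"
proof -
  have m: "u \<in> borel_measurable M" "v \<in> borel_measurable M"
    using assms by (auto simp: Lp_space_def)
  have "integrable M (\<lambda>x. 2 powr p * (norm (u x) powr p + norm (v x) powr p))"
    using assms by (intro integrable_mult_right Bochner_Integration.integrable_add) (auto simp: Lp_space_def)
  then have "integrable M (\<lambda>x. norm (u x + v x) powr p)"
  proof (rule Bochner_Integration.integrable_bound)
    show "(\<lambda>x. norm (u x + v x) powr p) \<in> borel_measurable M" using m by auto
    have "norm (u x + v x) powr p \<le> 2 powr p * (norm (u x) powr p + norm (v x) powr p)" for x
      using assms(3) by (intro order.trans[OF powr_mono2[OF _ _ norm_triangle_ineq] powr_add_le]) auto
    then show "AE x in M. norm (norm (u x + v x) powr p) \<le> norm (2 powr p * (norm (u x) powr p + norm (v x) powr p))"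
      by (intro AE_I2) (simp add: abs_of_nonneg)
  qed
  then show ?thesis using m by (simp add: Lp_space_def)
qed

lemma Lp_space_minus: "u \<in> Lp_space M p \<Longrightarrow> (\<lambda>x. - u x) \<in> Lp_space M p"
  by (simp add: Lp_space_def)

lemma Lp_space_diff:
  "u \<in> Lp_space M p \<Longrightarrow> v \<in> Lp_space M p \<Longrightarrow> p > 0 \<Longrightarrow> (\<lambda>x. u x - v x) \<in> Lp_space M p"
  using Lp_space_add[of u M p "\<lambda>x. - v x"] Lp_space_minus[of v M p] by simp

text \<open>Young's inequality takes the place of Hoelder's: its right-hand side is a sum of a
  \<open>p'\<close>-th and a \<open>p\<close>-th power of norms, exactly the quantities that
  membership in a Bochner space makes integrable in time.\<close>

lemma Lp_pair:
  fixes u v :: "'a \<Rightarrow> 'b::euclidean_space"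
  assumes p: "1 < p" "1 / p + 1 / p' = 1" and u: "u \<in> Lp_space M p'" and v: "v \<in> Lp_space M p"
  shows "integrable M (\<lambda>x. u x \<bullet> v x)"
    and "\<bar>LINT x|M. u x \<bullet> v x\<bar> \<le> Lp_norm M p' u powr p' + Lp_norm M p v powr p"
proof -
  have p': "1 < p'" using Young_conjugate(1)[OF p] .
  have m: "(\<lambda>x. u x \<bullet> v x) \<in> borel_measurable M"
    using u v by (auto simp: Lp_space_def)
  have i: "integrable M (\<lambda>x. norm (u x) powr p' + norm (v x) powr p)"
    using u v by (auto simp: Lp_space_def)
  have bound: "\<bar>u x \<bullet> v x\<bar> \<le> norm (u x) powr p' + norm (v x) powr p" for x
    using Young_conjugate(2)[OF p, of "norm (u x)" "norm (v x)"] Cauchy_Schwarz_ineq2[of "u x" "v x"] by simp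
  show int: "integrable M (\<lambda>x. u x \<bullet> v x)"
    by (rule Bochner_Integration.integrable_bound[OF i m]) (use bound in \<open>auto intro!: AE_I2\<close>)
  have "(LINT x|M. \<bar>u x \<bullet> v x\<bar>) \<le> (LINT x|M. norm (u x) powr p' + norm (v x) powr p)"
    using int i bound by (intro integral_mono) auto
  also have "\<dots> = Lp_norm M p' u powr p' + Lp_norm M p v powr p"
    using u v p p' by (simp add: Lp_norm_powr Lp_space_def)
  finally have le: "(LINT x|M. \<bar>u x \<bullet> v x\<bar>) \<le> Lp_norm M p' u powr p' + Lp_norm M p v powr p" .
  show "\<bar>LINT x|M. u x \<bullet> v x\<bar> \<le> Lp_norm M p' u powr p' + Lp_norm M p v powr p"
    using integral_abs_bound[of M "\<lambda>x. u x \<bullet> v x"] le by linarith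
qed

lemma Lp_norm_eq_0_imp_AE:
  assumes "u \<in> Lp_space M p" "Lp_norm M p u = 0" "p \<noteq> 0"
  shows "AE x in M. u x = 0"
proof -
  have "(LINT x|M. norm (u x) powr p) = 0"
    using Lp_norm_powr[OF assms(3), of M u] assms(2) by simp
  then have "AE x in M. norm (u x) powr p = 0"
    using integral_nonneg_eq_0_iff_AE[OF Lp_space_integrable[OF assms(1)]] by simp
  then show ?thesis by eventually_elim simp
qed

text \<open>A crude form of Hoelder's inequality: Young's inequality applied to \<open>v / \<parallel>v\<parallel>\<close>.\<close>

lemma Lp_pair_bound:
  fixes u v :: "'a \<Rightarrow> 'b::euclidean_space"
  assumes p: "1 < p" "1 / p + 1 / p' = 1" and u: "u \<in> Lp_space M p'" and v: "v \<in> Lp_space M p"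
  shows "\<bar>LINT x|M. u x \<bullet> v x\<bar> \<le> (Lp_norm M p' u powr p' + 1) * Lp_norm M p v"
proof (cases "Lp_norm M p v = 0")
  case True
  have "AE x in M. v x = 0"
    using Lp_norm_eq_0_imp_AE[OF v True] p by simp
  then have "(LINT x|M. u x \<bullet> v x) = (LINT x|M. 0)"
    using Lp_space_measurable[OF u] Lp_space_measurable[OF v]
    by (intro integral_cong_AE) (auto elim!: eventually_mono)
  then show ?thesis by (simp add: True)
next
  case False
  define c where "c = Lp_norm M p v"
  have c: "c > 0" using False by (simp add: c_def less_le)
  define w where "w x = v x /\<^sub>R c" for x
  have nw: "norm (w x) powr p = norm (v x) powr p / c powr p" for x
    using c by (simp add: w_def powr_mult powr_divide divide_inverse mult.commute powr_powr inverse_powr)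
  have w: "w \<in> Lp_space M p"
  proof -
    have "integrable M (\<lambda>x. norm (w x) powr p)"
      unfolding nw using v by (auto simp: Lp_space_def)
    moreover have "w \<in> borel_measurable M"
      using Lp_space_measurable[OF v] unfolding w_def by measurable
    ultimately show ?thesis by (simp add: Lp_space_def)
  qed
  have "Lp_norm M p w powr p = c powr p / c powr p"
    using p c Lp_norm_powr[of p M v] by (simp add: Lp_norm_powr nw c_def)
  then have "Lp_norm M p w powr p = 1" using c by simp
  with Lp_pair(2)[OF p u w] have "\<bar>LINT x|M. u x \<bullet> w x\<bar> \<le> Lp_norm M p' u powr p' + 1" by simp
  moreover have "(LINT x|M. u x \<bullet> w x) = (LINT x|M. u x \<bullet> v x) / c"
    by (simp add: w_def divide_inverse mult.commute)
  ultimately show ?thesis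
    using c by (simp add: abs_div_pos[symmetric] divide_le_eq c_def)
qed

lemma finite_measure_lebesgue_on:
  assumes "bounded \<Omega>" "\<Omega> \<in> sets lebesgue"
  shows "finite_measure (lebesgue_on \<Omega>)"
proof (rule finite_measureI)
  have "\<Omega> \<in> lmeasurable"
    using assms by (rule bounded_set_imp_lmeasurable)
  then show "emeasure (lebesgue_on \<Omega>) (space (lebesgue_on \<Omega>)) \<noteq> \<infinity>"
    using assms(2) by (auto simp: emeasure_restrict_space fmeasurable_def)
qed

lemma Lp_space_imp_integrable:
  assumes "finite_measure M" "u \<in> Lp_space M p" "p \<ge> 1"
  shows "integrable M u"
proof -
  interpret finite_measure M by fact
  have "integrable M (\<lambda>x. 1 + norm (u x) powr p)"
    using assms(2) by (auto simp: Lp_space_def)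
  then show ?thesis
  proof (rule Bochner_Integration.integrable_bound)
    show "u \<in> borel_measurable M" using assms(2) by (simp add: Lp_space_def)
    have "norm (u x) \<le> 1 + norm (u x) powr p" for x
    proof (cases "norm (u x) \<le> 1")
      case False
      then have "norm (u x) powr 1 \<le> norm (u x) powr p" using assms(3) by (intro powr_mono) auto
      then show ?thesis using False by simp
    qed (simp add: add_increasing2)
    then show "AE x in M. norm (u x) \<le> norm (1 + norm (u x) powr p)"
      by (intro AE_I2) (simp add: abs_of_nonneg)
  qed
qed

lemma integrable_imp_locally_integrable:
  assumes "open \<Omega>" "integrable (lebesgue_on \<Omega>) u"
  shows "locally_integrable \<Omega> u"
  unfolding locally_integrable_def
proof (intro allI impI)
  fix K assume K: "compact K \<and> K \<subseteq> \<Omega>"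
  have "integrable lebesgue (\<lambda>x. indicator \<Omega> x *\<^sub>R u x)"
    using assms by (subst (asm) integrable_restrict_space) auto
  moreover have "K \<in> sets lebesgue"
    using K compact_imp_closed[of K] by (intro sets_completionI_sets) (auto intro: borel_closed)
  ultimately have "integrable lebesgue (\<lambda>x. indicator K x *\<^sub>R (indicator \<Omega> x *\<^sub>R u x))"
    by (rule integrable_mult_indicator[rotated])
  also have "(\<lambda>x. indicator K x *\<^sub>R (indicator \<Omega> x *\<^sub>R u x)) = (\<lambda>x. indicator K x *\<^sub>R u x)"
    using K by (auto simp: indicator_def fun_eq_iff)
  finally show "u absolutely_integrable_on K"
    by (simp add: set_integrable_def)
qed

section \<open>Test fields as elements of \<open>V\<close>\<close>

lemma Lp_space_cont_compact_support:
  fixes f :: "'a::euclidean_space \<Rightarrow> 'b::euclidean_space"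
  assumes "open \<Omega>" "continuous_on UNIV f" "compact K" "\<And>x. x \<notin> K \<Longrightarrow> f x = 0" "p > 0"
  shows "f \<in> Lp_space (lebesgue_on \<Omega>) p"
proof -
  have fm: "f \<in> borel_measurable (lebesgue_on A)" for A
    using assms(2) by (intro measurable_restrict_space1 measurable_completion) (simp add: borel_measurable_continuous_onI)
  have "continuous_on K (\<lambda>x. norm (f x) powr p)"
    using assms(2,5) by (intro continuous_on_powr' continuous_intros continuous_on_subset[OF assms(2)]) auto
  from borel_integrable_compact[OF assms(3) this]
  have "integrable lborel (\<lambda>x. indicator K x *\<^sub>R norm (f x) powr p)" .
  also have "(\<lambda>x. indicator K x *\<^sub>R norm (f x) powr p) = (\<lambda>x. norm (f x) powr p)"
    using assms(4) by (auto simp: indicator_def fun_eq_iff)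
  finally have i: "integrable lborel (\<lambda>x. norm (f x) powr p)" .
  then have "integrable lebesgue (\<lambda>x. norm (f x) powr p)"
    by (subst integrable_completion) auto
  from integrable_mult_indicator[OF _ this, of \<Omega>] assms(1)
  have "integrable (lebesgue_on \<Omega>) (\<lambda>x. norm (f x) powr p)"
    by (subst integrable_restrict_space) auto
  with fm show ?thesis by (simp add: Lp_space_def)
qed

lemma locally_integrable_continuous:
  fixes f :: "'a::euclidean_space \<Rightarrow> 'b::euclidean_space"
  assumes "continuous_on UNIV f"
  shows "locally_integrable \<Omega> f"
  unfolding locally_integrable_def set_integrable_def
proof (intro allI impI)
  fix K assume "compact K \<and> K \<subseteq> \<Omega>"
  then have i: "integrable lborel (\<lambda>x. indicator K x *\<^sub>R f x)"
    using assms by (intro borel_integrable_compact) (auto intro: continuous_on_subset)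
  then show "integrable lebesgue (\<lambda>x. indicat_real K x *\<^sub>R f x)"
    by (subst integrable_completion) auto
qed

lemma test_function_mult:
  assumes "\<theta> \<in> test_functions S" "\<eta> \<in> test_functions S"
  shows "(\<lambda>x. \<theta> x * \<eta> x) \<in> test_functions S"
proof -
  have "closure {x. \<theta> x * \<eta> x \<noteq> 0} \<subseteq> closure {x. \<theta> x \<noteq> 0}"
    by (intro closure_mono) auto
  moreover have "compact (closure {x. \<theta> x * \<eta> x \<noteq> 0})"
    using assms(1) calculation unfolding test_functions_def
    by (auto dest: bounded_subset closure_subset[THEN bounded_subset[rotated]] compact_imp_bounded
        intro: bounded_subset)
  ultimately show ?thesis
    using assms unfolding test_functions_def smooth_def by (auto intro: k_smooth_mult)
qed

text \<open>The product of two test functions is again one, so its partial derivative integrates to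
  zero, and the product rule splits that integral.\<close>

lemma test_function_ibp:
  fixes \<theta> \<eta> :: "real^'d::finite \<Rightarrow> real"
  assumes "open \<Omega>" "\<theta> \<in> test_functions \<Omega>" "\<eta> \<in> test_functions \<Omega>"
  shows "(LINT x|lebesgue_on \<Omega>. \<theta> x * partial_deriv j \<eta> x) = - (LINT x|lebesgue_on \<Omega>. partial_deriv j \<theta> x * \<eta> x)"
proof -
  have b: "axis j 1 \<in> (Basis :: (real^'d) set)" by (simp add: axis_in_Basis_iff)
  have \<Omega>: "\<Omega> \<in> sets lebesgue" using assms(1) by auto
  have prod: "partial_deriv j (\<lambda>x. \<theta> x * \<eta> x) x = \<theta> x * partial_deriv j \<eta> x + partial_deriv j \<theta> x * \<eta> x" for x
    using frechet_derivative_at[OF has_derivative_mult[OF test_function_has_derivative[OF assms(2), of x]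
          test_function_has_derivative[OF assms(3), of x]]] by (metis (no_types, lifting))
  have "integrable (lebesgue_on \<Omega>) (\<lambda>x. partial_deriv j \<eta> x * \<theta> x)"
    using assms(2,3) test_function_partial_continuous[OF _ b]
    by (intro integrable_locally_times_test[OF assms(1)] locally_integrable_continuous) auto
  then have i1: "integrable (lebesgue_on \<Omega>) (\<lambda>x. \<theta> x * partial_deriv j \<eta> x)"
    by (simp add: mult.commute)
  have i2: "integrable (lebesgue_on \<Omega>) (\<lambda>x. partial_deriv j \<theta> x * \<eta> x)"
    using assms(2,3) test_function_partial_continuous[OF _ b]
    by (intro integrable_locally_times_test[OF assms(1)] locally_integrable_continuous) auto
  have "(LINT x|lebesgue_on \<Omega>. partial_deriv j (\<lambda>x. \<theta> x * \<eta> x) x) = (LINT x|lebesgue. partial_deriv j (\<lambda>x. \<theta> x * \<eta> x) x)"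
  proof -
    obtain K where "compact K" and K: "K \<subseteq> \<Omega>" and "\<And>x. x \<notin> K \<Longrightarrow> \<theta> x * \<eta> x = 0"
      and K': "\<And>x b. x \<notin> K \<Longrightarrow> frechet_derivative (\<lambda>x. \<theta> x * \<eta> x) (at x) b = 0"
      by (rule test_function_support[OF test_function_mult[OF assms(2,3)]], rule that)
    have "(LINT x|lebesgue_on \<Omega>. partial_deriv j (\<lambda>x. \<theta> x * \<eta> x) x) =
        (LINT x|lebesgue. indicator \<Omega> x *\<^sub>R partial_deriv j (\<lambda>x. \<theta> x * \<eta> x) x)"
      using \<Omega> by (subst integral_restrict_space) auto
    also have "\<dots> = (LINT x|lebesgue. partial_deriv j (\<lambda>x. \<theta> x * \<eta> x) x)"
    proof (rule Bochner_Integration.integral_cong[OF refl])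
      fix x show "indicator \<Omega> x *\<^sub>R partial_deriv j (\<lambda>x. \<theta> x * \<eta> x) x = partial_deriv j (\<lambda>x. \<theta> x * \<eta> x) x"
        using K K'[of x] by (cases "x \<in> \<Omega>") auto
    qed
    finally show ?thesis .
  qed
  also have "\<dots> = 0"
    using integral_partial_zero[OF test_function_mult[OF assms(2,3)] b] .
  finally show ?thesis
    using i1 i2 unfolding prod by simp
qed

text \<open>The classical gradient of the field with \<open>i\<close>-th component
  \<open>\<theta>\<close> and all others zero: \<open>axis i\<close> fills row \<open>i\<close> of
  the matrix and leaves the other rows zero.\<close>

definition test_grad :: "(real^'d::finite \<Rightarrow> real) \<Rightarrow> 'l \<Rightarrow> real^'d \<Rightarrow> real^'d^'l::finite" where
  "test_grad \<theta> i x = axis i (\<chi> j. partial_deriv j \<theta> x)"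

lemma test_grad_continuous:
  fixes \<Omega> :: "(real^'d::finite) set" and i :: "'l::finite"
  assumes "\<theta> \<in> test_functions \<Omega>"
  shows "continuous_on UNIV (test_grad \<theta> i)"
proof -
  have "continuous_on UNIV (\<lambda>x. \<Sum>j\<in>UNIV. partial_deriv j \<theta> x *\<^sub>R axis i (axis j 1 :: real^'d))"
    by (intro continuous_intros test_function_partial_continuous[OF assms]) simp
  moreover have "test_grad \<theta> i = (\<lambda>x. \<Sum>j\<in>UNIV. partial_deriv j \<theta> x *\<^sub>R axis i (axis j 1))"
    by (auto simp: test_grad_def vec_eq_iff axis_def sum.delta' if_distrib fun_eq_iff cong: if_cong)
  ultimately show ?thesis by simp
qed

lemma test_vfield_weak_grad:
  fixes \<Omega> :: "(real^'d::finite) set" and i :: "'l::finite"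
  assumes "open \<Omega>" "\<theta> \<in> test_functions \<Omega>"
  shows "has_weak_grad \<Omega> (\<lambda>x. \<theta> x *\<^sub>R axis i 1) (test_grad \<theta> i)"
  unfolding has_weak_grad_def
proof (intro conjI ballI allI)
  show "locally_integrable \<Omega> (\<lambda>x. \<theta> x *\<^sub>R axis i 1 :: real^'l)"
    using test_function_continuous[OF assms(2)]
    by (intro locally_integrable_continuous continuous_intros)
  show "locally_integrable \<Omega> (test_grad \<theta> i)"
    using test_grad_continuous[OF assms(2)] by (rule locally_integrable_continuous)
  fix \<eta> k j assume "\<eta> \<in> test_functions \<Omega>"
  then show "(LINT x|lebesgue_on \<Omega>. (\<theta> x *\<^sub>R axis i 1) $ k * partial_deriv j \<eta> x) =
       - (LINT x|lebesgue_on \<Omega>. test_grad \<theta> i x $ k $ j * \<eta> x)"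
    using test_function_ibp[OF assms] by (cases "k = i") (auto simp: test_grad_def axis_def)
qed

lemma W1p_has_weak_grad: "u \<in> W1p \<Omega> p \<Longrightarrow> has_weak_grad \<Omega> u (grad \<Omega> u)"
  using has_weak_grad_grad unfolding W1p_def by blast

lemma W1p_grad_Lp:
  assumes "open \<Omega>" "u \<in> W1p \<Omega> p"
  shows "grad \<Omega> u \<in> Lp_space (lebesgue_on \<Omega>) p"
proof -
  obtain g where g: "g \<in> Lp_space (lebesgue_on \<Omega>) p" "has_weak_grad \<Omega> u g"
    using assms(2) by (auto simp: W1p_def)
  have gg: "has_weak_grad \<Omega> u (grad \<Omega> u)" using assms(2) by (rule W1p_has_weak_grad)
  have "grad \<Omega> u \<in> borel_measurable (lebesgue_on \<Omega>)"
    using gg assms(1) by (intro locally_integrable_measurable) (auto simp: has_weak_grad_def)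
  then show ?thesis
    using has_weak_grad_unique[OF assms(1) g(2) gg] by (rule Lp_space_cong_AE[OF g(1)])
qed

lemma W1p_norm_powr:
  assumes "p > 0"
  shows "W1p_norm \<Omega> p u powr p = Lp_norm (lebesgue_on \<Omega>) p u powr p + Lp_norm (lebesgue_on \<Omega>) p (grad \<Omega> u) powr p"
  using assms by (simp add: W1p_norm_def powr_powr)

lemma Lp_norm_le_W1p_norm:
  assumes "p > 0"
  shows "Lp_norm (lebesgue_on \<Omega>) p u \<le> W1p_norm \<Omega> p u" "Lp_norm (lebesgue_on \<Omega>) p (grad \<Omega> u) \<le> W1p_norm \<Omega> p u"
proof -
  have *: "a \<le> b" if "a powr p \<le> b powr p" "0 \<le> a" "0 \<le> b" for a b :: real
    using that assms powr_less_mono2[of p b a] by linarith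
  have nn: "W1p_norm \<Omega> p u \<ge> 0"
    by (simp add: W1p_norm_def)
  show "Lp_norm (lebesgue_on \<Omega>) p u \<le> W1p_norm \<Omega> p u"
    by (rule *[OF _ Lp_norm_nonneg nn]) (simp add: W1p_norm_powr[OF assms])
  show "Lp_norm (lebesgue_on \<Omega>) p (grad \<Omega> u) \<le> W1p_norm \<Omega> p u"
    by (rule *[OF _ Lp_norm_nonneg nn]) (simp add: W1p_norm_powr[OF assms])
qed

text \<open>The norm refers to \<open>grad\<close>, and the gradient chosen for the zero field is
  known to vanish only almost everywhere.\<close>

lemma W1p_norm_zero:
  assumes "open \<Omega>" "p > 0"
  shows "W1p_norm (\<Omega> :: (real^'d::finite) set) p (\<lambda>x. 0 :: real^'l::finite) = 0"
proof -
  let ?z = "\<lambda>x. 0 :: real^'l" and ?M = "lebesgue_on \<Omega>"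
  have z: "has_weak_grad \<Omega> ?z (\<lambda>x. 0)"
    by (auto simp: has_weak_grad_def locally_integrable_continuous)
  have g: "has_weak_grad \<Omega> ?z (grad \<Omega> ?z)" using z by (rule has_weak_grad_grad)
  have "grad \<Omega> ?z \<in> borel_measurable ?M"
    using g assms(1) by (intro locally_integrable_measurable) (auto simp: has_weak_grad_def)
  then have "Lp_norm ?M p (grad \<Omega> ?z) = Lp_norm ?M p (\<lambda>x. 0 :: real^'d^'l)"
    using has_weak_grad_unique[OF assms(1) g z] by (intro Lp_norm_cong_AE) auto
  then show ?thesis by (simp add: W1p_norm_def Lp_norm_def)
qed

text \<open>In \<open>has_trace\<close> the constant sequence serves as smooth approximation; the
  trace is zero because the support is a compact subset of the open set \<open>\<Omega>\<close> and
  so misses the frontier. These fields are the supply of elements of \<open>V\<close> through which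
  identities of functionals on \<open>V\<close> become pointwise ones.\<close>

lemma test_vfield_in_V:
  fixes \<Omega> \<Gamma>D :: "(real^'d::finite) set" and i :: "'l::finite"
  assumes "open \<Omega>" "p > 0" "\<theta> \<in> test_functions \<Omega>"
  shows "(\<lambda>x. \<theta> x *\<^sub>R axis i 1) \<in> V_space \<Omega> \<Gamma>D p"
proof -
  let ?v = "\<lambda>x. \<theta> x *\<^sub>R axis i 1 :: real^'l"
  obtain K where K: "compact K" "K \<subseteq> \<Omega>" "\<And>x. x \<notin> K \<Longrightarrow> \<theta> x = 0"
      "\<And>x b. x \<notin> K \<Longrightarrow> frechet_derivative \<theta> (at x) b = 0"
    using test_function_support[OF assms(3)] by metis
  have "test_grad \<theta> i x = (0 :: real^'d^'l)" if "x \<notin> K" for x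
    using K(4)[OF that] by (simp add: test_grad_def vec_eq_iff axis_def)
  then have "(test_grad \<theta> i :: _ \<Rightarrow> real^'d^'l) \<in> Lp_space (lebesgue_on \<Omega>) p"
    using assms(2) by (rule Lp_space_cont_compact_support[OF assms(1) test_grad_continuous[OF assms(3)] K(1)])
  moreover have "?v \<in> Lp_space (lebesgue_on \<Omega>) p"
    using K(3) test_function_continuous[OF assms(3)] assms(2)
    by (intro Lp_space_cont_compact_support[OF assms(1) _ K(1)] continuous_intros) auto
  ultimately have "?v \<in> W1p \<Omega> p"
    unfolding W1p_def using test_vfield_weak_grad[OF assms(1,3)] by blast
  moreover have "has_trace \<Omega> p ?v (\<lambda>x. 0)"
    unfolding has_trace_def
  proof (intro conjI exI[of _ "\<lambda>n. ?v"] allI)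
    show "smooth ?v"
      using assms(3) by (auto simp: smooth_def test_functions_def intro: k_smooth_scaleR)
    show "(\<lambda>n. W1p_norm \<Omega> p (\<lambda>x. ?v x - ?v x)) \<longlonglongrightarrow> 0"
      by (simp add: W1p_norm_zero[OF assms(1,2)])
    have "(\<integral>\<^sup>+x\<in>frontier \<Omega>. ennreal (norm (?v x - 0) powr p) \<partial>surface_measure) = (\<integral>\<^sup>+x. 0 \<partial>(surface_measure :: (real^'d) measure))"
    proof (rule nn_integral_cong)
      fix x
      have "\<theta> x = 0" if "x \<in> frontier \<Omega>"
        using that K(2,3) assms(1) by (auto simp: frontier_def interior_open)
      then show "ennreal (norm (?v x - 0) powr p) * indicator (frontier \<Omega>) x = 0"
        by (auto simp: indicator_def)
    qed
    then show "(\<lambda>n. \<integral>\<^sup>+x\<in>frontier \<Omega>. ennreal (norm (?v x - 0) powr p) \<partial>surface_measure) \<longlonglongrightarrow> 0"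
      by simp
  qed auto
  ultimately show ?thesis
    unfolding V_space_def by (auto intro!: exI[of _ "\<lambda>x. 0"])
qed

section \<open>Iterated integrals of Lebesgue measurable functions\<close>

lemma complete_measure_borel_cong_AE:
  fixes f g :: "'a \<Rightarrow> 'b::topological_space"
  assumes "complete_measure M" "f \<in> borel_measurable M" "AE x in M. f x = g x"
  shows "g \<in> borel_measurable M"
proof (rule measurableI)
  fix A :: "'b set" assume A: "A \<in> sets borel"
  have "f -` A \<inter> space M \<in> sets M"
    using measurable_sets[OF assms(2) A] .
  moreover have "AE x in M. x \<in> f -` A \<inter> space M \<longleftrightarrow> x \<in> g -` A \<inter> space M"
    using assms(3) by eventually_elim simp
  ultimately show "g -` A \<inter> space M \<in> sets M"
    using complete_measure.in_sets_AE[OF assms(1), of "f -` A \<inter> space M" "g -` A \<inter> space M"] by simp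
qed simp

lemma complete_measure_lebesgue_on:
  assumes "S \<in> sets lebesgue"
  shows "complete_measure (lebesgue_on S)"
proof
  fix A B assume AB: "A \<subseteq> B" "B \<in> null_sets (lebesgue_on S)"
  have B: "B \<subseteq> S" "B \<in> null_sets lebesgue"
    using AB(2) null_sets_restrict_space[OF assms] by auto
  have "A \<in> sets lebesgue" using completion.complete[OF AB(1) B(2)] .
  then show "A \<in> sets (lebesgue_on S)"
    using AB(1) B(1) assms by (subst sets_restrict_space_iff) auto
qed

text \<open>By completeness, functions equal almost everywhere are measurable together; if neither
  is measurable, both integrals have the default value 0. This suits integrands built from chosen
  gradients and time derivatives, whose measurability is not at hand.\<close>

lemma integral_cong_AE_complete:
  fixes f g :: "'a \<Rightarrow> real"
  assumes "complete_measure M" "AE x in M. f x = g x"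
  shows "integral\<^sup>L M f = integral\<^sup>L M g"
proof (cases "f \<in> borel_measurable M")
  case True
  then show ?thesis
    using complete_measure_borel_cong_AE[OF assms(1) _ assms(2)] assms(2) by (intro integral_cong_AE)
next
  case False
  have "AE x in M. g x = f x" using assms(2) by eventually_elim simp
  then have "g \<notin> borel_measurable M"
    using False complete_measure_borel_cong_AE[OF assms(1), of g f] by blast
  with False have "\<not> integrable M f" "\<not> integrable M g"
    using borel_measurable_integrable by blast+
  then show ?thesis by (simp add: not_integrable_integral_eq)
qed

text \<open>\<open>ext_integral\<close> falls back to \<open>\<infinity>\<close> for an integrand
  that is not measurable; completeness ensures that this default applies to both sides or to
  neither.\<close>

lemma ext_integral_cong_AE:
  assumes "complete_measure M" "AE x in M. f x = g x"
  shows "ext_integral M f = ext_integral M g"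
proof -
  have "AE x in M. g x = f x" using assms(2) by eventually_elim simp
  then have "f \<in> borel_measurable M \<longleftrightarrow> g \<in> borel_measurable M"
    using complete_measure_borel_cong_AE[OF assms(1)] assms(2) by blast
  moreover have "(\<integral>\<^sup>+x. e2ennreal (f x) \<partial>M) = (\<integral>\<^sup>+x. e2ennreal (g x) \<partial>M)"
    using assms(2) by (intro nn_integral_cong_AE) (auto elim: eventually_mono)
  moreover have "(\<integral>\<^sup>+x. e2ennreal (- f x) \<partial>M) = (\<integral>\<^sup>+x. e2ennreal (- g x) \<partial>M)"
    using assms(2) by (intro nn_integral_cong_AE) (auto elim: eventually_mono)
  ultimately show ?thesis by (simp add: ext_integral_def)
qed

section \<open>Tonelli and Fubini for the completed measure on a product\<close>

lemma pair_sigma_finite_lborel: "pair_sigma_finite lborel lborel"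
  by (simp add: pair_sigma_finite_def lborel.sigma_finite_measure_axioms)

lemma AE_lborel_pair:
  fixes P :: "'a::euclidean_space \<times> 'b::euclidean_space \<Rightarrow> bool"
  assumes "AE z in lborel. P z"
  shows "AE t in lborel. AE x in lborel. P (t, x)"
proof -
  have "AE z in lborel \<Otimes>\<^sub>M lborel. P z"
    using assms by (simp only: lborel_prod)
  then show ?thesis
    by (rule pair_sigma_finite.AE_pair[OF pair_sigma_finite_lborel])
qed

lemma AE_lebesgue_on_iff: "S \<in> sets lebesgue \<Longrightarrow> (AE x in lebesgue_on S. P x) \<longleftrightarrow> (AE x in lborel. x \<in> S \<longrightarrow> P x)"
  by (simp add: AE_restrict_space_iff AE_completion_iff)

lemma sets_lebesgue_borel: "S \<in> sets borel \<Longrightarrow> S \<in> sets lebesgue"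
  by (intro sets_completionI_sets) simp

lemma AE_lebesgue_on_Times:
  fixes A :: "'a::euclidean_space set" and B :: "'b::euclidean_space set"
  assumes A: "A \<in> sets borel" and B: "B \<in> sets borel"
    and "AE z in lebesgue_on (A \<times> B). P z"
  shows "AE t in lebesgue_on A. AE x in lebesgue_on B. P (t, x)"
proof -
  have AB: "A \<times> B \<in> sets borel" using A B by (rule borel_Times)
  have "AE t in lborel. AE x in lborel. (t, x) \<in> A \<times> B \<longrightarrow> P (t, x)"
    using assms(3) AB by (intro AE_lborel_pair) (simp add: AE_lebesgue_on_iff sets_lebesgue_borel)
  then have "AE t in lborel. t \<in> A \<longrightarrow> (AE x in lborel. x \<in> B \<longrightarrow> P (t, x))"
    by eventually_elim auto
  then show ?thesis
    using A B by (simp add: AE_lebesgue_on_iff sets_lebesgue_borel)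
qed

text \<open>Lebesgue measure on a product is the completion of the product measure, so Tonelli is
  applied to a Borel version \<open>g\<close> of the extension \<open>H\<close> by zero. The
  sections of \<open>H\<close> and \<open>g\<close> agree almost everywhere only for almost every
  \<open>t\<close>, which is why measurability of the sections is claimed only for almost every
  \<open>t\<close>.\<close>

lemma lebesgue_on_Times_nn_integral:
  fixes A :: "'a::euclidean_space set" and B :: "'b::euclidean_space set"
    and h :: "'a \<times> 'b \<Rightarrow> ennreal"
  assumes A: "A \<in> sets borel" and B: "B \<in> sets borel"
    and h: "h \<in> borel_measurable (lebesgue_on (A \<times> B))"
  shows "AE t in lebesgue_on A. (\<lambda>x. h (t, x)) \<in> borel_measurable (lebesgue_on B)"
    and "(\<lambda>t. \<integral>\<^sup>+x. h (t, x) \<partial>lebesgue_on B) \<in> borel_measurable (lebesgue_on A)"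
    and "(\<integral>\<^sup>+z. h z \<partial>lebesgue_on (A \<times> B)) = (\<integral>\<^sup>+t. \<integral>\<^sup>+x. h (t, x) \<partial>lebesgue_on B \<partial>lebesgue_on A)"
proof -
  note AL = sets_lebesgue_borel[OF A] and BL = sets_lebesgue_borel[OF B]
  have AB: "A \<times> B \<in> sets lebesgue" using A B by (intro sets_lebesgue_borel borel_Times)
  define H where "H z = h z * indicator (A \<times> B) z" for z
  have H: "H \<in> borel_measurable lebesgue"
    using h AB borel_measurable_restrict_space_iff_ennreal[of "A \<times> B" lebesgue h]
    by (simp add: H_def[abs_def])
  obtain g where g: "g \<in> borel_measurable lborel" "AE z in lborel. H z = g z"
    using completion_ex_borel_measurable[OF H] by blast
  have gp: "g \<in> borel_measurable (lborel \<Otimes>\<^sub>M lborel)"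
    using g(1) by (simp add: lborel_prod)
  have sec: "AE t in lborel. AE x in lborel. H (t, x) = g (t, x)"
    by (rule AE_lborel_pair[OF g(2)])
  have Hsplit: "H (t, x) = indicator A t * (h (t, x) * indicator B x)" for t x
    by (simp add: H_def indicator_def)
  have inner: "(\<integral>\<^sup>+x. H (t, x) \<partial>lborel) = (\<integral>\<^sup>+x. h (t, x) \<partial>lebesgue_on B) * indicator A t" for t
  proof -
    have "(\<integral>\<^sup>+x. h (t, x) \<partial>lebesgue_on B) = (\<integral>\<^sup>+x. h (t, x) * indicator B x \<partial>lborel)"
      using BL by (subst nn_integral_restrict_space) (auto simp: nn_integral_completion)
    then show ?thesis
      unfolding Hsplit by (cases "t \<in> A") auto
  qed
  have secm: "AE t in lborel. t \<in> A \<longrightarrow> (\<lambda>x. h (t, x)) \<in> borel_measurable (lebesgue_on B)"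
    using sec
  proof eventually_elim
    fix t assume ae: "AE x in lborel. H (t, x) = g (t, x)"
    have "(\<lambda>x. g (t, x)) \<in> borel_measurable lebesgue"
      using measurable_Pair2[OF gp] by (intro measurable_completion) simp
    moreover have "AE x in lebesgue. g (t, x) = H (t, x)"
      using ae by (auto simp: AE_completion_iff elim: eventually_mono)
    ultimately have "(\<lambda>x. H (t, x)) \<in> borel_measurable lebesgue"
      by (rule complete_measure_borel_cong_AE[OF completion.complete_measure_axioms])
    then show "t \<in> A \<longrightarrow> (\<lambda>x. h (t, x)) \<in> borel_measurable (lebesgue_on B)"
      using BL borel_measurable_restrict_space_iff_ennreal[of B lebesgue "\<lambda>x. h (t, x)"]
      by (auto simp: Hsplit)
  qed
  then show "AE t in lebesgue_on A. (\<lambda>x. h (t, x)) \<in> borel_measurable (lebesgue_on B)"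
    using AL by (simp add: AE_lebesgue_on_iff)
  have gi: "(\<lambda>t. \<integral>\<^sup>+x. g (t, x) \<partial>lborel) \<in> borel_measurable lborel"
    using gp by (intro lborel.borel_measurable_nn_integral) (simp add: case_prod_beta')
  have eqi: "AE t in lborel. (\<integral>\<^sup>+x. g (t, x) \<partial>lborel) = (\<integral>\<^sup>+x. H (t, x) \<partial>lborel)"
    using sec by eventually_elim (auto intro!: nn_integral_cong_AE elim: eventually_mono)
  have "(\<lambda>t. \<integral>\<^sup>+x. g (t, x) \<partial>lborel) \<in> borel_measurable lebesgue"
    using gi by (rule measurable_completion)
  then have "(\<lambda>t. \<integral>\<^sup>+x. H (t, x) \<partial>lborel) \<in> borel_measurable lebesgue"
    by (rule complete_measure_borel_cong_AE[OF completion.complete_measure_axioms]) (simp add: AE_completion_iff eqi)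
  then show "(\<lambda>t. \<integral>\<^sup>+x. h (t, x) \<partial>lebesgue_on B) \<in> borel_measurable (lebesgue_on A)"
    unfolding inner using AL by (subst borel_measurable_restrict_space_iff_ennreal) auto
  have "(\<integral>\<^sup>+z. h z \<partial>lebesgue_on (A \<times> B)) = (\<integral>\<^sup>+z. H z \<partial>lborel)"
    using AB by (subst nn_integral_restrict_space) (auto simp: nn_integral_completion H_def[abs_def])
  also have "\<dots> = (\<integral>\<^sup>+z. g z \<partial>(lborel \<Otimes>\<^sub>M lborel))"
    using g(2) unfolding lborel_prod by (rule nn_integral_cong_AE)
  also have "\<dots> = (\<integral>\<^sup>+t. \<integral>\<^sup>+x. g (t, x) \<partial>lborel \<partial>lborel)"
    using gp by (rule lborel.nn_integral_fst[symmetric])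
  also have "\<dots> = (\<integral>\<^sup>+t. \<integral>\<^sup>+x. H (t, x) \<partial>lborel \<partial>lborel)"
    using eqi by (rule nn_integral_cong_AE)
  also have "\<dots> = (\<integral>\<^sup>+t. \<integral>\<^sup>+x. h (t, x) \<partial>lebesgue_on B \<partial>lebesgue_on A)"
    unfolding inner using AL by (subst nn_integral_restrict_space) (auto simp: nn_integral_completion)
  finally show "(\<integral>\<^sup>+z. h z \<partial>lebesgue_on (A \<times> B)) = (\<integral>\<^sup>+t. \<integral>\<^sup>+x. h (t, x) \<partial>lebesgue_on B \<partial>lebesgue_on A)" .
qed

text \<open>Null sections alone do not make a set null. Once the exceptional set is measurable,
  Tonelli for its indicator does.\<close>

lemma AE_lebesgue_on_TimesI:
  fixes A :: "'a::euclidean_space set" and B :: "'b::euclidean_space set"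
  assumes A: "A \<in> sets borel" and B: "B \<in> sets borel"
    and m: "{z \<in> space (lebesgue_on (A \<times> B)). \<not> P z} \<in> sets (lebesgue_on (A \<times> B))"
    and ae: "AE t in lebesgue_on A. AE x in lebesgue_on B. P (t, x)"
  shows "AE z in lebesgue_on (A \<times> B). P z"
proof -
  let ?Q = "lebesgue_on (A \<times> B)"
  define E where "E = {z \<in> space ?Q. \<not> P z}"
  have E: "E \<in> sets ?Q" using m by (simp add: E_def)
  have "emeasure ?Q E = (\<integral>\<^sup>+z. indicator E z \<partial>?Q)" using E by simp
  also have "\<dots> = (\<integral>\<^sup>+t. \<integral>\<^sup>+x. indicator E (t, x) \<partial>lebesgue_on B \<partial>lebesgue_on A)"
    using E by (intro lebesgue_on_Times_nn_integral(3)[OF A B]) simp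
  also have "\<dots> = (\<integral>\<^sup>+t. 0 \<partial>lebesgue_on A)"
  proof (rule nn_integral_cong_AE)
    show "AE t in lebesgue_on A. (\<integral>\<^sup>+x. indicator E (t, x) \<partial>lebesgue_on B) = 0"
      using ae
    proof eventually_elim
      case (elim t)
      then have "AE x in lebesgue_on B. indicator E (t, x) = (0 :: ennreal)"
        by eventually_elim (simp add: E_def)
      then have "(\<integral>\<^sup>+x. indicator E (t, x) \<partial>lebesgue_on B) = (\<integral>\<^sup>+x. 0 \<partial>lebesgue_on B)"
        by (rule nn_integral_cong_AE)
      then show ?case by simp
    qed
  qed
  finally have "E \<in> null_sets ?Q" using E by (simp add: null_sets_def)
  then show ?thesis unfolding E_def by (rule AE_I') auto
qed

text \<open>A countable basis of the value space leaves countably many preimages to check, so that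
  one null set of times serves for all of them. This generality covers reals, vectors and
  \<open>ereal\<close> alike.\<close>

lemma lebesgue_on_Times_section:
  fixes A :: "'a::euclidean_space set" and B :: "'b::euclidean_space set"
    and f :: "'a \<times> 'b \<Rightarrow> 'c::second_countable_topology"
  assumes A: "A \<in> sets borel" and B: "B \<in> sets borel"
    and f: "f \<in> borel_measurable (lebesgue_on (A \<times> B))"
  shows "AE t in lebesgue_on A. (\<lambda>x. f (t, x)) \<in> borel_measurable (lebesgue_on B)"
proof -
  obtain \<B> :: "'c set set" where \<B>: "countable \<B>" "topological_basis \<B>"
    using ex_countable_basis by blast
  have "AE t in lebesgue_on A. \<forall>U\<in>\<B>. t \<in> A \<longrightarrow> (\<lambda>x. f (t, x)) -` U \<inter> B \<in> sets (lebesgue_on B)"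
    using \<B>(1)
  proof (rule AE_ball_countable'[rotated])
    fix U assume "U \<in> \<B>"
    then have "open U" using \<B>(2) by (rule topological_basis_open[rotated])
    then have E: "f -` U \<inter> (A \<times> B) \<in> sets (lebesgue_on (A \<times> B))"
      using measurable_sets[OF f, of U] by simp
    have "AE t in lebesgue_on A. (\<lambda>x. indicator (f -` U \<inter> (A \<times> B)) (t, x) :: ennreal) \<in> borel_measurable (lebesgue_on B)"
      using E by (intro lebesgue_on_Times_nn_integral(1)[OF A B]) auto
    then show "AE t in lebesgue_on A. t \<in> A \<longrightarrow> (\<lambda>x. f (t, x)) -` U \<inter> B \<in> sets (lebesgue_on B)"
    proof eventually_elim
      fix t assume m: "(\<lambda>x. indicator (f -` U \<inter> (A \<times> B)) (t, x) :: ennreal) \<in> borel_measurable (lebesgue_on B)"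
      show "t \<in> A \<longrightarrow> (\<lambda>x. f (t, x)) -` U \<inter> B \<in> sets (lebesgue_on B)"
      proof
        assume "t \<in> A"
        have "(\<lambda>x. indicator (f -` U \<inter> (A \<times> B)) (t, x) :: ennreal) -` {1} \<inter> space (lebesgue_on B) \<in> sets (lebesgue_on B)"
          using m by (rule measurable_sets) simp
        also have "(\<lambda>x. indicator (f -` U \<inter> (A \<times> B)) (t, x) :: ennreal) -` {1} \<inter> space (lebesgue_on B) = (\<lambda>x. f (t, x)) -` U \<inter> B"
          using \<open>t \<in> A\<close> by (auto simp: indicator_def split: if_splits)
        finally show "(\<lambda>x. f (t, x)) -` U \<inter> B \<in> sets (lebesgue_on B)" .
      qed
    qed
  qed
  moreover have "AE t in lebesgue_on A. t \<in> A"
    using AE_space[of "lebesgue_on A"] by simp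
  ultimately show ?thesis
  proof eventually_elim
    fix t assume *: "\<forall>U\<in>\<B>. t \<in> A \<longrightarrow> (\<lambda>x. f (t, x)) -` U \<inter> B \<in> sets (lebesgue_on B)" "t \<in> A"
    show "(\<lambda>x. f (t, x)) \<in> borel_measurable (lebesgue_on B)"
      unfolding borel_eq_countable_basis[OF \<B>]
      by (rule measurable_measure_of) (use * in auto)
  qed
qed

lemma AE_lborel_pair_swap:
  fixes P :: "'a::euclidean_space \<times> 'b::euclidean_space \<Rightarrow> bool"
  assumes "AE z in lborel. P z"
  shows "AE x in lborel. AE t in lborel. P (t, x)"
proof -
  obtain N where N: "N \<in> null_sets (lborel :: ('a \<times> 'b) measure)" "{z. \<not> P z} \<subseteq> N"
    using assms unfolding eventually_ae_filter by auto
  have "AE z in lborel. z \<notin> N" using N(1) by (rule AE_not_in)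
  then have "AE t in lborel. AE x in lborel. (t, x) \<notin> N" by (rule AE_lborel_pair)
  then have "AE x in lborel. AE t in lborel. (t, x) \<notin> N"
  proof (subst lborel_pair.AE_commute[symmetric])
    have "{z \<in> space (lborel \<Otimes>\<^sub>M lborel). (fst z, snd z) \<notin> N} = space (lborel \<Otimes>\<^sub>M lborel) - N"
      by auto
    also have "\<dots> \<in> sets (lborel \<Otimes>\<^sub>M lborel)"
      using null_setsD2[OF N(1)] unfolding lborel_prod by (rule sets.compl_sets)
    finally show "{z \<in> space (lborel \<Otimes>\<^sub>M lborel). (fst z, snd z) \<notin> N} \<in> sets (lborel \<Otimes>\<^sub>M lborel)" .
  qed
  then show ?thesis
    by eventually_elim (use N(2) in \<open>auto elim!: eventually_mono\<close>)
qed

lemma lebesgue_on_borel_representative: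
  fixes f :: "'a::euclidean_space \<Rightarrow> real"
  assumes S: "S \<in> sets lebesgue" and f: "f \<in> borel_measurable (lebesgue_on S)"
  obtains g where "g \<in> borel_measurable borel" "AE z in lborel. indicator S z * f z = g z"
proof -
  have "(\<lambda>z. indicator S z *\<^sub>R f z) \<in> borel_measurable lebesgue"
    using f S borel_measurable_restrict_space_iff[of S lebesgue f] by simp
  from completion_ex_borel_measurable_real[OF this] show thesis
    using that by auto
qed

lemma lebesgue_on_integrable_iff_representative:
  fixes f :: "'a::euclidean_space \<Rightarrow> real"
  assumes S: "S \<in> sets lebesgue" and f: "f \<in> borel_measurable (lebesgue_on S)"
    and g: "g \<in> borel_measurable borel" "AE z in lborel. indicator S z * f z = g z"
  shows "integrable (lebesgue_on S) f \<longleftrightarrow> integrable lborel g"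
    and "(LINT z|lebesgue_on S. f z) = (LINT z|lborel. g z)"
proof -
  have Fm: "(\<lambda>z. indicator S z *\<^sub>R f z) \<in> borel_measurable lebesgue"
    using f S borel_measurable_restrict_space_iff[of S lebesgue f] by simp
  have gm: "g \<in> borel_measurable lebesgue"
    using g(1) by (intro measurable_completion) simp
  have ae: "AE z in lebesgue. indicator S z *\<^sub>R f z = g z"
    using g(2) by (simp add: AE_completion_iff)
  have "integrable (lebesgue_on S) f \<longleftrightarrow> integrable lebesgue (\<lambda>z. indicator S z *\<^sub>R f z)"
    using S by (subst integrable_restrict_space) auto
  also have "\<dots> \<longleftrightarrow> integrable lebesgue g"
    using Fm gm ae by (rule integrable_cong_AE)
  also have "\<dots> \<longleftrightarrow> integrable lborel g"
    using g(1) by (intro integrable_completion) simp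
  finally show "integrable (lebesgue_on S) f \<longleftrightarrow> integrable lborel g" .
  have "(LINT z|lebesgue_on S. f z) = (LINT z|lebesgue. indicator S z *\<^sub>R f z)"
    using S by (subst integral_restrict_space) auto
  also have "\<dots> = (LINT z|lebesgue. g z)"
    using Fm gm ae by (rule integral_cong_AE)
  also have "\<dots> = (LINT z|lborel. g z)"
    using g(1) by (intro integral_completion) simp
  finally show "(LINT z|lebesgue_on S. f z) = (LINT z|lborel. g z)" .
qed

lemma section_measurable_from_representative:
  fixes f :: "'a::euclidean_space \<Rightarrow> real"
  assumes S: "S \<in> sets lebesgue" and g: "g \<in> borel_measurable borel" "AE z in lborel. indicator S z * f z = g z"
  shows "f \<in> borel_measurable (lebesgue_on S)"
proof -
  have "g \<in> borel_measurable lebesgue"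
    using g(1) by (intro measurable_completion) simp
  moreover have "AE z in lebesgue. g z = indicator S z * f z"
    using g(2) by (auto simp: AE_completion_iff elim: eventually_mono)
  ultimately have "(\<lambda>z. indicator S z * f z) \<in> borel_measurable lebesgue"
    by (rule complete_measure_borel_cong_AE[OF completion.complete_measure_axioms])
  then show ?thesis
    using S borel_measurable_restrict_space_iff[of S lebesgue f] by simp
qed

lemma lebesgue_on_Times_integral:
  fixes A :: "'a::euclidean_space set" and B :: "'b::euclidean_space set" and f :: "'a \<times> 'b \<Rightarrow> real"
  assumes A: "A \<in> sets borel" and B: "B \<in> sets borel" and f: "integrable (lebesgue_on (A \<times> B)) f"
  shows "AE t in lebesgue_on A. integrable (lebesgue_on B) (\<lambda>x. f (t, x))"
    and "integrable (lebesgue_on A) (\<lambda>t. LINT x|lebesgue_on B. f (t, x))"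
    and "(LINT z|lebesgue_on (A \<times> B). f z) = (LINT t|lebesgue_on A. LINT x|lebesgue_on B. f (t, x))"
    and "AE x in lebesgue_on B. integrable (lebesgue_on A) (\<lambda>t. f (t, x))"
    and "integrable (lebesgue_on B) (\<lambda>x. LINT t|lebesgue_on A. f (t, x))"
    and "(LINT z|lebesgue_on (A \<times> B). f z) = (LINT x|lebesgue_on B. LINT t|lebesgue_on A. f (t, x))"
proof -
  note AL = sets_lebesgue_borel[OF A] and BL = sets_lebesgue_borel[OF B]
  have AB: "A \<times> B \<in> sets lebesgue" using A B by (intro sets_lebesgue_borel borel_Times)
  obtain g where g: "g \<in> borel_measurable borel" "AE z in lborel. indicator (A \<times> B) z * f z = g z"
    using lebesgue_on_borel_representative[OF AB borel_measurable_integrable[OF f]] by blast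
  note rep = lebesgue_on_integrable_iff_representative[OF AB borel_measurable_integrable[OF f] g]
  have gi: "integrable (lborel \<Otimes>\<^sub>M lborel) g"
    using rep(1) f by (simp add: lborel_prod)
  then have gi': "integrable (lborel \<Otimes>\<^sub>M lborel) (case_prod (\<lambda>t x. g (t, x)))" by simp
  have gsec: "(\<lambda>x. g (t, x)) \<in> borel_measurable borel" "(\<lambda>t. g (t, x)) \<in> borel_measurable borel" for t x
    using measurable_Pair2[of g lborel lborel borel t] measurable_Pair1[of g lborel lborel borel x] g(1)
    by (simp_all add: lborel_prod)
  have s1: "AE t in lborel. AE x in lborel. indicator A t * (indicator B x * f (t, x)) = g (t, x)"
    using AE_lborel_pair[OF g(2)] by eventually_elim (simp add: indicator_times ac_simps)
  have s2: "AE x in lborel. AE t in lborel. indicator B x * (indicator A t * f (t, x)) = g (t, x)"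
    using AE_lborel_pair_swap[OF g(2)] by eventually_elim (simp add: indicator_times ac_simps)
  have t1: "AE t in lborel. t \<in> A \<longrightarrow> (\<lambda>x. f (t, x)) \<in> borel_measurable (lebesgue_on B) \<and>
      (AE x in lborel. indicator B x * f (t, x) = g (t, x))"
    using s1
  proof eventually_elim
    case (elim t)
    show ?case
    proof
      assume "t \<in> A"
      with elim have ae: "AE x in lborel. indicator B x * f (t, x) = g (t, x)" by simp
      from section_measurable_from_representative[OF BL gsec(1) this] ae
      show "(\<lambda>x. f (t, x)) \<in> borel_measurable (lebesgue_on B) \<and> (AE x in lborel. indicator B x * f (t, x) = g (t, x))"
        by blast
    qed
  qed
  have t2: "AE x in lborel. x \<in> B \<longrightarrow> (\<lambda>t. f (t, x)) \<in> borel_measurable (lebesgue_on A) \<and>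
      (AE t in lborel. indicator A t * f (t, x) = g (t, x))"
    using s2
  proof eventually_elim
    case (elim x)
    show ?case
    proof
      assume "x \<in> B"
      with elim have ae: "AE t in lborel. indicator A t * f (t, x) = g (t, x)" by simp
      from section_measurable_from_representative[OF AL gsec(2) this] ae
      show "(\<lambda>t. f (t, x)) \<in> borel_measurable (lebesgue_on A) \<and> (AE t in lborel. indicator A t * f (t, x) = g (t, x))"
        by blast
    qed
  qed
  have i1: "AE t in lborel. t \<in> A \<longrightarrow> (integrable (lebesgue_on B) (\<lambda>x. f (t, x)) \<longleftrightarrow> integrable lborel (\<lambda>x. g (t, x))) \<and>
      (LINT x|lebesgue_on B. f (t, x)) = (LINT x|lborel. g (t, x))"
    using t1 by eventually_elim (use lebesgue_on_integrable_iff_representative[OF BL _ gsec(1)] in blast)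
  have i2: "AE x in lborel. x \<in> B \<longrightarrow> (integrable (lebesgue_on A) (\<lambda>t. f (t, x)) \<longleftrightarrow> integrable lborel (\<lambda>t. g (t, x))) \<and>
      (LINT t|lebesgue_on A. f (t, x)) = (LINT t|lborel. g (t, x))"
    using t2 by eventually_elim (use lebesgue_on_integrable_iff_representative[OF AL _ gsec(2)] in blast)
  \<comment> \<open>For \<open>t\<close> off \<open>A\<close> the inner integral of \<open>g\<close>
    has to vanish as well: only then is it, on the whole line of times, a version of the integral
    over \<open>B\<close> extended by zero.\<close>
  have z1: "AE t in lborel. t \<notin> A \<longrightarrow> (LINT x|lborel. g (t, x)) = 0"
    using s1
  proof eventually_elim
    case (elim t)
    show ?case
    proof
      assume "t \<notin> A"
      with elim have "AE x in lborel. g (t, x) = 0" by (auto elim: eventually_mono)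
      then show "(LINT x|lborel. g (t, x)) = 0" by (rule integral_eq_zero_AE)
    qed
  qed
  have z2: "AE x in lborel. x \<notin> B \<longrightarrow> (LINT t|lborel. g (t, x)) = 0"
    using s2
  proof eventually_elim
    case (elim x)
    show ?case
    proof
      assume "x \<notin> B"
      with elim have "AE t in lborel. g (t, x) = 0" by (auto elim: eventually_mono)
      then show "(LINT t|lborel. g (t, x)) = 0" by (rule integral_eq_zero_AE)
    qed
  qed
  have r1: "AE t in lborel. indicator A t * (LINT x|lebesgue_on B. f (t, x)) = (LINT x|lborel. g (t, x))"
    using i1 z1 by eventually_elim (auto simp: indicator_def)
  have r2: "AE x in lborel. indicator B x * (LINT t|lebesgue_on A. f (t, x)) = (LINT t|lborel. g (t, x))"
    using i2 z2 by eventually_elim (auto simp: indicator_def)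
  have f1: "integrable lborel (\<lambda>t. LINT x|lborel. g (t, x))" and f2: "integrable lborel (\<lambda>x. LINT t|lborel. g (t, x))"
    using lborel_pair.integrable_fst'[OF gi] lborel_pair.integrable_snd[OF gi'] by auto
  have m1: "(\<lambda>t. LINT x|lborel. g (t, x)) \<in> borel_measurable borel" and m2: "(\<lambda>x. LINT t|lborel. g (t, x)) \<in> borel_measurable borel"
    using borel_measurable_integrable[OF f1] borel_measurable_integrable[OF f2] by auto
  note c1 = lebesgue_on_integrable_iff_representative[OF AL section_measurable_from_representative[OF AL m1 r1] m1 r1]
  note c2 = lebesgue_on_integrable_iff_representative[OF BL section_measurable_from_representative[OF BL m2 r2] m2 r2]
  show "integrable (lebesgue_on A) (\<lambda>t. LINT x|lebesgue_on B. f (t, x))"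
    using c1(1) f1 by blast
  show "integrable (lebesgue_on B) (\<lambda>x. LINT t|lebesgue_on A. f (t, x))"
    using c2(1) f2 by blast
  show "(LINT z|lebesgue_on (A \<times> B). f z) = (LINT t|lebesgue_on A. LINT x|lebesgue_on B. f (t, x))"
    using lborel_pair.integral_fst'[OF gi] unfolding c1(2) rep(2) lborel_prod by simp
  show "(LINT z|lebesgue_on (A \<times> B). f z) = (LINT x|lebesgue_on B. LINT t|lebesgue_on A. f (t, x))"
    using lborel_pair.integral_snd[OF gi'] unfolding c2(2) rep(2) lborel_prod by simp
  have "AE t in lborel. t \<in> A \<longrightarrow> integrable (lebesgue_on B) (\<lambda>x. f (t, x))"
    using i1 lborel_pair.AE_integrable_fst'[OF gi] by eventually_elim blast
  then show "AE t in lebesgue_on A. integrable (lebesgue_on B) (\<lambda>x. f (t, x))"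
    using AL by (simp add: AE_lebesgue_on_iff)
  have "AE x in lborel. x \<in> B \<longrightarrow> integrable (lebesgue_on A) (\<lambda>t. f (t, x))"
    using i2 lborel_pair.AE_integrable_snd[OF gi'] by eventually_elim blast
  then show "AE x in lebesgue_on B. integrable (lebesgue_on A) (\<lambda>t. f (t, x))"
    using BL by (simp add: AE_lebesgue_on_iff)
qed

section \<open>Measurable selections and conjugates of integral functionals\<close>

text \<open>The least-norm point of a section is unique, so within \<open>A\<close> it is singled
  out by \<open>norm x \<le> norm (r s)\<close>. Sublevel sets of the least norm are projections;
  once this norm is measurable, the condition defines a measurable set, and preimages under
  \<open>r\<close> are projections too.\<close>

lemma convex_measurable_selection:
  fixes A :: "('s \<times> 'b::euclidean_space) set"
  assumes M: "finite_measure M" "complete_measure M"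
    and A: "A \<in> sets (M \<Otimes>\<^sub>M borel)"
    and sec: "\<And>s. s \<in> space M \<Longrightarrow> closed {r. (s, r) \<in> A} \<and> convex {r. (s, r) \<in> A} \<and> {r. (s, r) \<in> A} \<noteq> {}"
  shows "\<exists>r\<in>borel_measurable M. \<forall>s\<in>space M. (s, r s) \<in> A"
proof -
  define r where "r s = closest_point {r. (s, r) \<in> A} 0" for s
  have rA: "(s, r s) \<in> A" if "s \<in> space M" for s
    using closest_point_in_set[of "{r. (s, r) \<in> A}" 0] sec[OF that] by (simp add: r_def)
  have rle: "norm (r s) \<le> norm x" if "s \<in> space M" "(s, x) \<in> A" for s x
    using closest_point_le[of "{r. (s, r) \<in> A}" x 0] sec[OF that(1)] that(2) by (simp add: r_def dist_norm)
  have runiq: "x = r s" if s: "s \<in> space M" and x: "(s, x) \<in> A" "norm x \<le> norm (r s)" for s x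
    using any_closest_point_unique[of "{r. (s, r) \<in> A}" x "r s" 0] sec[OF s] x rA[OF s] rle[OF s]
    by (force simp: dist_norm intro: order.trans)
  have Asp: "A \<subseteq> space M \<times> UNIV"
    using sets.sets_into_space[OF A] by (simp add: space_pair_measure)
  have nm: "(\<lambda>s. norm (r s)) \<in> borel_measurable M"
  proof (rule borel_measurableI_less)
    fix a :: real
    have "{s \<in> space M. norm (r s) < a} = fst ` (A \<inter> (space M \<times> ball 0 a))"
    proof (intro equalityI subsetI)
      fix s assume "s \<in> {s \<in> space M. norm (r s) < a}"
      then show "s \<in> fst ` (A \<inter> (space M \<times> ball 0 a))"
        using rA by (intro image_eqI[of _ _ "(s, r s)"]) auto
    next
      fix s assume "s \<in> fst ` (A \<inter> (space M \<times> ball 0 a))"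
      then obtain x where "(s, x) \<in> A" "s \<in> space M" "norm x < a" by auto
      then show "s \<in> {s \<in> space M. norm (r s) < a}" using rle[of s x] by auto
    qed
    also have "\<dots> \<in> sets M"
      using A by (intro measurable_projection M sets.Int pair_measureI) auto
    finally show "{s \<in> space M. norm (r s) < a} \<in> sets M" .
  qed
  have "r \<in> borel_measurable M"
  proof (rule measurableI)
    fix B :: "'b set" assume B: "B \<in> sets borel"
    define C where "C = {z \<in> space (M \<Otimes>\<^sub>M (borel :: 'b measure)). norm (snd z) \<le> norm (r (fst z))}"
    have C: "C \<in> sets (M \<Otimes>\<^sub>M borel)"
      unfolding C_def
    proof (rule borel_measurable_le)
      show "(\<lambda>z. norm (snd z)) \<in> borel_measurable (M \<Otimes>\<^sub>M borel)" by measurable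
      show "(\<lambda>z. norm (r (fst z))) \<in> borel_measurable (M \<Otimes>\<^sub>M borel)"
        by (rule measurable_compose[OF measurable_fst nm])
    qed
    have "r -` B \<inter> space M = fst ` (A \<inter> C \<inter> (space M \<times> B))"
    proof (intro equalityI subsetI)
      fix s assume "s \<in> r -` B \<inter> space M"
      then show "s \<in> fst ` (A \<inter> C \<inter> (space M \<times> B))"
        using rA by (intro image_eqI[of _ _ "(s, r s)"]) (auto simp: C_def space_pair_measure)
    next
      fix s assume "s \<in> fst ` (A \<inter> C \<inter> (space M \<times> B))"
      then obtain x where x: "(s, x) \<in> A" "s \<in> space M" "norm x \<le> norm (r s)" "x \<in> B"
        by (auto simp: C_def)
      then have "x = r s" by (intro runiq)
      with x show "s \<in> r -` B \<inter> space M" by auto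
    qed
    also have "\<dots> \<in> sets M"
      using A B C by (intro measurable_projection M sets.Int pair_measureI) auto
    finally show "r -` B \<inter> space M \<in> sets M" .
  qed simp
  then show ?thesis using rA by blast
qed

text \<open>A supremum exceeds \<open>a\<close> iff one of its terms does. The strict superlevel set
  is therefore the projection of a product-measurable set, although the supremum runs over
  uncountably many points.\<close>

lemma conjugate_measurable:
  fixes g :: "'s \<Rightarrow> 'b::euclidean_space \<Rightarrow> ereal"
  assumes M: "finite_measure M" "complete_measure M"
    and g: "(\<lambda>(s, r). g s r) \<in> borel_measurable (M \<Otimes>\<^sub>M borel)" and y: "y \<in> borel_measurable M"
  shows "(\<lambda>s. fenchel_conj UNIV (\<bullet>) (g s) (y s)) \<in> borel_measurable M"
proof (rule borel_measurableI_greater)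
  fix a :: ereal
  have m: "(\<lambda>z. ereal (y (fst z) \<bullet> snd z) - (\<lambda>(s, r). g s r) z) \<in> borel_measurable (M \<Otimes>\<^sub>M borel)"
    using g measurable_compose[OF measurable_fst y] by measurable
  have "{s \<in> space M. a < fenchel_conj UNIV (\<bullet>) (g s) (y s)}
      = fst ` {z \<in> space (M \<Otimes>\<^sub>M borel). a < ereal (y (fst z) \<bullet> snd z) - (\<lambda>(s, r). g s r) z}"
    by (auto simp: fenchel_conj_def less_SUP_iff space_pair_measure image_iff)
  also have "\<dots> \<in> sets M"
    using m by (intro measurable_projection M borel_measurable_less[OF borel_measurable_const])
  finally show "{s \<in> space M. a < fenchel_conj UNIV (\<bullet>) (g s) (y s)} \<in> sets M" .
qed

lemma lsc_affine_sublevel_closed: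
  fixes g :: "'b::euclidean_space \<Rightarrow> ereal"
  assumes "\<And>r. g r \<le> Liminf (at r) g"
  shows "closed {r. g r \<le> ereal (y \<bullet> r + c)}"
proof -
  have "open {r. ereal (y \<bullet> r + c) < g r}"
  proof (subst open_subopen, rule ballI)
    fix r assume "r \<in> {r. ereal (y \<bullet> r + c) < g r}"
    then obtain e where e: "ereal (y \<bullet> r + c) < e" "e < g r" using dense by auto
    have "e < Liminf (at r) g" using e(2) assms[of r] by simp
    then have "\<forall>\<^sub>F r' in at r. e < g r'" by (rule less_LiminfD)
    moreover have "((\<lambda>r. ereal (y \<bullet> r + c)) \<longlongrightarrow> ereal (y \<bullet> r + c)) (at r)"
      by (intro tendsto_intros)
    then have "\<forall>\<^sub>F r' in at r. ereal (y \<bullet> r' + c) < e" using e(1) by (rule order_tendstoD(2))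
    ultimately have "\<forall>\<^sub>F r' in at r. ereal (y \<bullet> r' + c) < g r'" by eventually_elim simp
    \<comment> \<open>The punctured neighbourhood of \<open>at r\<close> is completed by
      \<open>r\<close> itself, where \<open>e < g r\<close>.\<close>
    then have "\<forall>\<^sub>F r' in nhds r. r' \<in> {r. ereal (y \<bullet> r + c) < g r}"
      using e by (auto simp: eventually_at_filter elim!: eventually_mono)
    then show "\<exists>T. open T \<and> r \<in> T \<and> T \<subseteq> {r. ereal (y \<bullet> r + c) < g r}"
      unfolding eventually_nhds by blast
  qed
  then have "closed (- {r. ereal (y \<bullet> r + c) < g r})" by (rule closed_Compl)
  also have "- {r. ereal (y \<bullet> r + c) < g r} = {r. g r \<le> ereal (y \<bullet> r + c)}" by auto
  finally show ?thesis .
qed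

lemma convex_affine_sublevel:
  fixes g :: "'b::euclidean_space \<Rightarrow> ereal"
  assumes "\<And>r s a. 0 < a \<and> a < 1 \<Longrightarrow> g (a *\<^sub>R r + (1 - a) *\<^sub>R s) \<le> ereal a * g r + ereal (1 - a) * g s"
  shows "convex {r. g r \<le> ereal (y \<bullet> r + c)}"
  unfolding convex_alt
proof (intro ballI allI impI)
  fix r s and u :: real
  assume rs: "r \<in> {r. g r \<le> ereal (y \<bullet> r + c)}" "s \<in> {r. g r \<le> ereal (y \<bullet> r + c)}" and u: "0 \<le> u \<and> u \<le> 1"
  consider "u = 0" | "u = 1" | "0 < 1 - u" "1 - u < 1" using u by linarith
  then show "(1 - u) *\<^sub>R r + u *\<^sub>R s \<in> {r. g r \<le> ereal (y \<bullet> r + c)}"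
  proof cases
    case 3
    have "g ((1 - u) *\<^sub>R r + u *\<^sub>R s) \<le> ereal (1 - u) * g r + ereal u * g s"
      using assms[of "1 - u" r s] 3 by simp
    also have "\<dots> \<le> ereal (1 - u) * ereal (y \<bullet> r + c) + ereal u * ereal (y \<bullet> s + c)"
      using rs 3 u by (intro add_mono ereal_mult_left_mono) auto
    also have "\<dots> = ereal (y \<bullet> ((1 - u) *\<^sub>R r + u *\<^sub>R s) + c)"
      by (simp add: inner_add_right algebra_simps)
    finally show ?thesis by simp
  qed (use rs in auto)
qed

lemma near_maximizing_selection:
  fixes g :: "'s \<Rightarrow> 'b::euclidean_space \<Rightarrow> ereal"
  assumes M: "finite_measure M" "complete_measure M"
    and g: "(\<lambda>(s, r). g s r) \<in> borel_measurable (M \<Otimes>\<^sub>M borel)" and y: "y \<in> borel_measurable M"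
    and S: "S \<in> sets M" "\<And>s. s \<in> S \<Longrightarrow> proper_convex_lsc (g s)"
    and c: "c \<in> borel_measurable M"
    and ex: "\<And>s. s \<in> S \<Longrightarrow> (\<exists>r. g s r \<le> ereal (y s \<bullet> r - c s))"
  shows "\<exists>r\<in>borel_measurable M. \<forall>s\<in>S. g s (r s) \<le> ereal (y s \<bullet> r s - c s)"
proof -
  define A1 where "A1 = {z \<in> space (M \<Otimes>\<^sub>M borel). (\<lambda>(s, r). g s r) z \<le> ereal (y (fst z) \<bullet> snd z - c (fst z))}"
  have A1: "A1 \<in> sets (M \<Otimes>\<^sub>M borel)"
    unfolding A1_def
  proof (rule borel_measurable_le[OF g])
    show "(\<lambda>z. ereal (y (fst z) \<bullet> snd z - c (fst z))) \<in> borel_measurable (M \<Otimes>\<^sub>M borel)"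
      using measurable_compose[OF measurable_fst y] measurable_compose[OF measurable_fst c] by measurable
  qed
  \<comment> \<open>Off \<open>S\<close> nothing is known about \<open>g\<close>; the fibre
    \<open>{0}\<close> keeps every section closed, convex and nonempty, as the selection lemma
    demands.\<close>
  define A where "A = (A1 \<inter> (S \<times> UNIV)) \<union> ((space M - S) \<times> {0})"
  have "A \<in> sets (M \<Otimes>\<^sub>M borel)"
    unfolding A_def using A1 S(1) by (intro sets.Un sets.Int pair_measureI sets.Diff) auto
  moreover have "closed {r. (s, r) \<in> A} \<and> convex {r. (s, r) \<in> A} \<and> {r. (s, r) \<in> A} \<noteq> {}" if s: "s \<in> space M" for s
  proof (cases "s \<in> S")
    case True
    have eq: "{r. (s, r) \<in> A} = {r. g s r \<le> ereal (y s \<bullet> r + - c s)}"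
      using True s by (auto simp: A_def A1_def space_pair_measure)
    have "closed {r. g s r \<le> ereal (y s \<bullet> r + - c s)}" "convex {r. g s r \<le> ereal (y s \<bullet> r + - c s)}"
      using S(2)[OF True] unfolding proper_convex_lsc_def
      by (intro lsc_affine_sublevel_closed convex_affine_sublevel; blast)+
    moreover have "{r. g s r \<le> ereal (y s \<bullet> r + - c s)} \<noteq> {}"
      using ex[OF True] by simp
    ultimately show ?thesis unfolding eq by blast
  next
    case False
    then have "{r. (s, r) \<in> A} = {0}" using s by (auto simp: A_def)
    then show ?thesis by simp
  qed
  ultimately obtain r where r: "r \<in> borel_measurable M" "\<And>s. s \<in> space M \<Longrightarrow> (s, r s) \<in> A"
    using convex_measurable_selection[OF M] by blast
  have "g s (r s) \<le> ereal (y s \<bullet> r s - c s)" if "s \<in> S" for s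
  proof -
    have "s \<in> space M" using that S(1) sets.sets_into_space by blast
    from r(2)[OF this] that show ?thesis by (auto simp: A_def A1_def)
  qed
  with r(1) show ?thesis by blast
qed

section \<open>Calculus of the extended integral\<close>

lemma ext_integral_eq:
  assumes "integrable M f" "AE x in M. h x = ereal (f x)" "h \<in> borel_measurable M"
  shows "ext_integral M h = ereal (LINT x|M. f x)"
proof -
  have 1: "(\<integral>\<^sup>+x. e2ennreal (h x) \<partial>M) = (\<integral>\<^sup>+x. ennreal (f x) \<partial>M)"
    using assms(2) by (intro nn_integral_cong_AE) (auto simp: ennreal.abs_eq e2ennreal_ereal elim: eventually_mono)
  have 2: "(\<integral>\<^sup>+x. e2ennreal (- h x) \<partial>M) = (\<integral>\<^sup>+x. ennreal (- f x) \<partial>M)"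
    using assms(2) by (intro nn_integral_cong_AE) (auto simp: e2ennreal_ereal elim: eventually_mono)
  have fin: "(\<integral>\<^sup>+x. ennreal (f x) \<partial>M) < \<infinity>" "(\<integral>\<^sup>+x. ennreal (- f x) \<partial>M) < \<infinity>"
    using assms(1) by (auto simp: real_integrable_def less_top)
  then obtain a b where ab: "(\<integral>\<^sup>+x. ennreal (f x) \<partial>M) = ennreal a" "a \<ge> 0" "(\<integral>\<^sup>+x. ennreal (- f x) \<partial>M) = ennreal b" "b \<ge> 0"
    by (metis ennreal_cases less_irrefl infinity_ennreal_def)
  have "ext_integral M h = ereal a - ereal b"
    using assms(3) ab by (simp add: ext_integral_def 1 2 enn2ereal_ennreal)
  also have "\<dots> = ereal (LINT x|M. f x)"
    using ab by (simp add: real_lebesgue_integral_def[OF assms(1)])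
  finally show ?thesis .
qed

lemma ext_integral_measurable: "ext_integral M h < \<infinity> \<Longrightarrow> h \<in> borel_measurable M"
  and ext_integral_pos_part: "ext_integral M h < \<infinity> \<Longrightarrow> (\<integral>\<^sup>+x. e2ennreal (h x) \<partial>M) < \<infinity>"
  by (auto simp: ext_integral_def split: if_splits)

lemma ext_integral_gt_MInfI:
  assumes "(\<integral>\<^sup>+x. e2ennreal (- h x) \<partial>M) < \<infinity>"
  shows "ext_integral M h > -\<infinity>"
proof -
  obtain b where "(\<integral>\<^sup>+x. e2ennreal (- h x) \<partial>M) = ennreal b" "b \<ge> 0"
    using assms by (metis ennreal_cases less_irrefl infinity_ennreal_def)
  then show ?thesis
    using enn2ereal_nonneg[of "\<integral>\<^sup>+x. e2ennreal (h x) \<partial>M"]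
    by (auto simp: ext_integral_def enn2ereal_ennreal ereal_minus_eq_minus_iff less_le minus_ereal_def
        dest!: arg_cong[of _ _ "\<lambda>z. z = -\<infinity>"])
qed

lemma ext_integral_finite:
  assumes "\<bar>ext_integral M h\<bar> \<noteq> \<infinity>"
  shows "integrable M (\<lambda>x. real_of_ereal (h x))" "AE x in M. h x = ereal (real_of_ereal (h x))"
    "ext_integral M h = ereal (LINT x|M. real_of_ereal (h x))"
proof -
  have lt: "ext_integral M h < \<infinity>" using assms by auto
  have h: "h \<in> borel_measurable M" using lt by (rule ext_integral_measurable)
  have P: "(\<integral>\<^sup>+x. e2ennreal (h x) \<partial>M) < \<infinity>" using lt by (rule ext_integral_pos_part)
  have N: "(\<integral>\<^sup>+x. e2ennreal (- h x) \<partial>M) < \<infinity>"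
  proof (rule ccontr)
    assume "\<not> (\<integral>\<^sup>+x. e2ennreal (- h x) \<partial>M) < \<infinity>"
    then have "(\<integral>\<^sup>+x. e2ennreal (- h x) \<partial>M) = top" by (simp add: less_top[symmetric])
    then have "ext_integral M h = enn2ereal (\<integral>\<^sup>+x. e2ennreal (h x) \<partial>M) - \<infinity>"
      using h P by (simp add: ext_integral_def)
    moreover have "enn2ereal (\<integral>\<^sup>+x. e2ennreal (h x) \<partial>M) \<noteq> \<infinity>"
      using P by (metis enn2ereal_eq_top_iff infinity_ennreal_def less_irrefl top_ereal_def)
    ultimately have "ext_integral M h = -\<infinity>" by (cases "enn2ereal (\<integral>\<^sup>+x. e2ennreal (h x) \<partial>M)") auto
    with assms show False by simp
  qed
  have m: "(\<lambda>x. e2ennreal (h x)) \<in> borel_measurable M" "(\<lambda>x. e2ennreal (- h x)) \<in> borel_measurable M"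
    using h by measurable
  have "AE x in M. e2ennreal (h x) \<noteq> \<infinity>" "AE x in M. e2ennreal (- h x) \<noteq> \<infinity>"
    using nn_integral_PInf_AE[OF m(1)] nn_integral_PInf_AE[OF m(2)] P N by auto
  then show ae: "AE x in M. h x = ereal (real_of_ereal (h x))"
  proof eventually_elim
    case (elim x)
    then show ?case by (cases "h x") auto
  qed
  have "(\<integral>\<^sup>+x. ennreal (norm (real_of_ereal (h x))) \<partial>M) = (\<integral>\<^sup>+x. e2ennreal (h x) + e2ennreal (- h x) \<partial>M)"
  proof (rule nn_integral_cong_AE)
    show "AE x in M. ennreal (norm (real_of_ereal (h x))) = e2ennreal (h x) + e2ennreal (- h x)"
      using ae
    proof eventually_elim
      case (elim x)
      then obtain r where "h x = ereal r" by blast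
      then show ?case by (cases "r \<ge> 0") (auto simp: e2ennreal_ereal ennreal_neg)
    qed
  qed
  also have "\<dots> = (\<integral>\<^sup>+x. e2ennreal (h x) \<partial>M) + (\<integral>\<^sup>+x. e2ennreal (- h x) \<partial>M)"
    using m by (rule nn_integral_add)
  also have "\<dots> < \<infinity>" using P N by simp
  finally show i: "integrable M (\<lambda>x. real_of_ereal (h x))"
    using h by (intro integrableI_bounded) auto
  show "ext_integral M h = ereal (LINT x|M. real_of_ereal (h x))"
    using i ae h by (rule ext_integral_eq)
qed

text \<open>The inequality bounds the negative part of \<open>a\<close> by the positive part of
  \<open>b\<close> plus \<open>\<bar>c\<bar>\<close>, so two integrable positive parts already
  exclude the value \<open>-\<infinity>\<close>. Integrability also keeps \<open>a\<close> and
  \<open>b\<close> below \<open>\<infinity>\<close> almost everywhere, which makes the bound a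
  statement about reals.\<close>

lemma ext_integral_Young:
  assumes a: "ext_integral M a < \<infinity>" and b: "ext_integral M b < \<infinity>"
    and c: "integrable M c" "AE x in M. ereal (c x) \<le> a x + b x"
  shows "\<bar>ext_integral M a\<bar> \<noteq> \<infinity>"
proof -
  have bm: "b \<in> borel_measurable M" using b by (rule ext_integral_measurable)
  have fb: "AE x in M. e2ennreal (b x) \<noteq> \<infinity>"
    using ext_integral_pos_part[OF b] bm by (intro nn_integral_PInf_AE) auto
  have fa: "AE x in M. e2ennreal (a x) \<noteq> \<infinity>"
    using ext_integral_pos_part[OF a] ext_integral_measurable[OF a] by (intro nn_integral_PInf_AE) auto
  have "(\<integral>\<^sup>+x. e2ennreal (- a x) \<partial>M) \<le> (\<integral>\<^sup>+x. e2ennreal (b x) + ennreal \<bar>c x\<bar> \<partial>M)"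
  proof (rule nn_integral_mono_AE)
    show "AE x in M. e2ennreal (- a x) \<le> e2ennreal (b x) + ennreal \<bar>c x\<bar>"
      using fa fb c(2)
    proof eventually_elim
      case (elim x)
      obtain p q where pq: "a x = ereal p" "b x = ereal q"
        using elim by (cases "a x"; cases "b x") auto
      then have "- p \<le> max 0 q + \<bar>c x\<bar>" using elim(3) by simp
      then have "ennreal (- p) \<le> ennreal (max 0 q + \<bar>c x\<bar>)" by (rule ennreal_leI)
      also have "\<dots> = ennreal (max 0 q) + ennreal \<bar>c x\<bar>" by (rule ennreal_plus) auto
      finally show ?case by (cases "q \<ge> 0") (auto simp: pq max_def ennreal_neg)
    qed
  qed
  also have "\<dots> = (\<integral>\<^sup>+x. e2ennreal (b x) \<partial>M) + (\<integral>\<^sup>+x. ennreal \<bar>c x\<bar> \<partial>M)"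
    using bm c(1) by (intro nn_integral_add) auto
  also have "\<dots> < \<infinity>"
    using ext_integral_pos_part[OF b] c(1) by (auto simp: integrable_iff_bounded)
  finally have "ext_integral M a > -\<infinity>" by (rule ext_integral_gt_MInfI)
  with a show ?thesis by auto
qed


lemma ext_integral_Young_le:
  assumes a: "\<bar>ext_integral M a\<bar> \<noteq> \<infinity>" and b: "\<bar>ext_integral M b\<bar> \<noteq> \<infinity>"
    and c: "integrable M c" "AE x in M. ereal (c x) \<le> a x + b x"
  shows "ereal (LINT x|M. c x) \<le> ext_integral M a + ext_integral M b"
proof -
  note A = ext_integral_finite[OF a] and B = ext_integral_finite[OF b]
  have "(LINT x|M. c x) \<le> (LINT x|M. real_of_ereal (a x) + real_of_ereal (b x))"
  proof (rule integral_mono_AE[OF c(1) Bochner_Integration.integrable_add[OF A(1) B(1)]])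
    show "AE x in M. c x \<le> real_of_ereal (a x) + real_of_ereal (b x)"
      using A(2) B(2) c(2)
    proof eventually_elim
      case (elim x)
      obtain p q where "a x = ereal p" "b x = ereal q" using elim(1,2) by blast
      with elim(3) show ?case by simp
    qed
  qed
  also have "\<dots> = (LINT x|M. real_of_ereal (a x)) + (LINT x|M. real_of_ereal (b x))"
    using A(1) B(1) by simp
  finally show ?thesis using A(3) B(3) by simp
qed

text \<open>Decomposability of \<open>Lp_space\<close>: a merely measurable selection is kept where
  it is bounded, which costs only the finite measure, and is replaced by a given element
  elsewhere.\<close>

lemma Lp_space_bounded_modification:
  assumes "finite_measure M" "r \<in> borel_measurable M" "r0 \<in> Lp_space M p" "0 < p" "0 \<le> k"
  shows "(\<lambda>x. if norm (r x) \<le> k then r x else r0 x) \<in> Lp_space M p"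
proof -
  interpret finite_measure M by fact
  have m: "(\<lambda>x. if norm (r x) \<le> k then r x else r0 x) \<in> borel_measurable M"
    using assms(2) Lp_space_measurable[OF assms(3)]
      borel_measurable_le[OF measurable_compose[OF assms(2) borel_measurable_norm] borel_measurable_const[of k]]
    by (intro measurable_If)
  have "integrable M (\<lambda>x. k powr p + norm (r0 x) powr p)"
    using Lp_space_integrable[OF assms(3)] by simp
  then have "integrable M (\<lambda>x. norm (if norm (r x) \<le> k then r x else r0 x) powr p)"
  proof (rule Bochner_Integration.integrable_bound)
    have "norm (if norm (r x) \<le> k then r x else r0 x) powr p \<le> k powr p + norm (r0 x) powr p" for x
    proof (cases "norm (r x) \<le> k")
      case True
      then have "norm (r x) powr p \<le> k powr p" using assms(4) by (intro powr_mono2) auto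
      then show ?thesis using True by (simp add: add_increasing2)
    qed simp
    then show "AE x in M. norm (norm (if norm (r x) \<le> k then r x else r0 x) powr p) \<le> norm (k powr p + norm (r0 x) powr p)"
      by (intro AE_I2) (simp add: abs_of_nonneg)
    show "(\<lambda>x. norm (if norm (r x) \<le> k then r x else r0 x) powr p) \<in> borel_measurable M"
      using m by measurable
  qed
  with m show ?thesis by (simp add: Lp_space_def)
qed

text \<open>\<open>e\<close> is the value of the maximand at \<open>r0\<close>, and
  \<open>r n\<close> improves on it by at least \<open>\<tau> n\<close>. A competitor equal to
  \<open>r n\<close> where its norm is at most \<open>k\<close> and to \<open>r0\<close> elsewhere
  shows that the integral of \<open>\<tau> n\<close> over that set is at most
  \<open>\<gamma>\<close> minus the integral of \<open>e\<close>. Fatou for \<open>k\<close>, then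
  for \<open>n\<close>, yields the hard inequality between the conjugates. The selections enter as
  hypotheses because they come from the whole cylinder.\<close>

lemma integral_functional_conjugate:
  fixes \<Phi> :: "'x \<Rightarrow> 'b::euclidean_space \<Rightarrow> ereal" and \<tau> :: "nat \<Rightarrow> 'x \<Rightarrow> real"
  assumes fin: "finite_measure M" and p: "1 < p" "1 / p + 1 / p' = 1"
    and y: "y \<in> Lp_space M p'" and r0: "r0 \<in> Lp_space M p"
    and b0: "\<bar>ext_integral M (\<lambda>x. \<Phi> x (r0 x))\<bar> \<noteq> \<infinity>"
    and \<Psi>: "(\<lambda>x. fenchel_conj UNIV (\<bullet>) (\<Phi> x) (y x)) \<in> borel_measurable M"
    and proper: "AE x in M. \<forall>r. \<Phi> x r \<noteq> -\<infinity>"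
    and r: "\<And>n. r n \<in> borel_measurable M" "\<And>n. (\<lambda>x. \<Phi> x (r n x)) \<in> borel_measurable M"
    and \<tau>: "\<And>n. \<tau> n \<in> borel_measurable M" "\<And>n x. 0 \<le> \<tau> n x"
    and near: "\<And>n. AE x in M. \<Phi> x (r n x)
        \<le> ereal (y x \<bullet> r n x - ((y x \<bullet> r0 x - real_of_ereal (\<Phi> x (r0 x))) + \<tau> n x))"
    and lim: "AE x in M. (\<lambda>n. ennreal (\<tau> n x)) \<longlonglongrightarrow>
        e2ennreal (fenchel_conj UNIV (\<bullet>) (\<Phi> x) (y x) - ereal (y x \<bullet> r0 x - real_of_ereal (\<Phi> x (r0 x))))"
    and G: "fenchel_conj (Lp_space M p) (\<lambda>u v. LINT x|M. u x \<bullet> v x) (\<lambda>v. ext_integral M (\<lambda>x. \<Phi> x (v x))) y < \<infinity>"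
  shows "\<bar>ext_integral M (\<lambda>x. fenchel_conj UNIV (\<bullet>) (\<Phi> x) (y x))\<bar> \<noteq> \<infinity>"
    and "fenchel_conj (Lp_space M p) (\<lambda>u v. LINT x|M. u x \<bullet> v x) (\<lambda>v. ext_integral M (\<lambda>x. \<Phi> x (v x))) y
      = ext_integral M (\<lambda>x. fenchel_conj UNIV (\<bullet>) (\<Phi> x) (y x))"
proof -
  interpret finite_measure M by fact
  have p': "1 < p'" using Young_conjugate(1)[OF p] .
  define G where "G = fenchel_conj (Lp_space M p) (\<lambda>u v. LINT x|M. u x \<bullet> v x) (\<lambda>v. ext_integral M (\<lambda>x. \<Phi> x (v x))) y"
  define \<Psi>' where "\<Psi>' x = fenchel_conj UNIV (\<bullet>) (\<Phi> x) (y x)" for x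
  define b where "b x = real_of_ereal (\<Phi> x (r0 x))" for x
  define e where "e x = y x \<bullet> r0 x - b x" for x
  note B = ext_integral_finite[OF b0, folded b_def]
  have yr: "integrable M (\<lambda>x. y x \<bullet> v x)" if "v \<in> Lp_space M p" for v
    using Lp_pair(1)[OF p y that] .
  have ei: "integrable M e" unfolding e_def using yr[OF r0] B(1) by simp
  have G_ge: "ereal (LINT x|M. y x \<bullet> v x) - ext_integral M (\<lambda>x. \<Phi> x (v x)) \<le> G" if "v \<in> Lp_space M p" for v
    unfolding G_def fenchel_conj_def using that by (intro SUP_upper)
  have "ereal (LINT x|M. e x) \<le> G"
    using G_ge[OF r0] B(3) yr[OF r0] B(1) by (simp add: e_def)
  with G obtain \<gamma> where \<gamma>: "G = ereal \<gamma>" "(LINT x|M. e x) \<le> \<gamma>"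
    unfolding G_def[symmetric] by (cases G) auto
  have Young: "AE x in M. \<forall>v. ereal (y x \<bullet> v) \<le> \<Phi> x v + \<Psi>' x"
    using proper
  proof eventually_elim
    case (elim x)
    show ?case
    proof
      fix v
      have "ereal (y x \<bullet> v) - \<Phi> x v \<le> \<Psi>' x"
        unfolding \<Psi>'_def fenchel_conj_def by (intro SUP_upper) simp
      then show "ereal (y x \<bullet> v) \<le> \<Phi> x v + \<Psi>' x"
        using elim by (cases "\<Phi> x v"; cases "\<Psi>' x") auto
    qed
  qed
  have yi: "integrable M y"
    using fin y p' by (intro Lp_space_imp_integrable) auto
  have part: "(\<integral>\<^sup>+x. ennreal (\<tau> n x) * indicator {x \<in> space M. norm (r n x) \<le> real k} x \<partial>M) \<le> ennreal (\<gamma> - (LINT x|M. e x))" for n k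
  proof -
    define v where "v x = (if norm (r n x) \<le> real k then r n x else r0 x)" for x
    have v: "v \<in> Lp_space M p"
      unfolding v_def using fin r(1) r0 p by (intro Lp_space_bounded_modification) auto
    have hm: "(\<lambda>x. \<Phi> x (v x)) \<in> borel_measurable M"
    proof -
      have "(\<lambda>x. if norm (r n x) \<le> real k then \<Phi> x (r n x) else \<Phi> x (r0 x)) \<in> borel_measurable M"
      proof (intro measurable_If r(2))
        show "{x \<in> space M. norm (r n x) \<le> real k} \<in> sets M"
          by (rule borel_measurable_le[OF measurable_compose[OF r(1) borel_measurable_norm] borel_measurable_const])
        show "(\<lambda>x. \<Phi> x (r0 x)) \<in> borel_measurable M"
          using b0 by (intro ext_integral_measurable) auto
      qed
      also have "(\<lambda>x. if norm (r n x) \<le> real k then \<Phi> x (r n x) else \<Phi> x (r0 x)) = (\<lambda>x. \<Phi> x (v x))"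
        by (auto simp: v_def)
      finally show ?thesis .
    qed
    \<comment> \<open>An integrable majorant of \<open>\<Phi> x (v x)\<close>: a competitor of
      energy \<open>\<infinity>\<close> would say nothing about \<open>G\<close>. The bound combines
      the truncation at \<open>k\<close> with the near-optimality of \<open>r n\<close>.\<close>
    define U where "U x = norm (y x) * real k + \<bar>e x\<bar> + \<bar>b x\<bar>" for x
    have Ui: "integrable M U" unfolding U_def using yi ei B(1) by simp
    have "AE x in M. \<Phi> x (v x) \<le> ereal (U x)"
      using near[of n] B(2)
    proof eventually_elim
      case (elim x)
      show ?case
      proof (cases "norm (r n x) \<le> real k")
        case True
        have "y x \<bullet> r n x \<le> norm (y x) * norm (r n x)" by (rule norm_cauchy_schwarz)
        also have "\<dots> \<le> norm (y x) * real k" using True by (intro mult_left_mono) auto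
        finally have "y x \<bullet> r n x - (e x + \<tau> n x) \<le> U x"
          using \<tau>(2)[of n x] unfolding U_def by linarith
        moreover have "\<Phi> x (r n x) \<le> ereal (y x \<bullet> r n x - (e x + \<tau> n x))"
          using elim(1) by (simp add: e_def b_def)
        ultimately show ?thesis using True by (auto simp: v_def intro: order.trans)
      next
        case False
        have "b x \<le> U x" unfolding U_def by (simp add: add_increasing)
        then show ?thesis using False elim(2) by (simp add: v_def)
      qed
    qed
    then have "(\<integral>\<^sup>+x. e2ennreal (\<Phi> x (v x)) \<partial>M) \<le> (\<integral>\<^sup>+x. ennreal (U x) \<partial>M)"
      by (intro nn_integral_mono_AE) (auto elim!: eventually_mono dest: e2ennreal_mono)
    also have "\<dots> < \<infinity>" using Ui by (auto simp: real_integrable_def less_top)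
    finally have lt: "ext_integral M (\<lambda>x. \<Phi> x (v x)) < \<infinity>"
    proof -
      assume P: "(\<integral>\<^sup>+x. e2ennreal (\<Phi> x (v x)) \<partial>M) < \<infinity>"
      then have "enn2ereal (\<integral>\<^sup>+x. e2ennreal (\<Phi> x (v x)) \<partial>M) < \<infinity>"
        by (metis enn2ereal_eq_top_iff ereal_infty_less(1) infinity_ennreal_def less_irrefl top_ereal_def)
      then show ?thesis
        using P hm enn2ereal_nonneg[of "\<integral>\<^sup>+x. e2ennreal (- \<Phi> x (v x)) \<partial>M"] unfolding ext_integral_def
        by (cases "enn2ereal (\<integral>\<^sup>+x. e2ennreal (\<Phi> x (v x)) \<partial>M)"; cases "enn2ereal (\<integral>\<^sup>+x. e2ennreal (- \<Phi> x (v x)) \<partial>M)") auto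
    qed
    \<comment> \<open>Energy \<open>-\<infinity>\<close> would force
      \<open>G = \<infinity>\<close>.\<close>
    have gt: "ext_integral M (\<lambda>x. \<Phi> x (v x)) \<noteq> -\<infinity>"
      using G_ge[OF v] \<gamma>(1) by (cases "ext_integral M (\<lambda>x. \<Phi> x (v x))") auto
    have "\<bar>ext_integral M (\<lambda>x. \<Phi> x (v x))\<bar> \<noteq> \<infinity>" using lt gt by auto
    note V = ext_integral_finite[OF this]
    let ?h = "\<lambda>x. real_of_ereal (\<Phi> x (v x))"
    have di: "integrable M (\<lambda>x. y x \<bullet> v x - ?h x - e x)" using yr[OF v] V(1) ei by simp
    have ge: "AE x in M. \<tau> n x * indicator {x \<in> space M. norm (r n x) \<le> real k} x \<le> y x \<bullet> v x - ?h x - e x"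
      using near[of n] V(2) AE_space
    proof eventually_elim
      case (elim x)
      then show ?case
      proof (cases "norm (r n x) \<le> real k")
        case True
        have "ereal (?h x) \<le> ereal (y x \<bullet> v x - (e x + \<tau> n x))"
          using elim(1,2) True by (simp add: v_def e_def b_def)
        then show ?thesis using True elim(3) by simp
      qed (simp add: v_def e_def b_def)
    qed
    have "(\<integral>\<^sup>+x. ennreal (\<tau> n x) * indicator {x \<in> space M. norm (r n x) \<le> real k} x \<partial>M) \<le> (\<integral>\<^sup>+x. ennreal (y x \<bullet> v x - ?h x - e x) \<partial>M)"
    proof (rule nn_integral_mono_AE)
      show "AE x in M. ennreal (\<tau> n x) * indicator {x \<in> space M. norm (r n x) \<le> real k} x \<le> ennreal (y x \<bullet> v x - ?h x - e x)"
        using ge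
      proof eventually_elim
        case (elim x)
        have "ennreal (\<tau> n x) * indicator {x \<in> space M. norm (r n x) \<le> real k} x
            = ennreal (\<tau> n x * indicator {x \<in> space M. norm (r n x) \<le> real k} x)"
          by (simp add: indicator_def)
        also have "\<dots> \<le> ennreal (y x \<bullet> v x - ?h x - e x)" using elim by (rule ennreal_leI)
        finally show ?case .
      qed
    qed
    also have "\<dots> = ennreal (LINT x|M. y x \<bullet> v x - ?h x - e x)"
    proof (rule nn_integral_eq_integral[OF di])
      show "AE x in M. 0 \<le> y x \<bullet> v x - ?h x - e x"
        using ge
      proof eventually_elim
        case (elim x)
        moreover have "0 \<le> \<tau> n x * indicator {x \<in> space M. norm (r n x) \<le> real k} x"
          using \<tau>(2) by simp
        ultimately show ?case by (rule order.trans[rotated])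
      qed
    qed
    also have "(LINT x|M. y x \<bullet> v x - ?h x - e x) = (LINT x|M. y x \<bullet> v x) - (LINT x|M. ?h x) - (LINT x|M. e x)"
      using yr[OF v] V(1) ei by simp
    also have "ennreal \<dots> \<le> ennreal (\<gamma> - (LINT x|M. e x))"
      using G_ge[OF v] V(3) \<gamma>(1) by (intro ennreal_leI) simp
    finally show ?thesis .
  qed
  \<comment> \<open>Fatou in the truncation level: at each point the truncation is inactive once
    \<open>k\<close> exceeds the norm of \<open>r n\<close>.\<close>
  have tau: "(\<integral>\<^sup>+x. ennreal (\<tau> n x) \<partial>M) \<le> ennreal (\<gamma> - (LINT x|M. e x))" for n
  proof -
    let ?f = "\<lambda>k x. ennreal (\<tau> n x) * indicator {x \<in> space M. norm (r n x) \<le> real k} x"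
    have "(\<integral>\<^sup>+x. ennreal (\<tau> n x) \<partial>M) \<le> (\<integral>\<^sup>+x. liminf (\<lambda>k. ?f k x) \<partial>M)"
    proof (rule nn_integral_mono)
      fix x assume x: "x \<in> space M"
      obtain K where K: "norm (r n x) \<le> real K" using real_arch_simple by blast
      have "\<forall>\<^sub>F k in sequentially. ?f k x = ennreal (\<tau> n x)"
        unfolding eventually_sequentially
      proof (intro exI[of _ K] allI impI)
        fix k assume "K \<le> k"
        then have "norm (r n x) \<le> real k" using K by linarith
        then show "?f k x = ennreal (\<tau> n x)" using x by simp
      qed
      then have "(\<lambda>k. ?f k x) \<longlonglongrightarrow> ennreal (\<tau> n x)" by (rule tendsto_eventually)
      then have "liminf (\<lambda>k. ?f k x) = ennreal (\<tau> n x)" by (rule lim_imp_Liminf[rotated]) simp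
      then show "ennreal (\<tau> n x) \<le> liminf (\<lambda>k. ?f k x)" by simp
    qed
    also have "\<dots> \<le> liminf (\<lambda>k. \<integral>\<^sup>+x. ?f k x \<partial>M)"
    proof (rule nn_integral_liminf)
      fix k
      have "{x \<in> space M. norm (r n x) \<le> real k} \<in> sets M"
        by (rule borel_measurable_le[OF measurable_compose[OF r(1) borel_measurable_norm] borel_measurable_const])
      then show "?f k \<in> borel_measurable M"
        using \<tau>(1)[of n] by (intro borel_measurable_times_ennreal) auto
    qed
    also have "\<dots> \<le> liminf (\<lambda>k::nat. ennreal (\<gamma> - (LINT x|M. e x)))"
      using part by (intro Liminf_mono) auto
    finally show ?thesis by (simp add: Liminf_const)
  qed
  have "(\<integral>\<^sup>+x. e2ennreal (\<Psi>' x - ereal (e x)) \<partial>M) \<le> (\<integral>\<^sup>+x. liminf (\<lambda>n. ennreal (\<tau> n x)) \<partial>M)"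
  proof (rule nn_integral_mono_AE)
    show "AE x in M. e2ennreal (\<Psi>' x - ereal (e x)) \<le> liminf (\<lambda>n. ennreal (\<tau> n x))"
      using lim
    proof eventually_elim
      case (elim x)
      then have "liminf (\<lambda>n. ennreal (\<tau> n x)) = e2ennreal (\<Psi>' x - ereal (e x))"
        unfolding \<Psi>'_def e_def b_def by (rule lim_imp_Liminf[rotated]) simp
      then show ?case by simp
    qed
  qed
  also have "\<dots> \<le> liminf (\<lambda>n. \<integral>\<^sup>+x. ennreal (\<tau> n x) \<partial>M)"
    using \<tau>(1) by (intro nn_integral_liminf) auto
  also have "\<dots> \<le> liminf (\<lambda>n::nat. ennreal (\<gamma> - (LINT x|M. e x)))"
    using tau by (intro Liminf_mono) auto
  finally have le\<gamma>: "(\<integral>\<^sup>+x. e2ennreal (\<Psi>' x - ereal (e x)) \<partial>M) \<le> ennreal (\<gamma> - (LINT x|M. e x))"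
    by (simp add: Liminf_const)
  define w where "w x = \<Psi>' x - ereal (e x)" for x
  have \<Psi>m: "\<Psi>' \<in> borel_measurable M" using \<Psi> by (simp add: \<Psi>'_def[abs_def])
  have wm: "w \<in> borel_measurable M"
    unfolding w_def using \<Psi>m ei by measurable
  have w0: "AE x in M. 0 \<le> w x"
    using Young B(2)
  proof eventually_elim
    case (elim x)
    have "ereal (y x \<bullet> r0 x) \<le> ereal (b x) + \<Psi>' x" using elim by metis
    then show ?case by (cases "\<Psi>' x") (auto simp: w_def e_def)
  qed
  have wneg: "(\<integral>\<^sup>+x. e2ennreal (- w x) \<partial>M) = 0"
  proof -
    have "(\<integral>\<^sup>+x. e2ennreal (- w x) \<partial>M) = (\<integral>\<^sup>+x. 0 \<partial>M)"
      using w0 by (intro nn_integral_cong_AE) (auto elim!: eventually_mono intro: e2ennreal_neg simp: ereal_uminus_le_reorder)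
    then show ?thesis by simp
  qed
  have wlt: "(\<integral>\<^sup>+x. e2ennreal (w x) \<partial>M) < \<infinity>"
    using le\<gamma> unfolding w_def by (auto intro: order.strict_trans1)
  have wle: "ext_integral M w \<le> ereal (\<gamma> - (LINT x|M. e x))"
  proof -
    have "ext_integral M w = enn2ereal (\<integral>\<^sup>+x. e2ennreal (w x) \<partial>M)"
      using wm wlt wneg by (simp add: ext_integral_def zero_ennreal.rep_eq)
    also have "\<dots> \<le> enn2ereal (ennreal (\<gamma> - (LINT x|M. e x)))"
      using le\<gamma> unfolding w_def by (simp add: less_eq_ennreal.rep_eq)
    also have "\<dots> = ereal (\<gamma> - (LINT x|M. e x))"
      using \<gamma>(2) by (simp add: enn2ereal_ennreal)
    finally show ?thesis .
  qed
  moreover have "ext_integral M w > -\<infinity>"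
    by (rule ext_integral_gt_MInfI) (simp add: wneg)
  ultimately have "\<bar>ext_integral M w\<bar> \<noteq> \<infinity>" by auto
  note W = ext_integral_finite[OF this]
  have \<Psi>ae: "AE x in M. \<Psi>' x = ereal (real_of_ereal (w x) + e x)"
    using W(2)
  proof eventually_elim
    case (elim x)
    then show ?case by (cases "\<Psi>' x") (auto simp: w_def)
  qed
  have \<Psi>i: "integrable M (\<lambda>x. real_of_ereal (w x) + e x)" using W(1) ei by simp
  have E: "ext_integral M \<Psi>' = ereal (LINT x|M. real_of_ereal (w x) + e x)"
    by (rule ext_integral_eq[OF \<Psi>i \<Psi>ae \<Psi>m])
  then have Efin: "\<bar>ext_integral M \<Psi>'\<bar> \<noteq> \<infinity>" by simp
  have "ext_integral M \<Psi>' \<le> G"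
    using wle W(1,3) ei \<gamma>(1) by (simp add: E)
  \<comment> \<open>The easy inequality, by integrating the pointwise one; a competitor of energy
    \<open>\<infinity>\<close> contributes only \<open>-\<infinity>\<close> to the supremum.\<close>
  moreover have "G \<le> ext_integral M \<Psi>'"
    unfolding G_def fenchel_conj_def
  proof (rule SUP_least)
    fix v :: "'x \<Rightarrow> 'b" assume v: "v \<in> Lp_space M p"
    show "ereal (LINT x|M. y x \<bullet> v x) - ext_integral M (\<lambda>x. \<Phi> x (v x)) \<le> ext_integral M \<Psi>'"
    proof (cases "ext_integral M (\<lambda>x. \<Phi> x (v x)) = \<infinity>")
      case False
      have Yv: "AE x in M. ereal (y x \<bullet> v x) \<le> \<Phi> x (v x) + \<Psi>' x"
        using Young by eventually_elim blast
      have fin: "\<bar>ext_integral M (\<lambda>x. \<Phi> x (v x))\<bar> \<noteq> \<infinity>"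
        using False Efin by (intro ext_integral_Young[OF _ _ yr[OF v] Yv]) auto
      have "ereal (LINT x|M. y x \<bullet> v x) \<le> ext_integral M (\<lambda>x. \<Phi> x (v x)) + ext_integral M \<Psi>'"
        by (rule ext_integral_Young_le[OF fin Efin yr[OF v] Yv])
      then show ?thesis using fin Efin
        by (cases "ext_integral M (\<lambda>x. \<Phi> x (v x))"; cases "ext_integral M \<Psi>'") auto
    qed simp
  qed
  ultimately show "fenchel_conj (Lp_space M p) (\<lambda>u v. LINT x|M. u x \<bullet> v x) (\<lambda>v. ext_integral M (\<lambda>x. \<Phi> x (v x))) y
      = ext_integral M (\<lambda>x. fenchel_conj UNIV (\<bullet>) (\<Phi> x) (y x))"
    unfolding G_def \<Psi>'_def[abs_def] by (rule antisym[rotated])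
  show "\<bar>ext_integral M (\<lambda>x. fenchel_conj UNIV (\<bullet>) (\<Phi> x) (y x))\<bar> \<noteq> \<infinity>"
    using Efin unfolding \<Psi>'_def[abs_def] .
qed

section \<open>Integration by parts in time\<close>

text \<open>A smooth step: the normalised primitive of a bump supported in \<open>[0,1]\<close>.\<close>

lemma smooth_step_exists:
  obtains \<sigma> \<rho> :: "real \<Rightarrow> real" where
    "\<And>k. k_smooth k \<sigma>" "\<And>x. (\<sigma> has_real_derivative \<rho> x) (at x)"
    "\<And>x. x \<le> 0 \<Longrightarrow> \<sigma> x = 0" "\<And>x. 1 \<le> x \<Longrightarrow> \<sigma> x = 1"
    "\<And>x. 0 \<le> \<sigma> x" "\<And>x. \<sigma> x \<le> 1"
    "continuous_on UNIV \<rho>" "\<And>x. x \<le> 0 \<or> 1 \<le> x \<Longrightarrow> \<rho> x = 0" "\<And>x. \<rho> x \<ge> 0"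
proof -
  define r where "r = box_cutoff (0::real) 1 1"
  have sm: "\<And>k. k_smooth k r"
    using smooth_box_cutoff[of "0::real" 1 1] by (simp add: smooth_def r_def)
  have cont: "continuous_on A r" for A
    using sm[of 0] by (auto intro: continuous_on_subset)
  have r0: "r x = 0" if "x \<le> 0 \<or> 1 \<le> x" for x
    using that box_weight_eq_0_iff[of 0 1 x] by (auto simp: r_def box_cutoff_def)
  have rpos: "r x \<ge> 0" for x
    unfolding r_def by (rule box_cutoff_bounds) simp
  have rpos': "r x > 0" if "0 < x" "x < 1" for x
  proof -
    have "box_weight 0 1 x > 0"
      using that box_weight_eq_0_iff[of 0 1 x] box_weight_nonneg[of 0 1 x] by (auto simp: less_le)
    then show ?thesis by (simp add: r_def box_cutoff_def)
  qed
  \<comment> \<open>The lower limit -1 lies to the left of the support of the bump, which leaves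
    room for a two-sided derivative at 0.\<close>
  define R where "R x = integral {-1..x} r" for x
  have R': "(R has_real_derivative r x) (at x)" for x
  proof (cases "x < 0")
    case True
    have R0: "R y = 0" if "y < 0" for y
    proof -
      have "R y = integral {-1..y} (\<lambda>_. 0)"
        unfolding R_def using that by (intro integral_cong) (auto intro!: r0)
      then show ?thesis by simp
    qed
    have "((\<lambda>_. 0) has_real_derivative r x) (at x)"
      using True r0[of x] by simp
    then show ?thesis
    proof (rule has_field_derivative_transform_within_open)
      show "open {..<0::real}" "x \<in> {..<0}" using True by auto
      show "0 = R y" if "y \<in> {..<0}" for y using R0[of y] that by simp
    qed
  next
    case False
    have "(R has_real_derivative r x) (at x within {-1..x + 1})"
      unfolding R_def using False by (intro integral_has_real_derivative cont) auto
    then show ?thesis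
      using False by (subst (asm) at_within_interior) (auto simp: interior_atLeastAtMost_real)
  qed
  have ri: "r integrable_on {a..b}" for a b
    using integrable_continuous_real[OF cont] .
  have R0: "R x = 0" if "x \<le> 0" for x
  proof -
    have "R x = integral {-1..x} (\<lambda>_. 0)"
      unfolding R_def using that by (intro integral_cong) (auto intro!: r0)
    then show ?thesis by simp
  qed
  have mono: "R x \<le> R y" if "x \<le> y" for x y
    using DERIV_nonneg_imp_nondecreasing[OF that, of R] R' rpos by blast
  have R1: "R x = R 1" if "1 \<le> x" for x
  proof -
    have "R x - R 1 = 0"
    proof (cases "x = 1")
      case False
      with that have "1 < x" by simp
      from MVT2[OF this R'] obtain z where "1 < z" "R x - R 1 = (x - 1) * r z" by blast
      then show ?thesis using r0[of z] by simp
    qed simp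
    then show ?thesis by simp
  qed
  have "R 1 > 0"
  proof -
    have "R 0 < R 1"
      using MVT2[of 0 1 R r] R' rpos' by force
    then show ?thesis by (simp add: R0)
  qed
  define c where "c = R 1"
  have c: "c > 0" using \<open>R 1 > 0\<close> by (simp add: c_def)
  show thesis
  proof (rule that[of "\<lambda>x. R x * inverse c" "\<lambda>x. r x * inverse c"])
    have der: "((\<lambda>x. R x * inverse c) has_real_derivative r x * inverse c) (at x)" for x
      using DERIV_cmult_right[OF R'] .
    then show "((\<lambda>x. R x * inverse c) has_real_derivative r x * inverse c) (at x)" for x .
    have sr: "k_smooth k (\<lambda>x. r x * inverse c)" for k
      by (intro k_smooth_mult sm k_smooth_const)
    show "k_smooth k (\<lambda>x. R x * inverse c)" for k
    proof (cases k)
      case 0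
      have "continuous_on UNIV (\<lambda>x. R x * inverse c)"
        using der by (intro DERIV_continuous_on[where D = "\<lambda>x. r x * inverse c"]) (auto intro: DERIV_subset)
      then show ?thesis by (simp add: 0)
    next
      case (Suc j)
      have "((\<lambda>x. R x * inverse c) has_derivative (\<lambda>h. r x * inverse c * h)) (at x)" for x
        using der[of x] by (simp add: has_field_derivative_def)
      then show ?thesis
        unfolding Suc by (rule k_smooth_SucI) (intro k_smooth_mult sm k_smooth_const)
    qed
    show "continuous_on UNIV (\<lambda>x. r x * inverse c)" by (intro continuous_intros cont)
    show "x \<le> 0 \<Longrightarrow> R x * inverse c = 0" for x by (simp add: R0)
    show "1 \<le> x \<Longrightarrow> R x * inverse c = 1" for x using c R1[of x] by (simp add: c_def)
    show "x \<le> 0 \<or> 1 \<le> x \<Longrightarrow> r x * inverse c = 0" for x by (simp add: r0)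
    show "r x * inverse c \<ge> 0" for x using rpos[of x] c by simp
    have "0 \<le> R x" for x using mono[of "min x 0" x] R0[of "min x 0"] by simp
    then show "0 \<le> R x * inverse c" for x using c by simp
    have "R x \<le> R 1" for x using mono[of x "max x 1"] R1[of "max x 1"] by simp
    then show "R x * inverse c \<le> 1" for x using c by (simp add: c_def field_simps)
  qed
qed

text \<open>The substitution \<open>x = s + u / (n + 1)\<close> moves the scaling from the kernel
  into \<open>a\<close>; continuity of \<open>a\<close> at \<open>s\<close> and the majorant
  \<open>C * \<rho>\<close> do the rest.\<close>

lemma integral_bump_tendsto:
  fixes a \<rho> :: "real \<Rightarrow> real"
  assumes a: "continuous_on UNIV a" "\<And>x. \<bar>a x\<bar> \<le> C"
    and \<rho>: "continuous_on UNIV \<rho>" "\<And>x. x \<le> 0 \<or> 1 \<le> x \<Longrightarrow> \<rho> x = 0" "\<And>x. \<rho> x \<ge> 0"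
      "(LINT x|lborel. \<rho> x) = 1"
  shows "(\<lambda>n. LINT x|lborel. a x * (real (Suc n) * \<rho> (real (Suc n) * (x - s)))) \<longlonglongrightarrow> a s"
proof -
  \<comment> \<open>A function that is not integrable has integral 0 by default, so the value 1
    implies integrability.\<close>
  have \<rho>i: "integrable lborel \<rho>"
    using \<rho>(4) not_integrable_integral_eq by fastforce
  have \<rho>m: "\<rho> \<in> borel_measurable borel" and am: "a \<in> borel_measurable borel"
    using \<rho>(1) a(1) by (auto intro: borel_measurable_continuous_onI)
  have eq: "(LINT x|lborel. a x * (real (Suc n) * \<rho> (real (Suc n) * (x - s)))) = (LINT u|lborel. a (s + u / real (Suc n)) * \<rho> u)" for n
  proof -
    have "(LINT x|lborel. a x * (real (Suc n) * \<rho> (real (Suc n) * (x - s)))) =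
        \<bar>1 / real (Suc n)\<bar> *\<^sub>R (LINT u|lborel. a (s + (1 / real (Suc n)) * u) * (real (Suc n) * \<rho> (real (Suc n) * ((s + (1 / real (Suc n)) * u) - s))))"
      by (rule lborel_integral_real_affine) simp
    also have "\<dots> = (LINT u|lborel. \<bar>1 / real (Suc n)\<bar> *\<^sub>R (a (s + (1 / real (Suc n)) * u) * (real (Suc n) * \<rho> (real (Suc n) * ((s + (1 / real (Suc n)) * u) - s)))))"
      by (rule integral_scaleR_right[symmetric])
    also have "\<dots> = (LINT u|lborel. a (s + u / real (Suc n)) * \<rho> u)"
      by (intro Bochner_Integration.integral_cong) auto
    finally show ?thesis .
  qed
  have "(\<lambda>n. LINT u|lborel. a (s + u / real (Suc n)) * \<rho> u) \<longlonglongrightarrow> (LINT u|lborel. a s * \<rho> u)"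
  proof (rule integral_dominated_convergence)
    show "integrable lborel (\<lambda>u. C * \<rho> u)" using \<rho>i by simp
    show "AE u in lborel. (\<lambda>n. a (s + u / real (Suc n)) * \<rho> u) \<longlonglongrightarrow> a s * \<rho> u"
    proof (rule AE_I2)
      fix u :: real
      have "(\<lambda>n. s + u * inverse (real (Suc n))) \<longlonglongrightarrow> s + u * 0"
        by (intro tendsto_intros LIMSEQ_inverse_real_of_nat)
      moreover have "isCont a s" using a(1) by (simp add: continuous_on_eq_continuous_at)
      ultimately have "(\<lambda>n. a (s + u / real (Suc n))) \<longlonglongrightarrow> a s"
        by (auto intro: isCont_tendsto_compose simp: divide_inverse)
      then show "(\<lambda>n. a (s + u / real (Suc n)) * \<rho> u) \<longlonglongrightarrow> a s * \<rho> u"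
        by (intro tendsto_mult tendsto_const)
    qed
    show "AE u in lborel. norm (a (s + u / real (Suc n)) * \<rho> u) \<le> C * \<rho> u" for n
      using a(2) \<rho>(3) by (intro AE_I2) (simp add: abs_mult mult_right_mono)
    show "(\<lambda>u. a (s + u / real (Suc n)) * \<rho> u) \<in> borel_measurable lborel" for n
      using am \<rho>m by measurable
  qed (use \<rho>m in auto)
  then show ?thesis
    unfolding eq by (simp only: integral_mult_right_zero \<rho>(4) mult_1_right)
qed

text \<open>Testing with a smooth step at \<open>s1\<close> minus one at \<open>s2\<close> produces
  bumps at the two points on the left and, in the limit, the indicator of the interval between them
  on the right. This settles interior points; continuity of \<open>a\<close> and of the primitive
  reaches the end points.\<close>

lemma weak_derivative_primitive:
  fixes a b :: "real \<Rightarrow> real"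
  assumes T: "0 < T" and a: "continuous_on {0..T} a" and b: "integrable (lebesgue_on {0<..<T}) b"
    and weak: "\<And>\<theta>. \<theta> \<in> test_functions {0<..<T} \<Longrightarrow>
      (LINT t|lebesgue_on {0<..<T}. a t * deriv \<theta> t) = - (LINT t|lebesgue_on {0<..<T}. b t * \<theta> t)"
    and t: "t \<in> {0..T}"
  shows "a t - a 0 = (LINT \<tau>|lebesgue_on {0<..<T}. indicator {0..t} \<tau> * b \<tau>)"
proof -
  let ?M = "lebesgue_on {0<..<T}"
  have bm: "b \<in> borel_measurable ?M" using b by auto
  have ind: "(indicator A :: real \<Rightarrow> real) \<in> borel_measurable ?M" if "A \<in> sets borel" for A
    using that by (intro measurable_restrict_space1 borel_measurable_indicator sets_lebesgue_borel)
  \<comment> \<open>Clamping the argument extends \<open>a\<close> to a bounded continuous function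
    on the whole line, the form in which the bump limit is stated.\<close>
  define a' where "a' x = a (max 0 (min T x))" for x
  have a'c: "continuous_on UNIV a'"
    unfolding a'_def using T by (intro continuous_on_compose2[OF a] continuous_intros) auto
  have "bounded (a ` {0..T})"
    using a by (intro compact_imp_bounded compact_continuous_image) auto
  then obtain C where C: "\<forall>y\<in>a ` {0..T}. norm y \<le> C" unfolding bounded_iff by blast
  have a'b: "\<bar>a' x\<bar> \<le> C" for x
  proof -
    have "a' x \<in> a ` {0..T}" unfolding a'_def using T by (intro imageI) auto
    with C show ?thesis by auto
  qed
  have a'a: "a' x = a x" if "x \<in> {0..T}" for x using that by (auto simp: a'_def)
  have inner: "a s2 - a s1 = (LINT \<tau>|?M. (indicator {s1<..s2} \<tau>) * b \<tau>)" if s: "0 < s1" "s1 < s2" "s2 < T" for s1 s2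
  proof -
    obtain \<sigma> \<rho> :: "real \<Rightarrow> real" where
      \<sigma>: "\<And>k. k_smooth k \<sigma>" "\<And>x. (\<sigma> has_real_derivative \<rho> x) (at x)"
        "\<And>x. x \<le> 0 \<Longrightarrow> \<sigma> x = 0" "\<And>x. 1 \<le> x \<Longrightarrow> \<sigma> x = 1" "\<And>x. 0 \<le> \<sigma> x" "\<And>x. \<sigma> x \<le> 1"
      and \<rho>: "continuous_on UNIV \<rho>" "\<And>x. x \<le> 0 \<or> 1 \<le> x \<Longrightarrow> \<rho> x = 0" "\<And>x. \<rho> x \<ge> 0"
      by (rule smooth_step_exists) (rule that, assumption+)
    have \<rho>1: "(LINT x|lborel. \<rho> x) = 1"
    proof -
      have "(LBINT x:{0..1}. \<rho> x) = \<sigma> 1 - \<sigma> 0"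
        unfolding set_lebesgue_integral_def real_scaleR_def mult.commute[of "indicator _ _"]
        using \<rho>(1) by (intro integral_FTC_Icc_real \<sigma>(2)) (auto simp: continuous_on_eq_continuous_at)
      moreover have "(LBINT x:{0..1}. \<rho> x) = (LINT x|lborel. \<rho> x)"
        unfolding set_lebesgue_integral_def
      proof (rule Bochner_Integration.integral_cong[OF refl])
        fix x show "indicator {0..1} x *\<^sub>R \<rho> x = \<rho> x" using \<rho>(2)[of x] by (cases "x \<in> {0..1}") fastforce+
      qed
      ultimately show ?thesis using \<sigma>(3)[of 0] \<sigma>(4)[of 1] by simp
    qed
    have scale: "0 < real (Suc n)" for n by simp
    define \<theta> where "\<theta> n \<tau> = \<sigma> (real (Suc n) * (\<tau> - s1)) + (- 1) * \<sigma> (real (Suc n) * (\<tau> - s2))" for n \<tau>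
    define \<eta> where "\<eta> n \<tau> = real (Suc n) * \<rho> (real (Suc n) * (\<tau> - s1)) - real (Suc n) * \<rho> (real (Suc n) * (\<tau> - s2))" for n \<tau>
    have \<theta>': "(\<theta> n has_real_derivative \<eta> n \<tau>) (at \<tau>)" for n \<tau>
    proof -
      have "((\<lambda>\<tau>. \<sigma> (real (Suc n) * (\<tau> - s))) has_real_derivative \<rho> (real (Suc n) * (\<tau> - s)) * real (Suc n)) (at \<tau>)" for s
        by (rule DERIV_chain2[OF \<sigma>(2)]) (auto intro!: derivative_eq_intros)
      from DERIV_add[OF this[of s1] DERIV_cmult[OF this[of s2], of "-1"]] show ?thesis
        unfolding \<theta>_def[abs_def] \<eta>_def by (simp add: mult.commute)
    qed
    \<comment> \<open>The step at \<open>s2\<close> is completed within length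
      \<open>1 / (n + 1)\<close> and must end before \<open>T\<close> for \<open>\<theta> n\<close>
      to be a test function on the interval; hence only \<open>n \<ge> N\<close> is tested.\<close>
    obtain N where N: "1 / real (Suc N) < T - s2"
      using reals_Archimedean[of "T - s2"] s(3) by (auto simp: inverse_eq_divide)
    have supp: "\<theta> n \<tau> = 0" if "n \<ge> N" "\<tau> \<notin> {s1..s2 + 1 / real (Suc N)}" for n \<tau>
    proof (cases "\<tau> < s1")
      case True
      then have "real (Suc n) * (\<tau> - s1) \<le> 0" "real (Suc n) * (\<tau> - s2) \<le> 0"
        using s by (auto simp: mult_le_0_iff)
      then show ?thesis by (simp add: \<theta>_def \<sigma>(3))
    next
      case False
      with that have "\<tau> - s2 > 1 / real (Suc N)" by auto
      moreover have "1 / real (Suc N) \<ge> 1 / real (Suc n)" using that by (intro divide_left_mono) auto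
      ultimately have "\<tau> - s2 \<ge> 1 / real (Suc n)" by linarith
      then have "1 \<le> real (Suc n) * (\<tau> - s2)" using scale[of n] by (simp add: pos_divide_le_eq mult.commute)
      moreover have "real (Suc n) * (\<tau> - s2) \<le> real (Suc n) * (\<tau> - s1)" using s by (intro mult_left_mono) auto
      ultimately have "1 \<le> real (Suc n) * (\<tau> - s2)" "1 \<le> real (Suc n) * (\<tau> - s1)" by linarith+
      then show ?thesis unfolding \<theta>_def by (simp only: \<sigma>(4))
    qed
    have test: "\<theta> n \<in> test_functions {0<..<T}" if "n \<ge> N" for n
    proof -
      have "k_smooth k (\<theta> n)" for k
      proof -
        have "k_smooth k (\<lambda>\<tau>. real (Suc n) * (\<tau> + - s))" for s
          by (intro k_smooth_mult k_smooth_add k_smooth_const k_smooth_linear bounded_linear_ident)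
        then have lin: "k_smooth k (\<lambda>\<tau>. real (Suc n) * (\<tau> - s))" for s
          by simp
        show ?thesis
          unfolding \<theta>_def[abs_def]
          by (rule k_smooth_add[OF k_smooth_compose[OF \<sigma>(1) lin]
                k_smooth_mult[OF k_smooth_const k_smooth_compose[OF \<sigma>(1) lin]]])
      qed
      moreover have "closure {x. \<theta> n x \<noteq> 0} \<subseteq> {s1..s2 + 1 / real (Suc N)}"
      proof (rule closure_minimal)
        show "{x. \<theta> n x \<noteq> 0} \<subseteq> {s1..s2 + 1 / real (Suc N)}"
          using supp[OF that] by blast
      qed simp
      moreover have "{s1..s2 + 1 / real (Suc N)} \<subseteq> {0<..<T}" using s N by auto
      moreover from calculation(2) have "compact (closure {x. \<theta> n x \<noteq> 0})"
        using bounded_subset[OF bounded_closed_interval order.trans[OF closure_subset]] by (simp add: compact_closure)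
      ultimately show ?thesis
        unfolding test_functions_def smooth_def by blast
    qed
    have 1: "(LINT t|?M. a t * deriv (\<theta> n) t) = (LINT x|lborel. a' x * (real (Suc n) * \<rho> (real (Suc n) * (x - s1))))
        - (LINT x|lborel. a' x * (real (Suc n) * \<rho> (real (Suc n) * (x - s2))))" if n: "n \<ge> N" for n
    proof -
      have int: "integrable lborel (\<lambda>x. a' x * (real (Suc n) * \<rho> (real (Suc n) * (x - s))))" for s
      proof -
        have c: "continuous_on UNIV (\<lambda>x. a' x * (real (Suc n) * \<rho> (real (Suc n) * (x - s))))"
          by (intro continuous_intros a'c continuous_on_compose2[OF \<rho>(1)]) auto
        have "integrable lborel (\<lambda>x. indicator {s..s + 1 / real (Suc n)} x *\<^sub>R (a' x * (real (Suc n) * \<rho> (real (Suc n) * (x - s)))))"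
          by (intro borel_integrable_compact continuous_on_subset[OF c]) auto
        also have "(\<lambda>x. indicator {s..s + 1 / real (Suc n)} x *\<^sub>R (a' x * (real (Suc n) * \<rho> (real (Suc n) * (x - s))))) = (\<lambda>x. a' x * (real (Suc n) * \<rho> (real (Suc n) * (x - s))))"
        proof
          fix x
          have "real (Suc n) * (x - s) \<le> 0 \<or> 1 \<le> real (Suc n) * (x - s)" if "x \<notin> {s..s + 1 / real (Suc n)}"
          proof (cases "x < s")
            case True then show ?thesis by (simp add: mult_le_0_iff)
          next
            case False
            with that have "1 / real (Suc n) \<le> x - s" by auto
            then show ?thesis using scale[of n] by (simp add: pos_divide_le_eq mult.commute)
          qed
          then show "indicator {s..s + 1 / real (Suc n)} x *\<^sub>R (a' x * (real (Suc n) * \<rho> (real (Suc n) * (x - s)))) = a' x * (real (Suc n) * \<rho> (real (Suc n) * (x - s)))"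
            using \<rho>(2) by (cases "x \<in> {s..s + 1 / real (Suc n)}") auto
        qed
        finally show ?thesis .
      qed
      have \<eta>0: "\<eta> n x = 0" if "x \<notin> {0<..<T}" for x
      proof -
        obtain K where K: "K \<subseteq> {0<..<T}" "\<And>x b. x \<notin> K \<Longrightarrow> frechet_derivative (\<theta> n) (at x) b = 0"
          by (rule test_function_support[OF test[OF n]], rule that)
        have "frechet_derivative (\<theta> n) (at x) 1 = \<eta> n x"
          using frechet_derivative_at[OF \<theta>'[of n x, unfolded has_field_derivative_def]] by (metis mult_1_right)
        moreover have "x \<notin> K" using K(1) that by blast
        ultimately show ?thesis using K(2) by metis
      qed
      have "(LINT t|?M. a t * deriv (\<theta> n) t) = (LINT t|lebesgue. indicator {0<..<T} t *\<^sub>R (a t * \<eta> n t))"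
        using \<theta>'[THEN DERIV_imp_deriv] by (subst integral_restrict_space) auto
      also have "\<dots> = (LINT t|lebesgue. a' t * \<eta> n t)"
      proof (rule Bochner_Integration.integral_cong[OF refl])
        fix t show "indicator {0<..<T} t *\<^sub>R (a t * \<eta> n t) = a' t * \<eta> n t"
          using \<eta>0[of t] a'a[of t] by (cases "t \<in> {0<..<T}") auto
      qed
      also have "\<dots> = (LINT t|lborel. a' t * \<eta> n t)"
      proof (rule integral_completion)
        have "continuous_on UNIV (\<lambda>t. a' t * \<eta> n t)"
          unfolding \<eta>_def by (intro continuous_intros a'c continuous_on_compose2[OF \<rho>(1)]) auto
        then show "(\<lambda>t. a' t * \<eta> n t) \<in> borel_measurable lborel"
          by (simp add: borel_measurable_continuous_onI)
      qed
      also have "\<dots> = (LINT x|lborel. a' x * (real (Suc n) * \<rho> (real (Suc n) * (x - s1))) - a' x * (real (Suc n) * \<rho> (real (Suc n) * (x - s2))))"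
        by (simp add: \<eta>_def algebra_simps)
      also have "\<dots> = (LINT x|lborel. a' x * (real (Suc n) * \<rho> (real (Suc n) * (x - s1))))
        - (LINT x|lborel. a' x * (real (Suc n) * \<rho> (real (Suc n) * (x - s2))))"
        by (intro Bochner_Integration.integral_diff int)
      finally show ?thesis .
    qed
    have "(\<lambda>n. (LINT x|lborel. a' x * (real (Suc n) * \<rho> (real (Suc n) * (x - s1))))
        - (LINT x|lborel. a' x * (real (Suc n) * \<rho> (real (Suc n) * (x - s2))))) \<longlonglongrightarrow> a' s1 - a' s2"
      by (intro tendsto_diff integral_bump_tendsto[OF a'c a'b \<rho> \<rho>1])
    then have lim1: "(\<lambda>n. LINT t|?M. a t * deriv (\<theta> n) t) \<longlonglongrightarrow> a' s1 - a' s2"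
      by (rule Lim_transform_eventually) (auto simp: eventually_sequentially 1 intro!: exI[of _ N])
    have "(\<lambda>n. LINT t|?M. b t * \<theta> n t) \<longlonglongrightarrow> (LINT t|?M. b t * indicator {s1<..s2} t)"
    proof (rule integral_dominated_convergence)
      show "integrable ?M (\<lambda>t. \<bar>b t\<bar>)" using b by simp
      show "(\<lambda>t. b t * indicator {s1<..s2} t) \<in> borel_measurable ?M"
        using bm ind by (intro borel_measurable_times) auto
      show "(\<lambda>t. b t * \<theta> n t) \<in> borel_measurable ?M" for n
      proof -
        have "continuous_on UNIV (\<theta> n)"
          using \<theta>' by (intro DERIV_continuous_on[where D = "\<eta> n"]) (auto intro: DERIV_subset)
        then have "\<theta> n \<in> borel_measurable ?M"
          by (intro measurable_restrict_space1 measurable_completion) (simp add: borel_measurable_continuous_onI)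
        with bm show ?thesis by (intro borel_measurable_times)
      qed
      \<comment> \<open>At the jump itself the value is \<open>\<sigma> 0 = 0\<close>, which is why
        the limit is the indicator of an interval open on the left and closed on the right.\<close>
      have step: "(\<lambda>n. \<sigma> (real (Suc n) * (t - s))) \<longlonglongrightarrow> (if t > s then 1 else 0)" for t s
      proof (cases "t > s")
        case True
        obtain N where N: "1 / real (Suc N) < t - s"
          using reals_Archimedean[of "t - s"] True by (auto simp: inverse_eq_divide)
        have "\<sigma> (real (Suc n) * (t - s)) = 1" if "n \<ge> N" for n
        proof -
          have "1 / real (Suc N) \<ge> 1 / real (Suc n)" using that by (intro divide_left_mono) auto
          with N have "1 / real (Suc n) \<le> t - s" by linarith
          then have "1 \<le> real (Suc n) * (t - s)" using scale[of n] by (simp add: pos_divide_le_eq mult.commute)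
          then show ?thesis by (rule \<sigma>(4))
        qed
        then have "\<forall>\<^sub>F n in sequentially. \<sigma> (real (Suc n) * (t - s)) = 1"
          by (auto simp: eventually_sequentially)
        then show ?thesis using True by (simp add: tendsto_eventually)
      next
        case False
        then have "\<sigma> (real (Suc n) * (t - s)) = 0" for n
          by (intro \<sigma>(3)) (simp add: mult_le_0_iff)
        then show ?thesis using False by simp
      qed
      show "AE t in ?M. (\<lambda>n. b t * \<theta> n t) \<longlonglongrightarrow> b t * indicator {s1<..s2} t"
      proof (rule AE_I2)
        fix t
        have "(\<lambda>n. b t * \<theta> n t) \<longlonglongrightarrow> b t * ((if t > s1 then 1 else 0) + (- 1) * (if t > s2 then 1 else 0))"
          unfolding \<theta>_def by (intro tendsto_mult tendsto_add tendsto_const step)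
        also have "b t * ((if t > s1 then 1 else 0) + (- 1) * (if t > s2 then 1 else 0)) = b t * indicator {s1<..s2} t"
          using s by (auto simp: indicator_def)
        finally show "(\<lambda>n. b t * \<theta> n t) \<longlonglongrightarrow> b t * indicator {s1<..s2} t" .
      qed
      have "\<bar>\<theta> n t\<bar> \<le> 1" for n t
        using \<sigma>(5,6)[of "real (Suc n) * (t - s1)"] \<sigma>(5,6)[of "real (Suc n) * (t - s2)"] by (simp add: \<theta>_def abs_le_iff)
      then show "AE t in ?M. norm (b t * \<theta> n t) \<le> \<bar>b t\<bar>" for n
        by (intro AE_I2) (simp add: abs_mult mult_left_le)
    qed
    then have "(\<lambda>n. - (LINT t|?M. b t * \<theta> n t)) \<longlonglongrightarrow> - (LINT t|?M. b t * indicator {s1<..s2} t)"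
      by (rule tendsto_minus)
    then have "(\<lambda>n. LINT t|?M. a t * deriv (\<theta> n) t) \<longlonglongrightarrow> - (LINT t|?M. b t * indicator {s1<..s2} t)"
      by (rule Lim_transform_eventually) (auto simp: eventually_sequentially weak test intro!: exI[of _ N])
    from LIMSEQ_unique[OF lim1 this] show ?thesis
      using a'a[of s1] a'a[of s2] s by (simp add: mult.commute)
  qed
  define B where "B s = (LINT \<tau>|?M. indicator {0..s} \<tau> * b \<tau>)" for s
  have bi: "integrable ?M (\<lambda>\<tau>. indicator A \<tau> * b \<tau>)" if "A \<in> sets borel" for A
  proof (rule Bochner_Integration.integrable_bound[OF b])
    show "(\<lambda>\<tau>. indicator A \<tau> * b \<tau>) \<in> borel_measurable ?M"
      by (rule borel_measurable_times[OF ind[OF that] bm])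
    show "AE \<tau> in ?M. norm (indicat_real A \<tau> * b \<tau>) \<le> norm (b \<tau>)"
      by (intro AE_I2) (simp add: indicator_def)
  qed
  have Bc: "continuous_on {0..T} B"
    unfolding continuous_on_sequentially
  proof (intro allI ballI impI)
    fix u l assume u: "l \<in> {0..T}" "(\<forall>n. u n \<in> {0..T}) \<and> u \<longlonglongrightarrow> (l::real)"
    have "(\<lambda>n. B (u n)) \<longlonglongrightarrow> B l"
      unfolding B_def
    proof (rule integral_dominated_convergence)
      show "integrable ?M (\<lambda>t. \<bar>b t\<bar>)" using b by simp
      have "AE \<tau> in ?M. \<tau> \<noteq> l"
      proof (subst AE_lebesgue_on_iff)
        show "AE \<tau> in lborel. \<tau> \<in> {0<..<T} \<longrightarrow> \<tau> \<noteq> l"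
          using AE_lborel_singleton[of l] by eventually_elim simp
      qed simp
      then show "AE \<tau> in ?M. (\<lambda>n. indicat_real {0..u n} \<tau> * b \<tau>) \<longlonglongrightarrow> indicat_real {0..l} \<tau> * b \<tau>"
      proof eventually_elim
        fix \<tau> assume "\<tau> \<noteq> l"
        then consider "\<tau> < l" | "l < \<tau>" by linarith
        then have "\<forall>\<^sub>F n in sequentially. indicat_real {0..u n} \<tau> * b \<tau> = indicat_real {0..l} \<tau> * b \<tau>"
        proof cases
          case 1
          from order_tendstoD(1)[OF conjunct2[OF u(2)] this] show ?thesis
            by eventually_elim (use 1 in \<open>auto simp: indicator_def\<close>)
        next
          case 2
          from order_tendstoD(2)[OF conjunct2[OF u(2)] this] show ?thesis
            by eventually_elim (use 2 in \<open>auto simp: indicator_def\<close>)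
        qed
        then show "(\<lambda>n. indicat_real {0..u n} \<tau> * b \<tau>) \<longlonglongrightarrow> indicat_real {0..l} \<tau> * b \<tau>"
          by (rule tendsto_eventually)
      qed
      show "AE \<tau> in ?M. norm (indicat_real {0..u n} \<tau> * b \<tau>) \<le> \<bar>b \<tau>\<bar>" for n
        by (intro AE_I2) (simp add: indicator_def)
    qed (auto intro!: borel_measurable_times ind bm)
    then show "(B \<circ> u) \<longlonglongrightarrow> B l" by (simp add: o_def)
  qed
  have diff: "B s2 - B s1 = (LINT \<tau>|?M. (indicator {s1<..s2} \<tau>) * b \<tau>)" if "0 \<le> s1" "s1 \<le> s2" for s1 s2
  proof -
    have "B s2 - B s1 = (LINT \<tau>|?M. indicator {0..s2} \<tau> * b \<tau> - indicator {0..s1} \<tau> * b \<tau>)"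
      unfolding B_def by (intro Bochner_Integration.integral_diff[symmetric] bi) auto
    also have "\<dots> = (LINT \<tau>|?M. (indicator {s1<..s2} \<tau>) * b \<tau>)"
      using that by (intro Bochner_Integration.integral_cong) (auto simp: indicator_def)
    finally show ?thesis .
  qed
  \<comment> \<open>Comparison with the midpoint makes \<open>a - B\<close> constant on the open
    interval.\<close>
  have const: "a s - B s = a (T/2) - B (T/2)" if "s \<in> {0<..<T}" for s
  proof -
    consider "s < T/2" | "s = T/2" | "s > T/2" by linarith
    then show ?thesis
      using that T inner[of s "T/2"] inner[of "T/2" s] diff[of s "T/2"] diff[of "T/2" s] by cases auto
  qed
  have cl: "closure {0<..<T} = {0..T}" using T by simp
  have "a s - B s = a (T/2) - B (T/2)" if "s \<in> {0..T}" for s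
  proof (rule continuous_constant_on_closure[of "{0<..<T}" "\<lambda>s. a s - B s" "a (T/2) - B (T/2)" s])
    show "continuous_on (closure {0<..<T}) (\<lambda>s. a s - B s)"
      unfolding cl by (intro continuous_intros a Bc)
    show "s \<in> closure {0<..<T}" using that cl by blast
  qed (rule const)
  from this[of t] this[of 0] t T have "a t - a 0 = B t - B 0" by simp
  moreover have "B 0 = 0"
  proof -
    have "B 0 = (LINT \<tau>|?M. 0)"
      unfolding B_def by (intro Bochner_Integration.integral_cong) (auto simp: indicator_def)
    then show ?thesis by simp
  qed
  ultimately show ?thesis by (simp add: B_def)
qed

text \<open>With \<open>B\<close> the primitive of \<open>b\<close>, the integral of
  \<open>b * B\<close> is that of \<open>b s * b t\<close> over the half plane
  \<open>s \<le> t\<close>. Fubini turns it into the integral over the mirrored half plane, and the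
  two fill the plane up to the diagonal. So \<open>2 * I\<close> is the square of the total
  integral.\<close>

lemma integral_primitive_square:
  fixes b :: "real \<Rightarrow> real"
  assumes b: "integrable lborel b"
  shows "(LINT t|lborel. b t * (c + (LINT s|lborel. indicator {..t} s * b s)))
    = (c + (LINT s|lborel. b s))\<^sup>2 / 2 - c\<^sup>2 / 2"
proof -
  define k where "k t s = indicator {..t} s * b s * b t" for t s :: real
  have bm [measurable]: "b \<in> borel_measurable borel" using b by auto
  have km: "case_prod k \<in> borel_measurable (lborel \<Otimes>\<^sub>M lborel)"
  proof -
    have "{z :: real \<times> real. snd z \<le> fst z} \<in> sets borel"
      by (intro borel_closed closed_Collect_le continuous_intros)
    moreover have "(\<lambda>z :: real \<times> real. b (snd z)) \<in> borel_measurable borel" "(\<lambda>z :: real \<times> real. b (fst z)) \<in> borel_measurable borel"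
      by (intro measurable_compose[OF _ bm] borel_measurable_continuous_onI continuous_intros)+
    ultimately have "(\<lambda>z. indicator {z :: real \<times> real. snd z \<le> fst z} z * b (snd z) * b (fst z)) \<in> borel_measurable borel"
      by (intro borel_measurable_times borel_measurable_indicator)
    also have "(\<lambda>z. indicator {z :: real \<times> real. snd z \<le> fst z} z * b (snd z) * b (fst z)) = case_prod k"
      by (auto simp: k_def indicator_def fun_eq_iff)
    finally show ?thesis by (simp add: lborel_prod)
  qed
  have bi: "integrable lborel (\<lambda>s. indicator A s * b s)" if "A \<in> sets borel" for A
    using integrable_mult_indicator[OF _ b, of A] that by simp
  have ki: "integrable (lborel \<Otimes>\<^sub>M lborel) (case_prod k)"
  proof (rule lborel_pair.Fubini_integrable[OF km])
    show "AE t in lborel. integrable lborel (\<lambda>s. case_prod k (t, s))"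
      using bi by (intro AE_I2) (simp add: k_def)
    have "integrable lborel (\<lambda>t. (LINT s|lborel. \<bar>b s\<bar>) * \<bar>b t\<bar>)"
      using b by simp
    then show "integrable lborel (\<lambda>t. LINT s|lborel. norm (case_prod k (t, s)))"
    proof (rule Bochner_Integration.integrable_bound)
      show "(\<lambda>t. LINT s|lborel. norm (case_prod k (t, s))) \<in> borel_measurable lborel"
        using km by (intro lborel.borel_measurable_lebesgue_integral) (simp add: case_prod_beta')
      have "(LINT s|lborel. norm (k t s)) \<le> (LINT s|lborel. \<bar>b s\<bar>) * \<bar>b t\<bar>" for t
      proof -
        have "(LINT s|lborel. norm (k t s)) \<le> (LINT s|lborel. \<bar>b s\<bar> * \<bar>b t\<bar>)"
        proof (rule integral_mono)
          show "integrable lborel (\<lambda>s. norm (k t s))" using bi by (simp add: k_def)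
          show "integrable lborel (\<lambda>s. \<bar>b s\<bar> * \<bar>b t\<bar>)" using b by simp
          show "norm (k t s) \<le> \<bar>b s\<bar> * \<bar>b t\<bar>" for s by (simp add: k_def abs_mult indicator_def)
        qed
        then show ?thesis by simp
      qed
      then show "AE t in lborel. norm (LINT s|lborel. norm (case_prod k (t, s))) \<le> norm ((LINT s|lborel. \<bar>b s\<bar>) * \<bar>b t\<bar>)"
        by (intro AE_I2) (simp add: abs_of_nonneg Bochner_Integration.integral_nonneg abs_mult)
    qed
  qed
  define B where "B t = (LINT s|lborel. indicator {..t} s * b s)" for t
  define I where "I = (LINT t|lborel. LINT s|lborel. k t s)"
  have inner1: "(LINT s|lborel. k t s) = b t * B t" for t
    by (simp add: k_def B_def mult.commute)
  have Bi: "integrable lborel (\<lambda>t. b t * B t)"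
    using lborel_pair.integrable_fst[OF ki] by (simp add: inner1)
  have I: "I = (LINT t|lborel. b t * B t)"
    by (simp add: I_def inner1)
  have "I = (LINT s|lborel. LINT t|lborel. k t s)"
    unfolding I_def using lborel_pair.Fubini_integral[OF ki] by simp
  also have "\<dots> = (LINT s|lborel. b s * ((LINT t|lborel. b t) - B s))"
  proof (rule Bochner_Integration.integral_cong[OF refl])
    fix s
    have "(LINT t|lborel. k t s) = (LINT t|lborel. b s * (b t - indicator {..s} t * b t))"
    proof (rule integral_cong_AE)
      show "(\<lambda>t. k t s) \<in> borel_measurable lborel"
        using measurable_Pair1[OF km, of s] by simp
      have "AE t in lborel. t \<noteq> s" by (rule AE_lborel_singleton)
      then show "AE t in lborel. k t s = b s * (b t - indicator {..s} t * b t)"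
        by eventually_elim (auto simp: k_def indicator_def)
    qed simp
    also have "\<dots> = b s * ((LINT t|lborel. b t) - B s)"
      using b bi[of "{..s}"] by (simp add: B_def)
    finally show "(LINT t|lborel. k t s) = b s * ((LINT t|lborel. b t) - B s)" .
  qed
  also have "\<dots> = (LINT s|lborel. b s * (LINT t|lborel. b t) - b s * B s)"
    by (simp add: right_diff_distrib)
  also have "\<dots> = (LINT t|lborel. b t)\<^sup>2 - I"
    using b Bi by (simp add: I power2_eq_square)
  finally have I2: "2 * I = (LINT t|lborel. b t)\<^sup>2" by simp
  have "(LINT t|lborel. b t * (c + B t)) = (LINT t|lborel. c * b t + b t * B t)"
    by (simp add: algebra_simps)
  also have "\<dots> = c * (LINT t|lborel. b t) + I"
    using b Bi by (simp add: I)
  also have "\<dots> = (c + (LINT s|lborel. b s))\<^sup>2 / 2 - c\<^sup>2 / 2"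
    using I2 by (simp add: power2_eq_square algebra_simps)
  finally show ?thesis unfolding B_def .
qed

text \<open>The formula \<open>prim\<close> holds off a null set that varies with \<open>t\<close>.
  A jointly Borel function \<open>m\<close> built from \<open>d\<close> and \<open>l 0\<close>
  equals \<open>l\<close> almost everywhere on the cylinder and replaces it under the integral. For
  almost every fixed \<open>x\<close>, \<open>m\<close> is a true primitive in time, and
  \<open>integral_primitive_square\<close> applies.\<close>

lemma scalar_energy_identity:
  fixes \<Omega> :: "'a::euclidean_space set" and l d :: "real \<Rightarrow> 'a \<Rightarrow> real"
  assumes T: "0 < T" and \<Omega>: "\<Omega> \<in> sets borel"
    and lm: "case_prod l \<in> borel_measurable (lebesgue_on (Qcyl T \<Omega>))"
    and di: "integrable (lebesgue_on (Qcyl T \<Omega>)) (case_prod d)"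
    and dl: "integrable (lebesgue_on (Qcyl T \<Omega>)) (\<lambda>(t, x). d t x * l t x)"
    and l0m: "l 0 \<in> borel_measurable (lebesgue_on \<Omega>)"
    and l0: "integrable (lebesgue_on \<Omega>) (\<lambda>x. (l 0 x)\<^sup>2)" and lT: "integrable (lebesgue_on \<Omega>) (\<lambda>x. (l T x)\<^sup>2)"
    and prim: "\<And>t. t \<in> {0..T} \<Longrightarrow> AE x in lebesgue_on \<Omega>.
      l t x - l 0 x = (LINT s|lebesgue_on {0<..<T}. indicator {0..t} s * d s x)"
  shows "(LINT z|lebesgue_on (Qcyl T \<Omega>). (\<lambda>(t, x). d t x * l t x) z)
    = (LINT x|lebesgue_on \<Omega>. (l T x)\<^sup>2) / 2 - (LINT x|lebesgue_on \<Omega>. (l 0 x)\<^sup>2) / 2"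
proof -
  let ?Q = "Qcyl T \<Omega>"
  have I: "{0<..<T} \<in> sets borel" by simp
  note IL = sets_lebesgue_borel[OF I] and \<Omega>L = sets_lebesgue_borel[OF \<Omega>]
  have Q: "?Q \<in> sets lebesgue" using I \<Omega> by (intro sets_lebesgue_borel borel_Times)
  obtain d' where d': "d' \<in> borel_measurable borel" "AE z in lborel. indicator ?Q z * case_prod d z = d' z"
    using lebesgue_on_borel_representative[OF Q borel_measurable_integrable[OF di]] by blast
  obtain c where c: "c \<in> borel_measurable borel" "AE x in lborel. indicator \<Omega> x * l 0 x = c x"
    using lebesgue_on_borel_representative[OF \<Omega>L l0m] by blast
  have d'i: "integrable (lborel \<Otimes>\<^sub>M lborel) (case_prod (\<lambda>t x. d' (t, x)))"
    using lebesgue_on_integrable_iff_representative(1)[OF Q borel_measurable_integrable[OF di] d'] di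
    by (simp add: lborel_prod)
  have d'm: "d' \<in> borel_measurable (lborel \<Otimes>\<^sub>M lborel)" using d'(1) by (simp add: lborel_prod)
  have d'sec: "(\<lambda>t. d' (t, x)) \<in> borel_measurable borel" for x
    using measurable_Pair1[OF d'm, of x] by simp
  \<comment> \<open>\<open>d'\<close> vanishes almost everywhere outside the cylinder, so
    integration from \<open>-\<infinity>\<close> agrees with integration from 0 and gives one
    formula for all times.\<close>
  define D where "D t x = (LINT s|lborel. indicator {..t} s * d' (s, x))" for t x
  have Dm: "(\<lambda>(t, x). D t x) \<in> borel_measurable (borel :: (real \<times> 'a) measure)"
  proof -
    let ?P = "(lborel :: (real \<times> 'a) measure) \<Otimes>\<^sub>M (lborel :: real measure)"
    have g: "{w :: (real \<times> 'a) \<times> real. snd w \<le> fst (fst w)} \<in> sets borel"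
      by (intro borel_closed closed_Collect_le continuous_intros)
    have "(\<lambda>w :: (real \<times> 'a) \<times> real. (snd w, snd (fst w))) \<in> borel_measurable borel"
      by (intro borel_measurable_continuous_onI continuous_intros)
    then have "(\<lambda>w :: (real \<times> 'a) \<times> real. d' (snd w, snd (fst w))) \<in> borel_measurable borel"
      by (rule measurable_compose[OF _ d'(1)])
    then have "(\<lambda>w. indicator {w :: (real \<times> 'a) \<times> real. snd w \<le> fst (fst w)} w * d' (snd w, snd (fst w))) \<in> borel_measurable borel"
      using g by (intro borel_measurable_times borel_measurable_indicator)
    also have "(\<lambda>w. indicator {w :: (real \<times> 'a) \<times> real. snd w \<le> fst (fst w)} w * d' (snd w, snd (fst w)))
        = (\<lambda>(z, s). indicator {..fst z} s * d' (s, snd z))"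
      by (auto simp: indicator_def fun_eq_iff)
    finally have "(\<lambda>(z, s). indicator {..fst z} s * d' (s, snd z)) \<in> borel_measurable ?P"
      by (simp add: lborel_prod)
    then have "(\<lambda>z. LINT s|lborel. indicator {..fst z} s * d' (s, snd z)) \<in> borel_measurable lborel"
      by (rule lborel.borel_measurable_lebesgue_integral)
    then show ?thesis by (simp add: D_def case_prod_beta')
  qed
  define m where "m = (\<lambda>(t, x). c x + D t x)"
  have mm: "m \<in> borel_measurable borel"
  proof -
    have "(\<lambda>z :: real \<times> 'a. c (snd z)) \<in> borel_measurable borel"
      by (intro measurable_compose[OF _ c(1)] borel_measurable_continuous_onI continuous_intros)
    with Dm show ?thesis unfolding m_def case_prod_beta' by (intro borel_measurable_add)
  qed
  have sw: "AE x in lborel. AE t in lborel. indicator {0<..<T} t * (indicator \<Omega> x * d t x) = d' (t, x)"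
    using AE_lborel_pair_swap[OF d'(2)] by eventually_elim (simp add: indicator_times ac_simps)
  have Dt: "AE x in lborel. x \<in> \<Omega> \<longrightarrow> l t x = c x + D t x" if t: "t \<in> {0..T}" for t
    using prim[OF t, unfolded AE_lebesgue_on_iff[OF \<Omega>L]] c(2) sw
  proof eventually_elim
    case (elim x)
    show ?case
    proof
      assume x: "x \<in> \<Omega>"
      have ae: "AE s in lborel. indicator {0<..<T} s * (indicator {0..t} s * d s x) = indicator {..t} s * d' (s, x)"
        using elim(3)
      proof eventually_elim
        case (elim s)
        then show ?case using x t by (auto simp: indicator_def split: if_splits)
      qed
      have bm: "(\<lambda>s. indicator {..t} s * d' (s, x)) \<in> borel_measurable borel"
        using d'sec by (intro borel_measurable_times) auto
      have "(LINT s|lebesgue_on {0<..<T}. indicator {0..t} s * d s x) = D t x"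
        unfolding D_def
        by (rule lebesgue_on_integrable_iff_representative(2)[OF IL section_measurable_from_representative[OF IL bm ae] bm ae])
      then show "l t x = c x + D t x" using elim(1,2) x by simp
    qed
  qed
  \<comment> \<open>Joint measurability of both functions turns the identity at each time into one
    almost everywhere on the cylinder.\<close>
  have lm_eq: "AE z in lebesgue_on ?Q. case_prod l z = m z"
  proof -
    have mQ: "m \<in> borel_measurable (lebesgue_on ?Q)"
      using mm by (intro measurable_restrict_space1 measurable_completion) simp
    show ?thesis
    proof (rule AE_lebesgue_on_TimesI[OF I \<Omega>])
      show "{z \<in> space (lebesgue_on ?Q). case_prod l z \<noteq> m z} \<in> sets (lebesgue_on ?Q)"
        using lm mQ by measurable
      show "AE t in lebesgue_on {0<..<T}. AE x in lebesgue_on \<Omega>. case_prod l (t, x) = m (t, x)"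
      proof (rule AE_I2)
        fix t assume "t \<in> space (lebesgue_on {0<..<T})"
        then have "AE x in lborel. x \<in> \<Omega> \<longrightarrow> l t x = c x + D t x" by (intro Dt) auto
        then show "AE x in lebesgue_on \<Omega>. case_prod l (t, x) = m (t, x)"
          by (simp add: AE_lebesgue_on_iff[OF \<Omega>L] m_def)
      qed
    qed
  qed
  have dm: "AE z in lborel. indicator ?Q z * (\<lambda>(t, x). d t x * l t x) z = d' z * m z"
    using d'(2) lm_eq[unfolded AE_lebesgue_on_iff[OF Q]]
  proof eventually_elim
    case (elim z)
    then show ?case
      by (cases z; cases "z \<in> ?Q") auto
  qed
  have dmm: "(\<lambda>z. d' z * m z) \<in> borel_measurable borel"
    using d'(1) mm by (rule borel_measurable_times)
  note dl_rep = lebesgue_on_integrable_iff_representative[OF Q borel_measurable_integrable[OF dl] dmm dm]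
  have dmi: "integrable (lborel \<Otimes>\<^sub>M lborel) (case_prod (\<lambda>t x. d' (t, x) * m (t, x)))"
    using dl_rep(1) dl by (simp add: lborel_prod case_prod_beta')
  have TT: "T \<in> {0..T}" using T by simp
  have inner: "AE x in lborel. indicator \<Omega> x * ((l T x)\<^sup>2 / 2 - (l 0 x)\<^sup>2 / 2) = (LINT t|lborel. d' (t, x) * m (t, x))"
    using lborel_pair.AE_integrable_snd[OF d'i] sw c(2) Dt[OF TT]
  proof eventually_elim
    case (elim x)
    have "(LINT t|lborel. d' (t, x) * m (t, x)) = (c x + (LINT s|lborel. d' (s, x)))\<^sup>2 / 2 - (c x)\<^sup>2 / 2"
      using integral_primitive_square[OF elim(1), of "c x"] by (simp add: m_def D_def)
    also have "\<dots> = indicator \<Omega> x * ((l T x)\<^sup>2 / 2 - (l 0 x)\<^sup>2 / 2)"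
    proof (cases "x \<in> \<Omega>")
      case True
      have "AE s in lborel. indicator {..T} s * d' (s, x) = d' (s, x)"
        using elim(2) by eventually_elim (auto simp: indicator_def split: if_splits)
      then have "D T x = (LINT s|lborel. d' (s, x))"
        unfolding D_def using d'sec by (intro integral_cong_AE borel_measurable_times) auto
      with True elim(3,4) T show ?thesis by simp
    next
      case False
      have "AE s in lborel. d' (s, x) = 0"
        using elim(2) by eventually_elim (use False in simp)
      then have "(LINT s|lborel. d' (s, x)) = 0" by (rule integral_eq_zero_AE)
      with False show ?thesis by simp
    qed
    finally show ?case by simp
  qed
  have bi: "(\<lambda>x. LINT t|lborel. d' (t, x) * m (t, x)) \<in> borel_measurable borel"
    using borel_measurable_integrable[OF lborel_pair.integrable_snd[OF dmi]] by simp
  have "(LINT z|lebesgue_on ?Q. (\<lambda>(t, x). d t x * l t x) z) = (LINT z|lborel. d' z * m z)"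
    by (rule dl_rep(2))
  also have "\<dots> = (LINT x|lborel. LINT t|lborel. d' (t, x) * m (t, x))"
    using lborel_pair.integral_snd[OF dmi] by (simp add: lborel_prod case_prod_beta')
  also have "\<dots> = (LINT x|lebesgue_on \<Omega>. (l T x)\<^sup>2 / 2 - (l 0 x)\<^sup>2 / 2)"
    by (rule lebesgue_on_integrable_iff_representative(2)[OF \<Omega>L section_measurable_from_representative[OF \<Omega>L bi inner] bi inner, symmetric])
  also have "\<dots> = (LINT x|lebesgue_on \<Omega>. (l T x)\<^sup>2) / 2 - (LINT x|lebesgue_on \<Omega>. (l 0 x)\<^sup>2) / 2"
    using l0 lT by simp
  finally show ?thesis .
qed

section \<open>Time derivatives in the evolution triple\<close>

lemma int_pair_test_vfield:
  "int_pair \<Omega> w (\<lambda>x. \<theta> x *\<^sub>R axis i 1) = (LINT x|lebesgue_on \<Omega>. (w x :: real^'l::finite) $ i * \<theta> x)"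
  unfolding int_pair_def by (simp add: inner_axis mult.commute)

lemma Lp_space_component:
  assumes "u \<in> Lp_space M p" "p > 0"
  shows "(\<lambda>x. (u x :: real^'l::finite) $ i) \<in> Lp_space M p"
proof -
  have m: "(\<lambda>x. u x $ i) \<in> borel_measurable M"
    using borel_measurable_inner[OF Lp_space_measurable[OF assms(1)] borel_measurable_const[of "axis i 1"]]
    by (simp add: inner_axis)
  have "integrable M (\<lambda>x. norm (u x $ i) powr p)"
    by (rule Bochner_Integration.integrable_bound[OF Lp_space_integrable[OF assms(1)]])
      (use m assms(2) in \<open>auto intro!: AE_I2 powr_mono2 component_le_norm_cart\<close>)
  with m show ?thesis by (simp add: Lp_space_def)
qed

lemma int_pair_H_continuous:
  assumes "\<forall>t\<in>{0..T}. lam t \<in> H_space \<Omega> \<and>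
      ((\<lambda>s. H_norm \<Omega> (\<lambda>x. lam s x - lam t x)) \<longlongrightarrow> 0) (at t within {0..T})"
    and v: "v \<in> H_space \<Omega>"
  shows "continuous_on {0..T} (\<lambda>t. int_pair \<Omega> (lam t) v)"
  unfolding continuous_on_def
proof
  fix t assume t: "t \<in> {0..T}"
  have two: "1 < (2::real)" "1 / 2 + 1 / 2 = (1::real)" by auto
  have bound: "\<bar>int_pair \<Omega> (lam s) v - int_pair \<Omega> (lam t) v\<bar> \<le> (H_norm \<Omega> v powr 2 + 1) * H_norm \<Omega> (\<lambda>x. lam s x - lam t x)"
    if "s \<in> {0..T}" for s
  proof -
    have L: "lam s \<in> H_space \<Omega>" "lam t \<in> H_space \<Omega>" using assms(1) that t by auto
    have "int_pair \<Omega> (lam s) v - int_pair \<Omega> (lam t) v = (LINT x|lebesgue_on \<Omega>. v x \<bullet> (lam s x - lam t x))"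
      using Lp_pair(1)[OF two L(1) v] Lp_pair(1)[OF two L(2) v] unfolding int_pair_def
      by (simp add: inner_diff_right inner_commute[of "v _"])
    then show ?thesis
      using Lp_pair_bound[OF two v Lp_space_diff[OF L]] by simp
  qed
  have "((\<lambda>s. int_pair \<Omega> (lam s) v - int_pair \<Omega> (lam t) v) \<longlongrightarrow> 0) (at t within {0..T})"
  proof (rule Lim_null_comparison)
    show "\<forall>\<^sub>F s in at t within {0..T}. norm (int_pair \<Omega> (lam s) v - int_pair \<Omega> (lam t) v) \<le> (H_norm \<Omega> v powr 2 + 1) * H_norm \<Omega> (\<lambda>x. lam s x - lam t x)"
      using bound by (simp add: eventually_at_filter)
    show "((\<lambda>s. (H_norm \<Omega> v powr 2 + 1) * H_norm \<Omega> (\<lambda>x. lam s x - lam t x)) \<longlongrightarrow> 0) (at t within {0..T})"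
      using assms(1) t by (intro tendsto_mult_right_zero) auto
  qed
  then show "((\<lambda>s. int_pair \<Omega> (lam s) v) \<longlongrightarrow> int_pair \<Omega> (lam t) v) (at t within {0..T})"
    by (rule Lim_transform[OF tendsto_const])
qed

text \<open>
  Testing with \<open>\<theta> e\<^sub>i\<close> identifies \<open>\<lambda>(t)\<close> pointwise in \<open>x\<close> with a primitive of its time
  derivative, so that integration by parts in time needs no regularisation.
\<close>

lemma time_derivative_energy:
  fixes \<Omega> :: "(real^'d::finite) set" and lam d :: "real \<Rightarrow> ('d, 'l::finite) vfield"
  assumes T: "0 < T" and \<Omega>: "open \<Omega>" "bounded \<Omega>"
    and p: "1 < p" "1 / p + 1 / p' = 1"
    and lam: "case_prod lam \<in> Lp_space (lebesgue_on (Qcyl T \<Omega>)) p"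
    and d: "case_prod d \<in> Lp_space (lebesgue_on (Qcyl T \<Omega>)) p'"
    and H: "\<forall>t\<in>{0..T}. lam t \<in> H_space \<Omega> \<and>
      ((\<lambda>s. H_norm \<Omega> (\<lambda>x. lam s x - lam t x)) \<longlongrightarrow> 0) (at t within {0..T})"
    and weak: "\<And>\<theta> v. \<theta> \<in> test_functions {0<..<T} \<Longrightarrow> v \<in> V_space \<Omega> \<Gamma>D p \<Longrightarrow>
      (LINT t|lebesgue_on {0<..<T}. int_pair \<Omega> (lam t) v * deriv \<theta> t)
      = - (LINT t|lebesgue_on {0<..<T}. int_pair \<Omega> (d t) v * \<theta> t)"
  shows "integrable (lebesgue_on (Qcyl T \<Omega>)) (\<lambda>(t, x). d t x \<bullet> lam t x)"
    and "(LINT z|lebesgue_on (Qcyl T \<Omega>). (\<lambda>(t, x). d t x \<bullet> lam t x) z)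
      = (H_norm \<Omega> (lam T))\<^sup>2 / 2 - (H_norm \<Omega> (lam 0))\<^sup>2 / 2"
proof -
  let ?Q = "Qcyl T \<Omega>" and ?M = "lebesgue_on {0<..<T}" and ?N = "lebesgue_on \<Omega>"
  have p': "1 < p'" using Young_conjugate(1)[OF p] .
  have I: "{0<..<T} \<in> sets borel" and \<Omega>b: "\<Omega> \<in> sets borel" using \<Omega>(1) by auto
  note IL = sets_lebesgue_borel[OF I] and \<Omega>L = sets_lebesgue_borel[OF \<Omega>b]
  have Q: "?Q \<in> sets lebesgue" using I \<Omega>b by (intro sets_lebesgue_borel borel_Times)
  have fin\<Omega>: "finite_measure ?N" using \<Omega>(2) \<Omega>L by (rule finite_measure_lebesgue_on)
  have finQ: "finite_measure (lebesgue_on ?Q)"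
    using Q \<Omega>(2) by (intro finite_measure_lebesgue_on bounded_Times) auto
  have di: "case_prod (\<lambda>t x. d t x $ i) \<in> Lp_space (lebesgue_on ?Q) p'" for i
    using Lp_space_component[OF d, of i] p' by (simp add: case_prod_beta')
  have li: "case_prod (\<lambda>t x. lam t x $ i) \<in> Lp_space (lebesgue_on ?Q) p" for i
    using Lp_space_component[OF lam, of i] p by (simp add: case_prod_beta')
  have di1: "integrable (lebesgue_on ?Q) (case_prod (\<lambda>t x. d t x $ i))" for i
    using finQ di p' by (intro Lp_space_imp_integrable) auto
  have dli: "integrable (lebesgue_on ?Q) (\<lambda>(t, x). d t x $ i * lam t x $ i)" for i
    using Lp_pair(1)[OF p di li, of i i] by (simp add: case_prod_beta' mult.commute)
  have Hi: "(\<lambda>x. lam t x $ i) \<in> Lp_space ?N 2" if "t \<in> {0..T}" for t i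
    using H that by (intro Lp_space_component) auto
  have Hsq: "integrable ?N (\<lambda>x. (lam t x $ i)\<^sup>2)" if "t \<in> {0..T}" for t i
    using Lp_space_integrable[OF Hi[OF that]] by simp
  have prim: "AE x in ?N. lam t x $ i - lam 0 x $ i = (LINT s|?M. indicator {0..t} s * d s x $ i)"
    if t: "t \<in> {0..T}" for t i
  proof -
    \<comment> \<open>Cutting \<open>d\<close> off after time \<open>t\<close> writes the primitive
      as an integral over the whole interval, so that Fubini can exchange it with the integral over
      \<open>\<Omega>\<close>.\<close>
    define e where "e = (\<lambda>(s, x). indicator {0..t} s * d s x $ i)"
    have ei: "integrable (lebesgue_on ?Q) e"
    proof (rule Bochner_Integration.integrable_bound[OF di1[of i]])
      have "(\<lambda>z. indicator ({0..t} \<times> UNIV) z :: real) \<in> borel_measurable (lebesgue_on ?Q)"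
        by (intro measurable_restrict_space1 borel_measurable_indicator sets_lebesgue_borel borel_Times) auto
      from borel_measurable_times[OF this borel_measurable_integrable[OF di1[of i]]]
      show "e \<in> borel_measurable (lebesgue_on ?Q)"
        by (simp add: e_def case_prod_beta' indicator_times)
    qed (auto intro!: AE_I2 simp: e_def indicator_def)
    define h where "h x = lam t x $ i - lam 0 x $ i - (LINT s|?M. e (s, x))" for x
    have l1: "integrable ?N (\<lambda>x. lam s x $ i)" if "s \<in> {0..T}" for s
      using Lp_space_imp_integrable[OF fin\<Omega> Hi[OF that]] by simp
    have hi: "integrable ?N h"
      unfolding h_def using t T l1 lebesgue_on_Times_integral(5)[OF I \<Omega>b ei]
      by (intro Bochner_Integration.integrable_diff) auto
    have "AE x in ?N. h x = 0"
    proof (rule fundamental_lemma[OF \<Omega>(1)])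
      show "locally_integrable \<Omega> h" using \<Omega>(1) hi by (rule integrable_imp_locally_integrable)
      fix \<theta> assume \<theta>: "\<theta> \<in> test_functions \<Omega>"
      define v where "v = (\<lambda>x. \<theta> x *\<^sub>R axis i 1 :: real^'l)"
      have vV: "v \<in> V_space \<Omega> \<Gamma>D p" and v2: "v \<in> H_space \<Omega>"
      proof -
        show "v \<in> V_space \<Omega> \<Gamma>D p"
          unfolding v_def using p by (intro test_vfield_in_V \<Omega> \<theta>) auto
        \<comment> \<open>Test fields lie in \<open>V_space\<close> for every positive exponent;
          exponent 2 yields membership in \<open>H\<close>.\<close>
        have "v \<in> V_space \<Omega> \<Gamma>D 2"
          unfolding v_def by (intro test_vfield_in_V \<Omega> \<theta>) auto
        then show "v \<in> H_space \<Omega>" by (auto simp: V_space_def W1p_def)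
      qed
      obtain C where C: "\<And>x. \<bar>\<theta> x\<bar> \<le> C" using test_function_bounded[OF \<theta>] by metis
      have \<theta>m: "(\<lambda>z. \<theta> (snd z)) \<in> borel_measurable (lebesgue_on ?Q)"
      proof -
        have "(\<lambda>z :: real \<times> (real^'d). \<theta> (snd z)) \<in> borel_measurable borel"
          by (intro borel_measurable_continuous_onI continuous_on_compose2[OF test_function_continuous[OF \<theta>, of UNIV]] continuous_intros) auto
        then show ?thesis by (intro measurable_restrict_space1 measurable_completion) simp
      qed
      have mult_int: "integrable (lebesgue_on ?Q) (\<lambda>z. g z * \<theta> (snd z))" if g: "integrable (lebesgue_on ?Q) g" for g
      proof (rule Bochner_Integration.integrable_bound)
        show "integrable (lebesgue_on ?Q) (\<lambda>z. C * g z)" using g by simp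
        show "(\<lambda>z. g z * \<theta> (snd z)) \<in> borel_measurable (lebesgue_on ?Q)"
          using g \<theta>m by (intro borel_measurable_times) auto
        have "\<bar>\<theta> x\<bar> \<le> \<bar>C\<bar>" for x using C[of x] by linarith
        then show "AE z in lebesgue_on ?Q. norm (g z * \<theta> (snd z)) \<le> norm (C * g z)"
          by (intro AE_I2) (simp add: abs_mult mult.commute[of "\<bar>C\<bar>"] mult_left_mono)
      qed
      define b where "b s = int_pair \<Omega> (d s) v" for s
      have b: "b s = (LINT x|?N. d s x $ i * \<theta> x)" for s
        unfolding b_def v_def by (rule int_pair_test_vfield)
      have bi: "integrable ?M b"
        using lebesgue_on_Times_integral(2)[OF I \<Omega>b mult_int[OF di1[of i]]] by (simp add: b[abs_def])
      \<comment> \<open>For the fixed field \<open>v\<close> the pairing of \<open>lam t\<close>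
        with \<open>v\<close> is continuous in time with integrable weak derivative
        \<open>b\<close>, hence a primitive of \<open>b\<close>.\<close>
      have "int_pair \<Omega> (lam t) v - int_pair \<Omega> (lam 0) v = (LINT s|?M. indicator {0..t} s * b s)"
        using weak vV bi[unfolded b_def[abs_def]] t int_pair_H_continuous[OF H v2]
        by (intro weak_derivative_primitive[OF T]) (auto simp: b_def)
      also have "\<dots> = (LINT s|?M. LINT x|?N. e (s, x) * \<theta> x)"
        by (simp add: b e_def mult.assoc)
      also have "\<dots> = (LINT x|?N. LINT s|?M. e (s, x) * \<theta> x)"
        using lebesgue_on_Times_integral(3,6)[OF I \<Omega>b mult_int[OF ei]] by simp
      also have "\<dots> = (LINT x|?N. (LINT s|?M. e (s, x)) * \<theta> x)"
        by simp
      finally have eq: "int_pair \<Omega> (lam t) v - int_pair \<Omega> (lam 0) v = (LINT x|?N. (LINT s|?M. e (s, x)) * \<theta> x)" .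
      have loc: "integrable ?N (\<lambda>x. g x * \<theta> x)" if "integrable ?N g" for g
        using integrable_locally_times_test[OF \<Omega>(1) integrable_imp_locally_integrable[OF \<Omega>(1) that] \<theta>] .
      have "(LINT x|?N. h x * \<theta> x) = (LINT x|?N. lam t x $ i * \<theta> x) - (LINT x|?N. lam 0 x $ i * \<theta> x) - (LINT x|?N. (LINT s|?M. e (s, x)) * \<theta> x)"
        unfolding h_def left_diff_distrib
        using loc[OF l1[OF t]] loc[OF l1[of 0]] loc[OF lebesgue_on_Times_integral(5)[OF I \<Omega>b ei]] T
        by simp
      also have "\<dots> = 0"
        using eq by (simp add: v_def int_pair_test_vfield)
      finally show "(LINT x|?N. h x * \<theta> x) = 0" .
    qed
    then show ?thesis
      by eventually_elim (simp add: h_def e_def)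
  qed
  have id: "(LINT z|lebesgue_on ?Q. (\<lambda>(t, x). d t x $ i * lam t x $ i) z)
      = (LINT x|?N. (lam T x $ i)\<^sup>2) / 2 - (LINT x|?N. (lam 0 x $ i)\<^sup>2) / 2" for i
    using T Hsq[of T i] Hsq[of 0 i] Lp_space_measurable[OF Hi[of 0 i]]
    by (intro scalar_energy_identity[of T \<Omega> "\<lambda>t x. lam t x $ i" "\<lambda>t x. d t x $ i"] \<Omega>b prim di1 dli
        Lp_space_measurable[OF li]) auto
  have sum_eq: "(\<lambda>(t, x). d t x \<bullet> lam t x) = (\<lambda>z. \<Sum>i\<in>UNIV. (\<lambda>(t, x). d t x $ i * lam t x $ i) z)"
    by (auto simp: inner_vec_def)
  show "integrable (lebesgue_on ?Q) (\<lambda>(t, x). d t x \<bullet> lam t x)"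
    unfolding sum_eq using dli by (intro Bochner_Integration.integrable_sum)
  have norm_sq: "(H_norm \<Omega> (lam t))\<^sup>2 = (\<Sum>i\<in>UNIV. (LINT x|?N. (lam t x $ i)\<^sup>2))" if "t \<in> {0..T}" for t
  proof -
    have "(H_norm \<Omega> (lam t))\<^sup>2 = H_norm \<Omega> (lam t) powr 2" by simp
    also have "\<dots> = (LINT x|?N. norm (lam t x) powr 2)" by (rule Lp_norm_powr) simp
    also have "\<dots> = (LINT x|?N. (\<Sum>i\<in>UNIV. (lam t x $ i)\<^sup>2))"
      by (intro Bochner_Integration.integral_cong) (auto simp: power2_norm_eq_inner inner_vec_def power2_eq_square[symmetric])
    also have "\<dots> = (\<Sum>i\<in>UNIV. (LINT x|?N. (lam t x $ i)\<^sup>2))"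
      using Hsq[OF that] by (intro Bochner_Integration.integral_sum)
    finally show ?thesis .
  qed
  have "(LINT z|lebesgue_on ?Q. (\<lambda>(t, x). d t x \<bullet> lam t x) z)
      = (\<Sum>i\<in>UNIV. (LINT z|lebesgue_on ?Q. (\<lambda>(t, x). d t x $ i * lam t x $ i) z))"
    unfolding sum_eq using dli by (intro Bochner_Integration.integral_sum)
  also have "\<dots> = (\<Sum>i\<in>UNIV. (LINT x|?N. (lam T x $ i)\<^sup>2) / 2 - (LINT x|?N. (lam 0 x $ i)\<^sup>2) / 2)"
    using id by simp
  also have "\<dots> = (H_norm \<Omega> (lam T))\<^sup>2 / 2 - (H_norm \<Omega> (lam 0))\<^sup>2 / 2"
    using T by (simp add: norm_sq sum_subtractf sum_divide_distrib)
  finally show "(LINT z|lebesgue_on ?Q. (\<lambda>(t, x). d t x \<bullet> lam t x) z)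
      = (H_norm \<Omega> (lam T))\<^sup>2 / 2 - (H_norm \<Omega> (lam 0))\<^sup>2 / 2" .
qed

section \<open>Conjugates on the space-time cylinder\<close>

text \<open>Reals that tend to \<open>\<theta>\<close> and lie strictly below it unless they are 0.
  The minimum with \<open>n\<close> copes with \<open>\<theta> = \<infinity>\<close>, the factor
  gives strictness, and the summand 2 keeps the factor at least 1/2. Strictness is what guarantees a
  point of the fibre that reaches the prescribed value, since suprema need not be attained.\<close>

definition below :: "nat \<Rightarrow> ennreal \<Rightarrow> real" where
  "below n \<theta> = (1 - 1 / (real n + 2)) * enn2real (min (of_nat n) \<theta>)"

lemma below_nonneg: "0 \<le> below n \<theta>"
  by (simp add: below_def divide_le_eq)

lemma below_less: "below n \<theta> = 0 \<or> ennreal (below n \<theta>) < \<theta>"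
proof (rule disjCI)
  assume "\<not> ennreal (below n \<theta>) < \<theta>"
  have fin: "min (of_nat n) \<theta> \<noteq> top"
    by (metis ennreal_of_nat_neq_top min.cobounded1 top.extremum_uniqueI)
  define q where "q = enn2real (min (of_nat n) \<theta>)"
  have q: "ennreal q \<le> \<theta>" "0 \<le> q"
    using fin by (auto simp: q_def ennreal_enn2real_if)
  show "below n \<theta> = 0"
  proof (rule ccontr)
    assume "below n \<theta> \<noteq> 0"
    then have "q > 0" using q(2) by (auto simp: below_def q_def less_le)
    then have "below n \<theta> < q"
      unfolding below_def q_def[symmetric] by (simp add: mult_less_cancel_right2)
    then have "ennreal (below n \<theta>) < ennreal q"
      using below_nonneg \<open>q > 0\<close> by (simp add: ennreal_lessI)
    with q(1) \<open>\<not> ennreal (below n \<theta>) < \<theta>\<close> show False by auto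
  qed
qed

lemma below_tendsto: "(\<lambda>n. ennreal (below n \<theta>)) \<longlonglongrightarrow> \<theta>"
proof (cases \<theta>)
  case (real q)
  obtain K where K: "q \<le> real K" using real_arch_simple by blast
  have "(\<lambda>n. (1 - 1 / (real n + 2)) * q) \<longlonglongrightarrow> (1 - 0) * q"
  proof (intro tendsto_mult tendsto_diff tendsto_const)
    show "(\<lambda>n. 1 / (real n + 2)) \<longlonglongrightarrow> 0"
      using LIMSEQ_Suc[OF LIMSEQ_inverse_real_of_nat] by (simp add: inverse_eq_divide add.commute)
  qed
  then have "(\<lambda>n. ennreal ((1 - 1 / (real n + 2)) * q)) \<longlonglongrightarrow> \<theta>"
    using real by (auto intro: tendsto_ennrealI)
  moreover have "\<forall>\<^sub>F n in sequentially. ennreal ((1 - 1 / (real n + 2)) * q) = ennreal (below n \<theta>)"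
    unfolding eventually_sequentially
  proof (intro exI[of _ K] allI impI)
    fix n assume "K \<le> n"
    then have "q \<le> real n" using K by linarith
    then have "min (of_nat n) \<theta> = ennreal q"
      using real by (simp add: min_absorb2 ennreal_of_nat_eq_real_of_nat)
    then show "ennreal ((1 - 1 / (real n + 2)) * q) = ennreal (below n \<theta>)"
      using real by (simp add: below_def)
  qed
  ultimately show ?thesis by (rule Lim_transform_eventually)
next
  case top
  have ge: "real n / 2 \<le> below n \<theta>" for n
  proof -
    have "enn2real (min (of_nat n) \<theta>) = real n"
      using top by (simp add: min_absorb1 ennreal_of_nat_eq_real_of_nat)
    moreover have "1 / 2 \<le> 1 - 1 / (real n + 2)" by (simp add: field_simps)
    ultimately show ?thesis
      unfolding below_def using mult_right_mono[of "1/2" "1 - 1 / (real n + 2)" "real n"] by simp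
  qed
  have "filterlim (\<lambda>n. below n \<theta>) at_top sequentially"
  proof (rule filterlim_at_top_mono)
    show "filterlim (\<lambda>n. real n * (1 / 2)) at_top sequentially"
      by (rule filterlim_at_top_mult_tendsto_pos[OF tendsto_const _ filterlim_real_sequentially]) simp
  qed (use ge in simp)
  then show ?thesis
    unfolding top by (simp add: ennreal_tendsto_top_eq_at_top)
qed

text \<open>The selections are made on the cylinder and then restricted; being countably many, they
  are measurable on almost every time slice simultaneously, where
  \<open>integral_functional_conjugate\<close> applies. The field \<open>r0\<close> supplies the
  reference energy; the gradient of \<open>\<lambda>\<close> will play this part.\<close>

lemma G_conj_eq_integrand_conj:
  fixes \<Omega> :: "(real^'d::finite) set" and \<phi> :: "real \<Rightarrow> real^'d \<Rightarrow> real^'d^'l::finite \<Rightarrow> ereal"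
  assumes T: "0 < T" and \<Omega>: "open \<Omega>" "bounded \<Omega>" and p: "1 < p" "1 / p + 1 / p' = 1"
    and \<phi>: "convex_normal_integrand T \<Omega> \<phi>"
    and ym: "case_prod y \<in> borel_measurable (lebesgue_on (Qcyl T \<Omega>))"
    and y: "AE t in lebesgue_on {0<..<T}. y t \<in> Lp_space (lebesgue_on \<Omega>) p'"
    and rm: "case_prod r0 \<in> borel_measurable (lebesgue_on (Qcyl T \<Omega>))"
    and r0: "AE t in lebesgue_on {0<..<T}. r0 t \<in> Lp_space (lebesgue_on \<Omega>) p"
    and fin: "AE t in lebesgue_on {0<..<T}. \<bar>I_space \<Omega> \<phi> t (r0 t)\<bar> \<noteq> \<infinity>"
    and G: "AE t in lebesgue_on {0<..<T}. G_conj \<Omega> p \<phi> t (y t) < \<infinity>"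
  shows "(\<lambda>(t, x). integrand_conj \<phi> t x (y t x)) \<in> borel_measurable (lebesgue_on (Qcyl T \<Omega>))"
    and "AE t in lebesgue_on {0<..<T}. \<bar>I_space \<Omega> (integrand_conj \<phi>) t (y t)\<bar> \<noteq> \<infinity> \<and>
      G_conj \<Omega> p \<phi> t (y t) = I_space \<Omega> (integrand_conj \<phi>) t (y t)"
proof -
  let ?Q = "lebesgue_on (Qcyl T \<Omega>)" and ?I = "lebesgue_on {0<..<T}" and ?N = "lebesgue_on \<Omega>"
  have I: "{0<..<T} \<in> sets borel" and \<Omega>b: "\<Omega> \<in> sets borel" using \<Omega>(1) by auto
  have QL: "Qcyl T \<Omega> \<in> sets lebesgue" using I \<Omega>b by (intro sets_lebesgue_borel borel_Times)
  have finQ: "finite_measure ?Q" using QL \<Omega>(2) by (intro finite_measure_lebesgue_on bounded_Times) auto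
  have cQ: "complete_measure ?Q" using QL by (rule complete_measure_lebesgue_on)
  have finN: "finite_measure ?N" using \<Omega>(2) sets_lebesgue_borel[OF \<Omega>b] by (rule finite_measure_lebesgue_on)
  define g where "g s = \<phi> (fst s) (snd s)" for s
  define Y where "Y s = y (fst s) (snd s)" for s
  define R where "R s = r0 (fst s) (snd s)" for s
  have gm: "(\<lambda>(s, r). g s r) \<in> borel_measurable (?Q \<Otimes>\<^sub>M borel)"
    using \<phi> by (simp add: convex_normal_integrand_def g_def case_prod_beta')
  have Ym: "Y \<in> borel_measurable ?Q" using ym by (simp add: Y_def[abs_def] case_prod_beta')
  have Rm: "R \<in> borel_measurable ?Q" using rm by (simp add: R_def[abs_def] case_prod_beta')
  have comp: "(\<lambda>s. g s (v s)) \<in> borel_measurable ?Q" if "v \<in> borel_measurable ?Q" for v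
  proof -
    have "(\<lambda>s. (s, v s)) \<in> measurable ?Q (?Q \<Otimes>\<^sub>M borel)"
      using that by (intro measurable_Pair) auto
    from measurable_compose[OF this gm] show ?thesis by simp
  qed
  define \<Psi> where "\<Psi> s = fenchel_conj UNIV (\<bullet>) (g s) (Y s)" for s
  have \<Psi>m: "\<Psi> \<in> borel_measurable ?Q"
    unfolding \<Psi>_def using finQ cQ gm Ym by (rule conjugate_measurable)
  have \<Psi>eq: "\<Psi> (t, x) = integrand_conj \<phi> t x (y t x)" for t x
    by (simp add: \<Psi>_def integrand_conj_def g_def Y_def)
  show "(\<lambda>(t, x). integrand_conj \<phi> t x (y t x)) \<in> borel_measurable ?Q"
    using \<Psi>m by (simp add: \<Psi>eq[symmetric] case_prod_beta')
  have gRm: "(\<lambda>s. g s (R s)) \<in> borel_measurable ?Q" using comp[OF Rm] .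
  have "AE s in ?Q. \<bar>g s (R s)\<bar> \<noteq> \<infinity>"
  proof (rule AE_lebesgue_on_TimesI[OF I \<Omega>b])
    have "(\<lambda>s. \<bar>g s (R s)\<bar>) \<in> borel_measurable ?Q" using gRm by measurable
    then have "(\<lambda>s. \<bar>g s (R s)\<bar>) -` {\<infinity>} \<inter> space ?Q \<in> sets ?Q" by (rule measurable_sets) simp
    also have "(\<lambda>s. \<bar>g s (R s)\<bar>) -` {\<infinity>} \<inter> space ?Q = {s \<in> space ?Q. \<not> \<bar>g s (R s)\<bar> \<noteq> \<infinity>}" by auto
    finally show "{s \<in> space ?Q. \<not> \<bar>g s (R s)\<bar> \<noteq> \<infinity>} \<in> sets ?Q" .
    show "AE t in ?I. AE x in ?N. \<bar>g (t, x) (R (t, x))\<bar> \<noteq> \<infinity>"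
      using fin
    proof eventually_elim
      case (elim t)
      have "AE x in ?N. \<phi> t x (r0 t x) = ereal (real_of_ereal (\<phi> t x (r0 t x)))"
        using ext_integral_finite(2) elim unfolding I_space_def .
      then show ?case
      proof eventually_elim
        case (elim x)
        then show ?case by (cases "\<phi> t x (r0 t x)") (auto simp: g_def R_def)
      qed
    qed
  qed
  moreover have "AE s in ?Q. proper_convex_lsc (g s)"
    using \<phi> by (simp add: convex_normal_integrand_def g_def case_prod_beta')
  ultimately have good: "AE s in ?Q. proper_convex_lsc (g s) \<and> \<bar>g s (R s)\<bar> \<noteq> \<infinity>"
    by eventually_elim simp
  \<comment> \<open>Its complement is a null set, and completeness makes that measurable; the
    predicate \<open>proper_convex_lsc\<close> offers no direct access to measurability.\<close>
  define S where "S = {s \<in> space ?Q. proper_convex_lsc (g s) \<and> \<bar>g s (R s)\<bar> \<noteq> \<infinity>}"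
  have S: "S \<in> sets ?Q"
  proof -
    have "{s \<in> space ?Q. \<not> (proper_convex_lsc (g s) \<and> \<bar>g s (R s)\<bar> \<noteq> \<infinity>)} \<in> sets ?Q"
      by (rule null_setsD2[OF complete_measure.AE_iff_null_sets[OF cQ, THEN iffD1, OF good]])
    then have "space ?Q - {s \<in> space ?Q. \<not> (proper_convex_lsc (g s) \<and> \<bar>g s (R s)\<bar> \<noteq> \<infinity>)} \<in> sets ?Q"
      by (rule sets.compl_sets)
    also have "space ?Q - {s \<in> space ?Q. \<not> (proper_convex_lsc (g s) \<and> \<bar>g s (R s)\<bar> \<noteq> \<infinity>)} = S"
      by (auto simp: S_def)
    finally show ?thesis .
  qed
  have "AE s in ?Q. s \<in> S"
    using good AE_space by eventually_elim (simp add: S_def)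
  then have St: "AE t in ?I. AE x in ?N. (t, x) \<in> S"
    by (rule AE_lebesgue_on_Times[OF I \<Omega>b])
  define E where "E s = Y s \<bullet> R s - real_of_ereal (g s (R s))" for s
  have Em: "E \<in> borel_measurable ?Q"
    unfolding E_def using Ym Rm gRm by measurable
  \<comment> \<open>The gain over the reference value \<open>E s\<close> that is demanded of the
    \<open>n\<close>-th selection. It tends to the full gain, which may be infinite.\<close>
  define \<tau> where "\<tau> n s = below n (e2ennreal (\<Psi> s - ereal (E s)))" for n s
  have \<tau>m: "\<tau> n \<in> borel_measurable ?Q" for n
    unfolding \<tau>_def below_def using \<Psi>m Em by measurable
  \<comment> \<open>Gain 0 is realised by \<open>R s\<close> itself; otherwise the demanded value
    lies strictly below the supremum, so some point exceeds it.\<close>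
  have ex: "\<exists>r. g s r \<le> ereal (Y s \<bullet> r - (E s + \<tau> n s))" if s: "s \<in> S" for n s
  proof -
    have gR: "g s (R s) = ereal (real_of_ereal (g s (R s)))"
      using s by (auto simp: S_def ereal_real)
    consider "\<tau> n s = 0" | "ennreal (\<tau> n s) < e2ennreal (\<Psi> s - ereal (E s))"
      unfolding \<tau>_def using below_less by blast
    then show ?thesis
    proof cases
      case 1
      then show ?thesis by (intro exI[of _ "R s"]) (subst gR, simp add: E_def)
    next
      case 2
      have "ereal (\<tau> n s) < \<Psi> s - ereal (E s)"
      proof (rule ccontr)
        assume "\<not> ereal (\<tau> n s) < \<Psi> s - ereal (E s)"
        then have "e2ennreal (\<Psi> s - ereal (E s)) \<le> e2ennreal (ereal (\<tau> n s))" by (intro e2ennreal_mono) simp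
        with 2 show False by simp
      qed
      then have "ereal (E s + \<tau> n s) < \<Psi> s" by (cases "\<Psi> s") auto
      then obtain r where r: "ereal (E s + \<tau> n s) < ereal (Y s \<bullet> r) - g s r"
        unfolding \<Psi>_def fenchel_conj_def less_SUP_iff by blast
      have "g s r \<noteq> -\<infinity>" using s by (auto simp: S_def proper_convex_lsc_def)
      with r show ?thesis by (intro exI[of _ r]) (cases "g s r", auto)
    qed
  qed
  have "\<exists>r\<in>borel_measurable ?Q. \<forall>s\<in>S. g s (r s) \<le> ereal (Y s \<bullet> r s - (E s + \<tau> n s))" for n
    using S ex Em \<tau>m by (intro near_maximizing_selection[OF finQ cQ gm Ym]) (auto simp: S_def)
  then obtain r where r: "\<And>n. r n \<in> borel_measurable ?Q"
      "\<And>n s. s \<in> S \<Longrightarrow> g s (r n s) \<le> ereal (Y s \<bullet> r n s - (E s + \<tau> n s))"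
    by metis
  have 1: "AE t in ?I. \<forall>n. (\<lambda>x. r n (t, x)) \<in> borel_measurable ?N"
    unfolding AE_all_countable using lebesgue_on_Times_section[OF I \<Omega>b r(1)] by blast
  have 2: "AE t in ?I. \<forall>n. (\<lambda>x. g (t, x) (r n (t, x))) \<in> borel_measurable ?N"
    unfolding AE_all_countable using lebesgue_on_Times_section[OF I \<Omega>b comp[OF r(1)]] by blast
  have 3: "AE t in ?I. \<forall>n. (\<lambda>x. \<tau> n (t, x)) \<in> borel_measurable ?N"
    unfolding AE_all_countable using lebesgue_on_Times_section[OF I \<Omega>b \<tau>m] by blast
  have 4: "AE t in ?I. (\<lambda>x. \<Psi> (t, x)) \<in> borel_measurable ?N"
    using lebesgue_on_Times_section[OF I \<Omega>b \<Psi>m] .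
  show "AE t in ?I. \<bar>I_space \<Omega> (integrand_conj \<phi>) t (y t)\<bar> \<noteq> \<infinity> \<and>
      G_conj \<Omega> p \<phi> t (y t) = I_space \<Omega> (integrand_conj \<phi>) t (y t)"
    using 1 2 3 4 St y r0 fin G
  proof eventually_elim
    case (elim t)
    have conj_eq: "fenchel_conj UNIV (\<bullet>) (\<phi> t x) (y t x) = \<Psi> (t, x)" for x
      by (simp add: \<Psi>_def g_def Y_def)
    have G_eq: "G_conj \<Omega> p \<phi> t (y t) = fenchel_conj (Lp_space ?N p) (\<lambda>u v. LINT x|?N. u x \<bullet> v x) (\<lambda>v. ext_integral ?N (\<lambda>x. \<phi> t x (v x))) (y t)"
      by (simp add: G_conj_def G_fun_def[abs_def] I_space_def[abs_def] int_pair_def[abs_def])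
    have I_eq: "I_space \<Omega> (integrand_conj \<phi>) t (y t) = ext_integral ?N (\<lambda>x. fenchel_conj UNIV (\<bullet>) (\<phi> t x) (y t x))"
      by (simp add: I_space_def integrand_conj_def)
    have b0: "\<bar>ext_integral ?N (\<lambda>x. \<phi> t x (r0 t x))\<bar> \<noteq> \<infinity>" using elim(8) by (simp add: I_space_def)
    have nomin: "AE x in ?N. \<forall>r. \<phi> t x r \<noteq> -\<infinity>"
      using elim(5) by eventually_elim (auto simp: S_def proper_convex_lsc_def g_def)
    have near: "AE x in ?N. \<phi> t x (r n (t, x)) \<le> ereal (y t x \<bullet> r n (t, x) - ((y t x \<bullet> r0 t x - real_of_ereal (\<phi> t x (r0 t x))) + \<tau> n (t, x)))" for n
      using elim(5)
    proof eventually_elim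
      case (elim x)
      from r(2)[OF this, of n] show ?case by (simp add: g_def Y_def R_def E_def)
    qed
    have lim: "AE x in ?N. (\<lambda>n. ennreal (\<tau> n (t, x))) \<longlonglongrightarrow> e2ennreal (fenchel_conj UNIV (\<bullet>) (\<phi> t x) (y t x) - ereal (y t x \<bullet> r0 t x - real_of_ereal (\<phi> t x (r0 t x))))"
      unfolding conj_eq \<tau>_def using below_tendsto by (intro AE_I2) (simp add: E_def g_def Y_def R_def)
    note main = integral_functional_conjugate[OF finN p elim(6,7) b0 _ nomin _ _ _ _ near lim]
    show ?case
      unfolding G_eq I_eq using elim(1-4,9) below_nonneg
      by (intro conjI main) (auto simp: conj_eq g_def \<tau>_def G_eq)
  qed
qed


lemma normal_integrand_compose:
  assumes g: "convex_normal_integrand T \<Omega> g"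
    and v: "case_prod v \<in> borel_measurable (lebesgue_on (Qcyl T \<Omega>))"
  shows "(\<lambda>(t, x). g t x (v t x)) \<in> borel_measurable (lebesgue_on (Qcyl T \<Omega>))"
proof -
  let ?Q = "lebesgue_on (Qcyl T \<Omega>)"
  have gm: "(\<lambda>((t, x), r). g t x r) \<in> borel_measurable (?Q \<Otimes>\<^sub>M borel)"
    using g by (simp add: convex_normal_integrand_def)
  have "(\<lambda>s. (s, case_prod v s)) \<in> measurable ?Q (?Q \<Otimes>\<^sub>M borel)"
    using v by (intro measurable_Pair) auto
  from measurable_compose[OF this gm] show ?thesis by (simp add: case_prod_beta')
qed

lemma integrand_conj_measurable:
  fixes \<Omega> :: "(real^'d::finite) set"
  assumes \<Omega>: "open \<Omega>" "bounded \<Omega>" and g: "convex_normal_integrand T \<Omega> g"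
    and v: "case_prod v \<in> borel_measurable (lebesgue_on (Qcyl T \<Omega>))"
  shows "(\<lambda>(t, x). integrand_conj g t x (v t x)) \<in> borel_measurable (lebesgue_on (Qcyl T \<Omega>))"
proof -
  let ?Q = "lebesgue_on (Qcyl T \<Omega>)"
  have QL: "Qcyl T \<Omega> \<in> sets lebesgue"
    using \<Omega>(1) by (intro sets_lebesgue_borel borel_Times) auto
  have "finite_measure ?Q" "complete_measure ?Q"
    using QL \<Omega>(2) by (auto intro!: finite_measure_lebesgue_on bounded_Times complete_measure_lebesgue_on)
  moreover have "(\<lambda>(s, r). g (fst s) (snd s) r) \<in> borel_measurable (?Q \<Otimes>\<^sub>M borel)"
    using g by (simp add: convex_normal_integrand_def case_prod_beta')
  ultimately have "(\<lambda>s. fenchel_conj UNIV (\<bullet>) (g (fst s) (snd s)) (case_prod v s)) \<in> borel_measurable ?Q"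
    using v by (rule conjugate_measurable)
  then show ?thesis by (simp add: integrand_conj_def case_prod_beta')
qed

section \<open>Representation of the dual variable\<close>

lemma k_smooth_partial:
  assumes "k_smooth (Suc k) f" "b \<in> Basis"
  shows "k_smooth k (\<lambda>x. frechet_derivative f (at x) b)"
  using assms by simp

lemma test_function_partial:
  assumes "\<theta> \<in> test_functions S" "b \<in> Basis"
  shows "(\<lambda>x. frechet_derivative \<theta> (at x) b) \<in> test_functions S"
proof -
  have "smooth \<theta>" using assms(1) by (simp add: test_functions_def)
  then have sm: "smooth (\<lambda>x. frechet_derivative \<theta> (at x) b)"
    unfolding smooth_def using k_smooth_partial[OF _ assms(2)] by blast
  obtain K where K: "compact K" "K \<subseteq> S" "\<And>x. x \<notin> K \<Longrightarrow> \<theta> x = 0"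
    and K': "\<And>x b. x \<notin> K \<Longrightarrow> frechet_derivative \<theta> (at x) b = 0"
    by (rule test_function_support[OF assms(1)], rule that)
  have sub: "closure {x. frechet_derivative \<theta> (at x) b \<noteq> 0} \<subseteq> K"
    using K' compact_imp_closed[OF K(1)] by (intro closure_minimal) auto
  have "compact (closure {x. frechet_derivative \<theta> (at x) b \<noteq> 0})"
    using compact_Int_closed[OF K(1) closed_closure[of "{x. frechet_derivative \<theta> (at x) b \<noteq> 0}"]] sub
    by (simp add: Int_absorb1)
  with sm sub K(2) show ?thesis by (auto simp: test_functions_def)
qed

lemma locally_integrable_vec_nth:
  fixes f :: "'a::euclidean_space \<Rightarrow> real^'l::finite"
  shows "locally_integrable \<Omega> f \<Longrightarrow> locally_integrable \<Omega> (\<lambda>x. f x $ i)"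
  using locally_integrable_component[of \<Omega> f "axis i 1"] by (simp add: inner_axis)

lemma locally_integrable_mat_nth:
  fixes f :: "'a::euclidean_space \<Rightarrow> real^'d::finite^'l::finite"
  shows "locally_integrable \<Omega> f \<Longrightarrow> locally_integrable \<Omega> (\<lambda>x. f x $ i $ j)"
  using locally_integrable_component[of \<Omega> f "axis i (axis j 1)"] by (simp add: inner_axis)

lemma locally_integrable_lincomb:
  assumes "locally_integrable \<Omega> f" "locally_integrable \<Omega> g"
  shows "locally_integrable \<Omega> (\<lambda>x. a *\<^sub>R f x + c *\<^sub>R g x)"
  using assms unfolding locally_integrable_def
  by (auto intro!: set_integral_add set_integrable_scaleR_right)

lemma has_weak_grad_lincomb:
  fixes \<Omega> :: "(real^'d::finite) set" and u v :: "('d, 'l::finite) vfield"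
  assumes \<Omega>: "open \<Omega>" and u: "has_weak_grad \<Omega> u g" and v: "has_weak_grad \<Omega> v h"
  shows "has_weak_grad \<Omega> (\<lambda>x. a *\<^sub>R u x + c *\<^sub>R v x) (\<lambda>x. a *\<^sub>R g x + c *\<^sub>R h x)"
  unfolding has_weak_grad_def
proof (intro conjI ballI allI)
  have L: "locally_integrable \<Omega> u" "locally_integrable \<Omega> v" "locally_integrable \<Omega> g" "locally_integrable \<Omega> h"
    using u v by (auto simp: has_weak_grad_def)
  show "locally_integrable \<Omega> (\<lambda>x. a *\<^sub>R u x + c *\<^sub>R v x)" "locally_integrable \<Omega> (\<lambda>x. a *\<^sub>R g x + c *\<^sub>R h x)"
    using locally_integrable_lincomb[OF L(1,2)] locally_integrable_lincomb[OF L(3,4)] by auto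
  fix \<theta> i j assume \<theta>: "\<theta> \<in> test_functions \<Omega>"
  have \<theta>j: "partial_deriv j \<theta> \<in> test_functions \<Omega>"
    using \<theta> by (rule test_function_partial) simp
  have int: "integrable (lebesgue_on \<Omega>) (\<lambda>x. u x $ i * partial_deriv j \<theta> x)"
      "integrable (lebesgue_on \<Omega>) (\<lambda>x. v x $ i * partial_deriv j \<theta> x)"
      "integrable (lebesgue_on \<Omega>) (\<lambda>x. g x $ i $ j * \<theta> x)"
      "integrable (lebesgue_on \<Omega>) (\<lambda>x. h x $ i $ j * \<theta> x)"
    using L \<theta> \<theta>j
    by (auto intro!: integrable_locally_times_test[OF \<Omega>] locally_integrable_vec_nth locally_integrable_mat_nth)
  have eq: "(LINT x|lebesgue_on \<Omega>. u x $ i * partial_deriv j \<theta> x) = - (LINT x|lebesgue_on \<Omega>. g x $ i $ j * \<theta> x)"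
      "(LINT x|lebesgue_on \<Omega>. v x $ i * partial_deriv j \<theta> x) = - (LINT x|lebesgue_on \<Omega>. h x $ i $ j * \<theta> x)"
    using u v \<theta> by (auto simp: has_weak_grad_def)
  have "(LINT x|lebesgue_on \<Omega>. (a *\<^sub>R u x + c *\<^sub>R v x) $ i * partial_deriv j \<theta> x)
      = (LINT x|lebesgue_on \<Omega>. a * (u x $ i * partial_deriv j \<theta> x) + c * (v x $ i * partial_deriv j \<theta> x))"
    by (simp add: algebra_simps)
  also have "\<dots> = - (LINT x|lebesgue_on \<Omega>. a * (g x $ i $ j * \<theta> x) + c * (h x $ i $ j * \<theta> x))"
    using int eq by simp
  also have "\<dots> = - (LINT x|lebesgue_on \<Omega>. (a *\<^sub>R g x + c *\<^sub>R h x) $ i $ j * \<theta> x)"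
    by (simp add: algebra_simps)
  finally show "(LINT x|lebesgue_on \<Omega>. (a *\<^sub>R u x + c *\<^sub>R v x) $ i * partial_deriv j \<theta> x)
      = - (LINT x|lebesgue_on \<Omega>. (a *\<^sub>R g x + c *\<^sub>R h x) $ i $ j * \<theta> x)" .
qed

text \<open>The chosen \<open>grad\<close> is linear only up to null sets. Inside a pairing, this
  lets a linear combination of gradients stand in for the gradient of the linear
  combination.\<close>

lemma int_pair_grad_cong:
  fixes \<Omega> :: "(real^'d::finite) set" and v :: "('d, 'l::finite) vfield"
  assumes "open \<Omega>" "has_weak_grad \<Omega> v g"
  shows "int_pair \<Omega> y (grad \<Omega> v) = int_pair \<Omega> y g"
  unfolding int_pair_def
proof (rule integral_cong_AE_complete)
  show "complete_measure (lebesgue_on \<Omega>)"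
    using assms(1) by (intro complete_measure_lebesgue_on) auto
  show "AE x in lebesgue_on \<Omega>. y x \<bullet> grad \<Omega> v x = y x \<bullet> g x"
    using has_weak_grad_unique[OF assms(1) has_weak_grad_grad[OF assms(2)] assms(2)] by eventually_elim simp
qed

text \<open>(C) speaks of elements of \<open>V_dual\<close>, so the functional inserted into
  \<open>F_conj\<close> has to be shown to be one. The bound \<open>Lp_pair_bound\<close> is linear
  in the norm of the tested field, as \<open>dual_space\<close> demands.\<close>

lemma grad_star_in_V_dual:
  fixes \<Omega> \<Gamma>D :: "(real^'d::finite) set" and y :: "('d, 'l::finite) tfield"
  assumes \<Omega>: "open \<Omega>" and p: "1 < p" "1 / p + 1 / p' = 1" and y: "y \<in> Lp_space (lebesgue_on \<Omega>) p'"
  shows "grad_star \<Omega> y \<in> V_dual \<Omega> \<Gamma>D p"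
proof -
  have lin: "grad_star \<Omega> y (\<lambda>x. a *\<^sub>R u x + c *\<^sub>R v x) = a * grad_star \<Omega> y u + c * grad_star \<Omega> y v"
    if "u \<in> V_space \<Omega> \<Gamma>D p" "v \<in> V_space \<Omega> \<Gamma>D p" for a c u v
  proof -
    have W: "u \<in> W1p \<Omega> p" "v \<in> W1p \<Omega> p" using that by (auto simp: V_space_def)
    have "grad_star \<Omega> y (\<lambda>x. a *\<^sub>R u x + c *\<^sub>R v x) = int_pair \<Omega> y (\<lambda>x. a *\<^sub>R grad \<Omega> u x + c *\<^sub>R grad \<Omega> v x)"
      unfolding grad_star_def using W
      by (intro int_pair_grad_cong[OF \<Omega>] has_weak_grad_lincomb[OF \<Omega>] W1p_has_weak_grad)
    also have "\<dots> = a * grad_star \<Omega> y u + c * grad_star \<Omega> y v"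
      using Lp_pair(1)[OF p y W1p_grad_Lp[OF \<Omega> W(1)]] Lp_pair(1)[OF p y W1p_grad_Lp[OF \<Omega> W(2)]]
      unfolding grad_star_def int_pair_def by (simp add: inner_add_right)
    finally show ?thesis .
  qed
  have "\<bar>grad_star \<Omega> y u\<bar> \<le> (Lp_norm (lebesgue_on \<Omega>) p' y powr p' + 1) * W1p_norm \<Omega> p u"
    if "u \<in> V_space \<Omega> \<Gamma>D p" for u
  proof -
    have W: "u \<in> W1p \<Omega> p" using that by (auto simp: V_space_def)
    have "\<bar>grad_star \<Omega> y u\<bar> \<le> (Lp_norm (lebesgue_on \<Omega>) p' y powr p' + 1) * Lp_norm (lebesgue_on \<Omega>) p (grad \<Omega> u)"
      unfolding grad_star_def int_pair_def by (rule Lp_pair_bound[OF p y W1p_grad_Lp[OF \<Omega> W]])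
    also have "\<dots> \<le> (Lp_norm (lebesgue_on \<Omega>) p' y powr p' + 1) * W1p_norm \<Omega> p u"
      using p by (intro mult_left_mono Lp_norm_le_W1p_norm) auto
    finally show ?thesis .
  qed
  then show ?thesis
    unfolding dual_space_def using lin[of _ _ 1 1] lin[of _ _ _ 0] by auto
qed

lemma dual_space_minus_diff:
  assumes "\<xi> \<in> dual_space X N" "\<zeta> \<in> dual_space X N"
  shows "(\<lambda>v. - \<xi> v - \<zeta> v) \<in> dual_space X N"
proof -
  obtain C D where C: "\<forall>u\<in>X. \<bar>\<xi> u\<bar> \<le> C * N u" and D: "\<forall>u\<in>X. \<bar>\<zeta> u\<bar> \<le> D * N u"
    using assms by (auto simp: dual_space_def)
  have "\<forall>u\<in>X. \<bar>- \<xi> u - \<zeta> u\<bar> \<le> (C + D) * N u"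
  proof
    fix u assume "u \<in> X"
    then show "\<bar>- \<xi> u - \<zeta> u\<bar> \<le> (C + D) * N u"
      using C D by (smt (verit) distrib_right)
  qed
  moreover have "- \<xi> (\<lambda>x. u x + v x) - \<zeta> (\<lambda>x. u x + v x) = (- \<xi> u - \<zeta> u) + (- \<xi> v - \<zeta> v)" if "u \<in> X" "v \<in> X" for u v
    using assms that by (simp add: dual_space_def)
  moreover have "- \<xi> (\<lambda>x. c *\<^sub>R u x) - \<zeta> (\<lambda>x. c *\<^sub>R u x) = c * (- \<xi> u - \<zeta> u)" if "u \<in> X" for u c
    using assms that by (simp add: dual_space_def right_diff_distrib)
  ultimately show ?thesis unfolding dual_space_def by blast
qed

text \<open>
  Any \<open>L\<^bsup>p'\<^esup>\<close> representative of \<open>- \<nabla>\<^sup>* y - \<partial>\<^sub>t \<lambda> + f\<close> is determined by test functions, hence equals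
  \<open>div y + f\<^sub>0 - \<partial>\<^sub>t \<lambda>\<close>; this is how the vanishing normal trace of \<open>y\<close> on the Neumann boundary enters.
\<close>

lemma dual_representative_eq_div:
  fixes \<Omega> \<Gamma>D :: "(real^'d::finite) set" and y :: "('d, 'l::finite) tfield"
  assumes \<Omega>: "open \<Omega>" "bounded \<Omega>" and p: "1 < p" "1 / p + 1 / p' = 1"
    and div: "has_weak_div \<Omega> y dy"
    and L: "dy \<in> Lp_space (lebesgue_on \<Omega>) p'" "d \<in> Lp_space (lebesgue_on \<Omega>) p'" "f0 \<in> Lp_space (lebesgue_on \<Omega>) p'"
      "w \<in> Lp_space (lebesgue_on \<Omega>) p'"
    and w: "\<forall>v\<in>V_space \<Omega> \<Gamma>D p. iota_star \<Omega> w v = - grad_star \<Omega> y v - iota_star \<Omega> d v + iota_star \<Omega> f0 v"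
  shows "AE x in lebesgue_on \<Omega>. w x = dy x + f0 x - d x"
proof -
  have p': "1 < p'" using Young_conjugate(1)[OF p] .
  have finN: "finite_measure (lebesgue_on \<Omega>)" using \<Omega> by (intro finite_measure_lebesgue_on) auto
  have loc: "locally_integrable \<Omega> u" if "u \<in> Lp_space (lebesgue_on \<Omega>) p'" for u :: "('d, 'l) vfield"
    using Lp_space_imp_integrable[OF finN that] p' \<Omega>(1) by (intro integrable_imp_locally_integrable) auto
  have "AE x in lebesgue_on \<Omega>. w x $ i - (dy x + f0 x - d x) $ i = 0" for i
  proof (rule fundamental_lemma[OF \<Omega>(1)])
    have li: "locally_integrable \<Omega> (\<lambda>x. u x $ i)" if "u \<in> Lp_space (lebesgue_on \<Omega>) p'" for u :: "('d, 'l) vfield"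
      using loc[OF that] by (rule locally_integrable_vec_nth)
    have "(\<lambda>x. dy x + f0 x - d x) \<in> Lp_space (lebesgue_on \<Omega>) p'"
      using L p' by (intro Lp_space_diff Lp_space_add) auto
    from locally_integrable_diff[OF li[OF L(4)] li[OF this]]
    show "locally_integrable \<Omega> (\<lambda>x. w x $ i - (dy x + f0 x - d x) $ i)" .
    fix \<theta> assume \<theta>: "\<theta> \<in> test_functions \<Omega>"
    define v where "v = (\<lambda>x. \<theta> x *\<^sub>R axis i 1 :: real^'l)"
    have "v \<in> V_space \<Omega> \<Gamma>D p"
      unfolding v_def using \<Omega>(1) p \<theta> by (intro test_vfield_in_V) auto
    then have eq: "iota_star \<Omega> w v = - grad_star \<Omega> y v - iota_star \<Omega> d v + iota_star \<Omega> f0 v"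
      using w by blast
    have io: "iota_star \<Omega> u v = (LINT x|lebesgue_on \<Omega>. u x $ i * \<theta> x)" for u
      unfolding iota_star_def v_def by (rule int_pair_test_vfield)
    have "grad_star \<Omega> y v = int_pair \<Omega> y (test_grad \<theta> i)"
      unfolding grad_star_def v_def by (rule int_pair_grad_cong[OF \<Omega>(1) test_vfield_weak_grad[OF \<Omega>(1) \<theta>]])
    also have "\<dots> = (LINT x|lebesgue_on \<Omega>. (\<Sum>j\<in>UNIV. y x $ i $ j * partial_deriv j \<theta> x))"
      unfolding int_pair_def test_grad_def by (simp add: inner_axis) (simp add: inner_vec_def)
    also have "\<dots> = - (LINT x|lebesgue_on \<Omega>. dy x $ i * \<theta> x)"
      using div \<theta> by (simp add: has_weak_div_def)
    finally have gs: "grad_star \<Omega> y v = - (LINT x|lebesgue_on \<Omega>. dy x $ i * \<theta> x)" .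
    have int: "integrable (lebesgue_on \<Omega>) (\<lambda>x. u x $ i * \<theta> x)" if "u \<in> Lp_space (lebesgue_on \<Omega>) p'" for u :: "('d, 'l) vfield"
      using integrable_locally_times_test[OF \<Omega>(1) li[OF that] \<theta>] .
    have "(LINT x|lebesgue_on \<Omega>. (w x $ i - (dy x + f0 x - d x) $ i) * \<theta> x)
      = (LINT x|lebesgue_on \<Omega>. w x $ i * \<theta> x - (dy x $ i * \<theta> x + f0 x $ i * \<theta> x - d x $ i * \<theta> x))"
      by (simp add: algebra_simps)
    also have "\<dots> = 0"
      using int[OF L(1)] int[OF L(2)] int[OF L(3)] int[OF L(4)] eq unfolding io gs by simp
    finally show "(LINT x|lebesgue_on \<Omega>. (w x $ i - (dy x + f0 x - d x) $ i) * \<theta> x) = 0" .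
  qed
  then have "AE x in lebesgue_on \<Omega>. \<forall>i. w x $ i - (dy x + f0 x - d x) $ i = 0"
    by (simp add: AE_all_countable)
  then show ?thesis
    by eventually_elim (simp add: vec_eq_iff)
qed

lemma iota_star_cong_AE:
  fixes \<Omega> :: "(real^'d::finite) set" and w :: "('d, 'l::finite) vfield"
  assumes "open \<Omega>" "AE x in lebesgue_on \<Omega>. w x = w' x"
  shows "iota_star \<Omega> w v = iota_star \<Omega> w' v"
  unfolding iota_star_def int_pair_def
proof (rule integral_cong_AE_complete)
  show "complete_measure (lebesgue_on \<Omega>)"
    using assms(1) by (intro complete_measure_lebesgue_on) auto
  show "AE x in lebesgue_on \<Omega>. w x \<bullet> v x = w' x \<bullet> v x"
    using assms(2) by eventually_elim simp
qed

section \<open>Passage between Bochner spaces and the cylinder\<close>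

lemma Bochner_LpD:
  assumes "u \<in> Bochner_Lp T X N p"
  shows "AE t in lebesgue_on {0<..<T}. u t \<in> X" "integrable (lebesgue_on {0<..<T}) (\<lambda>t. N (u t) powr p)"
  using assms by (auto simp: Bochner_Lp_def)

lemma Lp_Q_sections:
  fixes \<Omega> :: "(real^'d::finite) set" and u :: "real \<Rightarrow> real^'d \<Rightarrow> 'b::euclidean_space"
  assumes \<Omega>: "\<Omega> \<in> sets borel" and u: "u \<in> Lp_Q T \<Omega> p" and p: "0 < p"
  shows "case_prod u \<in> borel_measurable (lebesgue_on (Qcyl T \<Omega>))"
    and "AE t in lebesgue_on {0<..<T}. u t \<in> Lp_space (lebesgue_on \<Omega>) p"
    and "integrable (lebesgue_on {0<..<T}) (\<lambda>t. Lp_norm (lebesgue_on \<Omega>) p (u t) powr p)"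
proof -
  have I: "{0<..<T} \<in> sets borel" by simp
  show m: "case_prod u \<in> borel_measurable (lebesgue_on (Qcyl T \<Omega>))"
    using u by (simp add: Lp_Q_def Lp_space_def)
  have i: "integrable (lebesgue_on (Qcyl T \<Omega>)) (\<lambda>z. norm (case_prod u z) powr p)"
    using u by (simp add: Lp_Q_def Lp_space_def)
  have "AE t in lebesgue_on {0<..<T}. (\<lambda>x. u t x) \<in> borel_measurable (lebesgue_on \<Omega>)"
    using lebesgue_on_Times_section[OF I \<Omega> m] by simp
  then show "AE t in lebesgue_on {0<..<T}. u t \<in> Lp_space (lebesgue_on \<Omega>) p"
    using lebesgue_on_Times_integral(1)[OF I \<Omega> i] by eventually_elim (simp add: Lp_space_def)
  show "integrable (lebesgue_on {0<..<T}) (\<lambda>t. Lp_norm (lebesgue_on \<Omega>) p (u t) powr p)"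
    using lebesgue_on_Times_integral(2)[OF I \<Omega> i] p by (simp add: Lp_norm_powr)
qed

text \<open>Joint measurability of the representative admits Tonelli, and at each time the Sobolev
  norm dominates the Lebesgue norm.\<close>

lemma LpV_in_Lp_Q:
  fixes \<Omega> \<Gamma>D :: "(real^'d::finite) set" and u :: "real \<Rightarrow> ('d, 'l::finite) vfield"
  assumes \<Omega>: "open \<Omega>" and u: "u \<in> LpV T \<Omega> \<Gamma>D p" and p: "0 < p"
  shows "case_prod u \<in> Lp_space (lebesgue_on (Qcyl T \<Omega>)) p"
proof -
  have I: "{0<..<T} \<in> sets borel" and \<Omega>b: "\<Omega> \<in> sets borel" using \<Omega> by auto
  have B: "u \<in> Bochner_Lp T (V_space \<Omega> \<Gamma>D p) (W1p_norm \<Omega> p) p"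
    and m: "case_prod u \<in> borel_measurable (lebesgue_on (Qcyl T \<Omega>))"
    using u by (auto simp: LpV_def jointly_measurable_def)
  note V = Bochner_LpD[OF B]
  have hm: "(\<lambda>z. ennreal (norm (case_prod u z) powr p)) \<in> borel_measurable (lebesgue_on (Qcyl T \<Omega>))"
    using m by measurable
  have "(\<integral>\<^sup>+z. ennreal (norm (case_prod u z) powr p) \<partial>lebesgue_on (Qcyl T \<Omega>))
      = (\<integral>\<^sup>+t. \<integral>\<^sup>+x. ennreal (norm (u t x) powr p) \<partial>lebesgue_on \<Omega> \<partial>lebesgue_on {0<..<T})"
    using lebesgue_on_Times_nn_integral(3)[OF I \<Omega>b hm] by simp
  also have "\<dots> \<le> (\<integral>\<^sup>+t. ennreal (W1p_norm \<Omega> p (u t) powr p) \<partial>lebesgue_on {0<..<T})"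
  proof (rule nn_integral_mono_AE)
    show "AE t in lebesgue_on {0<..<T}. (\<integral>\<^sup>+x. ennreal (norm (u t x) powr p) \<partial>lebesgue_on \<Omega>) \<le> ennreal (W1p_norm \<Omega> p (u t) powr p)"
      using V(1)
    proof eventually_elim
      case (elim t)
      then have "u t \<in> Lp_space (lebesgue_on \<Omega>) p" by (auto simp: V_space_def W1p_def)
      then have "(\<integral>\<^sup>+x. ennreal (norm (u t x) powr p) \<partial>lebesgue_on \<Omega>) = ennreal (LINT x|lebesgue_on \<Omega>. norm (u t x) powr p)"
        by (intro nn_integral_eq_integral Lp_space_integrable) auto
      also have "\<dots> \<le> ennreal (W1p_norm \<Omega> p (u t) powr p)"
        using p by (intro ennreal_leI) (simp add: W1p_norm_powr Lp_norm_powr)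
      finally show ?case .
    qed
  qed
  also have "\<dots> < \<infinity>" using V(2) by (auto simp: real_integrable_def less_top)
  finally have "integrable (lebesgue_on (Qcyl T \<Omega>)) (\<lambda>z. norm (case_prod u z) powr p)"
    using m by (intro integrableI_bounded) auto
  with m show ?thesis by (simp add: Lp_space_def)
qed

section \<open>Lower bounds and the gap identity\<close>

text \<open>A single competitor of energy \<open>X\<close> and pairing \<open>c\<close> bounds a
  conjugate \<open>G\<close> from below, hence its negative part from above. All lower bounds in
  time rest on this estimate.\<close>

lemma e2ennreal_uminus_le:
  assumes "ereal c - X \<le> G" "\<bar>c\<bar> \<le> B"
  shows "e2ennreal (- G) \<le> e2ennreal X + ennreal B"
proof (cases X)
  case (real x)
  show ?thesis
  proof (cases G)
    case (real g)
    have "- g \<le> max 0 x + B" using assms \<open>X = ereal x\<close> real by auto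
    then have "ennreal (- g) \<le> ennreal (max 0 x + B)" by (rule ennreal_leI)
    also have "\<dots> = ennreal (max 0 x) + ennreal B" using assms(2) by (intro ennreal_plus) auto
    also have "ennreal (max 0 x) = ennreal x" by (cases "0 \<le> x") (auto simp: ennreal_neg)
    finally show ?thesis by (simp add: real \<open>X = ereal x\<close>)
  next
    case MInf
    with assms(1) \<open>X = ereal x\<close> show ?thesis by simp
  qed (simp add: e2ennreal_neg)
next
  case MInf
  with assms(1) have "G = \<infinity>" by simp
  then show ?thesis by (simp add: e2ennreal_neg)
qed simp

lemma e2ennreal_uminus_add_le: "e2ennreal (- (G + ereal c)) \<le> e2ennreal (- G) + ennreal \<bar>c\<bar>"
proof (cases G)
  case (real g)
  have "ennreal (- g - c) \<le> ennreal (max 0 (- g) + \<bar>c\<bar>)" by (intro ennreal_leI) auto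
  also have "\<dots> = ennreal (max 0 (- g)) + ennreal \<bar>c\<bar>" by (rule ennreal_plus) auto
  also have "ennreal (max 0 (- g)) = ennreal (- g)" by (cases "0 \<le> - g") (auto simp: ennreal_neg)
  finally show ?thesis by (simp add: real)
qed auto

lemma ext_integral_gt_MInf_if_dominated:
  assumes "AE t in M. e2ennreal (- h t) \<le> a t + ennreal (B t)"
    and "a \<in> borel_measurable M" "(\<integral>\<^sup>+t. a t \<partial>M) < \<infinity>" "integrable M B"
  shows "ext_integral M h > -\<infinity>"
proof (rule ext_integral_gt_MInfI)
  have "(\<integral>\<^sup>+t. e2ennreal (- h t) \<partial>M) \<le> (\<integral>\<^sup>+t. a t + ennreal (B t) \<partial>M)"
    using assms(1) by (rule nn_integral_mono_AE)
  also have "\<dots> = (\<integral>\<^sup>+t. a t \<partial>M) + (\<integral>\<^sup>+t. ennreal (B t) \<partial>M)"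
    using assms(2,4) by (intro nn_integral_add) auto
  also have "\<dots> < \<infinity>" using assms(3,4) by (auto simp: real_integrable_def less_top)
  finally show "(\<integral>\<^sup>+t. e2ennreal (- h t) \<partial>M) < \<infinity>" .
qed

text \<open>The competitor is the gradient of an element of \<open>V\<close> whose energy has
  integrable positive part, as (A) provides; its pairing with \<open>y\<close> is bounded by powers
  of norms that are integrable in time.\<close>

lemma I_time_G_conj_gt_MInf:
  fixes \<Omega> \<Gamma>D :: "(real^'d::finite) set" and y :: "real \<Rightarrow> ('d, 'l::finite) tfield"
  assumes \<Omega>: "open \<Omega>" and p: "1 < p" "1 / p + 1 / p' = 1"
    and y: "y \<in> LpY T \<Omega> p'" and u: "u \<in> LpV T \<Omega> \<Gamma>D p"
    and pos: "pos_part_L1 T (\<lambda>t. I_space \<Omega> \<phi> t (grad \<Omega> (u t)))"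
  shows "I_time T (G_conj \<Omega> p \<phi>) y > -\<infinity>"
  unfolding I_time_def
proof (rule ext_integral_gt_MInf_if_dominated)
  let ?N = "lebesgue_on \<Omega>"
  have Y: "AE t in lebesgue_on {0<..<T}. y t \<in> Lp_space ?N p'" "integrable (lebesgue_on {0<..<T}) (\<lambda>t. Lp_norm ?N p' (y t) powr p')"
    using y Bochner_LpD unfolding LpY_def by auto
  have U: "AE t in lebesgue_on {0<..<T}. u t \<in> V_space \<Omega> \<Gamma>D p" "integrable (lebesgue_on {0<..<T}) (\<lambda>t. W1p_norm \<Omega> p (u t) powr p)"
    using u Bochner_LpD unfolding LpV_def by auto
  show "AE t in lebesgue_on {0<..<T}. e2ennreal (- G_conj \<Omega> p \<phi> t (y t))
      \<le> e2ennreal (I_space \<Omega> \<phi> t (grad \<Omega> (u t))) + ennreal (Lp_norm ?N p' (y t) powr p' + W1p_norm \<Omega> p (u t) powr p)"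
    using Y(1) U(1)
  proof eventually_elim
    case (elim t)
    have g: "grad \<Omega> (u t) \<in> Lp_space ?N p"
      using elim(2) \<Omega> by (intro W1p_grad_Lp) (auto simp: V_space_def)
    show ?case
    proof (rule e2ennreal_uminus_le)
      show "ereal (int_pair \<Omega> (y t) (grad \<Omega> (u t))) - I_space \<Omega> \<phi> t (grad \<Omega> (u t)) \<le> G_conj \<Omega> p \<phi> t (y t)"
        unfolding G_conj_def fenchel_conj_def G_fun_def using g by (intro SUP_upper)
      have "\<bar>int_pair \<Omega> (y t) (grad \<Omega> (u t))\<bar> \<le> Lp_norm ?N p' (y t) powr p' + Lp_norm ?N p (grad \<Omega> (u t)) powr p"
        unfolding int_pair_def by (rule Lp_pair(2)[OF p elim(1) g])
      also have "\<dots> \<le> Lp_norm ?N p' (y t) powr p' + W1p_norm \<Omega> p (u t) powr p"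
        using p by (simp add: W1p_norm_powr)
      finally show "\<bar>int_pair \<Omega> (y t) (grad \<Omega> (u t))\<bar> \<le> Lp_norm ?N p' (y t) powr p' + W1p_norm \<Omega> p (u t) powr p" .
    qed
  qed
  show "integrable (lebesgue_on {0<..<T}) (\<lambda>t. Lp_norm ?N p' (y t) powr p' + W1p_norm \<Omega> p (u t) powr p)"
    using Y(2) U(2) by simp
qed (use pos in \<open>auto simp: pos_part_L1_def\<close>)

text \<open>Here the competitor is \<open>u\<close> itself, whose \<open>F\<close>-energy is finite;
  of \<open>\<xi>\<close> only a bound on \<open>\<xi> t (u t)\<close> integrable in time
  enters.\<close>

lemma I_time_F_conj_gt_MInf:
  fixes \<Omega> \<Gamma>D :: "(real^'d::finite) set" and u :: "real \<Rightarrow> ('d, 'l::finite) vfield"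
  assumes u: "u \<in> LpV T \<Omega> \<Gamma>D p" and F: "\<bar>I_time T (F_fun \<Omega> \<psi> f) u\<bar> \<noteq> \<infinity>"
    and B: "integrable (lebesgue_on {0<..<T}) B" "AE t in lebesgue_on {0<..<T}. \<bar>\<xi> t (u t)\<bar> \<le> B t"
  shows "I_time T (F_conj \<Omega> \<Gamma>D p \<psi> f) \<xi> > -\<infinity>"
proof -
  note Ff = ext_integral_finite[OF F[unfolded I_time_def]]
  let ?l = "\<lambda>t. real_of_ereal (F_fun \<Omega> \<psi> f t (u t))"
  have U: "AE t in lebesgue_on {0<..<T}. u t \<in> V_space \<Omega> \<Gamma>D p"
    using u Bochner_LpD unfolding LpV_def by auto
  show ?thesis
    unfolding I_time_def
  proof (rule ext_integral_gt_MInf_if_dominated)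
    show "AE t in lebesgue_on {0<..<T}. e2ennreal (- F_conj \<Omega> \<Gamma>D p \<psi> f t (\<xi> t)) \<le> ennreal (?l t) + ennreal (B t)"
      using U B(2) Ff(2)
    proof eventually_elim
      case (elim t)
      have "ereal (\<xi> t (u t)) - F_fun \<Omega> \<psi> f t (u t) \<le> F_conj \<Omega> \<Gamma>D p \<psi> f t (\<xi> t)"
        unfolding F_conj_def fenchel_conj_def using elim(1) by (intro SUP_upper)
      from e2ennreal_uminus_le[OF this elim(2)] show ?case
        using elim(3) by (metis e2ennreal_ereal)
    qed
    show "(\<integral>\<^sup>+t. ennreal (?l t) \<partial>lebesgue_on {0<..<T}) < \<infinity>" using Ff(1) by (auto simp: real_integrable_def less_top)
  qed (use B(1) Ff(1) in auto)
qed

text \<open>If the integral of the conjugate is \<open>\<infinity>\<close>, the left side is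
  \<open>-\<infinity>\<close>; if the energy is \<open>\<infinity>\<close>, so is the right side. In
  the remaining case \<open>ext_integral_Young\<close> makes both finite, and the pointwise
  inequality can be integrated.\<close>

lemma integral_functional_Young:
  fixes \<Omega> :: "(real^'d::finite) set"
  assumes int: "integrable (lebesgue_on \<Omega>) (\<lambda>x. z x \<bullet> v x)"
    and nm: "\<And>x r. x \<in> \<Omega> \<Longrightarrow> \<phi> t x r \<noteq> -\<infinity>"
  shows "ereal (int_pair \<Omega> z v) - I_space \<Omega> (integrand_conj \<phi>) t z \<le> I_space \<Omega> \<phi> t v"
proof (cases "I_space \<Omega> (integrand_conj \<phi>) t z = \<infinity> \<or> I_space \<Omega> \<phi> t v = \<infinity>")
  case False
  let ?N = "lebesgue_on \<Omega>"
  define a where "a x = integrand_conj \<phi> t x (z x)" for x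
  define b where "b x = \<phi> t x (v x)" for x
  have ab: "AE x in ?N. ereal (z x \<bullet> v x) \<le> a x + b x"
  proof (rule AE_I2)
    fix x assume "x \<in> space ?N"
    then have "b x \<noteq> -\<infinity>" using nm by (simp add: b_def)
    moreover have "ereal (z x \<bullet> v x) - b x \<le> a x"
      unfolding a_def b_def integrand_conj_def fenchel_conj_def by (intro SUP_upper) simp
    ultimately show "ereal (z x \<bullet> v x) \<le> a x + b x" by (cases "a x"; cases "b x") auto
  qed
  have ba: "AE x in ?N. ereal (z x \<bullet> v x) \<le> b x + a x" using ab by (simp add: add.commute)
  have I: "I_space \<Omega> (integrand_conj \<phi>) t z = ext_integral ?N a" "I_space \<Omega> \<phi> t v = ext_integral ?N b"
    by (simp_all add: I_space_def a_def[abs_def] b_def[abs_def])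
  have lt: "ext_integral ?N a < \<infinity>" "ext_integral ?N b < \<infinity>" using False by (auto simp: I)
  have fa: "\<bar>ext_integral ?N a\<bar> \<noteq> \<infinity>" by (rule ext_integral_Young[OF lt int ab])
  have fb: "\<bar>ext_integral ?N b\<bar> \<noteq> \<infinity>" by (rule ext_integral_Young[OF lt(2,1) int ba])
  have "ereal (LINT x|?N. z x \<bullet> v x) \<le> ext_integral ?N a + ext_integral ?N b"
    by (rule ext_integral_Young_le[OF fa fb int ab])
  then show ?thesis unfolding I int_pair_def
    using fa fb by (cases "ext_integral ?N a"; cases "ext_integral ?N b") auto
qed auto

text \<open>The roles of integrand and conjugate are exchanged: the dual element \<open>z\<close>
  from (A) bounds the \<open>\<phi>\<close>-energy from below, and the finite \<open>F\<close>-part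
  only shifts this bound by an integrable function.\<close>

lemma I_time_E_gt_MInf:
  fixes \<Omega> \<Gamma>D :: "(real^'d::finite) set" and z :: "real \<Rightarrow> ('d, 'l::finite) tfield"
  assumes \<Omega>: "open \<Omega>" and p: "1 < p" "1 / p + 1 / p' = 1"
    and nm: "\<And>t x r. t \<in> {0<..<T} \<Longrightarrow> x \<in> \<Omega> \<Longrightarrow> \<phi> t x r \<noteq> -\<infinity>"
    and z: "z \<in> LpY T \<Omega> p'" and u: "u \<in> LpV T \<Omega> \<Gamma>D p"
    and pos: "pos_part_L1 T (\<lambda>t. I_space \<Omega> (integrand_conj \<phi>) t (z t))"
    and F: "\<bar>I_time T (F_fun \<Omega> \<psi> f) u\<bar> \<noteq> \<infinity>"
  shows "I_time T (E_fun \<Omega> \<phi> \<psi> f) u > -\<infinity>"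
proof -
  let ?N = "lebesgue_on \<Omega>"
  note Ff = ext_integral_finite[OF F[unfolded I_time_def]]
  let ?l = "\<lambda>t. real_of_ereal (F_fun \<Omega> \<psi> f t (u t))"
  have Z: "AE t in lebesgue_on {0<..<T}. z t \<in> Lp_space ?N p'" "integrable (lebesgue_on {0<..<T}) (\<lambda>t. Lp_norm ?N p' (z t) powr p')"
    using z Bochner_LpD unfolding LpY_def by auto
  have U: "AE t in lebesgue_on {0<..<T}. u t \<in> V_space \<Omega> \<Gamma>D p" "integrable (lebesgue_on {0<..<T}) (\<lambda>t. W1p_norm \<Omega> p (u t) powr p)"
    using u Bochner_LpD unfolding LpV_def by auto
  let ?B = "\<lambda>t. Lp_norm ?N p' (z t) powr p' + W1p_norm \<Omega> p (u t) powr p"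
  show ?thesis
    unfolding I_time_def
  proof (rule ext_integral_gt_MInf_if_dominated)
    show "AE t in lebesgue_on {0<..<T}. e2ennreal (- E_fun \<Omega> \<phi> \<psi> f t (u t))
        \<le> e2ennreal (I_space \<Omega> (integrand_conj \<phi>) t (z t)) + ennreal (?B t + \<bar>?l t\<bar>)"
      using Z(1) U(1) Ff(2) AE_space
    proof eventually_elim
      case (elim t)
      have g: "grad \<Omega> (u t) \<in> Lp_space ?N p"
        using elim(2) \<Omega> by (intro W1p_grad_Lp) (auto simp: V_space_def)
      have "\<bar>int_pair \<Omega> (z t) (grad \<Omega> (u t))\<bar> \<le> Lp_norm ?N p' (z t) powr p' + Lp_norm ?N p (grad \<Omega> (u t)) powr p"
        unfolding int_pair_def by (rule Lp_pair(2)[OF p elim(1) g])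
      also have "\<dots> \<le> ?B t" using p by (simp add: W1p_norm_powr)
      finally have bd: "\<bar>int_pair \<Omega> (z t) (grad \<Omega> (u t))\<bar> \<le> ?B t" .
      have "ereal (int_pair \<Omega> (z t) (grad \<Omega> (u t))) - I_space \<Omega> (integrand_conj \<phi>) t (z t) \<le> I_space \<Omega> \<phi> t (grad \<Omega> (u t))"
        using elim(4) nm by (intro integral_functional_Young Lp_pair(1)[OF p elim(1) g]) auto
      from e2ennreal_uminus_le[OF this bd]
      have "e2ennreal (- I_space \<Omega> \<phi> t (grad \<Omega> (u t))) \<le> e2ennreal (I_space \<Omega> (integrand_conj \<phi>) t (z t)) + ennreal (?B t)" .
      then have s1: "e2ennreal (- I_space \<Omega> \<phi> t (grad \<Omega> (u t))) + ennreal \<bar>?l t\<bar>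
          \<le> e2ennreal (I_space \<Omega> (integrand_conj \<phi>) t (z t)) + ennreal (?B t) + ennreal \<bar>?l t\<bar>"
        by (rule add_right_mono)
      have s2: "e2ennreal (- E_fun \<Omega> \<phi> \<psi> f t (u t)) \<le> e2ennreal (- I_space \<Omega> \<phi> t (grad \<Omega> (u t))) + ennreal \<bar>?l t\<bar>"
        unfolding E_fun_def G_fun_def by (subst elim(3)) (rule e2ennreal_uminus_add_le)
      have s3: "ennreal (?B t) + ennreal \<bar>?l t\<bar> = ennreal (?B t + \<bar>?l t\<bar>)"
        by (intro ennreal_plus[symmetric] add_nonneg_nonneg powr_ge_zero abs_ge_zero)
      show ?case
        using order.trans[OF s2 s1] unfolding s3[symmetric] add.assoc[symmetric] .
    qed
    show "integrable (lebesgue_on {0<..<T}) (\<lambda>t. ?B t + \<bar>?l t\<bar>)"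
      by (intro Bochner_Integration.integrable_add integrable_abs Z(2) U(2) Ff(1))
  qed (use pos in \<open>auto simp: pos_part_L1_def\<close>)
qed

section \<open>Fenchel gaps at a fixed time and the gap identity\<close>

lemma H_norm_sq: "(H_norm \<Omega> u)\<^sup>2 = (LINT x|lebesgue_on \<Omega>. u x \<bullet> u x)"
proof -
  have "(H_norm \<Omega> u)\<^sup>2 = H_norm \<Omega> u powr 2" by simp
  also have "\<dots> = (LINT x|lebesgue_on \<Omega>. norm (u x) powr 2)" by (rule Lp_norm_powr) simp
  also have "\<dots> = (LINT x|lebesgue_on \<Omega>. u x \<bullet> u x)" by (simp add: power2_norm_eq_inner)
  finally show ?thesis .
qed

lemma H_norm_diff_sq:
  assumes "u \<in> H_space \<Omega>" "v \<in> H_space \<Omega>"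
  shows "(H_norm \<Omega> (\<lambda>x. u x - v x))\<^sup>2 = (H_norm \<Omega> u)\<^sup>2 - 2 * int_pair \<Omega> u v + (H_norm \<Omega> v)\<^sup>2"
proof -
  have two: "1 < (2::real)" "1 / 2 + 1 / 2 = (1::real)" by auto
  have "(LINT x|lebesgue_on \<Omega>. (u x - v x) \<bullet> (u x - v x)) = (LINT x|lebesgue_on \<Omega>. u x \<bullet> u x - 2 * (u x \<bullet> v x) + v x \<bullet> v x)"
    by (intro Bochner_Integration.integral_cong) (auto simp: inner_diff_left inner_diff_right inner_commute)
  also have "\<dots> = (LINT x|lebesgue_on \<Omega>. u x \<bullet> u x) - 2 * (LINT x|lebesgue_on \<Omega>. u x \<bullet> v x) + (LINT x|lebesgue_on \<Omega>. v x \<bullet> v x)"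
    using Lp_pair(1)[OF two assms(1) assms(1)] Lp_pair(1)[OF two assms] Lp_pair(1)[OF two assms(2) assms(2)] by simp
  finally show ?thesis by (simp add: H_norm_sq int_pair_def)
qed

text \<open>With both extended integrals finite and the pairing integrable, which is the situation
  at a fixed time, the gap may be split into three integrals. The second claim allows such values to
  be added in \<open>ennreal\<close> without truncation at 0.\<close>

lemma nn_integral_Fenchel_gap:
  fixes a b :: "'x \<Rightarrow> ereal"
  assumes a: "\<bar>ext_integral M a\<bar> \<noteq> \<infinity>" and b: "\<bar>ext_integral M b\<bar> \<noteq> \<infinity>" and c: "integrable M c"
    and ge: "\<And>x. x \<in> space M \<Longrightarrow> 0 \<le> a x - ereal (c x) + b x"
  shows "(\<integral>\<^sup>+x. e2ennreal (a x - ereal (c x) + b x) \<partial>M)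
      = ennreal (real_of_ereal (ext_integral M a) - (LINT x|M. c x) + real_of_ereal (ext_integral M b))"
    and "0 \<le> real_of_ereal (ext_integral M a) - (LINT x|M. c x) + real_of_ereal (ext_integral M b)"
proof -
  note A = ext_integral_finite[OF a] and B = ext_integral_finite[OF b]
  define h where "h x = real_of_ereal (a x) - c x + real_of_ereal (b x)" for x
  have hi: "integrable M h" unfolding h_def using A(1) B(1) c by simp
  have ae: "AE x in M. a x - ereal (c x) + b x = ereal (h x)"
    using A(2) B(2)
  proof eventually_elim
    case (elim x)
    then show ?case by (cases "a x"; cases "b x") (auto simp: h_def)
  qed
  have h0: "AE x in M. 0 \<le> h x"
    using ae AE_space
  proof eventually_elim
    case (elim x)
    then show ?case using ge[of x] by simp
  qed
  have int: "(LINT x|M. h x) = real_of_ereal (ext_integral M a) - (LINT x|M. c x) + real_of_ereal (ext_integral M b)"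
    unfolding h_def A(3) B(3) using A(1) B(1) c by simp
  have "(\<integral>\<^sup>+x. e2ennreal (a x - ereal (c x) + b x) \<partial>M) = (\<integral>\<^sup>+x. ennreal (h x) \<partial>M)"
    using ae by (intro nn_integral_cong_AE) (auto elim!: eventually_mono)
  also have "\<dots> = ennreal (LINT x|M. h x)" using hi h0 by (rule nn_integral_eq_integral)
  finally show "(\<integral>\<^sup>+x. e2ennreal (a x - ereal (c x) + b x) \<partial>M)
      = ennreal (real_of_ereal (ext_integral M a) - (LINT x|M. c x) + real_of_ereal (ext_integral M b))"
    by (simp add: int)
  have "0 \<le> (LINT x|M. h x)" using h0 by (rule integral_nonneg_AE)
  then show "0 \<le> real_of_ereal (ext_integral M a) - (LINT x|M. c x) + real_of_ereal (ext_integral M b)"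
    by (simp add: int)
qed

text \<open>Where \<open>\<phi> t x v = \<infinity>\<close> the gap is \<open>\<infinity>\<close>
  even if the conjugate is \<open>-\<infinity>\<close>, by the convention for sums in
  \<open>ereal\<close>. The gap is thus nonnegative at every point at which the integrand avoids
  \<open>-\<infinity>\<close>, and not merely almost everywhere.\<close>

lemma integrand_conj_gap_nonneg:
  assumes "\<phi> t x v \<noteq> -\<infinity>"
  shows "0 \<le> integrand_conj \<phi> t x z - ereal (z \<bullet> v) + \<phi> t x v"
proof -
  have "ereal (z \<bullet> v) - \<phi> t x v \<le> integrand_conj \<phi> t x z"
    unfolding integrand_conj_def fenchel_conj_def by (intro SUP_upper) simp
  with assms show ?thesis by (cases "\<phi> t x v"; cases "integrand_conj \<phi> t x z") auto
qed

lemma ext_integral_nonneg: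
  assumes "h \<in> borel_measurable M" "\<And>x. x \<in> space M \<Longrightarrow> 0 \<le> h x"
  shows "ext_integral M h = enn2ereal (\<integral>\<^sup>+x. e2ennreal (h x) \<partial>M)"
proof -
  have "(\<integral>\<^sup>+x. e2ennreal (- h x) \<partial>M) = (\<integral>\<^sup>+x. 0 \<partial>M)"
    using assms(2) by (intro nn_integral_cong) (simp add: e2ennreal_neg)
  then show ?thesis
    using assms(1) by (auto simp: ext_integral_def zero_ennreal.rep_eq less_top[symmetric])
qed

text \<open>The derivatives enter as given representatives \<open>div_y\<close>,
  \<open>dt_lam\<close> and \<open>grad_lam\<close>. In particular \<open>grad\<close> chooses a
  gradient separately at each time, which need not produce a jointly measurable function, while the
  integrals over the cylinder call for one.\<close>

theorem corollary4p11:
  fixes \<Omega> \<Gamma>D \<Gamma>N :: "(real^'d::finite) set"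
    and T p p' :: real
    and \<phi> :: "real \<Rightarrow> real^'d \<Rightarrow> real^'d^'l::finite \<Rightarrow> ereal"
    and \<psi> :: "real \<Rightarrow> real^'d \<Rightarrow> real^'l \<Rightarrow> ereal"
    and f :: "real \<Rightarrow> ('d, 'l) vdual"
    and u0 :: "('d, 'l) vfield"
    and f0 :: "real \<Rightarrow> ('d, 'l) vfield"
    and y :: "real \<Rightarrow> ('d, 'l) tfield"
    and lam :: "real \<Rightarrow> ('d, 'l) vfield"
    and div_y dt_lam :: "real \<Rightarrow> ('d, 'l) vfield"
    and grad_lam :: "real \<Rightarrow> ('d, 'l) tfield"
  assumes "lipschitz_domain \<Omega>" and "bounded \<Omega>" and "boundary_partition \<Omega> \<Gamma>D \<Gamma>N"
    and "T > 0" and "1 < p" and "p \<ge> 2 * real CARD('d) / (real CARD('d) + 2)"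
    and "1 / p + 1 / p' = 1"
    and "f \<in> LpVdual T \<Omega> \<Gamma>D p p'" and "u0 \<in> H_space \<Omega>"
    and "assumption_A T \<Omega> \<Gamma>D p p' \<phi> \<psi>"
    and "assumption_B T \<Omega> \<Gamma>D p \<psi> f"
    and "assumption_C T \<Omega> \<Gamma>D p p' \<psi> f"
    and "f0 \<in> Lp_Q T \<Omega> p'"
    and "AE t in lebesgue_on {0<..<T}. \<forall>v \<in> V_space \<Omega> \<Gamma>D p. f t v = iota_star \<Omega> (f0 t) v"
    and "\<exists>u \<in> LpV T \<Omega> \<Gamma>D p.
           I_time T (G_fun \<Omega> \<phi>) (\<lambda>t. grad \<Omega> (u t)) < \<infinity> \<and> I_time T (F_fun \<Omega> \<psi> f) u < \<infinity> \<and>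
           (continuous_at_in (LpV T \<Omega> \<Gamma>D p) (LpV_norm T \<Omega> p)
              (\<lambda>v. I_time T (G_fun \<Omega> \<phi>) (\<lambda>t. grad \<Omega> (v t))) u \<or>
            continuous_at_in (LpV T \<Omega> \<Gamma>D p) (LpV_norm T \<Omega> p) (I_time T (F_fun \<Omega> \<psi> f)) u)"
    and "(y, lam) \<in> dom_neg_D T \<Omega> \<Gamma>D p p' \<phi> \<psi> f u0"
    and "div_y \<in> Lp_Q T \<Omega> p'"
    and "AE t in lebesgue_on {0<..<T}. has_weak_div \<Omega> (y t) (div_y t)"
    and "dt_lam \<in> Lp_Q T \<Omega> p'"
    and "AE t in lebesgue_on {0<..<T}. \<forall>v \<in> V_space \<Omega> \<Gamma>D p.
           time_deriv T \<Omega> \<Gamma>D p p' lam t v = iota_star \<Omega> (dt_lam t) v"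
    and "grad_lam \<in> LpY T \<Omega> p"
    and "AE t in lebesgue_on {0<..<T}. has_weak_grad \<Omega> (lam t) (grad_lam t)"
  shows "eta_sq T \<Omega> \<Gamma>D p p' \<phi> \<psi> f u0 y lam =
      ext_integral (lebesgue_on (Qcyl T \<Omega>)) (\<lambda>(t, x).
        integrand_conj \<phi> t x (y t x) - ereal (y t x \<bullet> grad_lam t x) + \<phi> t x (grad_lam t x))
    + ext_integral (lebesgue_on (Qcyl T \<Omega>)) (\<lambda>(t, x).
        integrand_conj \<psi> t x (div_y t x + f0 t x - dt_lam t x)
        - ereal ((div_y t x + f0 t x - dt_lam t x) \<bullet> lam t x) + \<psi> t x (lam t x))
    + ereal ((H_norm \<Omega> (\<lambda>x. lam 0 x - u0 x))\<^sup>2 / 2)"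
proof -
  let ?I = "lebesgue_on {0<..<T}" and ?N = "lebesgue_on \<Omega>" and ?Q = "lebesgue_on (Qcyl T \<Omega>)"
  define w where "w t x = div_y t x + f0 t x - dt_lam t x" for t x
  define \<xi> where "\<xi> = (\<lambda>t v. - grad_star \<Omega> (y t) v - time_deriv T \<Omega> \<Gamma>D p p' lam t v)"
  have \<Omega>: "open \<Omega>" "bounded \<Omega>" using assms(1,2) by (auto simp: lipschitz_domain_def)
  note T = assms(4) and p = assms(5,7)
  have p0: "0 < p" and p': "1 < p'" using Young_conjugate(1)[OF p] p by auto
  have Ib: "{0<..<T} \<in> sets borel" and \<Omega>b: "\<Omega> \<in> sets borel" using \<Omega>(1) by auto
  have cI: "complete_measure ?I" and cN: "complete_measure ?N"
    using Ib \<Omega>b by (auto intro: complete_measure_lebesgue_on sets_lebesgue_borel)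

  have yY: "y \<in> LpY T \<Omega> p'" and lamW: "lam \<in> W_space T \<Omega> \<Gamma>D p p'"
    and D: "dual_functional T \<Omega> \<Gamma>D p p' \<phi> \<psi> f u0 y lam > -\<infinity>"
    using assms(16) by (auto simp: dom_neg_D_def)
  have lamV: "lam \<in> LpV T \<Omega> \<Gamma>D p" and H: "\<forall>t\<in>{0..T}. lam t \<in> H_space \<Omega> \<and>
      ((\<lambda>s. H_norm \<Omega> (\<lambda>x. lam s x - lam t x)) \<longlongrightarrow> 0) (at t within {0..T})"
    using lamW by (auto simp: W_space_def)
  have td: "time_deriv T \<Omega> \<Gamma>D p p' lam \<in> LpVdual T \<Omega> \<Gamma>D p p'"
    and tdw: "has_time_deriv T \<Omega> \<Gamma>D p lam (time_deriv T \<Omega> \<Gamma>D p p' lam)"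
  proof -
    have "\<exists>\<xi>. \<xi> \<in> LpVdual T \<Omega> \<Gamma>D p p' \<and> has_time_deriv T \<Omega> \<Gamma>D p lam \<xi>"
      using lamW by (auto simp: W_space_def)
    from someI_ex[OF this]
    show "time_deriv T \<Omega> \<Gamma>D p p' lam \<in> LpVdual T \<Omega> \<Gamma>D p p'"
      "has_time_deriv T \<Omega> \<Gamma>D p lam (time_deriv T \<Omega> \<Gamma>D p p' lam)"
      unfolding time_deriv_def by auto
  qed
  have cni: "convex_normal_integrand T \<Omega> \<phi>" "convex_normal_integrand T \<Omega> \<psi>"
    using assms(10) by (auto simp: assumption_A_def)
  have nm: "\<phi> t x r \<noteq> -\<infinity>" "\<psi> t x r' \<noteq> -\<infinity>" if "t \<in> {0<..<T}" "x \<in> \<Omega>" for t x r r'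
    using cni that by (auto simp: convex_normal_integrand_def)
  obtain us zs where us: "us \<in> LpV T \<Omega> \<Gamma>D p" and zs: "zs \<in> LpY T \<Omega> p'"
    and pos: "pos_part_L1 T (\<lambda>t. I_space \<Omega> \<phi> t (grad \<Omega> (us t)))"
      "pos_part_L1 T (\<lambda>t. I_space \<Omega> (integrand_conj \<phi>) t (zs t))"
    using assms(10) by (auto simp: assumption_A_def)
  have Ffin: "\<bar>I_time T (F_fun \<Omega> \<psi> f) lam\<bar> \<noteq> \<infinity>"
    using assms(11) lamV by (auto simp: assumption_B_def)

  have Yt: "AE t in ?I. y t \<in> Lp_space ?N p'" "integrable ?I (\<lambda>t. Lp_norm ?N p' (y t) powr p')"
    and Ym: "case_prod y \<in> borel_measurable ?Q"
    using yY Bochner_LpD unfolding LpY_def jointly_measurable_def by auto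
  have GLt: "AE t in ?I. grad_lam t \<in> Lp_space ?N p" and GLm: "case_prod grad_lam \<in> borel_measurable ?Q"
    using assms(21) Bochner_LpD unfolding LpY_def jointly_measurable_def by auto
  have Lt: "AE t in ?I. lam t \<in> V_space \<Omega> \<Gamma>D p" "integrable ?I (\<lambda>t. W1p_norm \<Omega> p (lam t) powr p)"
    and Lm: "case_prod lam \<in> borel_measurable ?Q"
    using lamV Bochner_LpD unfolding LpV_def jointly_measurable_def by auto
  have LQ: "case_prod lam \<in> Lp_space ?Q p" using \<Omega>(1) lamV p0 by (rule LpV_in_Lp_Q)
  have p'0: "0 < p'" using p' by simp
  note dt = Lp_Q_sections[OF \<Omega>b assms(19) p'0]
  note dv = Lp_Q_sections[OF \<Omega>b assms(17) p'0]
  note ff = Lp_Q_sections[OF \<Omega>b assms(13) p'0]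
  have dtQ: "case_prod dt_lam \<in> Lp_space ?Q p'" using assms(19) by (simp add: Lp_Q_def)
  have wm: "case_prod w \<in> borel_measurable ?Q"
    using dt(1) dv(1) ff(1) by (simp add: w_def[abs_def] case_prod_beta')
  have wt: "AE t in ?I. w t \<in> Lp_space ?N p'"
    using dt(2) dv(2) ff(2) by eventually_elim (auto simp: w_def[abs_def] intro!: Lp_space_diff Lp_space_add p'0)
  have GL: "AE t in ?I. grad_lam t \<in> Lp_space ?N p \<and> (AE x in ?N. grad \<Omega> (lam t) x = grad_lam t x)"
    using GLt assms(22)
    by eventually_elim (auto intro: has_weak_grad_unique[OF \<Omega>(1)] has_weak_grad_grad)

  \<comment> \<open>\<open>dt_lam\<close> may replace \<open>time_deriv\<close> in the weak identity
    because at almost every time the two agree as functionals on \<open>V\<close>.\<close>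
  have energy: "integrable ?Q (\<lambda>(t, x). dt_lam t x \<bullet> lam t x)"
    "(LINT z|?Q. (\<lambda>(t, x). dt_lam t x \<bullet> lam t x) z) = (H_norm \<Omega> (lam T))\<^sup>2 / 2 - (H_norm \<Omega> (lam 0))\<^sup>2 / 2"
  proof -
    have weak: "(LINT t|?I. int_pair \<Omega> (lam t) v * deriv \<theta> t) = - (LINT t|?I. int_pair \<Omega> (dt_lam t) v * \<theta> t)"
      if "\<theta> \<in> test_functions {0<..<T}" "v \<in> V_space \<Omega> \<Gamma>D p" for \<theta> v
    proof -
      have "(LINT t|?I. time_deriv T \<Omega> \<Gamma>D p p' lam t v * \<theta> t) = (LINT t|?I. int_pair \<Omega> (dt_lam t) v * \<theta> t)"
      proof (rule integral_cong_AE_complete[OF cI])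
        show "AE t in ?I. time_deriv T \<Omega> \<Gamma>D p p' lam t v * \<theta> t = int_pair \<Omega> (dt_lam t) v * \<theta> t"
          using assms(20)
        proof eventually_elim
          case (elim t)
          then have "time_deriv T \<Omega> \<Gamma>D p p' lam t v = iota_star \<Omega> (dt_lam t) v" using that(2) by blast
          then show ?case by (simp add: iota_star_def)
        qed
      qed
      then show ?thesis using tdw that unfolding has_time_deriv_def by simp
    qed
    show "integrable ?Q (\<lambda>(t, x). dt_lam t x \<bullet> lam t x)"
      "(LINT z|?Q. (\<lambda>(t, x). dt_lam t x \<bullet> lam t x) z) = (H_norm \<Omega> (lam T))\<^sup>2 / 2 - (H_norm \<Omega> (lam 0))\<^sup>2 / 2"
      using time_derivative_energy[OF T \<Omega> p LQ dtQ H weak] by blast+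
  qed
  define dl where "dl t = int_pair \<Omega> (dt_lam t) (lam t)" for t
  have dli: "integrable ?I dl" and dlI: "(LINT t|?I. dl t) = (H_norm \<Omega> (lam T))\<^sup>2 / 2 - (H_norm \<Omega> (lam 0))\<^sup>2 / 2"
    using lebesgue_on_Times_integral(2,3)[OF Ib \<Omega>b energy(1)] energy(2)
    by (simp_all add: dl_def[abs_def] int_pair_def)

  have \<xi>_eq: "AE t in ?I. \<forall>v\<in>V_space \<Omega> \<Gamma>D p. \<xi> t v = - grad_star \<Omega> (y t) v - iota_star \<Omega> (dt_lam t) v"
    using assms(20) by eventually_elim (simp add: \<xi>_def)
  have \<xi>_dual: "AE t in ?I. \<xi> t \<in> V_dual \<Omega> \<Gamma>D p"
  proof -
    have "AE t in ?I. time_deriv T \<Omega> \<Gamma>D p p' lam t \<in> V_dual \<Omega> \<Gamma>D p"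
      using td unfolding LpVdual_def by (rule Bochner_LpD)
    then show ?thesis
      using Yt(1)
    proof eventually_elim
      case (elim t)
      then show ?case
        unfolding \<xi>_def by (intro dual_space_minus_diff grad_star_in_V_dual[OF \<Omega>(1) p])
    qed
  qed

  define a where "a = I_time T (G_conj \<Omega> p \<phi>) y"
  define b where "b = I_time T (F_conj \<Omega> \<Gamma>D p \<psi> f) \<xi>"
  define c where "c = I_time T (E_fun \<Omega> \<phi> \<psi> f) lam"
  have a: "a > -\<infinity>"
    unfolding a_def by (rule I_time_G_conj_gt_MInf[OF \<Omega>(1) p yY us pos(1)])
  have b: "b > -\<infinity>"
    unfolding b_def
  proof (rule I_time_F_conj_gt_MInf[OF lamV Ffin])
    let ?B = "\<lambda>t. (Lp_norm ?N p' (y t) powr p' + W1p_norm \<Omega> p (lam t) powr p) + (Lp_norm ?N p' (dt_lam t) powr p' + W1p_norm \<Omega> p (lam t) powr p)"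
    show "integrable ?I ?B" using Yt(2) Lt(2) dt(3) by simp
    show "AE t in ?I. \<bar>\<xi> t (lam t)\<bar> \<le> ?B t"
      using \<xi>_eq Lt(1) Yt(1) dt(2)
    proof eventually_elim
      case (elim t)
      have W: "lam t \<in> W1p \<Omega> p" using elim(2) by (auto simp: V_space_def)
      have g: "grad \<Omega> (lam t) \<in> Lp_space ?N p" and l: "lam t \<in> Lp_space ?N p"
        using W1p_grad_Lp[OF \<Omega>(1) W] W by (auto simp: W1p_def)
      have "\<bar>grad_star \<Omega> (y t) (lam t)\<bar> \<le> Lp_norm ?N p' (y t) powr p' + Lp_norm ?N p (grad \<Omega> (lam t)) powr p"
        unfolding grad_star_def int_pair_def by (rule Lp_pair(2)[OF p elim(3) g])
      moreover have "\<bar>iota_star \<Omega> (dt_lam t) (lam t)\<bar> \<le> Lp_norm ?N p' (dt_lam t) powr p' + Lp_norm ?N p (lam t) powr p"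
        unfolding iota_star_def int_pair_def by (rule Lp_pair(2)[OF p elim(4) l])
      moreover have "\<xi> t (lam t) = - grad_star \<Omega> (y t) (lam t) - iota_star \<Omega> (dt_lam t) (lam t)"
        using elim(1,2) by blast
      moreover have "Lp_norm ?N p (grad \<Omega> (lam t)) powr p \<le> W1p_norm \<Omega> p (lam t) powr p"
        "Lp_norm ?N p (lam t) powr p \<le> W1p_norm \<Omega> p (lam t) powr p"
        using p0 by (auto simp: W1p_norm_powr)
      ultimately show ?case by linarith
    qed
  qed
  have c: "c > -\<infinity>"
    unfolding c_def using nm by (intro I_time_E_gt_MInf[OF \<Omega>(1) p _ zs lamV pos(2) Ffin])
  have Dabc: "dual_functional T \<Omega> \<Gamma>D p p' \<phi> \<psi> f u0 y lam
      = - a - b - c - ereal ((H_norm \<Omega> (lam T))\<^sup>2 / 2) + ereal (int_pair \<Omega> (lam 0) u0)"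
    by (simp add: dual_functional_def a_def b_def c_def \<xi>_def)
  \<comment> \<open>None of the three values is \<open>-\<infinity>\<close>, so their negatives
    cannot compensate one another, and a dual value above \<open>-\<infinity>\<close> excludes
    \<open>\<infinity>\<close> for each of them.\<close>
  have fin: "\<bar>a\<bar> \<noteq> \<infinity>" "\<bar>b\<bar> \<noteq> \<infinity>" "\<bar>c\<bar> \<noteq> \<infinity>"
    using D a b c unfolding Dabc by (cases a; cases b; cases c; simp)+
  note Af = ext_integral_finite[OF fin(1)[unfolded a_def I_time_def]]
  note Bf = ext_integral_finite[OF fin(2)[unfolded b_def I_time_def]]
  note Cf = ext_integral_finite[OF fin(3)[unfolded c_def I_time_def]]
  note Ff = ext_integral_finite[OF Ffin[unfolded I_time_def]]

  \<comment> \<open>A finite \<open>E\<close> controls only the sum of the two energies; the finite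
    \<open>F\<close>-energy of \<open>\<lambda>\<close> separates them. The chosen gradient gives
    way to \<open>grad_lam\<close> at the same time.\<close>
  have E_split: "AE t in ?I. \<bar>I_space \<Omega> \<phi> t (grad_lam t)\<bar> \<noteq> \<infinity> \<and> \<bar>I_space \<Omega> \<psi> t (lam t)\<bar> \<noteq> \<infinity> \<and>
      real_of_ereal (E_fun \<Omega> \<phi> \<psi> f t (lam t))
        = real_of_ereal (I_space \<Omega> \<phi> t (grad_lam t)) + (real_of_ereal (I_space \<Omega> \<psi> t (lam t)) - f t (lam t))"
    using Cf(2) Ff(2) GL
  proof eventually_elim
    case (elim t)
    have "I_space \<Omega> \<phi> t (grad \<Omega> (lam t)) = I_space \<Omega> \<phi> t (grad_lam t)"
      unfolding I_space_def
    proof (rule ext_integral_cong_AE[OF cN])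
      show "AE x in ?N. \<phi> t x (grad \<Omega> (lam t) x) = \<phi> t x (grad_lam t x)"
        using conjunct2[OF elim(3)] by eventually_elim simp
    qed
    then show ?case
      using elim(1,2) unfolding E_fun_def G_fun_def F_fun_def
      by (cases "I_space \<Omega> \<phi> t (grad_lam t)"; cases "I_space \<Omega> \<psi> t (lam t)") auto
  qed

  have G\<phi>: "(\<lambda>(t, x). integrand_conj \<phi> t x (y t x)) \<in> borel_measurable ?Q"
    "AE t in ?I. \<bar>I_space \<Omega> (integrand_conj \<phi>) t (y t)\<bar> \<noteq> \<infinity> \<and>
      G_conj \<Omega> p \<phi> t (y t) = I_space \<Omega> (integrand_conj \<phi>) t (y t)"
  proof -
    have 1: "AE t in ?I. \<bar>I_space \<Omega> \<phi> t (grad_lam t)\<bar> \<noteq> \<infinity>" using E_split by eventually_elim (erule conjunct1)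
    have 2: "AE t in ?I. G_conj \<Omega> p \<phi> t (y t) < \<infinity>"
      using Af(2)
    proof eventually_elim
      case (elim t)
      then show ?case by (cases "G_conj \<Omega> p \<phi> t (y t)") auto
    qed
    show "(\<lambda>(t, x). integrand_conj \<phi> t x (y t x)) \<in> borel_measurable ?Q"
      "AE t in ?I. \<bar>I_space \<Omega> (integrand_conj \<phi>) t (y t)\<bar> \<noteq> \<infinity> \<and>
        G_conj \<Omega> p \<phi> t (y t) = I_space \<Omega> (integrand_conj \<phi>) t (y t)"
      using G_conj_eq_integrand_conj[OF T \<Omega> p cni(1) Ym Yt(1) GLm GLt 1 2] by blast+
  qed

  \<comment> \<open>A finite conjugate excludes the second case of (C) and yields some
    representative \<open>w'\<close>. It agrees with \<open>w\<close> almost everywhere, so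
    \<open>w\<close> represents the same functional, and (C) is applied a second time, now to
    \<open>w\<close> itself.\<close>
  have F\<psi>: "AE t in ?I. \<bar>I_space \<Omega> (integrand_conj \<psi>) t (w t)\<bar> \<noteq> \<infinity> \<and>
      F_conj \<Omega> \<Gamma>D p \<psi> f t (\<xi> t) = I_space \<Omega> (integrand_conj \<psi>) t (w t) \<and>
      iota_star \<Omega> (w t) (lam t) = - grad_star \<Omega> (y t) (lam t) - iota_star \<Omega> (dt_lam t) (lam t) + iota_star \<Omega> (f0 t) (lam t)"
    using assms(12)[unfolded assumption_C_def] \<xi>_dual \<xi>_eq assms(14,18) Bf(2) wt dt(2) dv(2) ff(2) Lt(1)
  proof eventually_elim
    case (elim t)
    have V: "\<xi> t v + f t v = - grad_star \<Omega> (y t) v - iota_star \<Omega> (dt_lam t) v + iota_star \<Omega> (f0 t) v"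
      if "v \<in> V_space \<Omega> \<Gamma>D p" for v
      using elim(3,4) that by simp
    have "F_conj \<Omega> \<Gamma>D p \<psi> f t (\<xi> t) \<noteq> \<infinity>" using elim(6) by (cases "F_conj \<Omega> \<Gamma>D p \<psi> f t (\<xi> t)") auto
    then obtain w' where w': "w' \<in> Lp_space ?N p'" "\<forall>v\<in>V_space \<Omega> \<Gamma>D p. iota_star \<Omega> w' v = \<xi> t v + f t v"
      using elim(1,2) by blast
    then have w'V: "\<forall>v\<in>V_space \<Omega> \<Gamma>D p. iota_star \<Omega> w' v = - grad_star \<Omega> (y t) v - iota_star \<Omega> (dt_lam t) v + iota_star \<Omega> (f0 t) v"
      using V by simp
    have "AE x in ?N. w' x = w t x"
      using dual_representative_eq_div[OF \<Omega> p elim(5) elim(9) elim(8) elim(10) w'(1) w'V] by (simp add: w_def)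
    then have "iota_star \<Omega> w' v = iota_star \<Omega> (w t) v" for v
      by (rule iota_star_cong_AE[OF \<Omega>(1)])
    then have wV: "\<forall>v\<in>V_space \<Omega> \<Gamma>D p. iota_star \<Omega> (w t) v = \<xi> t v + f t v" using w'(2) by simp
    then have eq: "F_conj \<Omega> \<Gamma>D p \<psi> f t (\<xi> t) = I_space \<Omega> (integrand_conj \<psi>) t (w t)"
      using elim(1,2,7) by blast
    have "\<bar>I_space \<Omega> (integrand_conj \<psi>) t (w t)\<bar> \<noteq> \<infinity>"
      using elim(6) unfolding eq by (cases "I_space \<Omega> (integrand_conj \<psi>) t (w t)") auto
    moreover have "iota_star \<Omega> (w t) (lam t) = - grad_star \<Omega> (y t) (lam t) - iota_star \<Omega> (dt_lam t) (lam t) + iota_star \<Omega> (f0 t) (lam t)"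
      using wV V[OF elim(11)] elim(11) by simp
    ultimately show ?case using eq by blast
  qed
  have \<psi>m: "(\<lambda>(t, x). integrand_conj \<psi> t x (w t x)) \<in> borel_measurable ?Q"
    by (rule integrand_conj_measurable[OF \<Omega> cni(2) wm])

  define h1 where "h1 = (\<lambda>(t, x). integrand_conj \<phi> t x (y t x) - ereal (y t x \<bullet> grad_lam t x) + \<phi> t x (grad_lam t x))"
  define h2 where "h2 = (\<lambda>(t, x). integrand_conj \<psi> t x (w t x) - ereal (w t x \<bullet> lam t x) + \<psi> t x (lam t x))"
  have h1m: "h1 \<in> borel_measurable ?Q"
  proof -
    have "(\<lambda>(t, x). y t x \<bullet> grad_lam t x) \<in> borel_measurable ?Q"
      using borel_measurable_inner[OF Ym GLm] by (simp add: case_prod_beta')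
    with G\<phi>(1) normal_integrand_compose[OF cni(1) GLm] show ?thesis
      unfolding h1_def case_prod_beta' by (intro borel_measurable_ereal_add borel_measurable_ereal_diff borel_measurable_ereal)
  qed
  have h2m: "h2 \<in> borel_measurable ?Q"
  proof -
    have "(\<lambda>(t, x). w t x \<bullet> lam t x) \<in> borel_measurable ?Q"
      using borel_measurable_inner[OF wm Lm] by (simp add: case_prod_beta')
    with \<psi>m normal_integrand_compose[OF cni(2) Lm] show ?thesis
      unfolding h2_def case_prod_beta' by (intro borel_measurable_ereal_add borel_measurable_ereal_diff borel_measurable_ereal)
  qed
  have h1n: "0 \<le> h1 z" and h2n: "0 \<le> h2 z" if "z \<in> space ?Q" for z
    using that nm integrand_conj_gap_nonneg[of \<phi>] integrand_conj_gap_nonneg[of \<psi>]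
    by (auto simp: h1_def h2_def)
  \<comment> \<open>The time integrand of \<open>a + b + c\<close> together with the pairing of the
    time derivative with \<open>\<lambda>\<close>. It turns out to be the sum of the two gaps
    integrated over \<open>\<Omega>\<close> at time \<open>t\<close>.\<close>
  define r where "r t = real_of_ereal (G_conj \<Omega> p \<phi> t (y t)) + real_of_ereal (F_conj \<Omega> \<Gamma>D p \<psi> f t (\<xi> t))
      + real_of_ereal (E_fun \<Omega> \<phi> \<psi> f t (lam t)) + dl t" for t
  have ri: "integrable ?I r" unfolding r_def using Af(1) Bf(1) Cf(1) dli by simp
  have inner: "AE t in ?I. (\<integral>\<^sup>+x. e2ennreal (h1 (t, x)) \<partial>?N) + (\<integral>\<^sup>+x. e2ennreal (h2 (t, x)) \<partial>?N) = ennreal (r t) \<and> 0 \<le> r t"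
    using G\<phi>(2) F\<psi> E_split GL Yt(1) wt Lt(1) assms(14) AE_space
  proof eventually_elim
    case (elim t)
    have t: "t \<in> {0<..<T}" using elim(9) by simp
    have l: "lam t \<in> Lp_space ?N p" and lW: "lam t \<in> W1p \<Omega> p"
      using elim(7) by (auto simp: V_space_def W1p_def)
    have gs: "grad_star \<Omega> (y t) (lam t) = int_pair \<Omega> (y t) (grad_lam t)"
      unfolding grad_star_def int_pair_def
    proof (rule integral_cong_AE_complete[OF cN])
      show "AE x in ?N. y t x \<bullet> grad \<Omega> (lam t) x = y t x \<bullet> grad_lam t x"
        using conjunct2[OF elim(4)] by eventually_elim simp
    qed
    have fl: "f t (lam t) = iota_star \<Omega> (f0 t) (lam t)" using elim(7,8) by blast
    let ?r1 = "real_of_ereal (ext_integral ?N (\<lambda>x. integrand_conj \<phi> t x (y t x))) - (LINT x|?N. y t x \<bullet> grad_lam t x)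
        + real_of_ereal (ext_integral ?N (\<lambda>x. \<phi> t x (grad_lam t x)))"
    let ?r2 = "real_of_ereal (ext_integral ?N (\<lambda>x. integrand_conj \<psi> t x (w t x))) - (LINT x|?N. w t x \<bullet> lam t x)
        + real_of_ereal (ext_integral ?N (\<lambda>x. \<psi> t x (lam t x)))"
    have g1: "(\<integral>\<^sup>+x. e2ennreal (h1 (t, x)) \<partial>?N) = ennreal ?r1" "0 \<le> ?r1"
      unfolding h1_def prod.case using elim(1,3,4,5) t nm
      by (intro nn_integral_Fenchel_gap integrand_conj_gap_nonneg Lp_pair(1)[OF p]; simp add: I_space_def)+
    have g2: "(\<integral>\<^sup>+x. e2ennreal (h2 (t, x)) \<partial>?N) = ennreal ?r2" "0 \<le> ?r2"
      unfolding h2_def prod.case using elim(2,3,6) l t nm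
      by (intro nn_integral_Fenchel_gap integrand_conj_gap_nonneg Lp_pair(1)[OF p]; simp add: I_space_def)+
    \<comment> \<open>The representation of \<open>w\<close> tested with \<open>lam t\<close>: its
      first term cancels the pairing in the \<open>\<phi>\<close>-gap, and
      \<open>f t (lam t)\<close> is the load term contained in \<open>E_fun\<close>.\<close>
    have wl: "(LINT x|?N. w t x \<bullet> lam t x) = - int_pair \<Omega> (y t) (grad_lam t) - dl t + f t (lam t)"
      using elim(2) by (simp add: gs fl dl_def iota_star_def int_pair_def)
    have "?r1 + ?r2 = r t"
      using elim(1,2,3) unfolding r_def wl by (simp add: I_space_def int_pair_def)
    then show ?case
      using g1 g2 by (simp add: ennreal_plus[symmetric] del: ennreal_plus)
  qed
  have m1: "(\<lambda>z. e2ennreal (h1 z)) \<in> borel_measurable ?Q" and m2: "(\<lambda>z. e2ennreal (h2 z)) \<in> borel_measurable ?Q"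
    using h1m h2m by measurable
  note T1 = lebesgue_on_Times_nn_integral[OF Ib \<Omega>b m1] and T2 = lebesgue_on_Times_nn_integral[OF Ib \<Omega>b m2]
  \<comment> \<open>Nonnegativity allows the two integrals over the cylinder to be iterated and
    added before either is known to be finite.\<close>
  have "(\<integral>\<^sup>+z. e2ennreal (h1 z) \<partial>?Q) + (\<integral>\<^sup>+z. e2ennreal (h2 z) \<partial>?Q)
      = (\<integral>\<^sup>+t. (\<integral>\<^sup>+x. e2ennreal (h1 (t, x)) \<partial>?N) + (\<integral>\<^sup>+x. e2ennreal (h2 (t, x)) \<partial>?N) \<partial>?I)"
    unfolding T1(3) T2(3) using T1(2) T2(2) by (rule nn_integral_add[symmetric])
  also have "\<dots> = (\<integral>\<^sup>+t. ennreal (r t) \<partial>?I)"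
    using inner by (intro nn_integral_cong_AE) (auto elim!: eventually_mono)
  also have "\<dots> = ennreal (LINT t|?I. r t)"
    using inner by (intro nn_integral_eq_integral[OF ri]) (auto elim!: eventually_mono)
  finally have sum: "(\<integral>\<^sup>+z. e2ennreal (h1 z) \<partial>?Q) + (\<integral>\<^sup>+z. e2ennreal (h2 z) \<partial>?Q) = ennreal (LINT t|?I. r t)" .
  have r0: "0 \<le> (LINT t|?I. r t)"
    using inner by (intro integral_nonneg_AE) (auto elim!: eventually_mono)
  have "ext_integral ?Q h1 + ext_integral ?Q h2 = enn2ereal ((\<integral>\<^sup>+z. e2ennreal (h1 z) \<partial>?Q) + (\<integral>\<^sup>+z. e2ennreal (h2 z) \<partial>?Q))"
    using ext_integral_nonneg[OF h1m h1n] ext_integral_nonneg[OF h2m h2n] by (simp add: plus_ennreal.rep_eq)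
  also have "\<dots> = ereal (LINT t|?I. r t)"
    unfolding sum using r0 by (simp add: enn2ereal_ennreal)
  finally have ext: "ext_integral ?Q h1 + ext_integral ?Q h2 = ereal (LINT t|?I. r t)" .
  have "(LINT t|?I. r t) = real_of_ereal a + real_of_ereal b + real_of_ereal c
      + ((H_norm \<Omega> (lam T))\<^sup>2 / 2 - (H_norm \<Omega> (lam 0))\<^sup>2 / 2)"
    unfolding r_def a_def b_def c_def I_time_def Af(3) Bf(3) Cf(3) using Af(1) Bf(1) Cf(1) dli dlI by simp
  moreover have "eta_sq T \<Omega> \<Gamma>D p p' \<phi> \<psi> f u0 y lam
      = ereal (real_of_ereal a + real_of_ereal b + real_of_ereal c + (H_norm \<Omega> (lam T))\<^sup>2 / 2
          - int_pair \<Omega> (lam 0) u0 + (H_norm \<Omega> u0)\<^sup>2 / 2)"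
    unfolding eta_sq_def Dabc using fin by (cases a; cases b; cases c) auto
  \<comment> \<open>The terms at time \<open>T\<close> agree on both sides. What is left at time 0,
    including the pairing of \<open>lam 0\<close> with \<open>u0\<close>, completes to half of this
    square.\<close>
  moreover have "(H_norm \<Omega> (\<lambda>x. lam 0 x - u0 x))\<^sup>2 = (H_norm \<Omega> (lam 0))\<^sup>2 - 2 * int_pair \<Omega> (lam 0) u0 + (H_norm \<Omega> u0)\<^sup>2"
    using H T assms(9) by (intro H_norm_diff_sq) auto
  ultimately show ?thesis
    unfolding h1_def[symmetric] h2_def[symmetric, unfolded w_def] using ext
    by (simp add: h1_def h2_def w_def diff_divide_distrib add_divide_distrib)
qed

end
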